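(* Let $B_\star=\bigoplus_{\sigma\in\Sigma}B_\sigma$ be a graph-Frobenius algebra with poly-linear forms $(\cdot,\cdot)$ and $(\cdot,\cdot,\cdot)$. Then it generates a Film Topological Field Theory on $\{B_\sigma\mid\sigma\in\Sigma\}$ by means of the following construction. Fix a basis $\{b_i^\sigma\}$ of each $B_\sigma$, $\sigma\in\Sigma$, let $F^\sigma_{ij}=(b_i^\sigma,b_j^{\sigma^*})$ and let $F_\sigma^{ij}$ be the inverse matrix (indexed so that $\sum_iF_\sigma^{ij}(b_i^\sigma,b_l^{\sigma^*})=\delta_{jl}$). Define linear functionals on connected film surfaces by $$\Phi_{\Omega(\sigma_1,\dots,\sigma_n)}(x^1_{q_1}\otimes\cdots\otimes x^n_{q_n})=\sum_{\varsigma_1,\dots,\varsigma_{n-3}\in\Sigma}\ \sum_{i_1,j_1,\dots,i_{n-3},j_{n-3}}(x^1,x^2,b_{i_1}^{\varsigma_1})F_{\varsigma_1}^{i_1j_1}(b_{j_1}^{\varsigma_1^*},x^3,b_{i_2}^{\varsigma_2})F_{\varsigma_2}^{i_2j_2}(b_{j_2}^{\varsigma_2^*},x^4,b_{i_3}^{\varsigma_3})\cdots F_{\varsigma_{n-4}}^{i_{n-4}j_{n-4}}(b_{j_{n-4}}^{\varsigma_{n-4}^*},x^{n-2},b_{i_{n-3}}^{\varsigma_{n-3}})F_{\varsigma_{n-3}}^{i_{n-3}j_{n-3}}(b_{j_{n-3}}^{\varsigma_{n-3}^*},x^{n-1},x^n),$$ where $x^i\in B_{\sigma_i}$ and $x^i_{q_i}$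 is its copy in $B_{q_i}$ (for $n=3$ the right side is $(x^1,x^2,x^3)$, and for $n=2$ it is $(x^1,x^2)$). Define the linear functionals on non-connected film surfaces by the multiplicativity axiom (product over connected components). Then $\{\Phi_\Omega\}$ is a Film Topological Field Theory on $\{B_\sigma\mid\sigma\in\Sigma\}$ (with $K_\sigma^\otimes=\sum_{i,j}F_\sigma^{ij}\,b_i^\sigma\otimes b_j^{\sigma^*}$).
   Context: **Conventions.** $\mathbb K\supset\mathbb Q$ is a field and $S$ is a fixed set of colors. For a finite family $\{X_m\}_{m\in M}$ of vector spaces, $\otimes_{m\in M}X_m$ is the unordered tensor product (canonically isomorphic to the tensor product in any chosen order). **Graphs and complexes.** A graph is a compact 1-dimensional complex with edges and vertices; it is regular if the closure of every edge is a segment (no loops). A regular CW-complex $\Omega$ is a compact CW-complex of oriented 2-cells (disks), edges and vertices whose edges form a regular graph. It is given by a set $\check\Omega$ of closed oriented disks, a regular graph $\Delta$ and a gluing map $\varphi:\partial\check\Omega\to\Delta$ that is a homeomorphism (onto its image) on each boundary circle, with $\varphi(\partial\check\Omega)=\Delta$. A cyclic order on $\Omega$ is a choice, for each connected component, of a cyclic order on its vertices compatible with the orientations of the disks (the vertices met along each oriented disk boundary appear in that cyclic order). A regular CW-complex with a cyclic order is an almost cyclic complex. A graph-cut of a connected almost cyclic complex $\Omega$ is a connected regular graph $\gamma\subset\Omega$ such that (i) the restriction of $\gamma$ to any disk is empty or is one edge of $\gamma$; (ii) $\gamma$ divides $\Omega$ into two connected components, splitting the vertices of $\Omega$ into two nonempty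 groups compatibly with the cyclic order (each group consecutive). An almost cyclic complex is a cyclic complex if every division of the vertices compatible with the cyclic order is realized by a graph-cut. A graph (resp. CW-complex) is colored if each edge (resp. disk) has a color in $S$ and the colors are pairwise different within each connected component. A film surface is a colored cyclic complex; $\Omega_b$ is its set of vertices. A small neighborhood of a vertex $q$ is a cone over a regular graph $\sigma_q$, the vertex graph of $q$; its edges are oriented by the orientations of the disks outside the neighborhood and colored by the colors of the disks. $\Sigma$ is the set of isomorphism classes (homeomorphisms preserving colors and orientations) of connected regular oriented colored graphs; $\sigma\mapsto\sigma^*$ reverses all orientations. **Compatible surfaces.** $\Omega(\sigma_1,\dots,\sigma_n)$ denotes the set of isomorphism classes of connected film surfaces whose vertex graphs are $\sigma_1,\dots,\sigma_n$ (at vertices $q_1,\dots,q_n$), with the numbering giving the cyclic order of the vertices. It is empty or has one element; in the latter case the same symbol denotes that film surface. **Film Topological Field Theory.** Given finite-dimensional spaces $B_\sigma$ and tensors $K_\sigma^\otimes\in B_\sigma\otimes B_{\sigma^*}$ ($\sigma\in\Sigma$), put $V_\Omega=\otimes_{q\in\Omega_b}B_q$, where $B_q$ is a copy of $B_{\sigma_q}$. An isomorphism $\phi:\Omega\to\Omega'$ of film surfaces (homeomorphism preserving cyclic orders, orientations and colors) induces $\phi_*:V_\Omega\to V_{\Omega'}$. Cutting a connected $\Omega$ along a graph-cut $\gamma$ and contracting the two copies of $\gamma$ to points $q_+,q_-$ gives a film surface $\Omega'$ with $V_{\Omega'}=V_\Omega\otimes B_{q_+}\otimes B_{q_-}$,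 and the cut morphism $\eta:\Omega\to\Omega'$ induces $\eta_*(x)=x\otimes K_\sigma^\otimes$, $\sigma=\sigma_{q_+}=\sigma_{q_-}^*$. Disjoint union induces $\theta_*:V_{\Omega'}\otimes V_{\Omega''}\to V_{\Omega'\sqcup\Omega''}$. A Film Topological Field Theory is a family of linear forms $\Phi_\Omega:V_\Omega\to\mathbb K$, for all film surfaces $\Omega$, such that: 1. $\Phi_{\Omega'}(\phi_*(x))=\Phi_\Omega(x)$ for every isomorphism $\phi$; 2. for a film surface $\Omega$ with exactly two vertices $q_1,q_2$ (then $\sigma_{q_2}=\sigma^*$ where $\sigma=\sigma_{q_1}$), the form $(x',x'')_\sigma=\Phi_\Omega(x'_{q_1}\otimes x''_{q_2})$ on $B_\sigma\times B_{\sigma^*}$ is non-degenerate, for all $\sigma\in\Sigma$; 3. $\Phi_{\Omega'}(\eta_*(x))=\Phi_\Omega(x)$ for every cut morphism $\eta$; 4. $\Phi_{\Omega'\sqcup\Omega''}(\theta_*(x'\otimes x''))=\Phi_{\Omega'}(x')\Phi_{\Omega''}(x'')$. **Graph-Frobenius algebra.** If $\Omega(\sigma_1,\sigma_2,\sigma_3,\sigma_4)\neq\emptyset$, there are unique classes $\sigma_{(1,2|3,4)}$, $\sigma_{(4,1|2,3)}\in\Sigma$ such that, with $\sigma_{(3,4|1,2)}=\sigma_{(1,2|3,4)}^*$ and $\sigma_{(2,3|4,1)}=\sigma_{(4,1|2,3)}^*$, the sets $\Omega(\sigma_1,\sigma_2,\sigma_{(1,2|3,4)})$, $\Omega(\sigma_{(3,4|1,2)},\sigma_3,\sigma_4)$,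 $\Omega(\sigma_4,\sigma_1,\sigma_{(4,1|2,3)})$, $\Omega(\sigma_{(2,3|4,1)},\sigma_2,\sigma_3)$ are nonempty. A graph-Frobenius algebra is a direct sum $B_\star=\bigoplus_{\sigma\in\Sigma}B_\sigma$ of finite-dimensional spaces with a bilinear form $(\cdot,\cdot)$ and a three-linear form $(\cdot,\cdot,\cdot)$ with values in $\mathbb K$, such that - $(B_{\sigma_1},B_{\sigma_2})=0$ for $\sigma_1\ne\sigma_2^*$; - $(\cdot,\cdot)$ is non-degenerate; - $(B_{\sigma_1},B_{\sigma_2},B_{\sigma_3})=0$ if $\Omega(\sigma_1,\sigma_2,\sigma_3)=\emptyset$; - whenever $\Omega(\sigma_1,\sigma_2,\sigma_3,\sigma_4)\neq\emptyset$ and $x_k\in B_{\sigma_k}$, $$\sum_{i,j}(x_1,x_2,b_i^{(1,2|3,4)})F^{ij}_{(1,2|3,4)}(b_j^{(3,4|1,2)},x_3,x_4)=\sum_{i,j}(x_4,x_1,b_i^{(4,1|2,3)})F^{ij}_{(4,1|2,3)}(b_j^{(2,3|4,1)},x_2,x_3),$$ where $\{b_i^{(s,t|k,r)}\}$ is a basis of $B_{\sigma_{(s,t|k,r)}}$ and $F^{ij}_{(s,t|k,r)}$ is the inverse matrix of $(b_i^{(s,t|k,r)},b_j^{(k,r|s,t)})$, indexed so that $\sum_iF^{ij}_{(s,t|k,r)}(b_i^{(s,t|k,r)},b_l^{(k,r|s,t)})=\delta_{jl}$.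
   Formalization: The forms are also assumed rotation invariant, (x,y)=(y,x) and (x,y,z)=(y,z,x); without this the formula depends on the numbering of the vertices and the claim fails, e.g. for one color with an alternating pairing and zero three-linear form. *)

theory Defs
  imports Complex_Main "HOL-Library.FuncSet" "HOL-Library.Groups_Big_Fun"
begin

text \<open>
  All complexes and graphs are compact, hence finite, and are treated as combinatorial objects whose
  cells are labelled by natural numbers; homeomorphisms preserving the structure become bijections
  of cells. The set of colors is the type variable \<open>'c\<close>.
\<close>

definition connected_by :: "'v set \<Rightarrow> ('v \<times> 'v) set \<Rightarrow> bool" where
  "connected_by V r \<longleftrightarrow> V \<noteq> {} \<and> (\<forall>u\<in>V. \<forall>v\<in>V. (u, v) \<in> r\<^sup>*)"


section \<open>Oriented colored graphs\<close>

record 'c ograph =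
  gverts :: "nat set"
  gedges :: "nat set"
  gsrc :: "nat \<Rightarrow> nat"
  gtgt :: "nat \<Rightarrow> nat"
  gcolor :: "nat \<Rightarrow> 'c"

text \<open>Connected regular oriented colored graphs; a one-dimensional complex has at least one edge.\<close>

definition conn_graph :: "'c ograph \<Rightarrow> bool" where
  "conn_graph g \<longleftrightarrow>
     finite (gverts g) \<and> finite (gedges g) \<and> gedges g \<noteq> {} \<and>
     (\<forall>e\<in>gedges g. gsrc g e \<in> gverts g \<and> gtgt g e \<in> gverts g \<and> gsrc g e \<noteq> gtgt g e) \<and>
     connected_by (gverts g)
       {(u, v). \<exists>e\<in>gedges g. (u = gsrc g e \<and> v = gtgt g e) \<or> (u = gtgt g e \<and> v = gsrc g e)} \<and>
     inj_on (gcolor g) (gedges g)"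

definition graph_iso :: "'c ograph \<Rightarrow> 'c ograph \<Rightarrow> bool" where
  "graph_iso g h \<longleftrightarrow>
     (\<exists>fv fe. bij_betw fv (gverts g) (gverts h) \<and> bij_betw fe (gedges g) (gedges h) \<and>
        (\<forall>e\<in>gedges g. gsrc h (fe e) = fv (gsrc g e) \<and> gtgt h (fe e) = fv (gtgt g e) \<and>
                      gcolor h (fe e) = gcolor g e))"

definition graph_class :: "'c ograph \<Rightarrow> 'c ograph set" where
  "graph_class g = {h. conn_graph h \<and> graph_iso g h}"

definition Graphs :: "'c ograph set set" where
  "Graphs = graph_class ` {g. conn_graph g}"

definition reverse :: "'c ograph \<Rightarrow> 'c ograph" where
  "reverse g = g\<lparr>gsrc := gtgt g, gtgt := gsrc g\<rparr>"

definition star :: "'c ograph set \<Rightarrow> 'c ograph set" where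
  "star \<sigma> = reverse ` \<sigma>"


section \<open>Complexes with a cyclic order\<close>

text \<open>
  The gluing map of an oriented disk \<open>d\<close>, being a homeomorphism of its boundary circle onto the
  image, is recorded by the set \<open>bdry \<Omega> d\<close> of the triples \<open>(u, e, v)\<close> for which the oriented
  boundary of \<open>d\<close> runs along the edge \<open>e\<close> from the vertex \<open>u\<close> to the vertex \<open>v\<close>. The ternary
  relation \<open>cyc \<Omega>\<close> comprises the cyclic orders on the vertices of all connected components.
\<close>

record 'c complex2 =
  verts :: "nat set"
  edges :: "nat set"
  ends :: "nat \<Rightarrow> nat set"
  disks :: "nat set"
  bdry :: "nat \<Rightarrow> (nat \<times> nat \<times> nat) set"
  color :: "nat \<Rightarrow> 'c"
  cyc :: "(nat \<times> nat \<times> nat) set"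

definition traverses :: "'c complex2 \<Rightarrow> nat \<Rightarrow> nat list \<Rightarrow> nat list \<Rightarrow> bool" where
  "traverses \<Omega> d us es \<longleftrightarrow>
     us \<noteq> [] \<and> length es = length us \<and> distinct us \<and> distinct es \<and> set es \<subseteq> edges \<Omega> \<and>
     (\<forall>i<length us. ends \<Omega> (es ! i) = {us ! i, us ! (Suc i mod length us)}) \<and>
     bdry \<Omega> d = {(us ! i, es ! i, us ! (Suc i mod length us)) | i. i < length us}"

definition disk_verts :: "'c complex2 \<Rightarrow> nat \<Rightarrow> nat set" where
  "disk_verts \<Omega> d = {u. \<exists>e v. (u, e, v) \<in> bdry \<Omega> d}"

definition disk_edges :: "'c complex2 \<Rightarrow> nat \<Rightarrow> nat set" where
  "disk_edges \<Omega> d = {e. \<exists>u v. (u, e, v) \<in> bdry \<Omega> d}"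

text \<open>The last two conditions say that the gluing map is onto the graph.\<close>

definition regular_complex :: "'c complex2 \<Rightarrow> bool" where
  "regular_complex \<Omega> \<longleftrightarrow>
     finite (verts \<Omega>) \<and> finite (edges \<Omega>) \<and> finite (disks \<Omega>) \<and>
     (\<forall>e\<in>edges \<Omega>. ends \<Omega> e \<subseteq> verts \<Omega> \<and> card (ends \<Omega> e) = 2) \<and>
     (\<forall>d\<in>disks \<Omega>. \<exists>us es. traverses \<Omega> d us es) \<and>
     edges \<Omega> = (\<Union>d\<in>disks \<Omega>. disk_edges \<Omega> d) \<and>
     verts \<Omega> = (\<Union>d\<in>disks \<Omega>. disk_verts \<Omega> d)"

definition joined :: "'c complex2 \<Rightarrow> nat set \<Rightarrow> (nat \<times> nat) set" where
  "joined \<Omega> E = {(u, v). u \<in> verts \<Omega> \<and> v \<in> verts \<Omega> \<and>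
                    (u, v) \<in> {(a, b). \<exists>e\<in>E. ends \<Omega> e = {a, b}}\<^sup>*}"

text \<open>Disks have connected boundary, so components are determined by the graph; a component is
  represented by its set of vertices.\<close>

definition components_of :: "'c complex2 \<Rightarrow> nat set set" where
  "components_of \<Omega> = verts \<Omega> // joined \<Omega> (edges \<Omega>)"

definition connected_complex :: "'c complex2 \<Rightarrow> bool" where
  "connected_complex \<Omega> \<longleftrightarrow> components_of \<Omega> = {verts \<Omega>}"

definition restrict_complex :: "'c complex2 \<Rightarrow> nat set \<Rightarrow> 'c complex2" where
  "restrict_complex \<Omega> C =
     \<Omega>\<lparr>verts := C, edges := {e \<in> edges \<Omega>. ends \<Omega> e \<subseteq> C},
       disks := {d \<in> disks \<Omega>. disk_verts \<Omega> d \<subseteq> C}, cyc := cyc \<Omega> \<inter> C \<times> C \<times> C\<rparr>"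

definition cyclic_order_on :: "nat set \<Rightarrow> (nat \<times> nat \<times> nat) set \<Rightarrow> bool" where
  "cyclic_order_on C R \<longleftrightarrow>
     R \<subseteq> C \<times> C \<times> C \<and>
     (\<forall>a b c. (a, b, c) \<in> R \<longrightarrow> (b, c, a) \<in> R) \<and>
     (\<forall>a b c. (a, b, c) \<in> R \<longrightarrow> (c, b, a) \<notin> R) \<and>
     (\<forall>a b c d. (a, b, c) \<in> R \<and> (a, c, d) \<in> R \<longrightarrow> (a, b, d) \<in> R) \<and>
     (\<forall>a\<in>C. \<forall>b\<in>C. \<forall>c\<in>C. a \<noteq> b \<and> b \<noteq> c \<and> c \<noteq> a \<longrightarrow> (a, b, c) \<in> R \<or> (c, b, a) \<in> R)"

definition in_cyclic_order :: "(nat \<times> nat \<times> nat) set \<Rightarrow> nat list \<Rightarrow> bool" where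
  "in_cyclic_order R qs \<longleftrightarrow>
     distinct qs \<and> (\<forall>i j k. i < j \<and> j < k \<and> k < length qs \<longrightarrow> (qs ! i, qs ! j, qs ! k) \<in> R)"

definition almost_cyclic :: "'c complex2 \<Rightarrow> bool" where
  "almost_cyclic \<Omega> \<longleftrightarrow>
     regular_complex \<Omega> \<and>
     cyc \<Omega> \<subseteq> (\<Union>C\<in>components_of \<Omega>. C \<times> C \<times> C) \<and>
     (\<forall>C\<in>components_of \<Omega>. cyclic_order_on C (cyc \<Omega> \<inter> C \<times> C \<times> C)) \<and>
     (\<forall>d\<in>disks \<Omega>. \<forall>us es. traverses \<Omega> d us es \<longrightarrow> in_cyclic_order (cyc \<Omega>) us)"

definition numbering :: "'c complex2 \<Rightarrow> nat list \<Rightarrow> bool" where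
  "numbering \<Omega> qs \<longleftrightarrow> set qs = verts \<Omega> \<and> in_cyclic_order (cyc \<Omega>) qs"

definition division :: "'c complex2 \<Rightarrow> nat set \<Rightarrow> nat set \<Rightarrow> bool" where
  "division \<Omega> A B \<longleftrightarrow>
     A \<noteq> {} \<and> B \<noteq> {} \<and>
     (\<exists>qs k. numbering \<Omega> qs \<and> A = set (take k qs) \<and> B = set (drop k qs))"

text \<open>
  A graph \<open>\<gamma>\<close> in \<open>\<Omega>\<close> whose intersection with each disk is empty or one edge of \<open>\<gamma>\<close> is given by the
  set \<open>P\<close> of edges of \<open>\<Omega>\<close> carrying a vertex of \<open>\<gamma>\<close> in their interior and the set \<open>D\<close> of disks
  containing an edge of \<open>\<gamma>\<close>, a chord joining the points on the two edges in \<open>P\<close> on the boundary of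
  the disk. Removing \<open>\<gamma>\<close> disconnects exactly the edges in \<open>P\<close>. The relation in the third conjunct is
  adjacency in \<open>\<gamma>\<close>; the last line says that the complement of \<open>\<gamma>\<close> has exactly two components.
\<close>

definition graph_cut :: "'c complex2 \<Rightarrow> nat set \<Rightarrow> nat set \<Rightarrow> nat set \<Rightarrow> nat set \<Rightarrow> bool" where
  "graph_cut \<Omega> P D A B \<longleftrightarrow>
     P \<subseteq> edges \<Omega> \<and> D \<subseteq> disks \<Omega> \<and>
     (\<forall>d\<in>disks \<Omega>. card (P \<inter> disk_edges \<Omega> d) = (if d \<in> D then 2 else 0)) \<and>
     connected_by P {(e, e'). \<exists>d\<in>D. e \<noteq> e' \<and> {e, e'} = P \<inter> disk_edges \<Omega> d} \<and>
     A \<noteq> B \<and> verts \<Omega> // joined \<Omega> (edges \<Omega> - P) = {A, B} \<and> division \<Omega> A B"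

definition cyclic_complex :: "'c complex2 \<Rightarrow> bool" where
  "cyclic_complex \<Omega> \<longleftrightarrow>
     almost_cyclic \<Omega> \<and>
     (\<forall>C\<in>components_of \<Omega>. \<forall>A B. division (restrict_complex \<Omega> C) A B \<longrightarrow>
        (\<exists>P D. graph_cut (restrict_complex \<Omega> C) P D A B))"


section \<open>Film surfaces\<close>

definition film_surface :: "'c complex2 \<Rightarrow> bool" where
  "film_surface \<Omega> \<longleftrightarrow>
     cyclic_complex \<Omega> \<and>
     (\<forall>C\<in>components_of \<Omega>. inj_on (color \<Omega>) {d \<in> disks \<Omega>. disk_verts \<Omega> d \<subseteq> C})"

text \<open>
  The boundary of a disk at \<open>q\<close> enters \<open>q\<close> along one edge and leaves along another. Truncating the
  corner at \<open>q\<close>, the boundary orientation of the remaining part of the disk runs along the edge of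
  the vertex graph from the former to the latter.
\<close>

definition vertex_graph :: "'c complex2 \<Rightarrow> nat \<Rightarrow> 'c ograph" where
  "vertex_graph \<Omega> q =
     \<lparr>gverts = {e \<in> edges \<Omega>. q \<in> ends \<Omega> e},
      gedges = {d \<in> disks \<Omega>. q \<in> disk_verts \<Omega> d},
      gsrc = (\<lambda>d. THE e. \<exists>u. (u, e, q) \<in> bdry \<Omega> d),
      gtgt = (\<lambda>d. THE e. \<exists>v. (q, e, v) \<in> bdry \<Omega> d),
      gcolor = color \<Omega>\<rparr>"

definition vclass :: "'c complex2 \<Rightarrow> nat \<Rightarrow> 'c ograph set" where
  "vclass \<Omega> q = graph_class (vertex_graph \<Omega> q)"

definition film_iso ::
  "(nat \<Rightarrow> nat) \<Rightarrow> (nat \<Rightarrow> nat) \<Rightarrow> (nat \<Rightarrow> nat) \<Rightarrow> 'c complex2 \<Rightarrow> 'c complex2 \<Rightarrow> bool" where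
  "film_iso fv fe fd \<Omega> \<Omega>' \<longleftrightarrow>
     bij_betw fv (verts \<Omega>) (verts \<Omega>') \<and>
     bij_betw fe (edges \<Omega>) (edges \<Omega>') \<and>
     bij_betw fd (disks \<Omega>) (disks \<Omega>') \<and>
     (\<forall>e\<in>edges \<Omega>. ends \<Omega>' (fe e) = fv ` ends \<Omega> e) \<and>
     (\<forall>d\<in>disks \<Omega>. bdry \<Omega>' (fd d) = (\<lambda>(u, e, v). (fv u, fe e, fv v)) ` bdry \<Omega> d \<and>
                    color \<Omega>' (fd d) = color \<Omega> d) \<and>
     cyc \<Omega>' = (\<lambda>(a, b, c). (fv a, fv b, fv c)) ` cyc \<Omega>"

definition film_iso_rel :: "('c complex2 \<times> 'c complex2) set" where
  "film_iso_rel = {(\<Omega>, \<Omega>'). film_surface \<Omega> \<and> film_surface \<Omega>' \<and> (\<exists>fv fe fd. film_iso fv fe fd \<Omega> \<Omega>')}"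

text \<open>The set $\Omega(\sigma_1,\dots,\sigma_n)$ of isomorphism classes.\<close>

definition Film :: "'c ograph set list \<Rightarrow> 'c complex2 set set" where
  "Film \<sigma>s = {\<Omega>. film_surface \<Omega> \<and> connected_complex \<Omega> \<and>
                (\<exists>qs. numbering \<Omega> qs \<and> map (vclass \<Omega>) qs = \<sigma>s)} // film_iso_rel"

definition disjoint_union :: "'c complex2 \<Rightarrow> 'c complex2 \<Rightarrow> 'c complex2 \<Rightarrow> bool" where
  "disjoint_union \<Omega>1 \<Omega>2 \<Omega> \<longleftrightarrow>
     verts \<Omega>1 \<inter> verts \<Omega>2 = {} \<and> verts \<Omega> = verts \<Omega>1 \<union> verts \<Omega>2 \<and>
     edges \<Omega>1 \<inter> edges \<Omega>2 = {} \<and> edges \<Omega> = edges \<Omega>1 \<union> edges \<Omega>2 \<and>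
     disks \<Omega>1 \<inter> disks \<Omega>2 = {} \<and> disks \<Omega> = disks \<Omega>1 \<union> disks \<Omega>2 \<and>
     (\<forall>\<Omega>'\<in>{\<Omega>1, \<Omega>2}.
        (\<forall>e\<in>edges \<Omega>'. ends \<Omega> e = ends \<Omega>' e) \<and>
        (\<forall>d\<in>disks \<Omega>'. bdry \<Omega> d = bdry \<Omega>' d \<and> color \<Omega> d = color \<Omega>' d)) \<and>
     cyc \<Omega> = cyc \<Omega>1 \<union> cyc \<Omega>2"

text \<open>
  The piece of a cut complex that contains the vertices \<open>A\<close>, with its copy of \<open>\<gamma>\<close> contracted to the
  new vertex \<open>q\<close>. A cell survives in this piece iff it has a vertex in \<open>A\<close>. Of an edge crossed by
  \<open>\<gamma>\<close> the half at \<open>A\<close> remains, which now ends at \<open>q\<close>; of the boundary of a disk crossed by \<open>\<gamma>\<close> the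
  arc on the \<open>A\<close> side remains, closed up at \<open>q\<close>. In the cyclic order \<open>q\<close> takes the place of the
  consecutive vertices outside \<open>A\<close>.
\<close>

definition cut_piece :: "'c complex2 \<Rightarrow> nat set \<Rightarrow> nat \<Rightarrow> 'c complex2" where
  "cut_piece \<Omega> A q = (let \<kappa> = (\<lambda>v. if v \<in> A then v else q) in
     \<lparr>verts = insert q A,
      edges = {e \<in> edges \<Omega>. ends \<Omega> e \<inter> A \<noteq> {}},
      ends = (\<lambda>e. \<kappa> ` ends \<Omega> e),
      disks = {d \<in> disks \<Omega>. disk_verts \<Omega> d \<inter> A \<noteq> {}},
      bdry = (\<lambda>d. {(\<kappa> u, e, \<kappa> v) | u e v. (u, e, v) \<in> bdry \<Omega> d \<and> (u \<in> A \<or> v \<in> A)}),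
      color = color \<Omega>,
      cyc = {(\<kappa> a, \<kappa> b, \<kappa> c) | a b c. (a, b, c) \<in> cyc \<Omega> \<and> distinct [\<kappa> a, \<kappa> b, \<kappa> c]}\<rparr>)"

text \<open>
  The result of the cut is the disjoint union of the two pieces. Both pieces contain halves of the
  crossed edges and disks, so the edges and disks are relabelled.
\<close>

definition cut_result ::
  "'c complex2 \<Rightarrow> nat set \<Rightarrow> nat set \<Rightarrow> nat \<Rightarrow> nat \<Rightarrow> 'c complex2 \<Rightarrow> bool" where
  "cut_result \<Omega> A B qp qm \<Omega>' \<longleftrightarrow>
     qp \<noteq> qm \<and> qp \<notin> verts \<Omega> \<and> qm \<notin> verts \<Omega> \<and>
     (\<exists>\<Omega>1 \<Omega>2 fe1 fd1 fe2 fd2.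
        film_iso id fe1 fd1 (cut_piece \<Omega> A qp) \<Omega>1 \<and>
        film_iso id fe2 fd2 (cut_piece \<Omega> B qm) \<Omega>2 \<and>
        disjoint_union \<Omega>1 \<Omega>2 \<Omega>')"


section \<open>Unordered tensor products\<close>

definition multilinear_form ::
  "('k::field \<Rightarrow> 'b::ab_group_add \<Rightarrow> 'b) \<Rightarrow> 'i set \<Rightarrow> ('i \<Rightarrow> 'b set) \<Rightarrow> (('i \<Rightarrow> 'b) \<Rightarrow> 'k) \<Rightarrow> bool" where
  "multilinear_form scale I X M \<longleftrightarrow>
     (\<forall>x\<in>PiE I X. \<forall>i\<in>I. \<forall>y\<in>X i. \<forall>z\<in>X i. \<forall>c.
        M (x(i := y + z)) = M (x(i := y)) + M (x(i := z)) \<and>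
        M (x(i := scale c y)) = c * M (x(i := y)))"

text \<open>
  The tensor product of the subspaces \<open>X i\<close>, \<open>i \<in> I\<close>, is realized in the dual of the space of
  multilinear forms: \<open>pure_tensor\<close> is the evaluation functional at a family of vectors, and
  \<open>tensor_space\<close> is the span of these. See \<open>tensor_space_universal\<close> below.
\<close>

type_synonym ('i, 'b, 'k) tensor = "(('i \<Rightarrow> 'b) \<Rightarrow> 'k) \<Rightarrow> 'k"

definition pure_tensor ::
  "('k::field \<Rightarrow> 'b::ab_group_add \<Rightarrow> 'b) \<Rightarrow> 'i set \<Rightarrow> ('i \<Rightarrow> 'b set) \<Rightarrow> ('i \<Rightarrow> 'b) \<Rightarrow>
    ('i, 'b, 'k) tensor" where
  "pure_tensor scale I X x = (\<lambda>M. if multilinear_form scale I X M then M (restrict x I) else 0)"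

definition tensor_space ::
  "('k::field \<Rightarrow> 'b::ab_group_add \<Rightarrow> 'b) \<Rightarrow> 'i set \<Rightarrow> ('i \<Rightarrow> 'b set) \<Rightarrow> ('i, 'b, 'k) tensor set" where
  "tensor_space scale I X =
     {t. \<exists>T c. finite T \<and> T \<subseteq> PiE I X \<and> t = (\<lambda>M. \<Sum>x\<in>T. c x * pure_tensor scale I X x M)}"

definition linear_form_on :: "('i, 'b, 'k::field) tensor set \<Rightarrow> (('i, 'b, 'k) tensor \<Rightarrow> 'k) \<Rightarrow> bool" where
  "linear_form_on V f \<longleftrightarrow>
     (\<forall>t\<in>V. \<forall>u\<in>V. f (\<lambda>M. t M + u M) = f t + f u) \<and>
     (\<forall>t\<in>V. \<forall>c. f (\<lambda>M. c * t M) = c * f t)"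

text \<open>The map of tensor products induced by a bijection of index sets with inverse \<open>g : I \<rightarrow> J\<close>, where
  \<open>I\<close> and \<open>X\<close> belong to the target.\<close>

definition tensor_reindex ::
  "('k::field \<Rightarrow> 'b::ab_group_add \<Rightarrow> 'b) \<Rightarrow> 'i set \<Rightarrow> ('i \<Rightarrow> 'b set) \<Rightarrow> ('i \<Rightarrow> 'j) \<Rightarrow>
    ('j, 'b, 'k) tensor \<Rightarrow> ('i, 'b, 'k) tensor" where
  "tensor_reindex scale I X g t =
     (\<lambda>M. if multilinear_form scale I X M then t (\<lambda>x. M (\<lambda>i\<in>I. x (g i))) else 0)"

definition tensor_mult ::
  "('k::field \<Rightarrow> 'b::ab_group_add \<Rightarrow> 'b) \<Rightarrow> 'i set \<Rightarrow> 'i set \<Rightarrow> ('i \<Rightarrow> 'b set) \<Rightarrow>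
    ('i, 'b, 'k) tensor \<Rightarrow> ('i, 'b, 'k) tensor \<Rightarrow> ('i, 'b, 'k) tensor" where
  "tensor_mult scale I J X t u =
     (\<lambda>M. if multilinear_form scale (I \<union> J) X M
          then t (\<lambda>x. u (\<lambda>y. M (\<lambda>i\<in>I \<union> J. if i \<in> I then x i else y i))) else 0)"

lemma pure_tensor_in_space:
  assumes "x \<in> PiE I X"
  shows "pure_tensor scale I X x \<in> tensor_space scale I X"
  unfolding tensor_space_def
  by (rule CollectI, rule exI[of _ "{x}"], rule exI[of _ "\<lambda>_. 1"]) (use assms in simp)

lemma linear_form_on_lincomb:
  assumes "linear_form_on (tensor_space scale I X) f" "finite T" "T \<subseteq> PiE I X"
  shows "f (\<lambda>M. \<Sum>x\<in>T. c x * pure_tensor scale I X x M) = (\<Sum>x\<in>T. c x * f (pure_tensor scale I X x))"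
  using assms(2,3)
proof (induction T rule: finite_induct)
  case empty
  have z: "(\<lambda>M. 0) \<in> tensor_space scale I X"
    unfolding tensor_space_def by (auto intro: exI[of _ "{}"])
  have hom: "f (\<lambda>M. a * t M) = a * f t" if "t \<in> tensor_space scale I X" for a t
    using assms(1) that unfolding linear_form_on_def by blast
  have "f (\<lambda>M. 0) = 0"
    using hom[OF z, of 0] by simp
  then show ?case by simp
next
  case (insert x T)
  let ?p = "pure_tensor scale I X"
  have p: "?p x \<in> tensor_space scale I X"
    using insert by (auto intro: pure_tensor_in_space)
  have cp: "(\<lambda>M. c x * ?p x M) \<in> tensor_space scale I X"
    unfolding tensor_space_def
    by (rule CollectI, rule exI[of _ "{x}"], rule exI[of _ c]) (use insert in simp)
  have r: "(\<lambda>M. \<Sum>x\<in>T. c x * ?p x M) \<in> tensor_space scale I X"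
    unfolding tensor_space_def using insert by auto
  have add: "f (\<lambda>M. t M + u M) = f t + f u"
    if "t \<in> tensor_space scale I X" "u \<in> tensor_space scale I X" for t u
    using assms(1) that unfolding linear_form_on_def by blast
  have hom: "f (\<lambda>M. a * t M) = a * f t" if "t \<in> tensor_space scale I X" for a t
    using assms(1) that unfolding linear_form_on_def by blast
  show ?case
    using insert add[OF cp r] hom[OF p, of "c x"] by simp
qed

lemma tensor_space_universal:
  assumes "multilinear_form scale I X M"
  shows "\<exists>f. linear_form_on (tensor_space scale I X) f \<and>
             (\<forall>x\<in>PiE I X. f (pure_tensor scale I X x) = M x) \<and>
             (\<forall>f'. linear_form_on (tensor_space scale I X) f' \<and>
                   (\<forall>x\<in>PiE I X. f' (pure_tensor scale I X x) = M x) \<longrightarrow>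
                   (\<forall>t\<in>tensor_space scale I X. f' t = f t))"
proof -
  let ?f = "\<lambda>t. t M"
  have lin: "linear_form_on (tensor_space scale I X) ?f"
    unfolding linear_form_on_def by simp
  have ev: "\<forall>x\<in>PiE I X. ?f (pure_tensor scale I X x) = M x"
    using assms by (simp add: pure_tensor_def PiE_restrict)
  have "f' t = ?f t"
    if f': "linear_form_on (tensor_space scale I X) f'"
      and v: "\<forall>x\<in>PiE I X. f' (pure_tensor scale I X x) = M x"
      and t: "t \<in> tensor_space scale I X" for f' t
  proof -
    obtain T c where T: "finite T" "T \<subseteq> PiE I X"
      and t': "t = (\<lambda>M. \<Sum>x\<in>T. c x * pure_tensor scale I X x M)"
      using t unfolding tensor_space_def by blast
    show ?thesis
      unfolding t' linear_form_on_lincomb[OF f' T]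
      using v ev T(2) by (intro sum.cong) auto
  qed
  then show ?thesis using lin ev by blast
qed

lemma tensor_mult_pure:
  fixes scale :: "'k::field \<Rightarrow> 'b::ab_group_add \<Rightarrow> 'b" and X :: "'i \<Rightarrow> 'b set"
  assumes "I \<inter> J = {}" "x \<in> PiE I X" "y \<in> PiE J X"
    and closed: "\<And>i a b c. i \<in> I \<Longrightarrow> a \<in> X i \<Longrightarrow> b \<in> X i \<Longrightarrow> a + b \<in> X i \<and> scale c a \<in> X i"
  shows "tensor_mult scale I J X (pure_tensor scale I X x) (pure_tensor scale J X y) =
         pure_tensor scale (I \<union> J) X (\<lambda>i. if i \<in> I then x i else y i)"
proof
  fix M
  define m :: "('i \<Rightarrow> 'b) \<Rightarrow> ('i \<Rightarrow> 'b) \<Rightarrow> 'i \<Rightarrow> 'b" where "m = (\<lambda>x y. \<lambda>i\<in>I \<union> J. if i \<in> I then x i else y i)"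
  have mem: "m u v \<in> PiE (I \<union> J) X" if "u \<in> PiE I X" "v \<in> PiE J X" for u v
    using that by (auto simp: m_def PiE_iff)
  have updI: "m (u(i := a)) v = (m u v)(i := a)" if "i \<in> I" for u v i a
    using that by (auto simp: m_def fun_eq_iff)
  have updJ: "m u (v(i := a)) = (m u v)(i := a)" if "i \<in> J" for u v i a
    using that assms(1) by (auto simp: m_def fun_eq_iff)
  show "tensor_mult scale I J X (pure_tensor scale I X x) (pure_tensor scale J X y) M =
        pure_tensor scale (I \<union> J) X (\<lambda>i. if i \<in> I then x i else y i) M"
  proof (cases "multilinear_form scale (I \<union> J) X M")
    case True
    let ?N = "\<lambda>u. pure_tensor scale J X y (\<lambda>v. M (m u v))"
    have J: "multilinear_form scale J X (\<lambda>v. M (m u v))" if "u \<in> PiE I X" for u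
      using True mem[OF that] unfolding multilinear_form_def by (simp add: updJ)
    have N: "?N u = M (m u y)" if "u \<in> PiE I X" for u
      using J[OF that] assms(3) by (simp add: pure_tensor_def PiE_restrict)
    have upd: "u(i := a) \<in> PiE I X" if "u \<in> PiE I X" "i \<in> I" "a \<in> X i" for u i a
      using that by (auto simp: PiE_iff extensional_def)
    have I: "multilinear_form scale I X (\<lambda>u. M (m u y))"
      using True mem[OF _ assms(3)] unfolding multilinear_form_def by (simp add: updI)
    have "multilinear_form scale I X ?N"
      using I closed unfolding multilinear_form_def by (simp add: N upd)
    moreover have "pure_tensor scale I X x N = N x" if "multilinear_form scale I X N" for N
      using that assms(2) by (simp add: pure_tensor_def PiE_restrict)
    ultimately have "pure_tensor scale I X x ?N = M (m x y)"
      using N[OF assms(2)] by simp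
    then show ?thesis
      using True by (simp add: tensor_mult_def pure_tensor_def m_def)
  next
    case False
    then show ?thesis by (simp add: tensor_mult_def pure_tensor_def)
  qed
qed


section \<open>Film Topological Field Theories\<close>

definition fin_dim_subspace :: "('k::field \<Rightarrow> 'b::ab_group_add \<Rightarrow> 'b) \<Rightarrow> 'b set \<Rightarrow> bool" where
  "fin_dim_subspace scale U \<longleftrightarrow> (\<exists>S. finite S \<and> U = module.span scale S)"

definition state_space ::
  "('k::field \<Rightarrow> 'b::ab_group_add \<Rightarrow> 'b) \<Rightarrow> ('c ograph set \<Rightarrow> 'b set) \<Rightarrow> 'c complex2 \<Rightarrow>
    (nat, 'b, 'k) tensor set" where
  "state_space scale B \<Omega> = tensor_space scale (verts \<Omega>) (\<lambda>q. B (vclass \<Omega> q))"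

text \<open>$B_\sigma \otimes B_{\sigma^*}$, with the first factor indexed by \<open>True\<close>.\<close>

definition dual_pair :: "('c ograph set \<Rightarrow> 'b set) \<Rightarrow> 'c ograph set \<Rightarrow> bool \<Rightarrow> 'b set" where
  "dual_pair B \<sigma> = (\<lambda>i. if i then B \<sigma> else B (star \<sigma>))"

definition iso_map ::
  "('k::field \<Rightarrow> 'b::ab_group_add \<Rightarrow> 'b) \<Rightarrow> ('c ograph set \<Rightarrow> 'b set) \<Rightarrow> (nat \<Rightarrow> nat) \<Rightarrow>
    'c complex2 \<Rightarrow> 'c complex2 \<Rightarrow> (nat, 'b, 'k) tensor \<Rightarrow> (nat, 'b, 'k) tensor" where
  "iso_map scale B fv \<Omega> \<Omega>' =
     tensor_reindex scale (verts \<Omega>') (\<lambda>q. B (vclass \<Omega>' q)) (inv_into (verts \<Omega>) fv)"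

definition cut_map ::
  "('k::field \<Rightarrow> 'b::ab_group_add \<Rightarrow> 'b) \<Rightarrow> ('c ograph set \<Rightarrow> 'b set) \<Rightarrow>
    ('c ograph set \<Rightarrow> (bool, 'b, 'k) tensor) \<Rightarrow> nat \<Rightarrow> nat \<Rightarrow>
    'c complex2 \<Rightarrow> 'c complex2 \<Rightarrow> (nat, 'b, 'k) tensor \<Rightarrow> (nat, 'b, 'k) tensor" where
  "cut_map scale B K qp qm \<Omega> \<Omega>' t =
     tensor_mult scale (verts \<Omega>) {qp, qm} (\<lambda>q. B (vclass \<Omega>' q)) t
       (tensor_reindex scale {qp, qm} (\<lambda>q. B (vclass \<Omega>' q)) (\<lambda>q. q = qp) (K (vclass \<Omega>' qp)))"

definition union_map ::
  "('k::field \<Rightarrow> 'b::ab_group_add \<Rightarrow> 'b) \<Rightarrow> ('c ograph set \<Rightarrow> 'b set) \<Rightarrow>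
    'c complex2 \<Rightarrow> 'c complex2 \<Rightarrow> 'c complex2 \<Rightarrow>
    (nat, 'b, 'k) tensor \<Rightarrow> (nat, 'b, 'k) tensor \<Rightarrow> (nat, 'b, 'k) tensor" where
  "union_map scale B \<Omega>1 \<Omega>2 \<Omega> =
     tensor_mult scale (verts \<Omega>1) (verts \<Omega>2) (\<lambda>q. B (vclass \<Omega> q))"

definition film_tft ::
  "('k::field_char_0 \<Rightarrow> 'b::ab_group_add \<Rightarrow> 'b) \<Rightarrow> ('c ograph set \<Rightarrow> 'b set) \<Rightarrow>
    ('c ograph set \<Rightarrow> (bool, 'b, 'k) tensor) \<Rightarrow>
    ('c complex2 \<Rightarrow> (nat, 'b, 'k) tensor \<Rightarrow> 'k) \<Rightarrow> bool" where
  "film_tft scale B K \<Phi> \<longleftrightarrow>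
     vector_space scale \<and>
     (\<forall>\<sigma>\<in>Graphs. fin_dim_subspace scale (B \<sigma>) \<and>
                 K \<sigma> \<in> tensor_space scale UNIV (dual_pair B \<sigma>)) \<and>
     (\<forall>\<Omega>. film_surface \<Omega> \<longrightarrow> linear_form_on (state_space scale B \<Omega>) (\<Phi> \<Omega>)) \<and>
     (\<forall>\<Omega> \<Omega>' fv fe fd. film_surface \<Omega> \<and> film_surface \<Omega>' \<and> film_iso fv fe fd \<Omega> \<Omega>' \<longrightarrow>
        (\<forall>t\<in>state_space scale B \<Omega>. \<Phi> \<Omega>' (iso_map scale B fv \<Omega> \<Omega>' t) = \<Phi> \<Omega> t)) \<and>
     (\<forall>\<Omega> q1 q2 \<sigma>. film_surface \<Omega> \<and> verts \<Omega> = {q1, q2} \<and> q1 \<noteq> q2 \<and> \<sigma> = vclass \<Omega> q1 \<longrightarrow>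
        (let form = (\<lambda>x y. \<Phi> \<Omega> (pure_tensor scale {q1, q2} (\<lambda>q. B (vclass \<Omega> q))
                                (\<lambda>q. if q = q1 then x else y))) in
         (\<forall>x\<in>B \<sigma>. (\<forall>y\<in>B (star \<sigma>). form x y = 0) \<longrightarrow> x = 0) \<and>
         (\<forall>y\<in>B (star \<sigma>). (\<forall>x\<in>B \<sigma>. form x y = 0) \<longrightarrow> y = 0))) \<and>
     (\<forall>\<Omega> P D A A' qp qm \<Omega>'.
        film_surface \<Omega> \<and> connected_complex \<Omega> \<and> graph_cut \<Omega> P D A A' \<and>
        cut_result \<Omega> A A' qp qm \<Omega>' \<longrightarrow>
        (\<forall>t\<in>state_space scale B \<Omega>. \<Phi> \<Omega>' (cut_map scale B K qp qm \<Omega> \<Omega>' t) = \<Phi> \<Omega> t)) \<and>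
     (\<forall>\<Omega>1 \<Omega>2 \<Omega>. film_surface \<Omega>1 \<and> film_surface \<Omega>2 \<and> disjoint_union \<Omega>1 \<Omega>2 \<Omega> \<longrightarrow>
        (\<forall>t1\<in>state_space scale B \<Omega>1. \<forall>t2\<in>state_space scale B \<Omega>2.
           \<Phi> \<Omega> (union_map scale B \<Omega>1 \<Omega>2 \<Omega> t1 t2) = \<Phi> \<Omega>1 t1 * \<Phi> \<Omega>2 t2))"


section \<open>Graph-Frobenius algebras\<close>

definition is_basis :: "('k::field \<Rightarrow> 'b::ab_group_add \<Rightarrow> 'b) \<Rightarrow> 'b set \<Rightarrow> 'b list \<Rightarrow> bool" where
  "is_basis scale U bs \<longleftrightarrow>
     distinct bs \<and> \<not> module.dependent scale (set bs) \<and> module.span scale (set bs) = U"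

definition inverse_matrix ::
  "('b \<Rightarrow> 'b \<Rightarrow> 'k::field) \<Rightarrow> 'b list \<Rightarrow> 'b list \<Rightarrow> (nat \<Rightarrow> nat \<Rightarrow> 'k) \<Rightarrow> bool" where
  "inverse_matrix pair bs bs' F \<longleftrightarrow>
     length bs = length bs' \<and>
     (\<forall>j<length bs'. \<forall>l<length bs'.
        (\<Sum>i<length bs. F i j * pair (bs ! i) (bs' ! l)) = (if j = l then 1 else 0))"

text \<open>The algebra is the internal direct sum of the subspaces \<open>B \<sigma>\<close> of the vector space \<open>'b\<close>. In the
  last clause \<open>\<sigma>\<close> is $\sigma_{(1,2|3,4)}$ and \<open>\<rho>\<close> is $\sigma_{(4,1|2,3)}$; both are determined by the
  conditions on them.\<close>

definition graph_frobenius ::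
  "('k::field_char_0 \<Rightarrow> 'b::ab_group_add \<Rightarrow> 'b) \<Rightarrow> ('c ograph set \<Rightarrow> 'b set) \<Rightarrow>
    ('b \<Rightarrow> 'b \<Rightarrow> 'k) \<Rightarrow> ('b \<Rightarrow> 'b \<Rightarrow> 'b \<Rightarrow> 'k) \<Rightarrow> bool" where
  "graph_frobenius scale B pair tri \<longleftrightarrow>
     vector_space scale \<and>
     (\<forall>\<sigma>\<in>Graphs. fin_dim_subspace scale (B \<sigma>)) \<and>
     (\<forall>x. \<exists>!v. (\<forall>\<sigma>\<in>Graphs. v \<sigma> \<in> B \<sigma>) \<and> (\<forall>\<sigma>. \<sigma> \<notin> Graphs \<longrightarrow> v \<sigma> = 0) \<and>
               finite {\<sigma>. v \<sigma> \<noteq> 0} \<and> x = (\<Sum>\<sigma> | v \<sigma> \<noteq> 0. v \<sigma>)) \<and>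
     (\<forall>y. Vector_Spaces.linear scale (*) (\<lambda>x. pair x y)) \<and>
     (\<forall>x. Vector_Spaces.linear scale (*) (\<lambda>y. pair x y)) \<and>
     (\<forall>y z. Vector_Spaces.linear scale (*) (\<lambda>x. tri x y z)) \<and>
     (\<forall>x z. Vector_Spaces.linear scale (*) (\<lambda>y. tri x y z)) \<and>
     (\<forall>x y. Vector_Spaces.linear scale (*) (\<lambda>z. tri x y z)) \<and>
     (\<forall>\<sigma>1\<in>Graphs. \<forall>\<sigma>2\<in>Graphs. \<sigma>1 \<noteq> star \<sigma>2 \<longrightarrow> (\<forall>x\<in>B \<sigma>1. \<forall>y\<in>B \<sigma>2. pair x y = 0)) \<and>
     (\<forall>x. (\<forall>y. pair x y = 0) \<longrightarrow> x = 0) \<and>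
     (\<forall>y. (\<forall>x. pair x y = 0) \<longrightarrow> y = 0) \<and>
     (\<forall>\<sigma>1\<in>Graphs. \<forall>\<sigma>2\<in>Graphs. \<forall>\<sigma>3\<in>Graphs. Film [\<sigma>1, \<sigma>2, \<sigma>3] = {} \<longrightarrow>
        (\<forall>x\<in>B \<sigma>1. \<forall>y\<in>B \<sigma>2. \<forall>z\<in>B \<sigma>3. tri x y z = 0)) \<and>
     (\<forall>\<sigma>1\<in>Graphs. \<forall>\<sigma>2\<in>Graphs. \<forall>\<sigma>3\<in>Graphs. \<forall>\<sigma>4\<in>Graphs. \<forall>\<sigma>\<in>Graphs. \<forall>\<rho>\<in>Graphs.
        Film [\<sigma>1, \<sigma>2, \<sigma>3, \<sigma>4] \<noteq> {} \<and>
        Film [\<sigma>1, \<sigma>2, \<sigma>] \<noteq> {} \<and> Film [star \<sigma>, \<sigma>3, \<sigma>4] \<noteq> {} \<and>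
        Film [\<sigma>4, \<sigma>1, \<rho>] \<noteq> {} \<and> Film [star \<rho>, \<sigma>2, \<sigma>3] \<noteq> {} \<longrightarrow>
        (\<forall>b b' F c c' G.
           is_basis scale (B \<sigma>) b \<and> is_basis scale (B (star \<sigma>)) b' \<and> inverse_matrix pair b b' F \<and>
           is_basis scale (B \<rho>) c \<and> is_basis scale (B (star \<rho>)) c' \<and> inverse_matrix pair c c' G \<longrightarrow>
           (\<forall>x1\<in>B \<sigma>1. \<forall>x2\<in>B \<sigma>2. \<forall>x3\<in>B \<sigma>3. \<forall>x4\<in>B \<sigma>4.
              (\<Sum>i<length b. \<Sum>j<length b'. tri x1 x2 (b ! i) * F i j * tri (b' ! j) x3 x4) =
              (\<Sum>i<length c. \<Sum>j<length c'. tri x4 x1 (c ! i) * G i j * tri (c' ! j) x2 x3))))"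

text \<open>
  The numbering $q_1,\dots,q_n$ of the vertices of a connected film surface is determined only up to
  rotation. Hence the formula \<open>chain_sum\<close> below for the value on a surface with two or three
  vertices, which is $(x^1,x^2)$ or $(x^1,x^2,x^3)$, defines a functional only if the forms are
  invariant under rotation. The axioms of \<open>graph_frobenius\<close> do not imply this: over a single color,
  let $B_\sigma$ be two-dimensional for the only class $\sigma = \sigma^*$, the pairing alternating
  and the three-linear form zero.
\<close>

definition rotation_invariant :: "('b \<Rightarrow> 'b \<Rightarrow> 'k) \<Rightarrow> ('b \<Rightarrow> 'b \<Rightarrow> 'b \<Rightarrow> 'k) \<Rightarrow> bool" where
  "rotation_invariant pair tri \<longleftrightarrow>
     (\<forall>x y. pair x y = pair y x) \<and> (\<forall>x y z. tri x y z = tri y z x)"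


section \<open>The construction\<close>

definition indices :: "('c ograph set \<Rightarrow> 'b list) \<Rightarrow> 'c ograph set list \<Rightarrow> nat list set" where
  "indices b \<sigma>s = {I. length I = length \<sigma>s \<and> (\<forall>k<length \<sigma>s. I ! k < length (b (\<sigma>s ! k)))}"

text \<open>
  With \<open>m = n - 3\<close> and all lists counted from 0, the summand is the product of the \<open>m\<close> matrix
  entries and of the \<open>m + 1\<close> values of the three-linear form, whose middle arguments are
  $x^2,\dots,x^{n-1}$. The sum over all lists of classes in $\Sigma$ has at most one non-zero term, so
  \<open>Sum_any\<close>, which would return 0 for infinitely many non-zero terms, is the intended sum.
\<close>

definition chain_term ::
  "('b \<Rightarrow> 'b \<Rightarrow> 'b \<Rightarrow> 'k::field) \<Rightarrow> ('c ograph set \<Rightarrow> 'b list) \<Rightarrow>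
    ('c ograph set \<Rightarrow> nat \<Rightarrow> nat \<Rightarrow> 'k) \<Rightarrow> 'b list \<Rightarrow> 'c ograph set list \<Rightarrow>
    nat list \<Rightarrow> nat list \<Rightarrow> 'k" where
  "chain_term tri b F xs \<sigma>s I J = (let m = length \<sigma>s in
     (\<Prod>k<m. F (\<sigma>s ! k) (I ! k) (J ! k)) *
     (\<Prod>k\<le>m. tri (if k = 0 then xs ! 0 else b (star (\<sigma>s ! (k - 1))) ! (J ! (k - 1)))
                (xs ! (k + 1))
                (if k = m then xs ! (m + 2) else b (\<sigma>s ! k) ! (I ! k))))"

definition chain_sum ::
  "('b \<Rightarrow> 'b \<Rightarrow> 'k::field) \<Rightarrow> ('b \<Rightarrow> 'b \<Rightarrow> 'b \<Rightarrow> 'k) \<Rightarrow> ('c ograph set \<Rightarrow> 'b list) \<Rightarrow>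
    ('c ograph set \<Rightarrow> nat \<Rightarrow> nat \<Rightarrow> 'k) \<Rightarrow> 'b list \<Rightarrow> 'k" where
  "chain_sum pair tri b F xs =
     (if length xs = 2 then pair (xs ! 0) (xs ! 1)
      else Sum_any (\<lambda>\<sigma>s.
        if set \<sigma>s \<subseteq> Graphs \<and> length \<sigma>s = length xs - 3
        then \<Sum>I\<in>indices b \<sigma>s. \<Sum>J\<in>indices b (map star \<sigma>s). chain_term tri b F xs \<sigma>s I J
        else 0))"

text \<open>The functionals are required to be given by the formula for every numbering compatible with the
  cyclic order, so the existence of such a family includes independence of the numbering.\<close>

definition film_construction ::
  "('k::field_char_0 \<Rightarrow> 'b::ab_group_add \<Rightarrow> 'b) \<Rightarrow> ('c ograph set \<Rightarrow> 'b set) \<Rightarrow>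
    ('b \<Rightarrow> 'b \<Rightarrow> 'k) \<Rightarrow> ('b \<Rightarrow> 'b \<Rightarrow> 'b \<Rightarrow> 'k) \<Rightarrow> ('c ograph set \<Rightarrow> 'b list) \<Rightarrow>
    ('c ograph set \<Rightarrow> nat \<Rightarrow> nat \<Rightarrow> 'k) \<Rightarrow> ('c complex2 \<Rightarrow> (nat, 'b, 'k) tensor \<Rightarrow> 'k) \<Rightarrow> bool" where
  "film_construction scale B pair tri b F \<Phi> \<longleftrightarrow>
     (\<forall>\<Omega>. film_surface \<Omega> \<longrightarrow> linear_form_on (state_space scale B \<Omega>) (\<Phi> \<Omega>)) \<and>
     (\<forall>\<Omega> qs. film_surface \<Omega> \<and> connected_complex \<Omega> \<and> numbering \<Omega> qs \<longrightarrow>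
        (\<forall>x\<in>PiE (verts \<Omega>) (\<lambda>q. B (vclass \<Omega> q)).
           \<Phi> \<Omega> (pure_tensor scale (verts \<Omega>) (\<lambda>q. B (vclass \<Omega> q)) x) =
           chain_sum pair tri b F (map x qs))) \<and>
     (\<forall>\<Omega>. film_surface \<Omega> \<longrightarrow>
        (\<forall>x\<in>PiE (verts \<Omega>) (\<lambda>q. B (vclass \<Omega> q)).
           \<Phi> \<Omega> (pure_tensor scale (verts \<Omega>) (\<lambda>q. B (vclass \<Omega> q)) x) =
           (\<Prod>C\<in>components_of \<Omega>.
              \<Phi> (restrict_complex \<Omega> C)
                (pure_tensor scale C (\<lambda>q. B (vclass (restrict_complex \<Omega> C) q)) x))))"

definition cut_tensor ::
  "('k::field \<Rightarrow> 'b::ab_group_add \<Rightarrow> 'b) \<Rightarrow> ('c ograph set \<Rightarrow> 'b set) \<Rightarrow>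
    ('c ograph set \<Rightarrow> 'b list) \<Rightarrow> ('c ograph set \<Rightarrow> nat \<Rightarrow> nat \<Rightarrow> 'k) \<Rightarrow>
    'c ograph set \<Rightarrow> (bool, 'b, 'k) tensor" where
  "cut_tensor scale B b F \<sigma> =
     (\<lambda>M. \<Sum>i<length (b \<sigma>). \<Sum>j<length (b (star \<sigma>)).
        F \<sigma> i j * pure_tensor scale UNIV (dual_pair B \<sigma>)
                    (\<lambda>s. if s then b \<sigma> ! i else b (star \<sigma>) ! j) M)"

end

theory Submission
  imports Defs
begin

text \<open>
  Contracting consecutive vertices of a connected film surface \<Omega> again gives a film surface, and the
  vertex graph of the new vertex depends only on the set of contracted vertices. So every partition of
  the cyclically ordered vertices into arcs is realized by a film surface whose vertices carry the
  classes of the arcs. On arcs with three vertices this gives a product \<open>mult\<close> on the spaces attached to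
  arcs, dual to the three-linear form; the Frobenius axiom, applied to partitions into four arcs, says
  that it is associative. Hence the chain formula is the pairing of the products over any two
  complementary arcs, which yields at once its invariance under rotation and, expanding the pairing in
  dual bases, its invariance under cuts.

  In the chain formula one sums over all intermediate classes, so one needs that at most one choice
  contributes. Classes are determined by the partition of their flags (color, side) into vertices. Two
  of the three classes of a surface with three vertices determine the third up to classes with disjoint
  sets of colors, and the colors of an intermediate class occur on both sides of the corresponding cut.
\<close>

section \<open>Cyclic orders and lists\<close>

text \<open>Two classes may have several third classes, so the three-linear form gives no single
  product of \<open>B \<sigma>\<close> and \<open>B \<tau>\<close>. This is why \<open>mult\<close>
  carries its target class as a parameter and is only used with targets read off from the arcs of
  one fixed surface. Associativity is tested against a further non-empty arc, since the axiom speaks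
  of four arcs; there is no product over the whole circle, and every evaluation ends with a pairing.
  Symmetry of the pairing and cyclic symmetry of the three-linear form allow a vertex to be moved
  from one factor of that pairing to the other. Contraction of an arc is the operation
  \<open>cut_piece\<close> that also defines cuts, so the surfaces fed into the Frobenius axiom and
  the pieces of the cut axiom come from one construction. As tensors are functionals on multilinear
  forms, a linear functional prescribed on pure tensors is evaluation at one such form; a claim
  about every admissible \<open>\<Phi>\<close> thereby becomes a claim about
  \<open>surface_value\<close>.\<close>

definition rotated :: "'a list \<Rightarrow> 'a list \<Rightarrow> bool" where
  "rotated xs ys \<longleftrightarrow> (\<exists>l r. xs = l @ r \<and> ys = r @ l)"

text \<open>Splitting a list is the convenient form for arcs and for \<open>concat\<close>,
  \<open>filter\<close> and \<open>set\<close>; \<open>rotate\<close> serves for transitivity and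
  for lists that are rotated in parallel.\<close>

lemma rotated_iff_rotate: "rotated xs ys \<longleftrightarrow> (\<exists>k. ys = rotate k xs)"
proof
  assume "rotated xs ys"
  then obtain l r where "xs = l @ r" "ys = r @ l" unfolding rotated_def by blast
  then show "\<exists>k. ys = rotate k xs" by (metis rotate_append)
next
  assume "\<exists>k. ys = rotate k xs"
  then show "rotated xs ys"
    unfolding rotated_def by (metis append_take_drop_id rotate_drop_take)
qed

lemma rotated_refl [simp]: "rotated xs xs"
  unfolding rotated_def by (rule exI[of _ "[]"]) simp

lemma rotated_append: "rotated (l @ r) (r @ l)"
  unfolding rotated_def by blast

lemma rotated_trans: "rotated xs ys \<Longrightarrow> rotated ys zs \<Longrightarrow> rotated xs zs"
  unfolding rotated_iff_rotate by (metis rotate_rotate)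

lemma rotated_set: "rotated xs ys \<Longrightarrow> set ys = set xs"
  unfolding rotated_def by auto

lemma rotated_distinct: "rotated xs ys \<Longrightarrow> distinct ys = distinct xs"
  unfolding rotated_def by auto

lemma rotated_length: "rotated xs ys \<Longrightarrow> length ys = length xs"
  unfolding rotated_def by auto

lemma rotated_to_front:
  assumes "x \<in> set xs" shows "\<exists>ys. rotated xs (x # ys)"
proof -
  obtain l r where "xs = l @ x # r" using assms by (meson split_list)
  then show ?thesis unfolding rotated_def by (intro exI[of _ "r @ l"] exI[of _ l] exI[of _ "x # r"]) simp
qed

lemma rotated_concat_map:
  "rotated xs ys \<Longrightarrow> rotated (concat (map f xs)) (concat (map f ys))"
  unfolding rotated_def by (metis concat_append map_append)

lemma in_cyclic_order_Nil [simp]: "in_cyclic_order R []"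
  unfolding in_cyclic_order_def by simp

text \<open>Fixing the first element turns the ternary relation into a binary one, so cyclic orders
  can be handled by \<open>sorted_wrt\<close> and list induction.\<close>

lemma in_cyclic_order_Cons:
  "in_cyclic_order R (x # xs) \<longleftrightarrow>
     x \<notin> set xs \<and> sorted_wrt (\<lambda>a b. (x, a, b) \<in> R) xs \<and> in_cyclic_order R xs" (is "?L \<longleftrightarrow> ?R")
proof
  assume L: ?L
  have "sorted_wrt (\<lambda>a b. (x, a, b) \<in> R) xs"
    unfolding sorted_wrt_iff_nth_less
  proof (intro allI impI)
    fix i j assume "i < j" "j < length xs"
    then have "((x # xs) ! 0, (x # xs) ! Suc i, (x # xs) ! Suc j) \<in> R"
      using L unfolding in_cyclic_order_def by (metis Suc_less_eq length_Cons zero_less_Suc)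
    then show "(x, xs ! i, xs ! j) \<in> R" by simp
  qed
  moreover have "in_cyclic_order R xs"
    using L unfolding in_cyclic_order_def
    by (metis Suc_less_eq distinct.simps(2) length_Cons nth_Cons_Suc)
  ultimately show ?R using L unfolding in_cyclic_order_def by simp
next
  assume R: ?R
  have "((x # xs) ! i, (x # xs) ! j, (x # xs) ! k) \<in> R"
    if "i < j" "j < k" "k < length (x # xs)" for i j k
  proof -
    obtain j' k' where jk: "j = Suc j'" "k = Suc k'" "j' < k'" "k' < length xs"
      using \<open>i < j\<close> \<open>j < k\<close> \<open>k < length (x # xs)\<close> by (cases j; cases k) auto
    show ?thesis
      using R jk \<open>i < j\<close> unfolding in_cyclic_order_def sorted_wrt_iff_nth_less by (cases i) auto
  qed
  then show ?L using R unfolding in_cyclic_order_def by auto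
qed

lemma in_cyclic_order_snoc:
  "in_cyclic_order R (xs @ [x]) \<longleftrightarrow>
     x \<notin> set xs \<and> sorted_wrt (\<lambda>a b. (a, b, x) \<in> R) xs \<and> in_cyclic_order R xs"
  by (induction xs) (auto simp: in_cyclic_order_Cons sorted_wrt_append)

lemma in_cyclic_order_distinct: "in_cyclic_order R xs \<Longrightarrow> distinct xs"
  unfolding in_cyclic_order_def by simp

lemma in_cyclic_order_filter: "in_cyclic_order R xs \<Longrightarrow> in_cyclic_order R (filter P xs)"
  by (induction xs) (auto simp: in_cyclic_order_Cons sorted_wrt_filter)

lemma in_cyclic_order_cong:
  assumes "\<And>a b c. a \<in> set xs \<Longrightarrow> b \<in> set xs \<Longrightarrow> c \<in> set xs \<Longrightarrow> (a, b, c) \<in> R \<Longrightarrow> (a, b, c) \<in> R'"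
    and "in_cyclic_order R xs"
  shows "in_cyclic_order R' xs"
  using assms unfolding in_cyclic_order_def
  by (meson dual_order.strict_trans nth_mem)

text \<open>One element at a time moves from the front to the end: the conditions for
  \<open>x # xs\<close> and \<open>xs @ [x]\<close> differ exactly by a cyclic shift of the
  triples.\<close>

lemma in_cyclic_order_rotated:
  assumes cyc: "\<And>a b c. (a, b, c) \<in> R \<Longrightarrow> (b, c, a) \<in> R"
    and "in_cyclic_order R xs" "rotated xs ys"
  shows "in_cyclic_order R ys"
proof -
  obtain l r where "xs = l @ r" "ys = r @ l" using assms(3) unfolding rotated_def by blast
  moreover have "in_cyclic_order R (l @ r) \<Longrightarrow> in_cyclic_order R (r @ l)"
  proof (induction l arbitrary: r)
    case (Cons x l)
    have "in_cyclic_order R (x # (l @ r))" using Cons.prems by simp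
    then have "in_cyclic_order R ((l @ r) @ [x])"
      unfolding in_cyclic_order_Cons in_cyclic_order_snoc
      using cyc by (auto elim: sorted_wrt_mono_rel[rotated])
    then show ?case using Cons.IH[of "r @ [x]"] by simp
  qed simp
  ultimately show ?thesis using assms(2) by simp
qed

lemma sorted_wrt_same_set:
  assumes "sorted_wrt r xs" "sorted_wrt r ys" "set xs = set ys" "distinct xs" "distinct ys"
    and asym: "\<And>a b. a \<in> set xs \<Longrightarrow> b \<in> set xs \<Longrightarrow> r a b \<Longrightarrow> \<not> r b a"
  shows "xs = ys"
  using assms
proof (induction xs arbitrary: ys)
  case (Cons x xs)
  obtain y ys' where ys: "ys = y # ys'" using Cons.prems(3) by (cases ys) auto
  have "x = y"
  proof (rule ccontr)
    assume "x \<noteq> y"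
    then have "y \<in> set xs" "x \<in> set ys'" using Cons.prems(3) ys by (metis list.set_intros(1) set_ConsD)+
    then have "r x y" "r y x" using Cons.prems(1,2) ys by auto
    then show False using Cons.prems(6)[of x y] \<open>y \<in> set xs\<close> by auto
  qed
  moreover have "xs = ys'"
  proof (rule Cons.IH)
    show "set xs = set ys'" using Cons.prems(3,4,5) ys \<open>x = y\<close> by auto
    show "\<And>a b. a \<in> set xs \<Longrightarrow> b \<in> set xs \<Longrightarrow> r a b \<Longrightarrow> \<not> r b a" using Cons.prems(6) by simp
  qed (use Cons.prems ys in auto)
  ultimately show ?case using ys by simp
qed simp

text \<open>After \<open>xs\<close> is rotated to start with the head \<open>y\<close> of
  \<open>ys\<close>, both tails are sorted by the asymmetric relation
  \<open>(y, a, b) \<in> R\<close> and have the same elements, so they coincide.\<close>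

lemma in_cyclic_order_unique:
  assumes cyc: "\<And>a b c. (a, b, c) \<in> R \<Longrightarrow> (b, c, a) \<in> R"
    and asym: "\<And>a b c. (a, b, c) \<in> R \<Longrightarrow> (c, b, a) \<notin> R"
    and xs: "in_cyclic_order R xs" and ys: "in_cyclic_order R ys" and "set xs = set ys"
  shows "rotated xs ys"
proof (cases ys)
  case Nil
  then show ?thesis using assms(5) by simp
next
  case (Cons y ys')
  then obtain xs' where xs': "rotated xs (y # xs')" using rotated_to_front assms(5) by force
  have 1: "in_cyclic_order R (y # xs')" using in_cyclic_order_rotated[OF cyc xs xs'] .
  have 2: "in_cyclic_order R (y # ys')" using ys Cons by simp
  have "set (y # xs') = set (y # ys')" using rotated_set[OF xs'] assms(5) Cons by simp
  then have "set xs' = set ys'" using 1 2 unfolding in_cyclic_order_Cons by (metis insert_ident list.simps(15))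
  then have "xs' = ys'"
    using sorted_wrt_same_set[of "\<lambda>a b. (y, a, b) \<in> R" xs' ys'] 1 2 asym cyc
    unfolding in_cyclic_order_Cons by (metis in_cyclic_order_distinct)
  then show ?thesis using xs' Cons by simp
qed

lemma cyclic_order_onD:
  assumes "cyclic_order_on C R"
  shows "R \<subseteq> C \<times> C \<times> C"
    and "(a, b, c) \<in> R \<Longrightarrow> (b, c, a) \<in> R"
    and "(a, b, c) \<in> R \<Longrightarrow> (c, b, a) \<notin> R"
    and "(a, b, c) \<in> R \<Longrightarrow> (a, c, d) \<in> R \<Longrightarrow> (a, b, d) \<in> R"
    and "a \<in> C \<Longrightarrow> b \<in> C \<Longrightarrow> c \<in> C \<Longrightarrow> a \<noteq> b \<Longrightarrow> b \<noteq> c \<Longrightarrow> c \<noteq> a \<Longrightarrow> (a, b, c) \<in> R \<or> (c, b, a) \<in> R"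
  using assms unfolding cyclic_order_on_def by blast+

lemma cyclic_order_on_distinct:
  assumes "cyclic_order_on C R" "(a, b, c) \<in> R" shows "a \<noteq> b" "b \<noteq> c" "c \<noteq> a"
  using cyclic_order_onD(2,3)[OF assms(1)] assms(2) by metis+

lemma ex_sorted_wrt:
  assumes "finite S" and trans: "\<And>a b c. r a b \<Longrightarrow> r b c \<Longrightarrow> r a c"
    and total: "\<And>a b. a \<in> S \<Longrightarrow> b \<in> S \<Longrightarrow> a \<noteq> b \<Longrightarrow> r a b \<or> r b a"
  shows "\<exists>xs. set xs = S \<and> distinct xs \<and> sorted_wrt r xs"
  using assms(1) total
proof (induction S rule: finite_induct)
  case (insert y S)
  then obtain xs where xs: "set xs = S" "distinct xs" "sorted_wrt r xs" by (metis insertI2)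
  have tot: "a \<in> S \<Longrightarrow> r a y \<or> r y a" for a using insert.prems insert.hyps(2) by (metis insertI1 insertI2)
  let ?L = "filter (\<lambda>x. r x y) xs" and ?R = "filter (\<lambda>x. \<not> r x y) xs"
  have LR: "a \<in> set xs \<Longrightarrow> r a y \<Longrightarrow> b \<in> set xs \<Longrightarrow> \<not> r b y \<Longrightarrow> r a b" for a b
    using tot xs(1) trans by blast
  have yR: "b \<in> set xs \<Longrightarrow> \<not> r b y \<Longrightarrow> r y b" for b
    using tot xs(1) by blast
  have "sorted_wrt r (?L @ y # ?R)"
    unfolding sorted_wrt_append using LR yR xs(3) by (auto simp: sorted_wrt_filter)
  moreover have "set (?L @ y # ?R) = insert y S" "distinct (?L @ y # ?R)"
    using xs insert.hyps(2) by auto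
  ultimately show ?case by blast
qed simp

text \<open>Cutting the circle at a point \<open>a\<close> leaves the strict linear order
  \<open>(a, x, y) \<in> R\<close> on the other points; listing them in this order gives the
  numbering.\<close>

lemma ex_in_cyclic_order:
  assumes C: "cyclic_order_on C R" and "finite C"
  shows "\<exists>qs. set qs = C \<and> in_cyclic_order R qs"
proof (cases "C = {}")
  case False
  then obtain a where a: "a \<in> C" by blast
  note D = cyclic_order_onD[OF C]
  have "\<exists>xs. set xs = C - {a} \<and> distinct xs \<and> sorted_wrt (\<lambda>x y. (a, x, y) \<in> R) xs"
  proof (rule ex_sorted_wrt)
    fix x y assume "x \<in> C - {a}" "y \<in> C - {a}" "x \<noteq> y"
    then show "(a, x, y) \<in> R \<or> (a, y, x) \<in> R" using D(2,5) a by (metis Diff_iff insertI1)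
  qed (use assms(2) D(4) in \<open>auto\<close>)
  then obtain xs where xs: "set xs = C - {a}" "distinct xs" "sorted_wrt (\<lambda>x y. (a, x, y) \<in> R) xs"
    by blast
  have "in_cyclic_order R xs" using xs(2,3)
  proof (induction xs)
    case (Cons x xs)
    have "sorted_wrt (\<lambda>y z. (x, y, z) \<in> R) xs"
    proof (rule sorted_wrt_mono_rel[rotated])
      show "sorted_wrt (\<lambda>y z. (a, y, z) \<in> R) xs" using Cons.prems by simp
      fix y z assume yz: "y \<in> set xs" "z \<in> set xs" "(a, y, z) \<in> R"
      have "(a, x, y) \<in> R" using Cons.prems(2) yz(1) by simp
      \<comment> \<open>Transitivity is applied with base point \<open>y\<close> to the rotated
        triples \<open>(y, z, a)\<close> and \<open>(y, a, x)\<close>.\<close>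
      then show "(x, y, z) \<in> R" using D(2,4) yz(3) by meson
    qed
    then show ?case using Cons unfolding in_cyclic_order_Cons by simp
  qed simp
  then have "in_cyclic_order R (a # xs)" unfolding in_cyclic_order_Cons using xs by simp
  then show ?thesis using xs(1) a by (intro exI[of _ "a # xs"]) auto
qed (auto intro: exI[of _ "[]"])

section \<open>The standard cyclic order of a list of distinct points\<close>

definition circ :: "nat \<Rightarrow> nat \<Rightarrow> nat \<Rightarrow> bool" where
  "circ i j k \<longleftrightarrow> i < j \<and> j < k \<or> j < k \<and> k < i \<or> k < i \<and> i < j"

definition circle :: "nat list \<Rightarrow> (nat \<times> nat \<times> nat) set" where
  "circle qs = {(qs ! i, qs ! j, qs ! k) | i j k.
                 i < length qs \<and> j < length qs \<and> k < length qs \<and> circ i j k}"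

lemma circle_nth:
  assumes "distinct qs" "i < length qs" "j < length qs" "k < length qs"
  shows "(qs ! i, qs ! j, qs ! k) \<in> circle qs \<longleftrightarrow> circ i j k"
  using assms unfolding circle_def by (auto simp: nth_eq_iff_index_eq)

lemma circleE:
  assumes "(a, b, c) \<in> circle qs"
  obtains i j k where "a = qs ! i" "b = qs ! j" "c = qs ! k"
    "i < length qs" "j < length qs" "k < length qs" "circ i j k"
  using assms unfolding circle_def by blast

lemma cyclic_order_on_circle:
  assumes "distinct qs" shows "cyclic_order_on (set qs) (circle qs)"
  unfolding cyclic_order_on_def
proof (intro conjI allI impI ballI)
  show "circle qs \<subseteq> set qs \<times> set qs \<times> set qs" unfolding circle_def by auto
next
  fix a b c assume "(a, b, c) \<in> circle qs"
  then show "(b, c, a) \<in> circle qs" by (elim circleE) (auto simp: circle_nth[OF assms] circ_def)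
next
  fix a b c assume "(a, b, c) \<in> circle qs"
  then show "(c, b, a) \<notin> circle qs" by (elim circleE) (auto simp: circle_nth[OF assms] circ_def)
next
  fix a b c d assume A: "(a, b, c) \<in> circle qs \<and> (a, c, d) \<in> circle qs"
  obtain i j k where 1: "a = qs ! i" "b = qs ! j" "c = qs ! k"
    "i < length qs" "j < length qs" "k < length qs" "circ i j k" using A by (blast elim: circleE)
  obtain l where 2: "d = qs ! l" "l < length qs" using A unfolding circle_def by blast
  then show "(a, b, d) \<in> circle qs" using A 1
    by (auto simp: circle_nth[OF assms] circ_def)
next
  fix a b c assume A: "a \<in> set qs" "b \<in> set qs" "c \<in> set qs" "a \<noteq> b \<and> b \<noteq> c \<and> c \<noteq> a"
  then obtain i j k where 1: "a = qs ! i" "b = qs ! j" "c = qs ! k"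
    "i < length qs" "j < length qs" "k < length qs" by (metis in_set_conv_nth)
  then have "i \<noteq> j" "j \<noteq> k" "k \<noteq> i" using A by auto
  then show "(a, b, c) \<in> circle qs \<or> (c, b, a) \<in> circle qs"
    using 1 by (auto simp: circle_nth[OF assms] circ_def)
qed

lemma in_cyclic_order_circle: "distinct qs \<Longrightarrow> in_cyclic_order (circle qs) qs"
  unfolding in_cyclic_order_def by (auto simp: circle_nth circ_def)

text \<open>Every triple of \<open>circle qs\<close> lies in \<open>R\<close> by rotation. Nothing
  more fits in: \<open>circle qs\<close> is already total, and a further triple of \<open>R\<close>
  would clash with its reverse.\<close>

lemma circle_unique:
  assumes C: "cyclic_order_on (set qs) R" and qs: "in_cyclic_order R qs"
  shows "R = circle qs"
proof -
  note D = cyclic_order_onD[OF C]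
  have d: "distinct qs" using qs by (rule in_cyclic_order_distinct)
  have sub: "circle qs \<subseteq> R"
  proof (clarify elim!: circleE)
    fix i j k assume ijk: "i < length qs" "j < length qs" "k < length qs" "circ i j k"
    have step: "(qs ! i, qs ! j, qs ! k) \<in> R" if "i < j" "j < k" "k < length qs" for i j k
      using qs that unfolding in_cyclic_order_def by blast
    show "(qs ! i, qs ! j, qs ! k) \<in> R"
      using ijk step D(2) unfolding circ_def by meson
  qed
  moreover have "R \<subseteq> circle qs"
  proof clarify
    fix a b c assume abc: "(a, b, c) \<in> R"
    have "a \<in> set qs" "b \<in> set qs" "c \<in> set qs" using D(1) abc by auto
    moreover have "a \<noteq> b" "b \<noteq> c" "c \<noteq> a" using cyclic_order_on_distinct[OF C abc] .
    ultimately have "(a, b, c) \<in> circle qs \<or> (c, b, a) \<in> circle qs"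
      using cyclic_order_onD(5)[OF cyclic_order_on_circle[OF d]] by blast
    then show "(a, b, c) \<in> circle qs" using sub D(3)[OF abc] by blast
  qed
  ultimately show ?thesis by blast
qed

section \<open>Classes of graphs\<close>

lemma graph_iso_refl: "graph_iso g g"
  unfolding graph_iso_def by (intro exI[of _ id]) auto

lemma graph_iso_trans:
  assumes "graph_iso g h" "graph_iso h k" shows "graph_iso g k"
proof -
  obtain fv fe where 1: "bij_betw fv (gverts g) (gverts h)" "bij_betw fe (gedges g) (gedges h)"
    "\<forall>e\<in>gedges g. gsrc h (fe e) = fv (gsrc g e) \<and> gtgt h (fe e) = fv (gtgt g e) \<and>
                  gcolor h (fe e) = gcolor g e"
    using assms(1) unfolding graph_iso_def by blast
  obtain fv' fe' where 2: "bij_betw fv' (gverts h) (gverts k)" "bij_betw fe' (gedges h) (gedges k)"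
    "\<forall>e\<in>gedges h. gsrc k (fe' e) = fv' (gsrc h e) \<and> gtgt k (fe' e) = fv' (gtgt h e) \<and>
                  gcolor k (fe' e) = gcolor h e"
    using assms(2) unfolding graph_iso_def by blast
  show ?thesis unfolding graph_iso_def
    by (intro exI[of _ "fv' \<circ> fv"] exI[of _ "fe' \<circ> fe"] conjI bij_betw_trans[OF 1(1) 2(1)]
        bij_betw_trans[OF 1(2) 2(2)]) (use 1 2 bij_betwE[OF 1(2)] in simp)
qed

lemma conn_graph_ends:
  assumes "conn_graph g" "e \<in> gedges g"
  shows "gsrc g e \<in> gverts g" "gtgt g e \<in> gverts g" "gsrc g e \<noteq> gtgt g e"
  using assms unfolding conn_graph_def by blast+

text \<open>\<open>conn_graph g\<close> supplies that the ends of edges are vertices, where the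
  inverse of the vertex bijection undoes it.\<close>

lemma graph_iso_sym:
  assumes g: "conn_graph g" and "graph_iso g h" shows "graph_iso h g"
proof -
  obtain fv fe where 1: "bij_betw fv (gverts g) (gverts h)" "bij_betw fe (gedges g) (gedges h)"
    "\<forall>e\<in>gedges g. gsrc h (fe e) = fv (gsrc g e) \<and> gtgt h (fe e) = fv (gtgt g e) \<and>
                  gcolor h (fe e) = gcolor g e"
    using assms(2) unfolding graph_iso_def by blast
  show ?thesis unfolding graph_iso_def
  proof (intro exI conjI ballI)
    show "bij_betw (inv_into (gverts g) fv) (gverts h) (gverts g)"
      "bij_betw (inv_into (gedges g) fe) (gedges h) (gedges g)"
      using 1 by (auto intro: bij_betw_inv_into)
    fix e assume "e \<in> gedges h"
    then obtain e' where e': "e' \<in> gedges g" "e = fe e'" using 1(2) by (auto simp: bij_betw_def)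
    then have i: "inv_into (gedges g) fe e = e'" using 1(2) by (simp add: bij_betw_def)
    show "gsrc g (inv_into (gedges g) fe e) = inv_into (gverts g) fv (gsrc h e)"
      "gtgt g (inv_into (gedges g) fe e) = inv_into (gverts g) fv (gtgt h e)"
      "gcolor g (inv_into (gedges g) fe e) = gcolor h e"
      using e' 1 conn_graph_ends[OF g e'(1)] unfolding i by (auto simp: bij_betw_def)
  qed
qed

lemma graph_class_eq:
  assumes "conn_graph g" "graph_iso g h" shows "graph_class g = graph_class h"
  unfolding graph_class_def using graph_iso_trans graph_iso_sym assms by blast

text \<open>Sources and targets of the graphs in question are given by \<open>THE\<close> and are
  meaningless off the edges, so equality of records would be too much to ask.\<close>

lemma graph_class_cong:
  assumes "gverts g = gverts h" "gedges g = gedges h"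
    and "\<And>e. e \<in> gedges h \<Longrightarrow> gsrc g e = gsrc h e \<and> gtgt g e = gtgt h e \<and> gcolor g e = gcolor h e"
  shows "graph_class g = graph_class h"
proof -
  have "graph_iso g k \<longleftrightarrow> graph_iso h k" for k
    unfolding graph_iso_def using assms by (metis (no_types, lifting))
  then show ?thesis unfolding graph_class_def by simp
qed

lemma self_in_graph_class: "conn_graph g \<Longrightarrow> g \<in> graph_class g"
  unfolding graph_class_def using graph_iso_refl by blast

lemma graph_class_in_Graphs: "conn_graph g \<Longrightarrow> graph_class g \<in> Graphs"
  unfolding Graphs_def by blast

lemma GraphsE:
  assumes "\<sigma> \<in> Graphs" obtains g where "conn_graph g" "\<sigma> = graph_class g"
  using assms unfolding Graphs_def by blast

lemma reverse_sel [simp]: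
  "gverts (reverse g) = gverts g" "gedges (reverse g) = gedges g"
  "gsrc (reverse g) = gtgt g" "gtgt (reverse g) = gsrc g" "gcolor (reverse g) = gcolor g"
  unfolding reverse_def by simp_all

lemma reverse_reverse [simp]: "reverse (reverse g) = g"
  unfolding reverse_def by simp

lemma graph_iso_reverse: "graph_iso (reverse g) (reverse h) \<longleftrightarrow> graph_iso g h"
proof -
  have "graph_iso (reverse g) (reverse h)" if "graph_iso g h" for g h :: "'a ograph"
    using that unfolding graph_iso_def reverse_sel by blast
  from this[of g h] this[of "reverse g" "reverse h"] show ?thesis by auto
qed

lemma conn_graph_reverse [simp]: "conn_graph (reverse g) \<longleftrightarrow> conn_graph g"
proof -
  have "{(u, v). \<exists>e\<in>gedges g. u = gtgt g e \<and> v = gsrc g e \<or> u = gsrc g e \<and> v = gtgt g e} =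
        {(u, v). \<exists>e\<in>gedges g. u = gsrc g e \<and> v = gtgt g e \<or> u = gtgt g e \<and> v = gsrc g e}"
    by auto
  then show ?thesis unfolding conn_graph_def by auto
qed

lemma star_graph_class: "star (graph_class g) = graph_class (reverse g)"
proof -
  have "h \<in> star (graph_class g) \<longleftrightarrow> h \<in> graph_class (reverse g)" for h
  proof
    assume "h \<in> star (graph_class g)"
    then show "h \<in> graph_class (reverse g)"
      unfolding star_def graph_class_def by (auto simp: graph_iso_reverse)
  next
    assume "h \<in> graph_class (reverse g)"
    then have "reverse h \<in> graph_class g"
      unfolding graph_class_def using graph_iso_reverse[of g "reverse h"] by simp
    then show "h \<in> star (graph_class g)" unfolding star_def by (metis imageI reverse_reverse)
  qed
  then show ?thesis by blast
qed

lemma star_star [simp]: "star (star \<sigma>) = \<sigma>"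
  unfolding star_def by (simp add: image_image)

lemma star_in_Graphs [simp]: "star \<sigma> \<in> Graphs \<longleftrightarrow> \<sigma> \<in> Graphs"
proof -
  have "star \<sigma> \<in> Graphs" if "\<sigma> \<in> Graphs" for \<sigma> :: "'a ograph set"
    using that by (elim GraphsE) (simp add: star_graph_class graph_class_in_Graphs)
  from this[of \<sigma>] this[of "star \<sigma>"] show ?thesis by auto
qed

text \<open>The pair of a color and \<open>True\<close> or \<open>False\<close> stands for the source or target end of the edge of this
  color.\<close>

definition flags :: "'c ograph \<Rightarrow> nat \<Rightarrow> ('c \<times> bool) set" where
  "flags g v = {(gcolor g e, True) | e. e \<in> gedges g \<and> gsrc g e = v} \<union>
               {(gcolor g e, False) | e. e \<in> gedges g \<and> gtgt g e = v}"

definition blocks :: "'c ograph \<Rightarrow> ('c \<times> bool) set set" where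
  "blocks g = flags g ` gverts g"

lemma conn_graph_color_inj:
  assumes "conn_graph g" "e \<in> gedges g" "e' \<in> gedges g" "gcolor g e = gcolor g e'"
  shows "e = e'"
  using assms unfolding conn_graph_def inj_on_def by blast

text \<open>A connected graph with at least one edge has no isolated vertices.\<close>

lemma flags_nonempty:
  assumes g: "conn_graph g" and v: "v \<in> gverts g" shows "flags g v \<noteq> {}"
proof
  assume emp: "flags g v = {}"
  then have no: "gsrc g e \<noteq> v" "gtgt g e \<noteq> v" if "e \<in> gedges g" for e
    using that unfolding flags_def by auto
  obtain e where e: "e \<in> gedges g" using g unfolding conn_graph_def by blast
  define r where "r = {(u, v). \<exists>e\<in>gedges g. (u = gsrc g e \<and> v = gtgt g e) \<or> (u = gtgt g e \<and> v = gsrc g e)}"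
  have "(v, gsrc g e) \<in> r\<^sup>*"
    using g v conn_graph_ends[OF g e] unfolding conn_graph_def connected_by_def r_def by blast
  moreover have "gsrc g e \<noteq> v" using no e by blast
  ultimately obtain w where "(v, w) \<in> r" by (metis converse_rtranclE)
  then show False using no unfolding r_def by auto
qed

lemma flags_disjoint:
  assumes "conn_graph g" "flags g v \<inter> flags g w \<noteq> {}" shows "v = w"
proof -
  obtain p where "p \<in> flags g v" "p \<in> flags g w" using assms(2) by blast
  then obtain e e' where "e \<in> gedges g" "e' \<in> gedges g" "gcolor g e = gcolor g e'"
    "gsrc g e = v \<and> gsrc g e' = w \<or> gtgt g e = v \<and> gtgt g e' = w" unfolding flags_def by auto
  then show ?thesis using conn_graph_color_inj[OF assms(1)] by metis
qed

lemma inj_on_flags: "conn_graph g \<Longrightarrow> inj_on (flags g) (gverts g)"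
  by (rule inj_onI) (use flags_disjoint flags_nonempty in fastforce)

lemma blocks_disjoint:
  assumes "conn_graph g" "\<beta> \<in> blocks g" "\<beta>' \<in> blocks g" "\<beta> \<inter> \<beta>' \<noteq> {}" shows "\<beta> = \<beta>'"
  using assms flags_disjoint unfolding blocks_def by blast

lemma blocks_nonempty: "conn_graph g \<Longrightarrow> blocks g \<noteq> {}"
  unfolding blocks_def conn_graph_def connected_by_def by blast

lemma gcolor_blocks:
  assumes "conn_graph g" shows "gcolor g ` gedges g = fst ` \<Union> (blocks g)"
proof -
  have "gcolor g e \<in> fst ` \<Union> (blocks g)" if "e \<in> gedges g" for e
  proof -
    have "(gcolor g e, True) \<in> flags g (gsrc g e)" using that unfolding flags_def by blast
    moreover have "flags g (gsrc g e) \<in> blocks g"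
      unfolding blocks_def using conn_graph_ends(1)[OF assms that] by blast
    ultimately show ?thesis by (metis UnionI fst_conv image_eqI)
  qed
  moreover have "fst p \<in> gcolor g ` gedges g" if "p \<in> \<Union> (blocks g)" for p
    using that unfolding blocks_def flags_def by auto
  ultimately show ?thesis by blast
qed

lemma graph_iso_blocks:
  assumes g: "conn_graph g" and "graph_iso g h"
  shows "blocks h = blocks g"
proof -
  obtain fv fe where 1: "bij_betw fv (gverts g) (gverts h)" "bij_betw fe (gedges g) (gedges h)"
    "\<forall>e\<in>gedges g. gsrc h (fe e) = fv (gsrc g e) \<and> gtgt h (fe e) = fv (gtgt g e) \<and>
                  gcolor h (fe e) = gcolor g e"
    using assms(2) unfolding graph_iso_def by blast
  have E: "gedges h = fe ` gedges g" and V: "gverts h = fv ` gverts g"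
    using 1 by (auto simp: bij_betw_def)
  have inj: "fv u = fv v \<longleftrightarrow> u = v" if "u \<in> gverts g" "v \<in> gverts g" for u v
    using 1(1) that by (auto simp: bij_betw_def inj_on_def)
  have "flags h (fv v) = flags g v" if v: "v \<in> gverts g" for v
  proof -
    have s: "gsrc h (fe e) = fv v \<longleftrightarrow> gsrc g e = v" "gtgt h (fe e) = fv v \<longleftrightarrow> gtgt g e = v"
      "gcolor h (fe e) = gcolor g e" if "e \<in> gedges g" for e
      using that 1(3) inj v conn_graph_ends[OF g that] by auto
    have "{(gcolor h e, True) | e. e \<in> fe ` gedges g \<and> gsrc h e = fv v} =
          {(gcolor g e, True) | e. e \<in> gedges g \<and> gsrc g e = v}"
      "{(gcolor h e, False) | e. e \<in> fe ` gedges g \<and> gtgt h e = fv v} =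
          {(gcolor g e, False) | e. e \<in> gedges g \<and> gtgt g e = v}"
      using s by force+
    then show ?thesis unfolding flags_def E by simp
  qed
  then show ?thesis unfolding blocks_def V by (simp add: image_image)
qed

text \<open>Vertices are recovered as blocks and edges as colors. The edge of a given color starts
  at the vertex whose block contains its \<open>True\<close> flag and ends at the one with its
  \<open>False\<close> flag, so incidence is preserved as well.\<close>

lemma blocks_graph_iso:
  assumes g: "conn_graph g" and h: "conn_graph h" and eq: "blocks g = blocks h"
  shows "graph_iso g h"
proof -
  define fv where "fv = inv_into (gverts h) (flags h) \<circ> flags g"
  define fe where "fe = inv_into (gedges h) (gcolor h) \<circ> gcolor g"
  have bv: "bij_betw (flags g) (gverts g) (blocks g)" "bij_betw (flags h) (gverts h) (blocks h)"
    using inj_on_flags g h unfolding blocks_def by (auto intro: inj_on_imp_bij_betw)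
  have be: "bij_betw (gcolor g) (gedges g) (gcolor g ` gedges g)"
    "bij_betw (gcolor h) (gedges h) (gcolor g ` gedges g)"
    using g h eq gcolor_blocks[OF g] gcolor_blocks[OF h] unfolding conn_graph_def
    by (auto intro: inj_on_imp_bij_betw simp: bij_betw_def)
  have fv: "bij_betw fv (gverts g) (gverts h)"
    unfolding fv_def by (rule bij_betw_trans[OF bv(1)]) (use bv(2) eq bij_betw_inv_into in force)
  have fe: "bij_betw fe (gedges g) (gedges h)"
    unfolding fe_def by (rule bij_betw_trans[OF be(1)]) (use be(2) bij_betw_inv_into in force)
  have flv: "flags h (fv v) = flags g v" if "v \<in> gverts g" for v
  proof -
    have "flags g v \<in> flags h ` gverts h" using that eq unfolding blocks_def by blast
    then show ?thesis unfolding fv_def by (simp add: f_inv_into_f)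
  qed
  have ce: "gcolor h (fe e) = gcolor g e" if "e \<in> gedges g" for e
    using that be(2) unfolding fe_def by (simp add: bij_betw_def f_inv_into_f)
  have "gsrc h (fe e) = fv (gsrc g e) \<and> gtgt h (fe e) = fv (gtgt g e)" if e: "e \<in> gedges g" for e
  proof -
    have "(gcolor g e, True) \<in> flags h (fv (gsrc g e))" "(gcolor g e, False) \<in> flags h (fv (gtgt g e))"
      using flv conn_graph_ends[OF g e] e by (auto simp: flags_def)
    then obtain e1 e2 where
      "e1 \<in> gedges h" "gcolor h e1 = gcolor g e" "gsrc h e1 = fv (gsrc g e)"
      "e2 \<in> gedges h" "gcolor h e2 = gcolor g e" "gtgt h e2 = fv (gtgt g e)"
      unfolding flags_def by auto
    moreover have "fe e \<in> gedges h" using fe e by (auto simp: bij_betw_def)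
    ultimately show ?thesis using conn_graph_color_inj[OF h] ce[OF e] by metis
  qed
  then show ?thesis unfolding graph_iso_def using fv fe ce by blast
qed

lemma graph_class_eq_iff_blocks:
  assumes "conn_graph g" "conn_graph h"
  shows "graph_class g = graph_class h \<longleftrightarrow> blocks g = blocks h"
proof
  assume "graph_class g = graph_class h"
  then have "graph_iso g h" using self_in_graph_class[OF assms(2)] unfolding graph_class_def by auto
  then show "blocks g = blocks h" using graph_iso_blocks[OF assms(1)] by simp
next
  assume "blocks g = blocks h"
  then show "graph_class g = graph_class h" using blocks_graph_iso graph_class_eq assms by blast
qed

text \<open>All members of a class have the same blocks, so the union is this common value and no
  representative has to be chosen; see \<open>class_blocks_graph_class\<close>.\<close>

definition class_blocks :: "'c ograph set \<Rightarrow> ('c \<times> bool) set set" where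
  "class_blocks \<sigma> = (\<Union>g\<in>\<sigma>. blocks g)"

definition class_colors :: "'c ograph set \<Rightarrow> 'c set" where
  "class_colors \<sigma> = fst ` \<Union> (class_blocks \<sigma>)"

lemma class_blocks_graph_class: "conn_graph g \<Longrightarrow> class_blocks (graph_class g) = blocks g"
proof -
  assume g: "conn_graph g"
  have "blocks h = blocks g" if "h \<in> graph_class g" for h
    using that graph_iso_blocks[OF g] unfolding graph_class_def by simp
  then show ?thesis using self_in_graph_class[OF g] unfolding class_blocks_def by blast
qed

lemma class_colors_graph_class:
  "conn_graph g \<Longrightarrow> class_colors (graph_class g) = gcolor g ` gedges g"
  unfolding class_colors_def by (simp add: class_blocks_graph_class gcolor_blocks)

lemma class_colors_star [simp]:
  assumes "\<sigma> \<in> Graphs" shows "class_colors (star \<sigma>) = class_colors \<sigma>"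
  using assms by (elim GraphsE) (simp add: star_graph_class class_colors_graph_class)

lemma class_colors_nonempty:
  assumes "\<sigma> \<in> Graphs" shows "class_colors \<sigma> \<noteq> {}"
  using assms by (elim GraphsE) (auto simp: class_colors_graph_class conn_graph_def)

lemma class_blocks_eqD:
  assumes "\<sigma> \<in> Graphs" "\<tau> \<in> Graphs" "class_blocks \<sigma> = class_blocks \<tau>" shows "\<sigma> = \<tau>"
  using assms by (elim GraphsE) (simp add: class_blocks_graph_class graph_class_eq_iff_blocks)

lemma class_blocks_disjoint:
  assumes "\<sigma> \<in> Graphs" "\<beta> \<in> class_blocks \<sigma>" "\<beta>' \<in> class_blocks \<sigma>" "\<beta> \<inter> \<beta>' \<noteq> {}"
  shows "\<beta> = \<beta>'"
  using assms blocks_disjoint by (elim GraphsE) (simp add: class_blocks_graph_class)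

section \<open>Boundaries of disks\<close>

lemma zip_rotate:
  assumes "length xs = length ys"
  shows "zip (rotate k xs) (rotate k ys) = rotate k (zip xs ys)"
proof (induction k)
  case (Suc k)
  have "zip (rotate1 as) (rotate1 bs) = rotate1 (zip as bs)" if "length as = length bs"
    for as :: "'a list" and bs :: "'b list"
    using that by (cases as; cases bs) auto
  then show ?case using Suc assms by simp
qed simp

text \<open>Index arithmetic modulo the length is replaced by \<open>rotate1\<close>, which turns
  invariance under rotation into a statement about \<open>zip\<close>.\<close>

lemma traverses_iff_zip:
  "traverses \<Omega> d us es \<longleftrightarrow>
     us \<noteq> [] \<and> length es = length us \<and> distinct us \<and> distinct es \<and> set es \<subseteq> edges \<Omega> \<and>
     (\<forall>(u, e, v)\<in>bdry \<Omega> d. ends \<Omega> e = {u, v}) \<and> bdry \<Omega> d = set (zip us (zip es (rotate1 us)))"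
proof (cases "length es = length us")
  case True
  let ?S = "{(us ! i, es ! i, us ! (Suc i mod length us)) | i. i < length us}"
  have S: "?S = set (zip us (zip es (rotate1 us)))"
    using True by (auto simp: set_zip nth_rotate1 cong: conj_cong)
  have E: "(\<forall>i<length us. ends \<Omega> (es ! i) = {us ! i, us ! (Suc i mod length us)}) \<longleftrightarrow>
           (\<forall>(u, e, v)\<in>?S. ends \<Omega> e = {u, v})"
    by blast
  show ?thesis unfolding traverses_def E S[symmetric]
    by (intro iffI; elim conjE; intro conjI; simp)
qed (simp add: traverses_def)

lemma traverses_rotated:
  assumes "traverses \<Omega> d us es" "rotated us us'" shows "\<exists>es'. traverses \<Omega> d us' es'"
proof -
  obtain k where k: "us' = rotate k us" using assms(2) unfolding rotated_iff_rotate by blast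
  have "rotate1 (rotate k us) = rotate k (rotate1 us)" by (rule rotate1_rotate_swap)
  then have "set (zip us' (zip (rotate k es) (rotate1 us'))) = set (zip us (zip es (rotate1 us)))"
    using assms(1) unfolding traverses_iff_zip k by (simp add: zip_rotate)
  then have "traverses \<Omega> d us' (rotate k es)" using assms(1) unfolding traverses_iff_zip k by simp
  then show ?thesis by blast
qed

lemma traverses_bdry:
  assumes "traverses \<Omega> d us es"
  shows "(u, e, v) \<in> bdry \<Omega> d \<longleftrightarrow> (\<exists>i<length us. u = us ! i \<and> e = es ! i \<and> v = us ! (Suc i mod length us))"
  using assms unfolding traverses_def by auto

lemma traverses_disk_verts: "traverses \<Omega> d us es \<Longrightarrow> disk_verts \<Omega> d = set us"
  unfolding disk_verts_def by (auto simp: traverses_bdry in_set_conv_nth)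

lemma traverses_out_unique:
  assumes "traverses \<Omega> d us es" "(u, e, v) \<in> bdry \<Omega> d" "(u, e', v') \<in> bdry \<Omega> d"
  shows "e = e' \<and> v = v'"
  using assms(2,3) assms(1) unfolding traverses_bdry[OF assms(1)]
  by (auto simp: traverses_def nth_eq_iff_index_eq)

lemma traverses_edge_unique:
  assumes "traverses \<Omega> d us es" "(u, e, v) \<in> bdry \<Omega> d" "(u', e, v') \<in> bdry \<Omega> d"
  shows "u = u' \<and> v = v'"
  using assms(2,3) assms(1) unfolding traverses_bdry[OF assms(1)]
  by (auto simp: traverses_def nth_eq_iff_index_eq)

lemma Suc_mod_inj:
  assumes "i < n" "j < n" "Suc i mod n = Suc j mod n" shows "i = j"
  using assms by (metis Suc_inject mod_Suc mod_less nat.distinct(1))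

lemma traverses_in_unique:
  assumes "traverses \<Omega> d us es" "(u, e, v) \<in> bdry \<Omega> d" "(u', e', v) \<in> bdry \<Omega> d"
  shows "u = u' \<and> e = e'"
proof -
  obtain i j where ij: "i < length us" "u = us ! i" "e = es ! i" "v = us ! (Suc i mod length us)"
    "j < length us" "u' = us ! j" "e' = es ! j" "v = us ! (Suc j mod length us)"
    using assms(2,3) unfolding traverses_bdry[OF assms(1)] by blast
  have "distinct us" "us \<noteq> []" using assms(1) unfolding traverses_def by auto
  then have "Suc i mod length us = Suc j mod length us"
    using ij by (metis length_greater_0_conv mod_less_divisor nth_eq_iff_index_eq)
  then show ?thesis using ij Suc_mod_inj by metis
qed

text \<open>Out of each vertex the boundary has one continuation, so two traversals with the same
  starting vertex agree; the first is rotated to start where the second does.\<close>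

lemma traverses_unique:
  assumes "traverses \<Omega> d us es" "traverses \<Omega> d us' es'" shows "rotated us us'"
proof -
  have ne: "us' \<noteq> []" using assms(2) unfolding traverses_def by simp
  have sets: "set us = set us'" using assms traverses_disk_verts by metis
  have "hd us' \<in> set us" using sets ne by simp
  then obtain t where t: "rotated us (hd us' # t)" using rotated_to_front by metis
  then obtain fs where fs: "traverses \<Omega> d (hd us' # t) fs" using traverses_rotated[OF assms(1)] by blast
  let ?ws = "hd us' # t"
  have n: "length ?ws = length us'"
    using traverses_disk_verts[OF fs] traverses_disk_verts[OF assms(2)] fs assms(2)
    unfolding traverses_def by (metis distinct_card)
  have "?ws ! i = us' ! i" if "i < length us'" for i
    using that
  proof (induction i)
    case 0 then show ?case using ne by (simp add: hd_conv_nth)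
  next
    case (Suc i)
    have "(?ws ! i, fs ! i, ?ws ! Suc i) \<in> bdry \<Omega> d"
      unfolding traverses_bdry[OF fs] using Suc.prems n by (intro exI[of _ i]) auto
    moreover have "(us' ! i, es' ! i, us' ! Suc i) \<in> bdry \<Omega> d"
      unfolding traverses_bdry[OF assms(2)] using Suc.prems by (intro exI[of _ i]) auto
    ultimately show ?case using Suc traverses_out_unique[OF fs] by (metis Suc_lessD)
  qed
  then have "?ws = us'" using n by (metis nth_equalityI)
  then show ?thesis using t by simp
qed

lemma regular_complexD:
  assumes "regular_complex \<Omega>"
  shows "finite (verts \<Omega>)" "finite (edges \<Omega>)" "finite (disks \<Omega>)"
    and "\<forall>e\<in>edges \<Omega>. ends \<Omega> e \<subseteq> verts \<Omega> \<and> card (ends \<Omega> e) = 2"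
    and "\<forall>d\<in>disks \<Omega>. \<exists>us es. traverses \<Omega> d us es"
    and "edges \<Omega> = (\<Union>d\<in>disks \<Omega>. disk_edges \<Omega> d)" "verts \<Omega> = (\<Union>d\<in>disks \<Omega>. disk_verts \<Omega> d)"
  using assms unfolding regular_complex_def by metis+

lemma regular_disk:
  assumes "regular_complex \<Omega>" "d \<in> disks \<Omega>" obtains us es where "traverses \<Omega> d us es"
  using regular_complexD(5)[OF assms(1)] assms(2) by meson

lemma bdry_ends:
  assumes R: "regular_complex \<Omega>" and d: "d \<in> disks \<Omega>" and b: "(u, e, v) \<in> bdry \<Omega> d"
  shows "e \<in> edges \<Omega>" "ends \<Omega> e = {u, v}" "u \<noteq> v" "u \<in> verts \<Omega>" "v \<in> verts \<Omega>"
proof -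
  obtain us es where t: "traverses \<Omega> d us es" using regular_disk[OF R d] .
  then show e: "e \<in> edges \<Omega>" and en: "ends \<Omega> e = {u, v}"
    using b unfolding traverses_bdry[OF t] by (auto simp: traverses_def)
  have "card (ends \<Omega> e) = 2" using regular_complexD(4)[OF R] e by simp
  then show "u \<noteq> v" using en by auto
  have "ends \<Omega> e \<subseteq> verts \<Omega>" using regular_complexD(4)[OF R] e by simp
  then show "u \<in> verts \<Omega>" "v \<in> verts \<Omega>" using en by auto
qed

lemma bdry_out_unique:
  assumes "regular_complex \<Omega>" "d \<in> disks \<Omega>" "(u, e, v) \<in> bdry \<Omega> d" "(u, e', v') \<in> bdry \<Omega> d"
  shows "e = e'" "v = v'"
proof -
  obtain us es where t: "traverses \<Omega> d us es" using regular_disk[OF assms(1,2)] .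
  show "e = e'" "v = v'" using traverses_out_unique[OF t assms(3,4)] by auto
qed

lemma bdry_in_unique:
  assumes "regular_complex \<Omega>" "d \<in> disks \<Omega>" "(u, e, v) \<in> bdry \<Omega> d" "(u', e', v) \<in> bdry \<Omega> d"
  shows "e = e'" "u = u'"
proof -
  obtain us es where t: "traverses \<Omega> d us es" using regular_disk[OF assms(1,2)] .
  show "e = e'" "u = u'" using traverses_in_unique[OF t assms(3,4)] by auto
qed

lemma bdry_edge_unique:
  assumes "regular_complex \<Omega>" "d \<in> disks \<Omega>" "(u, e, v) \<in> bdry \<Omega> d" "(u', e, v') \<in> bdry \<Omega> d"
  shows "u = u'" "v = v'"
proof -
  obtain us es where t: "traverses \<Omega> d us es" using regular_disk[OF assms(1,2)] .
  show "u = u'" "v = v'" using traverses_edge_unique[OF t assms(3,4)] by auto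
qed

lemma disk_verts_bdry:
  assumes "regular_complex \<Omega>" "d \<in> disks \<Omega>" "(u, e, v) \<in> bdry \<Omega> d"
  shows "u \<in> disk_verts \<Omega> d" "v \<in> disk_verts \<Omega> d"
proof -
  obtain us es where t: "traverses \<Omega> d us es" using regular_disk[OF assms(1,2)] .
  then have "us \<noteq> []" unfolding traverses_def by simp
  then show "u \<in> disk_verts \<Omega> d" "v \<in> disk_verts \<Omega> d"
    using assms(3) unfolding traverses_disk_verts[OF t] traverses_bdry[OF t] by auto
qed

lemma disk_verts_subset:
  assumes "regular_complex \<Omega>" "d \<in> disks \<Omega>" shows "disk_verts \<Omega> d \<subseteq> verts \<Omega>"
  using bdry_ends(4)[OF assms] unfolding disk_verts_def by auto

lemma disk_verts_nonempty:
  assumes "regular_complex \<Omega>" "d \<in> disks \<Omega>" shows "disk_verts \<Omega> d \<noteq> {}"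
proof -
  obtain us es where t: "traverses \<Omega> d us es" using regular_disk[OF assms] .
  then show ?thesis using traverses_disk_verts[OF t] unfolding traverses_def by simp
qed

text \<open>Induction along the boundary circle, rotated to start at \<open>u0\<close>.\<close>

lemma disk_verts_closed:
  assumes R: "regular_complex \<Omega>" "d \<in> disks \<Omega>" and "u0 \<in> disk_verts \<Omega> d" "u0 \<in> T"
    and step: "\<And>u e v. (u, e, v) \<in> bdry \<Omega> d \<Longrightarrow> u \<in> T \<Longrightarrow> v \<in> T"
  shows "disk_verts \<Omega> d \<subseteq> T"
proof -
  obtain us es where t: "traverses \<Omega> d us es" using regular_disk[OF R] .
  obtain us' where r: "rotated us (u0 # us')"
    using rotated_to_front assms(3) unfolding traverses_disk_verts[OF t] by metis
  then obtain fs where f: "traverses \<Omega> d (u0 # us') fs" using traverses_rotated[OF t] by blast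
  let ?ws = "u0 # us'"
  have "?ws ! i \<in> T" if "i < length ?ws" for i
    using that
  proof (induction i)
    case (Suc i)
    have "(?ws ! i, fs ! i, ?ws ! Suc i) \<in> bdry \<Omega> d"
      unfolding traverses_bdry[OF f] using Suc.prems by (auto intro!: exI[of _ i])
    then show ?case using Suc step by (metis Suc_lessD)
  qed (use assms(4) in simp)
  then show ?thesis unfolding traverses_disk_verts[OF f] by (metis in_set_conv_nth subsetI)
qed

lemma bdry_leaves:
  assumes "regular_complex \<Omega>" "d \<in> disks \<Omega>" "disk_verts \<Omega> d \<inter> T \<noteq> {}" "\<not> disk_verts \<Omega> d \<subseteq> T"
  shows "\<exists>u e v. (u, e, v) \<in> bdry \<Omega> d \<and> u \<in> T \<and> v \<notin> T"
  using disk_verts_closed[OF assms(1,2)] assms(3,4) by blast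

text \<open>If no step entered \<open>T\<close>, the complement of \<open>T\<close> would be closed
  under the steps of the boundary.\<close>

lemma bdry_enters:
  assumes "regular_complex \<Omega>" "d \<in> disks \<Omega>" "disk_verts \<Omega> d \<inter> T \<noteq> {}" "\<not> disk_verts \<Omega> d \<subseteq> T"
  shows "\<exists>u e v. (u, e, v) \<in> bdry \<Omega> d \<and> u \<notin> T \<and> v \<in> T"
  using disk_verts_closed[OF assms(1,2), of _ "- T"] assms(3,4) by blast


section \<open>Connected film surfaces\<close>

definition crossing :: "'c complex2 \<Rightarrow> nat set \<Rightarrow> nat set" where
  "crossing \<Omega> S = {e \<in> edges \<Omega>. ends \<Omega> e \<inter> S \<noteq> {} \<and> \<not> ends \<Omega> e \<subseteq> S}"

definition edge_rel :: "'c complex2 \<Rightarrow> nat set \<Rightarrow> (nat \<times> nat) set" where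
  "edge_rel \<Omega> S = {(u, v). u \<in> S \<and> v \<in> S \<and> (\<exists>e\<in>edges \<Omega>. ends \<Omega> e = {u, v})}"

definition span_connected :: "'c complex2 \<Rightarrow> nat set \<Rightarrow> bool" where
  "span_connected \<Omega> S \<longleftrightarrow> (\<forall>u\<in>S. \<forall>v\<in>S. (u, v) \<in> (edge_rel \<Omega> S)\<^sup>*)"

text \<open>Adjacency in the graph that cuts off \<open>S\<close>: its vertices are the crossed
  edges, and a crossed disk contributes a chord between its two crossed edges.\<close>

definition cut_rel :: "'c complex2 \<Rightarrow> nat set \<Rightarrow> (nat \<times> nat) set" where
  "cut_rel \<Omega> S = {(e, e'). \<exists>d\<in>disks \<Omega>. e \<noteq> e' \<and> {e, e'} = crossing \<Omega> S \<inter> disk_edges \<Omega> d}"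

definition cut_connected :: "'c complex2 \<Rightarrow> nat set \<Rightarrow> bool" where
  "cut_connected \<Omega> S \<longleftrightarrow> connected_by (crossing \<Omega> S) (cut_rel \<Omega> S)"

text \<open>
  The edges crossed by a graph-cut are exactly those joining the two groups of vertices (a disk is
  crossed twice or not at all, so along a connected graph-cut all edges are of this kind or none is).
  Hence the existence of graph-cuts is a connectedness condition on the arcs of vertices.
\<close>

definition film_on :: "'c complex2 \<Rightarrow> nat list \<Rightarrow> bool" where
  "film_on \<Omega> qs \<longleftrightarrow>
     qs \<noteq> [] \<and> distinct qs \<and> verts \<Omega> = set qs \<and> finite (edges \<Omega>) \<and> finite (disks \<Omega>) \<and>
     (\<forall>e\<in>edges \<Omega>. ends \<Omega> e \<subseteq> verts \<Omega> \<and> card (ends \<Omega> e) = 2) \<and>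
     edges \<Omega> = (\<Union>d\<in>disks \<Omega>. disk_edges \<Omega> d) \<and> verts \<Omega> = (\<Union>d\<in>disks \<Omega>. disk_verts \<Omega> d) \<and>
     (\<forall>d\<in>disks \<Omega>. \<exists>es. traverses \<Omega> d (filter (\<lambda>v. v \<in> disk_verts \<Omega> d) qs) es) \<and>
     cyc \<Omega> = circle qs \<and> inj_on (color \<Omega>) (disks \<Omega>) \<and>
     (\<forall>as bs. rotated qs (as @ bs) \<and> as \<noteq> [] \<and> bs \<noteq> [] \<longrightarrow>
        span_connected \<Omega> (set as) \<and> cut_connected \<Omega> (set as))"

lemma film_onD:
  assumes "film_on \<Omega> qs"
  shows "qs \<noteq> []" "distinct qs" "verts \<Omega> = set qs" "finite (edges \<Omega>)" "finite (disks \<Omega>)"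
    and "\<And>e. e \<in> edges \<Omega> \<Longrightarrow> ends \<Omega> e \<subseteq> set qs \<and> card (ends \<Omega> e) = 2"
    and "edges \<Omega> = (\<Union>d\<in>disks \<Omega>. disk_edges \<Omega> d)" "verts \<Omega> = (\<Union>d\<in>disks \<Omega>. disk_verts \<Omega> d)"
    and "\<And>d. d \<in> disks \<Omega> \<Longrightarrow> \<exists>es. traverses \<Omega> d (filter (\<lambda>v. v \<in> disk_verts \<Omega> d) qs) es"
    and "cyc \<Omega> = circle qs" "inj_on (color \<Omega>) (disks \<Omega>)"
  using assms unfolding film_on_def by blast+

lemma film_on_connected:
  assumes "film_on \<Omega> qs" "rotated qs (as @ bs)" "as \<noteq> []" "bs \<noteq> []"
  shows "span_connected \<Omega> (set as)" "cut_connected \<Omega> (set as)"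
  using assms unfolding film_on_def by blast+

lemma film_on_regular:
  assumes "film_on \<Omega> qs" shows "regular_complex \<Omega>"
  unfolding regular_complex_def using film_onD[OF assms] by (metis List.finite_set)

text \<open>A closed boundary circle that leaves \<open>T\<close> also enters it, along a different
  edge.\<close>

lemma crossing_other:
  assumes R: "regular_complex \<Omega>" "d \<in> disks \<Omega>" and "e \<in> crossing \<Omega> T \<inter> disk_edges \<Omega> d"
  shows "\<exists>e'. e' \<noteq> e \<and> e' \<in> crossing \<Omega> T \<inter> disk_edges \<Omega> d"
proof -
  obtain u v where uv: "(u, e, v) \<in> bdry \<Omega> d" using assms(3) unfolding disk_edges_def by blast
  note E = bdry_ends[OF R]
  have "disk_verts \<Omega> d \<inter> T \<noteq> {}" "\<not> disk_verts \<Omega> d \<subseteq> T"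
    using assms(3) E(2)[OF uv] disk_verts_bdry[OF R uv] unfolding crossing_def by auto
  then obtain u1 e1 v1 u2 e2 v2 where 1: "(u1, e1, v1) \<in> bdry \<Omega> d" "u1 \<in> T" "v1 \<notin> T"
    and 2: "(u2, e2, v2) \<in> bdry \<Omega> d" "u2 \<notin> T" "v2 \<in> T"
    using bdry_leaves[OF R] bdry_enters[OF R] by metis
  have "e1 \<noteq> e2" using bdry_edge_unique[OF R 1(1)] 1 2 by blast
  moreover have "e1 \<in> crossing \<Omega> T \<inter> disk_edges \<Omega> d" "e2 \<in> crossing \<Omega> T \<inter> disk_edges \<Omega> d"
    using E(1,2) 1 2 unfolding crossing_def disk_edges_def by auto
  ultimately show ?thesis by metis
qed

lemma crossing_on_path:
  assumes "(u, v) \<in> {(a, b). \<exists>e\<in>edges \<Omega>. ends \<Omega> e = {a, b}}\<^sup>*" "u \<in> T" "v \<notin> T"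
  shows "crossing \<Omega> T \<noteq> {}"
  using assms
proof (induction rule: rtrancl_induct)
  case (step y z)
  then show ?case unfolding crossing_def by auto
qed simp

lemma equiv_joined: "equiv (verts \<Omega>) (joined \<Omega> E)"
proof -
  let ?r = "{(a, b). \<exists>e\<in>E. ends \<Omega> e = {a, b}}"
  have "sym ?r" by (auto simp: sym_def insert_commute)
  then have "sym (?r\<^sup>*)" by (rule sym_rtrancl)
  then show ?thesis unfolding joined_def
    by (intro equivI refl_onI symI transI) (auto dest: symD intro: rtrancl_trans)
qed

lemma joined_closed:
  assumes "\<forall>e\<in>edges \<Omega>. ends \<Omega> e \<subseteq> verts \<Omega>" "E \<subseteq> edges \<Omega>" "A \<in> verts \<Omega> // joined \<Omega> E"
    and "u \<in> A" "e \<in> E" "ends \<Omega> e = {u, v}"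
  shows "v \<in> A"
proof -
  have "u \<in> verts \<Omega>" "v \<in> verts \<Omega>" using assms(1,2,5,6) by auto
  then have "(u, v) \<in> joined \<Omega> E" using assms(5,6) unfolding joined_def by auto
  then show ?thesis using assms(3,4) equiv_joined by (metis in_quotient_imp_closed)
qed

text \<open>\<open>A\<close> is a class of the graph without \<open>P\<close>, so paths inside it
  can avoid \<open>P\<close>. Connectedness of the cut transfers once \<open>P\<close> is identified
  with the set of edges that leave \<open>A\<close>.\<close>

lemma graph_cut_connected:
  assumes R: "regular_complex \<Omega>" and "connected_complex \<Omega>"
    and cut: "graph_cut \<Omega> P D A B" and AB: "A \<inter> B = {}" "A \<noteq> {}" "B \<noteq> {}"
  shows "span_connected \<Omega> A" "cut_connected \<Omega> A"
proof -
  have E: "\<forall>e\<in>edges \<Omega>. ends \<Omega> e \<subseteq> verts \<Omega>" using regular_complexD(4)[OF R] by simp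
  have P: "P \<subseteq> edges \<Omega>" "D \<subseteq> disks \<Omega>" and
    con: "connected_by P {(e, e'). \<exists>d\<in>D. e \<noteq> e' \<and> {e, e'} = P \<inter> disk_edges \<Omega> d}" and
    quo: "verts \<Omega> // joined \<Omega> (edges \<Omega> - P) = {A, B}"
    using cut unfolding graph_cut_def by blast+
  have A: "A \<in> verts \<Omega> // joined \<Omega> (edges \<Omega> - P)" using quo by blast
  have closed: "v \<in> A" if "u \<in> A" "e \<in> edges \<Omega> - P" "ends \<Omega> e = {u, v}" for u v e
    using joined_closed[OF E _ A that] by blast
  show "span_connected \<Omega> A" unfolding span_connected_def
  proof (intro ballI)
    fix u v assume uv: "u \<in> A" "v \<in> A"
    then have "(u, v) \<in> joined \<Omega> (edges \<Omega> - P)"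
      using A equiv_joined by (metis in_quotient_imp_in_rel insert_subset empty_subsetI)
    then have "(u, v) \<in> {(a, b). \<exists>e\<in>edges \<Omega> - P. ends \<Omega> e = {a, b}}\<^sup>*" unfolding joined_def by blast
    then have "v \<in> A \<and> (u, v) \<in> (edge_rel \<Omega> A)\<^sup>*"
    proof (induction rule: rtrancl_induct)
      case (step y z)
      then have "z \<in> A" using closed by blast
      then have "(y, z) \<in> edge_rel \<Omega> A" using step unfolding edge_rel_def by blast
      then show ?case using step \<open>z \<in> A\<close> by (meson rtrancl.rtrancl_into_rtrancl)
    qed (use uv in simp)
    then show "(u, v) \<in> (edge_rel \<Omega> A)\<^sup>*" by blast
  qed
  have sub: "crossing \<Omega> A \<subseteq> P"
  proof
    fix e assume e: "e \<in> crossing \<Omega> A"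
    then have "card (ends \<Omega> e) = 2" using regular_complexD(4)[OF R] unfolding crossing_def by blast
    then obtain a b where ab: "ends \<Omega> e = {a, b}" by (meson card_2_iff)
    then show "e \<in> P" using e closed[of a e b] closed[of b e a]
      unfolding crossing_def by (auto simp: insert_commute)
  qed
  have "\<exists>u v. u \<in> A \<and> v \<in> B" using AB by blast
  then obtain u v where uv: "u \<in> A" "v \<in> B" by blast
  have "A \<subseteq> verts \<Omega>" "B \<subseteq> verts \<Omega>" using quo equiv_joined
    by (metis Union_quotient Union_upper insertCI)+
  then have "u \<in> verts \<Omega>" "v \<in> verts \<Omega>" using uv by auto
  then have "(u, v) \<in> joined \<Omega> (edges \<Omega>)"
    using assms(2) equiv_joined unfolding connected_complex_def components_of_def
    by (metis in_quotient_imp_in_rel insertI1 insert_subset empty_subsetI)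
  then have "crossing \<Omega> A \<noteq> {}"
    using crossing_on_path[of u v] uv AB(1) unfolding joined_def by blast
  then obtain e0 where e0: "e0 \<in> crossing \<Omega> A" by blast
  \<comment> \<open>Walk along the graph-cut from \<open>e0\<close>: a disk with the crossing edge
    \<open>y\<close> has a second crossing edge, and \<open>z\<close> is the only candidate because
    \<open>P\<close> meets the disk in just these two edges.\<close>
  have "e \<in> crossing \<Omega> A" if "e \<in> P" for e
  proof -
    have "(e0, e) \<in> {(e, e'). \<exists>d\<in>D. e \<noteq> e' \<and> {e, e'} = P \<inter> disk_edges \<Omega> d}\<^sup>*"
      using con that e0 sub unfolding connected_by_def by blast
    then show ?thesis
    proof (induction rule: rtrancl_induct)
      case (step y z)
      then obtain d where d: "d \<in> D" "{y, z} = P \<inter> disk_edges \<Omega> d" by blast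
      then have "y \<in> crossing \<Omega> A \<inter> disk_edges \<Omega> d" using step.IH by blast
      then obtain e' where "e' \<noteq> y" "e' \<in> crossing \<Omega> A \<inter> disk_edges \<Omega> d"
        using crossing_other[OF R] d(1) P(2) by blast
      then show ?case using d(2) sub by blast
    qed (rule e0)
  qed
  then have PA: "P = crossing \<Omega> A" using sub by blast
  have "{(e, e'). \<exists>d\<in>D. e \<noteq> e' \<and> {e, e'} = P \<inter> disk_edges \<Omega> d} \<subseteq> cut_rel \<Omega> A"
    unfolding cut_rel_def PA using P(2) by blast
  then show "cut_connected \<Omega> A"
    using con unfolding cut_connected_def connected_by_def PA
    by (meson rtrancl_mono subsetD)
qed

lemma restrict_complex_verts:
  assumes "regular_complex \<Omega>" "cyc \<Omega> \<subseteq> verts \<Omega> \<times> verts \<Omega> \<times> verts \<Omega>"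
  shows "restrict_complex \<Omega> (verts \<Omega>) = \<Omega>"
proof -
  have "{e \<in> edges \<Omega>. ends \<Omega> e \<subseteq> verts \<Omega>} = edges \<Omega>"
    using regular_complexD(4)[OF assms(1)] by auto
  moreover have "{d \<in> disks \<Omega>. disk_verts \<Omega> d \<subseteq> verts \<Omega>} = disks \<Omega>"
    using disk_verts_subset[OF assms(1)] by blast
  moreover have "cyc \<Omega> \<inter> verts \<Omega> \<times> verts \<Omega> \<times> verts \<Omega> = cyc \<Omega>" using assms(2) by blast
  ultimately show ?thesis unfolding restrict_complex_def by simp
qed

lemma connected_film_cyc:
  assumes "almost_cyclic \<Omega>" "connected_complex \<Omega>"
  shows "cyclic_order_on (verts \<Omega>) (cyc \<Omega>)" "cyc \<Omega> \<subseteq> verts \<Omega> \<times> verts \<Omega> \<times> verts \<Omega>"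
proof -
  have C: "components_of \<Omega> = {verts \<Omega>}" using assms(2) unfolding connected_complex_def .
  show sub: "cyc \<Omega> \<subseteq> verts \<Omega> \<times> verts \<Omega> \<times> verts \<Omega>"
    using assms(1) unfolding almost_cyclic_def C by simp
  have "cyc \<Omega> \<inter> verts \<Omega> \<times> verts \<Omega> \<times> verts \<Omega> = cyc \<Omega>" using sub by blast
  then show "cyclic_order_on (verts \<Omega>) (cyc \<Omega>)"
    using assms(1) unfolding almost_cyclic_def C by simp
qed

text \<open>The definition of a film surface quantifies over all traversals and all compatible
  divisions; here everything is expressed through the one list \<open>qs\<close>.\<close>

lemma film_on_if_numbering:
  assumes film: "film_surface \<Omega>" and con: "connected_complex \<Omega>" and num: "numbering \<Omega> qs"
  shows "film_on \<Omega> qs"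
proof -
  have ac: "almost_cyclic \<Omega>" and cc: "cyclic_complex \<Omega>"
    using film unfolding film_surface_def cyclic_complex_def by blast+
  have R: "regular_complex \<Omega>" using ac unfolding almost_cyclic_def by simp
  have C: "components_of \<Omega> = {verts \<Omega>}" using con unfolding connected_complex_def .
  note cyc = connected_film_cyc[OF ac con]
  note CD = cyclic_order_onD[OF cyc(1)]
  have qs: "set qs = verts \<Omega>" "in_cyclic_order (cyc \<Omega>) qs" using num unfolding numbering_def by blast+
  then have dqs: "distinct qs" using in_cyclic_order_distinct by blast
  have res: "restrict_complex \<Omega> (verts \<Omega>) = \<Omega>" using restrict_complex_verts[OF R cyc(2)] .
  have "verts \<Omega> \<noteq> {}"
    using C equiv_joined in_quotient_imp_non_empty unfolding components_of_def
    by (metis insertI1)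
  moreover have "\<exists>es. traverses \<Omega> d (filter (\<lambda>v. v \<in> disk_verts \<Omega> d) qs) es" if d: "d \<in> disks \<Omega>" for d
  proof -
    obtain us es where t: "traverses \<Omega> d us es" using regular_disk[OF R d] .
    have "in_cyclic_order (cyc \<Omega>) us" using ac t d unfolding almost_cyclic_def by blast
    moreover have "in_cyclic_order (cyc \<Omega>) (filter (\<lambda>v. v \<in> disk_verts \<Omega> d) qs)"
      using qs(2) by (rule in_cyclic_order_filter)
    moreover have "set us = set (filter (\<lambda>v. v \<in> disk_verts \<Omega> d) qs)"
      using traverses_disk_verts[OF t] disk_verts_subset[OF R d] qs(1) by auto
    \<comment> \<open>The traversal of the disk and the trace of \<open>qs\<close> on its vertices
      are both in cyclic order and have the same elements, so they differ by a rotation.\<close>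
    ultimately have "rotated us (filter (\<lambda>v. v \<in> disk_verts \<Omega> d) qs)"
      using in_cyclic_order_unique CD(2,3) by metis
    then show ?thesis using traverses_rotated[OF t] by blast
  qed
  moreover have "cyc \<Omega> = circle qs" using circle_unique cyc(1) qs by metis
  moreover have "inj_on (color \<Omega>) (disks \<Omega>)"
  proof -
    have "{d \<in> disks \<Omega>. disk_verts \<Omega> d \<subseteq> verts \<Omega>} = disks \<Omega>" using disk_verts_subset[OF R] by blast
    then show ?thesis using film unfolding film_surface_def C by simp
  qed
  moreover have "span_connected \<Omega> (set as) \<and> cut_connected \<Omega> (set as)"
    if s: "rotated qs (as @ bs)" "as \<noteq> []" "bs \<noteq> []" for as bs
  proof -
    have "in_cyclic_order (cyc \<Omega>) (as @ bs)"
      using in_cyclic_order_rotated[OF _ qs(2) s(1)] CD(2) by blast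
    then have "numbering \<Omega> (as @ bs)" using rotated_set[OF s(1)] qs(1) unfolding numbering_def by simp
    then have "division \<Omega> (set as) (set bs)"
      unfolding division_def using s by (intro conjI exI[of _ "as @ bs"] exI[of _ "length as"]) auto
    moreover have "\<forall>A B. division \<Omega> A B \<longrightarrow> (\<exists>P D. graph_cut \<Omega> P D A B)"
      using cc unfolding cyclic_complex_def C by (simp add: res)
    ultimately obtain P D where "graph_cut \<Omega> P D (set as) (set bs)" by meson
    moreover have "set as \<inter> set bs = {}" using rotated_distinct[OF s(1)] dqs by simp
    ultimately show ?thesis using graph_cut_connected[OF R con] s by auto
  qed
  ultimately show ?thesis unfolding film_on_def
    using regular_complexD[OF R] dqs qs(1) by (intro conjI) (assumption | auto)+
qed

lemma ex_film_on:
  assumes "film_surface \<Omega>" "connected_complex \<Omega>" shows "\<exists>qs. film_on \<Omega> qs"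
proof -
  have ac: "almost_cyclic \<Omega>" using assms(1) unfolding film_surface_def cyclic_complex_def by blast
  then have "finite (verts \<Omega>)" using regular_complexD(1)[of \<Omega>] unfolding almost_cyclic_def by simp
  then obtain qs where "numbering \<Omega> qs"
    using ex_in_cyclic_order connected_film_cyc(1)[OF ac assms(2)] unfolding numbering_def by metis
  then show ?thesis using film_on_if_numbering assms by blast
qed

section \<open>Disks and arcs of a connected film surface\<close>

lemma rotated_filter: "rotated xs ys \<Longrightarrow> rotated (filter P xs) (filter P ys)"
  unfolding rotated_def by (metis filter_append)

lemma rtrancl_map:
  assumes "\<And>x y. (x, y) \<in> r \<Longrightarrow> (f x, f y) \<in> s\<^sup>*" and "(x, y) \<in> r\<^sup>*"
  shows "(f x, f y) \<in> s\<^sup>*"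
  using assms(2)
proof (induction rule: rtrancl_induct)
  case (step y z)
  then show ?case using assms(1) by (meson rtrancl_trans)
qed simp

lemma film_on_disk:
  assumes "film_on \<Omega> qs" "rotated qs (as @ bs)" "d \<in> disks \<Omega>"
  obtains es where
    "traverses \<Omega> d (filter (\<lambda>v. v \<in> disk_verts \<Omega> d) as @ filter (\<lambda>v. v \<in> disk_verts \<Omega> d) bs) es"
proof -
  obtain es where "traverses \<Omega> d (filter (\<lambda>v. v \<in> disk_verts \<Omega> d) qs) es"
    using film_onD(9)[OF assms(1,3)] by blast
  then show thesis using that traverses_rotated rotated_filter[OF assms(2)] filter_append by metis
qed

text \<open>The boundary meets the vertices of the disk in the order of \<open>as @ bs\<close>,
  first those in \<open>as\<close>, then those in \<open>bs\<close>; only its closing step can lead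
  back into \<open>as\<close>.\<close>

lemma entering_unique:
  assumes F: "film_on \<Omega> qs" "rotated qs (as @ bs)" "d \<in> disks \<Omega>"
    and 1: "(u, e, v) \<in> bdry \<Omega> d" "u \<notin> set as" "v \<in> set as"
    and 2: "(u', e', v') \<in> bdry \<Omega> d" "u' \<notin> set as" "v' \<in> set as"
  shows "e = e'"
proof -
  define us1 us2 where "us1 = filter (\<lambda>v. v \<in> disk_verts \<Omega> d) as"
    and "us2 = filter (\<lambda>v. v \<in> disk_verts \<Omega> d) bs"
  obtain es where t: "traverses \<Omega> d (us1 @ us2) es"
    using film_on_disk[OF F] unfolding us1_def us2_def by blast
  let ?us = "us1 @ us2" and ?n = "length (us1 @ us2)"
  have d: "set as \<inter> set bs = {}"
    using film_onD(2)[OF F(1)] rotated_distinct[OF F(2)] by simp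
  have mem: "?us ! i \<in> set as \<longleftrightarrow> i < length us1" if i: "i < ?n" for i
  proof (cases "i < length us1")
    case True
    then have "?us ! i \<in> set us1" by (simp add: nth_append)
    then show ?thesis using True unfolding us1_def by auto
  next
    case False
    then have "?us ! i \<in> set us2" using i by (simp add: nth_append)
    then show ?thesis using False d unfolding us2_def by auto
  qed
  have last: "i = ?n - 1" if "i < ?n" "?us ! i \<notin> set as" "?us ! (Suc i mod ?n) \<in> set as" for i
  proof (rule ccontr)
    assume "i \<noteq> ?n - 1"
    then have "Suc i < ?n" using that(1) by linarith
    then show False using that mem by simp
  qed
  obtain i j where "i < ?n" "u = ?us ! i" "e = es ! i" "v = ?us ! (Suc i mod ?n)"
    "j < ?n" "u' = ?us ! j" "e' = es ! j" "v' = ?us ! (Suc j mod ?n)"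
    using 1(1) 2(1) unfolding traverses_bdry[OF t] by blast
  then show ?thesis using last 1 2 by metis
qed

lemma film_on_complement:
  assumes "film_on \<Omega> qs" "rotated qs (as @ bs)" "v \<in> verts \<Omega>"
  shows "v \<in> set bs \<longleftrightarrow> v \<notin> set as"
  using film_onD(2,3)[OF assms(1)] rotated_distinct[OF assms(2)] rotated_set[OF assms(2)] assms(3)
  by auto

lemma leaving_unique:
  assumes F: "film_on \<Omega> qs" "rotated qs (as @ bs)" "d \<in> disks \<Omega>"
    and 1: "(u, e, v) \<in> bdry \<Omega> d" "u \<in> set as" "v \<notin> set as"
    and 2: "(u', e', v') \<in> bdry \<Omega> d" "u' \<in> set as" "v' \<notin> set as"
  shows "e = e'"
proof -
  have r: "rotated qs (bs @ as)" using F(2) rotated_append rotated_trans by blast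
  note E = bdry_ends(4,5)[OF film_on_regular[OF F(1)] F(3)]
  show ?thesis
    using entering_unique[OF F(1) r F(3) 1(1) _ _ 2(1)] 1 2
      film_on_complement[OF F(1,2)] E[OF 1(1)] E[OF 2(1)] by blast
qed

lemma disk_crossing:
  assumes F: "film_on \<Omega> qs" "rotated qs (as @ bs)" "d \<in> disks \<Omega>"
    and e1: "(u1, e1, v1) \<in> bdry \<Omega> d" "u1 \<notin> set as" "v1 \<in> set as"
    and e2: "(u2, e2, v2) \<in> bdry \<Omega> d" "u2 \<in> set as" "v2 \<notin> set as"
  shows "crossing \<Omega> (set as) \<inter> disk_edges \<Omega> d = {e1, e2}" "e1 \<noteq> e2"
proof -
  note R = film_on_regular[OF F(1)] F(3)
  have "e \<in> {e1, e2}" if e: "e \<in> crossing \<Omega> (set as) \<inter> disk_edges \<Omega> d" for e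
  proof -
    obtain u v where uv: "(u, e, v) \<in> bdry \<Omega> d" using e unfolding disk_edges_def by blast
    then have "u \<in> set as \<and> v \<notin> set as \<or> u \<notin> set as \<and> v \<in> set as"
      using e bdry_ends(2)[OF R uv] unfolding crossing_def by auto
    then show ?thesis using entering_unique[OF F uv _ _ e1] leaving_unique[OF F uv _ _ e2] by blast
  qed
  moreover have "e1 \<in> crossing \<Omega> (set as) \<inter> disk_edges \<Omega> d" "e2 \<in> crossing \<Omega> (set as) \<inter> disk_edges \<Omega> d"
    using bdry_ends(1,2)[OF R e1(1)] bdry_ends(1,2)[OF R e2(1)] e1 e2
    unfolding crossing_def disk_edges_def by auto
  ultimately show "crossing \<Omega> (set as) \<inter> disk_edges \<Omega> d = {e1, e2}" by blast
  show "e1 \<noteq> e2" using bdry_edge_unique(1)[OF R e1(1)] e2 e1 by blast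
qed

lemma crossing_disk_ends:
  assumes "regular_complex \<Omega>" "d \<in> disks \<Omega>" "e \<in> crossing \<Omega> S \<inter> disk_edges \<Omega> d"
  shows "disk_verts \<Omega> d \<inter> S \<noteq> {}" "\<not> disk_verts \<Omega> d \<subseteq> S"
proof -
  obtain u v where uv: "(u, e, v) \<in> bdry \<Omega> d" using assms(3) unfolding disk_edges_def by blast
  have "ends \<Omega> e = {u, v}" using bdry_ends(2)[OF assms(1,2) uv] .
  then show "disk_verts \<Omega> d \<inter> S \<noteq> {}" "\<not> disk_verts \<Omega> d \<subseteq> S"
    using disk_verts_bdry[OF assms(1,2) uv] assms(3) unfolding crossing_def by auto
qed

lemma film_on_length:
  assumes "film_on \<Omega> qs" shows "2 \<le> length qs"
proof -
  note R = film_on_regular[OF assms]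
  have "verts \<Omega> \<noteq> {}" using film_onD(1,3)[OF assms] by simp
  then obtain d where d: "d \<in> disks \<Omega>" "disk_verts \<Omega> d \<noteq> {}" using film_onD(8)[OF assms] by auto
  then obtain u e v where uv: "(u, e, v) \<in> bdry \<Omega> d" unfolding disk_verts_def by blast
  have "u \<noteq> v" "{u, v} \<subseteq> set qs" using bdry_ends[OF R d(1) uv] film_onD(3)[OF assms] by auto
  then have "2 \<le> card (set qs)" by (metis List.finite_set card_2_iff card_mono)
  then show ?thesis using card_length le_trans by blast
qed

lemma edge_rel_rtrancl:
  "edge_rel \<Omega> S \<subseteq> {(a, b). \<exists>e\<in>edges \<Omega> - crossing \<Omega> S. ends \<Omega> e = {a, b}}"
  unfolding edge_rel_def crossing_def by auto

lemma crossing_complement: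
  assumes F: "film_on \<Omega> qs" "rotated qs (as @ bs)"
  shows "crossing \<Omega> (set bs) = crossing \<Omega> (set as)"
proof -
  have "e \<in> crossing \<Omega> (set bs) \<longleftrightarrow> e \<in> crossing \<Omega> (set as)" if e: "e \<in> edges \<Omega>" for e
  proof -
    have "ends \<Omega> e \<subseteq> verts \<Omega>" using film_onD(3,6)[OF F(1)] e by blast
    then show ?thesis using film_on_complement[OF F] e unfolding crossing_def by blast
  qed
  then show ?thesis unfolding crossing_def by blast
qed

text \<open>Both arcs stay connected without the crossing edges, and only crossing edges lead from
  one arc to the other.\<close>

lemma joined_minus_crossing:
  assumes F: "film_on \<Omega> qs" "rotated qs (as @ bs)" "as \<noteq> []" "bs \<noteq> []"
  shows "joined \<Omega> (edges \<Omega> - crossing \<Omega> (set as)) = set as \<times> set as \<union> set bs \<times> set bs"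
proof -
  let ?r = "{(a, b). \<exists>e\<in>edges \<Omega> - crossing \<Omega> (set as). ends \<Omega> e = {a, b}}"
  have rb: "rotated qs (bs @ as)" using F(2) rotated_append rotated_trans by blast
  have V: "verts \<Omega> = set as \<union> set bs" using film_onD(3)[OF F(1)] rotated_set[OF F(2)] by simp
  have "edge_rel \<Omega> (set as) \<subseteq> ?r" "edge_rel \<Omega> (set bs) \<subseteq> ?r"
    using edge_rel_rtrancl[of \<Omega> "set as"] edge_rel_rtrancl[of \<Omega> "set bs"]
      crossing_complement[OF F(1,2)] by simp_all
  then have "(edge_rel \<Omega> (set as))\<^sup>* \<subseteq> ?r\<^sup>*" "(edge_rel \<Omega> (set bs))\<^sup>* \<subseteq> ?r\<^sup>*"
    using rtrancl_mono by blast+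
  then have "set as \<times> set as \<union> set bs \<times> set bs \<subseteq> joined \<Omega> (edges \<Omega> - crossing \<Omega> (set as))"
    using film_on_connected(1)[OF F] film_on_connected(1)[OF F(1) rb F(4,3)] V
    unfolding span_connected_def joined_def by auto
  moreover have "v \<in> set as \<longleftrightarrow> u \<in> set as" if "(u, v) \<in> ?r\<^sup>*" for u v
    using that
  proof (induction rule: rtrancl_induct)
    case (step y z)
    then show ?case unfolding crossing_def by auto
  qed simp
  then have "joined \<Omega> (edges \<Omega> - crossing \<Omega> (set as)) \<subseteq> set as \<times> set as \<union> set bs \<times> set bs"
    using film_on_complement[OF F(1,2)] V unfolding joined_def by blast
  ultimately show ?thesis by blast
qed

text \<open>\<open>film_on\<close> asserts connectedness of proper arcs only. Splitting off one
  vertex \<open>a\<close> and using an edge that crosses to the remaining arc joins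
  everything.\<close>

lemma film_on_joined:
  assumes F: "film_on \<Omega> qs"
  shows "joined \<Omega> (edges \<Omega>) = verts \<Omega> \<times> verts \<Omega>"
proof -
  obtain a bs where qs: "qs = a # bs" using film_onD(1)[OF F] by (cases qs) auto
  have ne: "bs \<noteq> []" using film_on_length[OF F] qs by auto
  have r: "rotated qs ([a] @ bs)" "rotated qs (bs @ [a])"
    using qs rotated_append[of "[a]" bs] by auto
  let ?J = "joined \<Omega> (edges \<Omega>)"
  have V: "verts \<Omega> = insert a (set bs)" using film_onD(3)[OF F] qs by simp
  have "joined \<Omega> (edges \<Omega> - crossing \<Omega> (set [a])) \<subseteq> ?J"
  proof -
    have "{(x, y). \<exists>e\<in>edges \<Omega> - crossing \<Omega> (set [a]). ends \<Omega> e = {x, y}} \<subseteq>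
          {(x, y). \<exists>e\<in>edges \<Omega>. ends \<Omega> e = {x, y}}" by blast
    from rtrancl_mono[OF this] show ?thesis unfolding joined_def by auto
  qed
  then have sub: "{(a, a)} \<union> set bs \<times> set bs \<subseteq> ?J"
    using joined_minus_crossing[OF F r(1) _ ne] by simp
  obtain e where e: "e \<in> crossing \<Omega> {a}"
    using film_on_connected(2)[OF F r(1) _ ne] unfolding cut_connected_def connected_by_def by auto
  then have "card (ends \<Omega> e) = 2" "ends \<Omega> e \<subseteq> verts \<Omega>" "a \<in> ends \<Omega> e" "e \<in> edges \<Omega>"
    using film_onD(3,6)[OF F] unfolding crossing_def by auto
  then obtain x y where "ends \<Omega> e = {x, y}" "x \<noteq> y" "a = x \<or> a = y" "{x, y} \<subseteq> verts \<Omega>"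
    by (metis card_2_iff insertE singletonD)
  then obtain b where b: "ends \<Omega> e = {a, b}" "a \<noteq> b" "b \<in> verts \<Omega>"
    by (metis insert_commute insert_subset)
  have "(a, b) \<in> ?J" using b \<open>e \<in> edges \<Omega>\<close> V unfolding joined_def by auto
  have "b \<in> set bs" using b V by auto
  have *: "(a, u) \<in> ?J" if "u \<in> verts \<Omega>" for u
  proof -
    from that consider "u = a" | "(b, u) \<in> ?J" using sub V \<open>b \<in> set bs\<close> by auto
    then show ?thesis
      using sub \<open>(a, b) \<in> ?J\<close> equiv_joined[of \<Omega> "edges \<Omega>"] unfolding equiv_def
      by (cases; blast dest: transD)
  qed
  have "u \<in> verts \<Omega> \<Longrightarrow> v \<in> verts \<Omega> \<Longrightarrow> (u, v) \<in> ?J" for u v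
    using *[of u] *[of v] equiv_joined[of \<Omega> "edges \<Omega>"] unfolding equiv_def by (meson symE transE)
  moreover have "?J \<subseteq> verts \<Omega> \<times> verts \<Omega>" unfolding joined_def by blast
  ultimately show ?thesis by auto
qed

lemma film_on_components:
  assumes "film_on \<Omega> qs" shows "components_of \<Omega> = {verts \<Omega>}"
proof -
  have "verts \<Omega> \<noteq> {}" using film_onD(1,3)[OF assms] by simp
  then show ?thesis unfolding components_of_def film_on_joined[OF assms]
    by (auto simp: quotient_def)
qed

lemma film_on_numbering:
  assumes "film_on \<Omega> qs" shows "numbering \<Omega> qs"
  using film_onD[OF assms] in_cyclic_order_circle unfolding numbering_def by metis

lemma numbering_rotated:
  assumes F: "film_on \<Omega> qs" and "numbering \<Omega> qs'" shows "rotated qs qs'"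
proof -
  have "cyclic_order_on (set qs) (cyc \<Omega>)"
    using film_onD(2,10)[OF F] cyclic_order_on_circle by metis
  note D = cyclic_order_onD[OF this]
  have q: "in_cyclic_order (cyc \<Omega>) qs" "in_cyclic_order (cyc \<Omega>) qs'" "set qs = set qs'"
    using film_on_numbering[OF F] assms(2) unfolding numbering_def by auto
  show ?thesis by (rule in_cyclic_order_unique[OF D(2,3) q])
qed

text \<open>The witnesses are the edges between the two arcs and the disks that contain such
  edges.\<close>

lemma film_on_graph_cut:
  assumes F: "film_on \<Omega> qs" "rotated qs (as @ bs)" "as \<noteq> []" "bs \<noteq> []"
    and div: "division \<Omega> (set as) (set bs)"
  shows "\<exists>P D. graph_cut \<Omega> P D (set as) (set bs)"
proof -
  let ?P = "crossing \<Omega> (set as)"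
  define D where "D = {d \<in> disks \<Omega>. ?P \<inter> disk_edges \<Omega> d \<noteq> {}}"
  note R = film_on_regular[OF F(1)]
  have two: "\<exists>e1 e2. ?P \<inter> disk_edges \<Omega> d = {e1, e2} \<and> e1 \<noteq> e2"
    if d: "d \<in> disks \<Omega>" "?P \<inter> disk_edges \<Omega> d \<noteq> {}" for d
  proof -
    obtain e where "e \<in> ?P \<inter> disk_edges \<Omega> d" using d(2) by blast
    note c = crossing_disk_ends[OF R d(1) this]
    show ?thesis
      using bdry_enters[OF R d(1) c] bdry_leaves[OF R d(1) c] disk_crossing[OF F(1,2) d(1)] by metis
  qed
  have card: "card (?P \<inter> disk_edges \<Omega> d) = (if d \<in> D then 2 else 0)" if d: "d \<in> disks \<Omega>" for d
  proof (cases "?P \<inter> disk_edges \<Omega> d = {}")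
    case False
    then show ?thesis using two[OF d False] d unfolding D_def by auto
  qed (simp add: D_def)
  have "cut_rel \<Omega> (set as) \<subseteq> {(e, e'). \<exists>d\<in>D. e \<noteq> e' \<and> {e, e'} = ?P \<inter> disk_edges \<Omega> d}"
    unfolding cut_rel_def D_def by blast
  then have con: "connected_by ?P {(e, e'). \<exists>d\<in>D. e \<noteq> e' \<and> {e, e'} = ?P \<inter> disk_edges \<Omega> d}"
    using film_on_connected(2)[OF F] rtrancl_mono unfolding cut_connected_def connected_by_def
    by (meson subsetD)
  have V: "verts \<Omega> = set as \<union> set bs" using film_onD(3)[OF F(1)] rotated_set[OF F(2)] by simp
  have disj: "set as \<inter> set bs = {}" using film_onD(2)[OF F(1)] rotated_distinct[OF F(2)] by simp
  let ?J = "set as \<times> set as \<union> set bs \<times> set bs"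
  have "?J `` {x} = set as" if "x \<in> set as" for x using that disj by auto
  moreover have "?J `` {x} = set bs" if "x \<in> set bs" for x using that disj by auto
  ultimately have "(set as \<union> set bs) // ?J = {set as, set bs}"
    using F(3,4) unfolding quotient_def by (auto simp: neq_Nil_conv)
  then have "verts \<Omega> // joined \<Omega> (edges \<Omega> - ?P) = {set as, set bs}"
    unfolding joined_minus_crossing[OF F] V .
  moreover have "set as \<noteq> set bs" using disj F(3) by auto
  moreover have "?P \<subseteq> edges \<Omega>" "D \<subseteq> disks \<Omega>" unfolding crossing_def D_def by blast+
  ultimately have "graph_cut \<Omega> ?P D (set as) (set bs)"
    unfolding graph_cut_def using card con div by simp
  then show ?thesis by blast
qed

lemma divisionE:
  assumes F: "film_on \<Omega> qs" and "division \<Omega> A B"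
  obtains as bs where "rotated qs (as @ bs)" "as \<noteq> []" "bs \<noteq> []" "A = set as" "B = set bs"
proof -
  obtain qs' k where q: "numbering \<Omega> qs'" "A = set (take k qs')" "B = set (drop k qs')"
    and ne: "A \<noteq> {}" "B \<noteq> {}" using assms(2) unfolding division_def by metis
  have "rotated qs (take k qs' @ drop k qs')" using numbering_rotated[OF F q(1)] by simp
  then show thesis using that ne q by (metis set_empty)
qed

text \<open>Converse of \<open>film_on_if_numbering\<close>: together they make
  \<open>film_on\<close> an exact description of connected film surfaces with a numbering.\<close>

theorem film_on_imp_film_surface:
  assumes F: "film_on \<Omega> qs" shows "film_surface \<Omega>" "connected_complex \<Omega>"
proof -
  note R = film_on_regular[OF F] and C = film_on_components[OF F]
  show "connected_complex \<Omega>" unfolding connected_complex_def C ..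
  have co: "cyclic_order_on (verts \<Omega>) (cyc \<Omega>)"
    using film_onD(2,3,10)[OF F] cyclic_order_on_circle by metis
  note D = cyclic_order_onD[OF co]
  have sub: "cyc \<Omega> \<inter> verts \<Omega> \<times> verts \<Omega> \<times> verts \<Omega> = cyc \<Omega>" using D(1) by blast
  have "in_cyclic_order (cyc \<Omega>) us" if d: "d \<in> disks \<Omega>" and t: "traverses \<Omega> d us es" for d us es
  proof -
    obtain fs where f: "traverses \<Omega> d (filter (\<lambda>v. v \<in> disk_verts \<Omega> d) qs) fs"
      using film_onD(9)[OF F d] by blast
    have "in_cyclic_order (cyc \<Omega>) (filter (\<lambda>v. v \<in> disk_verts \<Omega> d) qs)"
      using film_on_numbering[OF F] in_cyclic_order_filter unfolding numbering_def by blast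
    then show ?thesis using in_cyclic_order_rotated[OF D(2)] traverses_unique[OF f t] by blast
  qed
  then have "almost_cyclic \<Omega>"
    unfolding almost_cyclic_def C using R co D(1) by (simp add: sub)
  moreover have "restrict_complex \<Omega> (verts \<Omega>) = \<Omega>" using restrict_complex_verts[OF R D(1)] .
  ultimately have "cyclic_complex \<Omega>"
    unfolding cyclic_complex_def C using divisionE[OF F] film_on_graph_cut[OF F]
    by (metis singletonD)
  moreover have "inj_on (color \<Omega>) {d \<in> disks \<Omega>. disk_verts \<Omega> d \<subseteq> verts \<Omega>}"
    using film_onD(11)[OF F] by (rule inj_on_subset) blast
  ultimately show "film_surface \<Omega>" unfolding film_surface_def C by simp
qed

text \<open>Clause by clause this would be awkward, since disks and cyclic order are described
  through \<open>qs\<close>; the detour over numberings of a film surface avoids it.\<close>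

lemma film_on_rotated:
  assumes "film_on \<Omega> qs" "rotated qs qs'" shows "film_on \<Omega> qs'"
proof -
  have "cyclic_order_on (verts \<Omega>) (cyc \<Omega>)"
    using film_onD(2,3,10)[OF assms(1)] cyclic_order_on_circle by metis
  note D = cyclic_order_onD[OF this]
  have "numbering \<Omega> qs'"
    using film_on_numbering[OF assms(1)] rotated_set[OF assms(2)]
      in_cyclic_order_rotated[OF D(2) _ assms(2)] unfolding numbering_def by simp
  then show ?thesis using film_on_if_numbering film_on_imp_film_surface[OF assms(1)] by blast
qed

lemma film_onI:
  assumes "qs \<noteq> []" "distinct qs" "verts \<Omega> = set qs" "finite (edges \<Omega>)" "finite (disks \<Omega>)"
    and "\<forall>e\<in>edges \<Omega>. ends \<Omega> e \<subseteq> verts \<Omega> \<and> card (ends \<Omega> e) = 2"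
    and "edges \<Omega> = (\<Union>d\<in>disks \<Omega>. disk_edges \<Omega> d)" "verts \<Omega> = (\<Union>d\<in>disks \<Omega>. disk_verts \<Omega> d)"
    and "\<And>d. d \<in> disks \<Omega> \<Longrightarrow> \<exists>es. traverses \<Omega> d (filter (\<lambda>v. v \<in> disk_verts \<Omega> d) qs) es"
    and "cyc \<Omega> = circle qs" "inj_on (color \<Omega>) (disks \<Omega>)"
    and "\<And>as bs. rotated qs (as @ bs) \<Longrightarrow> as \<noteq> [] \<Longrightarrow> bs \<noteq> [] \<Longrightarrow>
           span_connected \<Omega> (set as) \<and> cut_connected \<Omega> (set as)"
  shows "film_on \<Omega> qs"
  unfolding film_on_def using assms by (intro conjI) metis+

section \<open>Relabelling of edges and disks\<close>

context
  fixes fe fd :: "nat \<Rightarrow> nat" and \<Omega> \<Omega>' :: "'c complex2"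
  assumes iso: "film_iso id fe fd \<Omega> \<Omega>'"
begin

lemma film_isoD:
  "verts \<Omega>' = verts \<Omega>" "edges \<Omega>' = fe ` edges \<Omega>" "disks \<Omega>' = fd ` disks \<Omega>"
  "inj_on fe (edges \<Omega>)" "inj_on fd (disks \<Omega>)"
  "e \<in> edges \<Omega> \<Longrightarrow> ends \<Omega>' (fe e) = ends \<Omega> e"
  "d \<in> disks \<Omega> \<Longrightarrow> bdry \<Omega>' (fd d) = (\<lambda>(u, e, v). (u, fe e, v)) ` bdry \<Omega> d"
  "d \<in> disks \<Omega> \<Longrightarrow> color \<Omega>' (fd d) = color \<Omega> d"
  "cyc \<Omega>' = cyc \<Omega>"
  using iso unfolding film_iso_def bij_betw_def by auto

lemma film_iso_disk:
  assumes "d \<in> disks \<Omega>"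
  shows "disk_verts \<Omega>' (fd d) = disk_verts \<Omega> d" "disk_edges \<Omega>' (fd d) = fe ` disk_edges \<Omega> d"
  unfolding disk_verts_def disk_edges_def film_isoD(7)[OF assms] by (force simp: image_iff)+

lemma film_iso_traverses:
  assumes "d \<in> disks \<Omega>" "traverses \<Omega> d us es" shows "traverses \<Omega>' (fd d) us (map fe es)"
proof -
  have es: "set es \<subseteq> edges \<Omega>" "length es = length us" using assms(2) unfolding traverses_def by auto
  then have "inj_on fe (set es)" using film_isoD(4) inj_on_subset by blast
  moreover have "{(us ! i, map fe es ! i, us ! (Suc i mod length us)) | i. i < length us} =
    (\<lambda>(u, e, v). (u, fe e, v)) ` {(us ! i, es ! i, us ! (Suc i mod length us)) | i. i < length us}"
    using es(2) by (force simp: image_iff)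
  moreover have "es ! i \<in> edges \<Omega>" if "i < length us" for i
    using that es by (metis nth_mem subsetD)
  ultimately show ?thesis
    using assms(2) es film_isoD(2,6) film_isoD(7)[OF assms(1)] unfolding traverses_def
    by (auto simp: distinct_map)
qed

text \<open>The vertices keep their names. Such relabellings come from cuts, and also occur with
  identity maps, when two complexes have the same cells but \<open>ends\<close>, \<open>bdry\<close>
  or \<open>color\<close> differ off these cells.\<close>

lemma film_iso_film_on:
  assumes F: "film_on \<Omega> qs" shows "film_on \<Omega>' qs"
proof -
  note D = film_onD[OF F]
  have cr: "crossing \<Omega>' S = fe ` crossing \<Omega> S" for S
    unfolding crossing_def film_isoD(2) using film_isoD(6) by (force simp: image_iff)
  have er: "edge_rel \<Omega>' S = edge_rel \<Omega> S" for S
    unfolding edge_rel_def film_isoD(2) using film_isoD(6) by auto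
  have cut: "cut_connected \<Omega>' S" if S: "cut_connected \<Omega> S" for S
  proof -
    have step: "(fe e, fe e') \<in> (cut_rel \<Omega>' S)\<^sup>*" if "(e, e') \<in> cut_rel \<Omega> S" for e e'
    proof -
      obtain d where d: "d \<in> disks \<Omega>" "e \<noteq> e'" "{e, e'} = crossing \<Omega> S \<inter> disk_edges \<Omega> d"
        using \<open>(e, e') \<in> cut_rel \<Omega> S\<close> unfolding cut_rel_def by blast
      have sub: "disk_edges \<Omega> d \<subseteq> edges \<Omega>" "crossing \<Omega> S \<subseteq> edges \<Omega>"
        using D(7) d(1) unfolding crossing_def by blast+
      then have "crossing \<Omega>' S \<inter> disk_edges \<Omega>' (fd d) = {fe e, fe e'}"
        unfolding cr film_iso_disk(2)[OF d(1)] using inj_on_image_Int[OF film_isoD(4)] d(3)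
        by (metis image_insert image_empty)
      moreover have "e \<in> edges \<Omega>" "e' \<in> edges \<Omega>" using d(3) sub(1) by blast+
      then have "fe e \<noteq> fe e'" using d(2) film_isoD(4) by (meson inj_onD)
      ultimately show ?thesis
        using d(1) film_isoD(3) unfolding cut_rel_def by (auto intro!: r_into_rtrancl)
    qed
    show ?thesis
      using S rtrancl_map[of "cut_rel \<Omega> S" fe, OF step]
      unfolding cut_connected_def connected_by_def cr by auto
  qed
  have cc: "span_connected \<Omega>' (set as) \<and> cut_connected \<Omega>' (set as)"
    if "rotated qs (as @ bs)" "as \<noteq> []" "bs \<noteq> []" for as bs
    using cut film_on_connected[OF F that] unfolding span_connected_def er by blast
  show ?thesis
  proof (rule film_onI)
    fix d assume d: "d \<in> disks \<Omega>'"
    obtain d0 where d0: "d = fd d0" "d0 \<in> disks \<Omega>" using d unfolding film_isoD(3) by (rule imageE)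
    obtain es where "traverses \<Omega> d0 (filter (\<lambda>v. v \<in> disk_verts \<Omega> d0) qs) es" using D(9)[OF d0(2)] ..
    from film_iso_traverses[OF d0(2) this]
    show "\<exists>es. traverses \<Omega>' d (filter (\<lambda>v. v \<in> disk_verts \<Omega>' d) qs) es"
      unfolding d0(1) film_iso_disk(1)[OF d0(2)] by blast
  next
    show "inj_on (color \<Omega>') (disks \<Omega>')"
      using D(11) film_isoD(8) unfolding film_isoD(3) inj_on_def by auto
    show "edges \<Omega>' = (\<Union>d\<in>disks \<Omega>'. disk_edges \<Omega>' d)"
      using D(7) film_iso_disk(2) unfolding film_isoD(2,3) by auto
    show "verts \<Omega>' = (\<Union>d\<in>disks \<Omega>'. disk_verts \<Omega>' d)"
      using D(8) film_iso_disk(1) unfolding film_isoD(1,3) by auto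
    show "\<forall>e\<in>edges \<Omega>'. ends \<Omega>' e \<subseteq> verts \<Omega>' \<and> card (ends \<Omega>' e) = 2"
      using D(3,6) film_isoD(1,6) unfolding film_isoD(2) by auto
  qed (use D(1-5,10) film_isoD(1,2,3,9) cc in simp_all)
qed

end

section \<open>Contraction of an arc of vertices\<close>

text \<open>The map \<open>\<kappa>\<close> from the definition of \<open>cut_piece\<close>.\<close>

definition collapse :: "nat set \<Rightarrow> nat \<Rightarrow> nat \<Rightarrow> nat" where
  "collapse A q v = (if v \<in> A then v else q)"

lemma cut_piece_sel [simp]:
  "verts (cut_piece \<Omega> A q) = insert q A"
  "edges (cut_piece \<Omega> A q) = {e \<in> edges \<Omega>. ends \<Omega> e \<inter> A \<noteq> {}}"
  "ends (cut_piece \<Omega> A q) e = collapse A q ` ends \<Omega> e"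
  "disks (cut_piece \<Omega> A q) = {d \<in> disks \<Omega>. disk_verts \<Omega> d \<inter> A \<noteq> {}}"
  "bdry (cut_piece \<Omega> A q) d =
     {(collapse A q u, e, collapse A q v) | u e v. (u, e, v) \<in> bdry \<Omega> d \<and> (u \<in> A \<or> v \<in> A)}"
  "color (cut_piece \<Omega> A q) = color \<Omega>"
  "cyc (cut_piece \<Omega> A q) =
     {(collapse A q a, collapse A q b, collapse A q c) | a b c.
        (a, b, c) \<in> cyc \<Omega> \<and> distinct [collapse A q a, collapse A q b, collapse A q c]}"
  unfolding cut_piece_def Let_def collapse_def by (simp_all cong: if_cong)

context
  fixes \<Omega> :: "'c complex2" and as bs :: "nat list" and q :: nat
  assumes F: "film_on \<Omega> (as @ bs)" and ne: "as \<noteq> []" "bs \<noteq> []" and q: "q \<notin> set as"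
begin

abbreviation (input) "piece \<equiv> cut_piece \<Omega> (set as) q"
abbreviation (input) "merge \<equiv> collapse (set as) q"

lemma arcs_disjoint: "set as \<inter> set bs = {}"
  using film_onD(2)[OF F] by simp

text \<open>On the boundary of a crossed disk the stretch through \<open>bs\<close> shrinks to a
  single visit of \<open>q\<close>, which comes last as in the list \<open>as @ [q]\<close>.\<close>

lemma cut_piece_traverses:
  assumes d: "d \<in> disks piece"
  shows "\<exists>es. traverses piece d (filter (\<lambda>v. v \<in> disk_verts piece d) (as @ [q])) es"
proof -
  define f1 f2 where "f1 = filter (\<lambda>v. v \<in> disk_verts \<Omega> d) as"
    and "f2 = filter (\<lambda>v. v \<in> disk_verts \<Omega> d) bs"
  have d': "d \<in> disks \<Omega>" "disk_verts \<Omega> d \<inter> set as \<noteq> {}" using d by auto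
  note R = film_on_regular[OF F] d'(1)
  obtain es where t: "traverses \<Omega> d (f1 @ f2) es"
    using film_on_disk[OF F rotated_refl d'(1)] unfolding f1_def f2_def by blast
  have f1: "set f1 \<subseteq> set as" "f1 \<noteq> []" and f2: "set f2 \<inter> set as = {}"
  proof -
    show "set f1 \<subseteq> set as" "set f2 \<inter> set as = {}" using arcs_disjoint unfolding f1_def f2_def by auto
    show "f1 \<noteq> []" using d'(2) unfolding f1_def by (auto simp: filter_empty_conv)
  qed
  have tr: "distinct (f1 @ f2)" "distinct es" "length es = length (f1 @ f2)"
    using t unfolding traverses_def by auto
  have ends: "ends piece e = {x, y} \<and> e \<in> edges piece" if "(x, e, y) \<in> bdry piece d" for x e y
    using that bdry_ends(1,2)[OF R] by auto
  have dv: "filter (\<lambda>v. v \<in> disk_verts piece d) (as @ [q]) = us"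
    if "traverses piece d us es'" "us = f1 \<or> us = f1 @ [q]" for us es'
  proof -
    have "disk_verts piece d = set us" using traverses_disk_verts[OF that(1)] .
    have *: "v \<in> disk_verts piece d \<longleftrightarrow> v \<in> disk_verts \<Omega> d" if v: "v \<in> set as" for v
    proof -
      have "v \<noteq> q" using q v by blast
      then have "v \<in> set us \<longleftrightarrow> v \<in> set f1" using \<open>us = f1 \<or> us = f1 @ [q]\<close> by (elim disjE) simp_all
      also have "\<dots> \<longleftrightarrow> v \<in> disk_verts \<Omega> d" using v unfolding f1_def by simp
      finally show ?thesis unfolding \<open>disk_verts piece d = set us\<close> .
    qed
    have "filter (\<lambda>v. v \<in> disk_verts piece d) as = f1"
      unfolding f1_def by (rule filter_cong[OF refl *])
    then have "filter (\<lambda>v. v \<in> disk_verts piece d) (as @ [q]) = f1 @ (if q \<in> set us then [q] else [])"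
      using \<open>disk_verts piece d = set us\<close> by simp
    moreover have "q \<notin> set f1" using q f1(1) by blast
    ultimately show ?thesis using that(2) by (elim disjE) simp_all
  qed
  have trI: "traverses piece d us es'"
    if h: "us \<noteq> []" "length es' = length us" "distinct us" "distinct es'"
      "bdry piece d = {(us ! i, es' ! i, us ! (Suc i mod length us)) | i. i < length us}" for us es'
  proof -
    have "ends piece (es' ! i) = {us ! i, us ! (Suc i mod length us)} \<and> es' ! i \<in> edges piece"
      if "i < length us" for i
      by (rule ends) (use h(5) that in blast)
    then show ?thesis using h unfolding traverses_def by (auto simp: in_set_conv_nth simp del: cut_piece_sel)
  qed
  show ?thesis
  proof (cases "f2 = []")
    case True
    have "bdry piece d = bdry \<Omega> d"
    proof -
      have "u \<in> set as \<and> v \<in> set as" if "(u, e, v) \<in> bdry \<Omega> d" for u e v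
        using that f1(1) disk_verts_bdry[OF R] traverses_disk_verts[OF t] True by auto
      then show ?thesis by (force simp: collapse_def)
    qed
    moreover have "bdry \<Omega> d = {(f1 ! i, es ! i, f1 ! (Suc i mod length f1)) | i. i < length f1}"
      using t True unfolding traverses_def by simp
    ultimately have "traverses piece d f1 es"
      using tr True f1(2) by (intro trI) simp_all
    then show ?thesis using dv by metis
  next
    case False
    define k n where "k = length f1" and "n = length (f1 @ f2)"
    have kn: "0 < k" "k < n" using f1(2) False unfolding k_def n_def by auto
    \<comment> \<open>Steps \<open>0\<close> to \<open>k - 1\<close> start in \<open>as\<close>, the
      last of them leading into \<open>bs\<close>; the steps inside \<open>bs\<close> vanish, and
      step \<open>n - 1\<close> is the return from \<open>bs\<close>, now from
      \<open>q\<close>.\<close>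
    define us es' where "us = f1 @ [q]" and "es' = take k es @ [es ! (n - 1)]"
    have len: "length us = Suc k" "length es' = Suc k" "length es = n"
      using tr(3) kn unfolding us_def es'_def k_def n_def by auto
    have mem: "(f1 @ f2) ! i \<in> set as \<longleftrightarrow> i < k" if "i < n" for i
    proof (cases "i < k")
      case True
      then show ?thesis using f1(1) unfolding k_def by (auto simp: nth_append)
    next
      case False
      then have "(f1 @ f2) ! i \<in> set f2" using that unfolding k_def n_def by (simp add: nth_append)
      then show ?thesis using False f2 by auto
    qed
    have us: "us ! i = merge ((f1 @ f2) ! i)" if "i \<le> k" for i
      using mem[of i] kn that unfolding us_def collapse_def k_def by (auto simp: nth_append)
    have es': "es' ! i = (if i < k then es ! i else es ! (n - 1))" if "i \<le> k" for i
      using that kn len unfolding es'_def by (auto simp: nth_append)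
    have last: "us ! k = merge ((f1 @ f2) ! (n - 1))" "us ! 0 = merge ((f1 @ f2) ! 0)"
      using us[of k] us[of 0] mem[of "n - 1"] mem[of k] kn unfolding collapse_def by auto
    have "bdry piece d = {(us ! i, es' ! i, us ! (Suc i mod length us)) | i. i < length us}" (is "_ = ?S")
    proof (intro subset_antisym subsetI)
      fix p assume "p \<in> bdry piece d"
      then obtain j where j: "j < n" and p: "p = (merge ((f1 @ f2) ! j), es ! j, merge ((f1 @ f2) ! (Suc j mod n)))"
        and A: "(f1 @ f2) ! j \<in> set as \<or> (f1 @ f2) ! (Suc j mod n) \<in> set as"
        using traverses_bdry[OF t] unfolding n_def by auto
      show "p \<in> ?S"
      proof (cases "j < k")
        case True
        then show ?thesis using us[of j] us[of "Suc j"] es'[of j] len kn unfolding p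
          by (intro CollectI exI[of _ j]) auto
      next
        case False
        then have "Suc j = n" using A j mem[of j] mem[of "Suc j mod n"]
          by (cases "Suc j < n") auto
        then show ?thesis using last es'[of k] len False unfolding p
          by (auto intro!: exI[of _ k])
      qed
    next
      fix p assume "p \<in> ?S"
      then obtain i where i': "i < Suc k" and p: "p = (us ! i, es' ! i, us ! (Suc i mod Suc k))"
        unfolding len(1) by blast
      have i: "i \<le> k" using i' by simp
      have "\<exists>j<n. p = (merge ((f1 @ f2) ! j), es ! j, merge ((f1 @ f2) ! (Suc j mod n))) \<and>
                  ((f1 @ f2) ! j \<in> set as \<or> (f1 @ f2) ! (Suc j mod n) \<in> set as)"
      proof (cases "i < k")
        case True
        then show ?thesis using us[of i] us[of "Suc i"] es'[of i] mem[of i] kn unfolding p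
          by (intro exI[of _ i]) auto
      next
        case False
        then show ?thesis using i last es'[of i] mem[of 0] kn unfolding p
          by (intro exI[of _ "n - 1"]) auto
      qed
      then show "p \<in> bdry piece d" using traverses_bdry[OF t] unfolding n_def by auto
    qed
    moreover have "distinct es'"
    proof -
      have "es ! (n - 1) = drop k es ! (n - 1 - k)" using kn len by (simp add: nth_drop)
      moreover have "n - 1 - k < length (drop k es)" using kn len by simp
      ultimately have "es ! (n - 1) \<in> set (drop k es)" using nth_mem by metis
      then show ?thesis unfolding es'_def using tr(2) set_take_disj_set_drop_if_distinct[of es k k] by auto
    qed
    moreover have "distinct us" using tr(1) f1(1) q unfolding us_def by auto
    ultimately have "traverses piece d us es'"
      using len by (intro trI) auto
    then show ?thesis using dv us_def by metis
  qed
qed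

text \<open>In terms of positions the contraction is the map from \<open>i\<close> to
  \<open>min i k\<close>, and this map preserves \<open>circ\<close> as long as the three images
  stay distinct.\<close>

lemma cut_piece_cyc: "cyc piece = circle (as @ [q])"
proof -
  define k where "k = length as"
  have kn: "k < length (as @ bs)" using ne unfolding k_def by simp
  have merge_nth: "merge ((as @ bs) ! i) = (as @ [q]) ! min i k" if "i < length (as @ bs)" for i
  proof (cases "i < k")
    case False
    then have "(as @ bs) ! i \<in> set bs" using that unfolding k_def by (simp add: nth_append)
    then show ?thesis using False arcs_disjoint unfolding k_def collapse_def by (auto simp: min_def nth_append)
  qed (simp add: k_def collapse_def nth_append)
  have len: "length (as @ [q]) = Suc k" unfolding k_def by simp
  show ?thesis
  proof (intro subset_antisym subsetI)
    fix p assume "p \<in> cyc piece"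
    then obtain a b c where p: "p = (merge a, merge b, merge c)" "(a, b, c) \<in> circle (as @ bs)"
      "merge a \<noteq> merge b" "merge b \<noteq> merge c" "merge a \<noteq> merge c" using film_onD(10)[OF F] by auto
    then obtain i j l where ijl: "a = (as @ bs) ! i" "b = (as @ bs) ! j" "c = (as @ bs) ! l"
      "i < length (as @ bs)" "j < length (as @ bs)" "l < length (as @ bs)" "circ i j l"
      by (elim circleE)
    have "min i k \<noteq> min j k" "min j k \<noteq> min l k" "min i k \<noteq> min l k"
      using p(3-5) ijl(4-6) unfolding ijl(1-3) merge_nth[OF ijl(4)] merge_nth[OF ijl(5)] merge_nth[OF ijl(6)] by metis+
    then have "circ (min i k) (min j k) (min l k)"
      using ijl(7) unfolding circ_def by linarith
    moreover have "distinct (as @ [q])" using q film_onD(2)[OF F] by simp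
    moreover have "min i k < length (as @ [q])" "min j k < length (as @ [q])" "min l k < length (as @ [q])"
      unfolding len by linarith+
    ultimately show "p \<in> circle (as @ [q])"
      unfolding p(1) ijl(1-3) merge_nth[OF ijl(4)] merge_nth[OF ijl(5)] merge_nth[OF ijl(6)] using circle_nth by blast
  next
    fix p assume "p \<in> circle (as @ [q])"
    then obtain i j l where ijl: "p = ((as @ [q]) ! i, (as @ [q]) ! j, (as @ [q]) ! l)"
      "i \<le> k" "j \<le> k" "l \<le> k" "circ i j l" unfolding circle_def len by auto
    have n: "i < length (as @ bs)" "j < length (as @ bs)" "l < length (as @ bs)"
      using ijl(2-4) kn by linarith+
    have "((as @ bs) ! i, (as @ bs) ! j, (as @ bs) ! l) \<in> cyc \<Omega>"
      using ijl(5) n unfolding film_onD(10)[OF F] circle_nth[OF film_onD(2)[OF F] n] by simp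
    moreover have "p = (merge ((as @ bs) ! i), merge ((as @ bs) ! j), merge ((as @ bs) ! l))"
      unfolding ijl(1) merge_nth[OF n(1)] merge_nth[OF n(2)] merge_nth[OF n(3)] using ijl(2-4) by (simp add: min_absorb1)
    moreover have "distinct [merge ((as @ bs) ! i), merge ((as @ bs) ! j), merge ((as @ bs) ! l)]"
    proof -
      have "distinct (as @ [q])" using q film_onD(2)[OF F] by simp
      then show ?thesis unfolding merge_nth[OF n(1)] merge_nth[OF n(2)] merge_nth[OF n(3)]
        using ijl(2-5) len unfolding circ_def
        by (auto simp: nth_eq_iff_index_eq min_absorb1 simp del: distinct_append)
    qed
    ultimately show "p \<in> cyc piece" unfolding cut_piece_sel by blast
  qed
qed

text \<open>An arc \<open>l\<close> of the piece is the image of the arc \<open>l'\<close> of the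
  surface in which \<open>q\<close> is expanded to \<open>bs\<close>, and the same edges cross both.
  Connectedness is then pushed forward along \<open>merge\<close>.\<close>

lemma cut_piece_connected:
  assumes r: "rotated (as @ [q]) (l @ r)" "l \<noteq> []" "r \<noteq> []"
  shows "span_connected piece (set l) \<and> cut_connected piece (set l)"
proof -
  define g where "g v = (if v = q then bs else [v])" for v
  define l' r' where "l' = concat (map g l)" and "r' = concat (map g r)"
  have "concat (map g as) = as"
    using q unfolding g_def by (induction as) auto
  then have "concat (map g (as @ [q])) = as @ bs" unfolding g_def by simp
  then have r': "rotated (as @ bs) (l' @ r')"
    using rotated_concat_map[OF r(1), of g] unfolding l'_def r'_def by simp
  have "concat (map g xs) \<noteq> []" if "xs \<noteq> []" for xs
    using that ne(2) by (cases xs) (auto simp: g_def)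
  then have ne': "l' \<noteq> []" "r' \<noteq> []" using r(2,3) unfolding l'_def r'_def by blast+
  have sub: "set l \<subseteq> insert q (set as)" using rotated_set[OF r(1)] by auto
  have V: "verts \<Omega> = set as \<union> set bs" using film_onD(3)[OF F] by simp
  have mem: "v \<in> set l' \<longleftrightarrow> merge v \<in> set l" if "v \<in> verts \<Omega>" for v
    using that arcs_disjoint q sub unfolding V l'_def g_def collapse_def by auto
  have ends: "\<exists>u v. ends \<Omega> e = {u, v} \<and> u \<in> verts \<Omega> \<and> v \<in> verts \<Omega>" if "e \<in> edges \<Omega>" for e
    using film_onD(3,6)[OF F] that by (metis card_2_iff insert_subset)
  \<comment> \<open>An edge whose ends are merged has both ends on the same side of
    \<open>l'\<close>, so it crosses neither arc.\<close>
  have cr: "crossing piece (set l) = crossing \<Omega> (set l')"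
  proof -
    have "e \<in> crossing piece (set l) \<longleftrightarrow> e \<in> crossing \<Omega> (set l')" if e: "e \<in> edges \<Omega>" for e
    proof -
      obtain u v where uv: "ends \<Omega> e = {u, v}" "u \<in> verts \<Omega>" "v \<in> verts \<Omega>" using ends[OF e] by blast
      show ?thesis
      proof (cases "merge u = merge v")
        case False
        then have "u \<in> set as \<or> v \<in> set as" by (auto simp: collapse_def split: if_splits)
        then show ?thesis unfolding crossing_def using e uv mem[of u] mem[of v] by auto
      qed (use mem[of u] mem[of v] uv in \<open>auto simp: crossing_def\<close>)
    qed
    then show ?thesis unfolding crossing_def by auto
  qed
  have c: "span_connected \<Omega> (set l')" "cut_connected \<Omega> (set l')"
    using film_on_connected[OF F r' ne'] .
  have step: "(merge u, merge v) \<in> (edge_rel piece (set l))\<^sup>*" if uv: "(u, v) \<in> edge_rel \<Omega> (set l')" for u v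
  proof (cases "merge u = merge v")
    case False
    obtain e where e: "e \<in> edges \<Omega>" "ends \<Omega> e = {u, v}" "u \<in> set l'" "v \<in> set l'"
      using uv unfolding edge_rel_def by blast
    then have "u \<in> verts \<Omega>" "v \<in> verts \<Omega>" using film_onD(6)[OF F e(1)] unfolding film_onD(3)[OF F] by auto
    then have "merge u \<in> set l" "merge v \<in> set l" using mem e by auto
    moreover have "u \<in> set as \<or> v \<in> set as" using False unfolding collapse_def by (auto split: if_splits)
    ultimately have "(merge u, merge v) \<in> edge_rel piece (set l)"
      using e(1,2) unfolding edge_rel_def by (auto intro!: bexI[of _ e])
    then show ?thesis by blast
  qed simp
  have surj: "\<exists>u\<in>set l'. merge u = x" if "x \<in> set l" for x
  proof (cases "x \<in> set as")
    case True
    then show ?thesis using that mem[of x] V by (intro bexI[of _ x]) (auto simp: collapse_def)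
  next
    case False
    then have "x = q" "hd bs \<in> set bs" using that sub ne by auto
    then show ?thesis using that mem[of "hd bs"] V arcs_disjoint
      by (intro bexI[of _ "hd bs"]) (auto simp: collapse_def)
  qed
  have "span_connected piece (set l)" unfolding span_connected_def
  proof (intro ballI)
    fix x y assume "x \<in> set l" "y \<in> set l"
    then obtain u v where "u \<in> set l'" "v \<in> set l'" "x = merge u" "y = merge v" using surj by metis
    then show "(x, y) \<in> (edge_rel piece (set l))\<^sup>*"
      using rtrancl_map[of "edge_rel \<Omega> (set l')" merge, OF step] c(1) unfolding span_connected_def by simp
  qed
  moreover have "cut_rel \<Omega> (set l') \<subseteq> cut_rel piece (set l)"
  proof clarify
    fix e e' assume "(e, e') \<in> cut_rel \<Omega> (set l')"
    then obtain d where d: "d \<in> disks \<Omega>" "e \<noteq> e'" "{e, e'} = crossing \<Omega> (set l') \<inter> disk_edges \<Omega> d"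
      unfolding cut_rel_def by blast
    note R = film_on_regular[OF F] d(1)
    have A: "u \<in> set as \<or> v \<in> set as" if "(u, e1, v) \<in> bdry \<Omega> d" "e1 \<in> crossing \<Omega> (set l')" for u v e1
      using that bdry_ends(2)[OF R that(1)] cr unfolding crossing_def by auto
    have "disk_edges piece d \<inter> crossing \<Omega> (set l') = disk_edges \<Omega> d \<inter> crossing \<Omega> (set l')"
      using A unfolding disk_edges_def cut_piece_sel by blast
    then have "{e, e'} = crossing piece (set l) \<inter> disk_edges piece d" using d(3) unfolding cr by blast
    moreover have "d \<in> disks piece"
    proof -
      obtain u v where uv: "(u, e, v) \<in> bdry \<Omega> d" "e \<in> crossing \<Omega> (set l')"
        using d(3) unfolding disk_edges_def by blast
      show ?thesis using A[OF uv] disk_verts_bdry[OF R uv(1)] d(1) by auto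
    qed
    ultimately show "(e, e') \<in> cut_rel piece (set l)" using d(2) unfolding cut_rel_def by blast
  qed
  then have "cut_connected piece (set l)"
    using c(2) rtrancl_mono unfolding cut_connected_def connected_by_def cr by (meson subsetD)
  ultimately show ?thesis ..
qed

theorem film_on_cut_piece: "film_on piece (as @ [q])"
proof (rule film_onI)
  note D = film_onD[OF F] and R = film_on_regular[OF F]
  have V: "verts \<Omega> = set as \<union> set bs" using D(3) by simp
  show "distinct (as @ [q])" using D(2) q by simp
  show "finite (edges piece)" "finite (disks piece)" using D(4,5) by auto
  show "\<forall>e\<in>edges piece. ends piece e \<subseteq> verts piece \<and> card (ends piece e) = 2"
  proof
    fix e assume e: "e \<in> edges piece"
    then have "card (ends \<Omega> e) = 2" using D(6)[of e] by simp
    then obtain u v where uv: "ends \<Omega> e = {u, v}" "u \<noteq> v" by (meson card_2_iff)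
    have "merge u \<noteq> merge v" using e uv q unfolding collapse_def by auto
    moreover have "ends piece e = {merge u, merge v}" using uv(1) by simp
    moreover have "{merge u, merge v} \<subseteq> verts piece" by (simp add: collapse_def)
    ultimately show "ends piece e \<subseteq> verts piece \<and> card (ends piece e) = 2" by simp
  qed
  show "edges piece = (\<Union>d\<in>disks piece. disk_edges piece d)"
  proof (intro subset_antisym subsetI)
    fix e assume e: "e \<in> edges piece"
    then obtain d where d: "d \<in> disks \<Omega>" "e \<in> disk_edges \<Omega> d" using D(7) by auto
    then obtain u v where uv: "(u, e, v) \<in> bdry \<Omega> d" unfolding disk_edges_def by blast
    have A: "u \<in> set as \<or> v \<in> set as" using e bdry_ends(2)[OF R d(1) uv] by auto
    then have "d \<in> disks piece" using d(1) disk_verts_bdry[OF R d(1) uv] by auto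
    moreover have "e \<in> disk_edges piece d" using uv A unfolding disk_edges_def by auto
    ultimately show "e \<in> (\<Union>d\<in>disks piece. disk_edges piece d)" by blast
  next
    fix e assume "e \<in> (\<Union>d\<in>disks piece. disk_edges piece d)"
    then obtain d u v where d: "d \<in> disks \<Omega>" "(u, e, v) \<in> bdry \<Omega> d" "u \<in> set as \<or> v \<in> set as"
      unfolding disk_edges_def by auto
    then show "e \<in> edges piece" using bdry_ends(1,2)[OF R d(1,2)] by auto
  qed
  show "verts piece = (\<Union>d\<in>disks piece. disk_verts piece d)"
  proof (intro subset_antisym subsetI)
    fix x assume x: "x \<in> verts piece"
    show "x \<in> (\<Union>d\<in>disks piece. disk_verts piece d)"
    proof (cases "x \<in> set as")
      case True
      then obtain d where d: "d \<in> disks \<Omega>" "x \<in> disk_verts \<Omega> d" using D(8) V by blast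
      then obtain e v where "(x, e, v) \<in> bdry \<Omega> d" unfolding disk_verts_def by blast
      then have "(x, e, merge v) \<in> bdry piece d" using True by (auto simp: collapse_def)
      moreover have "d \<in> disks piece" using d True by auto
      ultimately show ?thesis unfolding disk_verts_def by blast
    next
      case False
      then have xq: "x = q" using x by simp
      \<comment> \<open>The graph that cuts off \<open>as\<close> is connected, hence non-empty; a
        disk that it crosses has \<open>q\<close> on its boundary after the contraction.\<close>
      obtain e where "e \<in> crossing \<Omega> (set as)"
        using film_on_connected(2)[OF F rotated_refl ne] unfolding cut_connected_def connected_by_def by blast
      moreover from this obtain d where d: "d \<in> disks \<Omega>" "e \<in> disk_edges \<Omega> d"
        using D(7) unfolding crossing_def by auto
      ultimately have c: "disk_verts \<Omega> d \<inter> set as \<noteq> {}" "\<not> disk_verts \<Omega> d \<subseteq> set as"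
        using crossing_disk_ends[OF R d(1)] by blast+
      obtain u e v where "(u, e, v) \<in> bdry \<Omega> d" "u \<notin> set as" "v \<in> set as"
        using bdry_enters[OF R d(1) c] by blast
      then have "(x, e, v) \<in> bdry piece d" using xq by (auto simp: collapse_def)
      moreover have "d \<in> disks piece" using d(1) c by auto
      ultimately show ?thesis unfolding disk_verts_def by blast
    qed
  next
    fix x assume "x \<in> (\<Union>d\<in>disks piece. disk_verts piece d)"
    then obtain u where "x = merge u" unfolding disk_verts_def by auto
    then show "x \<in> verts piece" by (simp add: collapse_def)
  qed
  show "inj_on (color piece) (disks piece)" using D(11) by (auto intro: inj_on_subset)
qed (use cut_piece_traverses cut_piece_cyc cut_piece_connected in auto)

end

section \<open>The graph cutting off an arc\<close>

definition enters :: "'c complex2 \<Rightarrow> nat set \<Rightarrow> nat \<Rightarrow> nat \<Rightarrow> bool" where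
  "enters \<Omega> S d e \<longleftrightarrow> d \<in> disks \<Omega> \<and> (\<exists>u v. (u, e, v) \<in> bdry \<Omega> d \<and> u \<notin> S \<and> v \<in> S)"

definition leaves :: "'c complex2 \<Rightarrow> nat set \<Rightarrow> nat \<Rightarrow> nat \<Rightarrow> bool" where
  "leaves \<Omega> S d e \<longleftrightarrow> d \<in> disks \<Omega> \<and> (\<exists>u v. (u, e, v) \<in> bdry \<Omega> d \<and> u \<in> S \<and> v \<notin> S)"

text \<open>The graph that cuts off \<open>S\<close>, oriented like the vertex graph of a vertex
  replacing \<open>S\<close>: an edge runs from where the boundary of a disk enters \<open>S\<close>
  to where it leaves. The \<open>THE\<close> terms are determined when \<open>S\<close> is an arc or
  a single vertex.\<close>

definition arc_graph :: "'c complex2 \<Rightarrow> nat set \<Rightarrow> 'c ograph" where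
  "arc_graph \<Omega> S =
     \<lparr>gverts = crossing \<Omega> S, gedges = {d. \<exists>e. enters \<Omega> S d e},
      gsrc = (\<lambda>d. THE e. enters \<Omega> S d e), gtgt = (\<lambda>d. THE e. leaves \<Omega> S d e), gcolor = color \<Omega>\<rparr>"

definition arc_class :: "'c complex2 \<Rightarrow> nat set \<Rightarrow> 'c ograph set" where
  "arc_class \<Omega> S = graph_class (arc_graph \<Omega> S)"

lemma enters_iff_leaves:
  assumes R: "regular_complex \<Omega>"
  shows "(\<exists>e. enters \<Omega> S d e) \<longleftrightarrow> (\<exists>e. leaves \<Omega> S d e)"
proof -
  have "disk_verts \<Omega> d \<inter> S \<noteq> {} \<and> \<not> disk_verts \<Omega> d \<subseteq> S"
    if "(u, e, v) \<in> bdry \<Omega> d" "u \<in> S \<longleftrightarrow> v \<notin> S" "d \<in> disks \<Omega>" for u e v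
    using disk_verts_bdry[OF R that(3,1)] that(2) by blast
  then show ?thesis unfolding enters_def leaves_def
    using bdry_enters[OF R, of d S] bdry_leaves[OF R, of d S] by metis
qed

lemma arc_graph_gedges:
  assumes R: "regular_complex \<Omega>"
  shows "gedges (arc_graph \<Omega> S) = {d \<in> disks \<Omega>. disk_verts \<Omega> d \<inter> S \<noteq> {} \<and> \<not> disk_verts \<Omega> d \<subseteq> S}"
proof -
  have "(\<exists>e. enters \<Omega> S d e) \<longleftrightarrow> d \<in> disks \<Omega> \<and> disk_verts \<Omega> d \<inter> S \<noteq> {} \<and> \<not> disk_verts \<Omega> d \<subseteq> S" for d
  proof
    assume "\<exists>e. enters \<Omega> S d e"
    then show "d \<in> disks \<Omega> \<and> disk_verts \<Omega> d \<inter> S \<noteq> {} \<and> \<not> disk_verts \<Omega> d \<subseteq> S"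
      unfolding enters_def using disk_verts_bdry[OF R, of d] by blast
  next
    assume "d \<in> disks \<Omega> \<and> disk_verts \<Omega> d \<inter> S \<noteq> {} \<and> \<not> disk_verts \<Omega> d \<subseteq> S"
    then show "\<exists>e. enters \<Omega> S d e" unfolding enters_def using bdry_enters[OF R, of d S] by metis
  qed
  then show ?thesis unfolding arc_graph_def by simp
qed

lemma arc_graph_gverts: "gverts (arc_graph \<Omega> S) = crossing \<Omega> S"
  unfolding arc_graph_def by simp

text \<open>Passing to the complement exchanges entering and leaving, so the two graphs are equal as
  records and not merely isomorphic.\<close>

lemma arc_graph_complement:
  assumes "regular_complex \<Omega>"
  shows "arc_graph \<Omega> (- S) = reverse (arc_graph \<Omega> S)"
proof -
  have "enters \<Omega> (- S) = leaves \<Omega> S" "leaves \<Omega> (- S) = enters \<Omega> S"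
    unfolding enters_def leaves_def by (auto simp: fun_eq_iff)
  moreover have "crossing \<Omega> (- S) = crossing \<Omega> S" unfolding crossing_def by blast
  ultimately show ?thesis
    unfolding arc_graph_def reverse_def using enters_iff_leaves[OF assms] by simp
qed

lemma arc_class_complement:
  "regular_complex \<Omega> \<Longrightarrow> arc_class \<Omega> (- S) = star (arc_class \<Omega> S)"
  unfolding arc_class_def by (simp add: arc_graph_complement star_graph_class)

text \<open>This allows the complementary arc \<open>bs\<close> to be exchanged for the set
  complement of \<open>as\<close>.\<close>

lemma arc_class_cong:
  assumes R: "regular_complex \<Omega>" and eq: "S \<inter> verts \<Omega> = T \<inter> verts \<Omega>"
  shows "arc_class \<Omega> S = arc_class \<Omega> T"
proof -
  have "(\<exists>u v. (u, e, v) \<in> bdry \<Omega> d \<and> u \<notin> S \<and> v \<in> S) \<longleftrightarrow> (\<exists>u v. (u, e, v) \<in> bdry \<Omega> d \<and> u \<notin> T \<and> v \<in> T)"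
    "(\<exists>u v. (u, e, v) \<in> bdry \<Omega> d \<and> u \<in> S \<and> v \<notin> S) \<longleftrightarrow> (\<exists>u v. (u, e, v) \<in> bdry \<Omega> d \<and> u \<in> T \<and> v \<notin> T)"
    if "d \<in> disks \<Omega>" for d e
    using bdry_ends(4,5)[OF R that] eq by blast+
  then have "enters \<Omega> S = enters \<Omega> T" "leaves \<Omega> S = leaves \<Omega> T"
    unfolding enters_def leaves_def fun_eq_iff by (intro allI conj_cong refl; simp)+
  moreover have "crossing \<Omega> S = crossing \<Omega> T"
  proof -
    have "ends \<Omega> e \<inter> S = ends \<Omega> e \<inter> T" if "e \<in> edges \<Omega>" for e
      using regular_complexD(4)[OF R] that eq by blast
    then show ?thesis unfolding crossing_def by blast
  qed
  ultimately show ?thesis unfolding arc_class_def arc_graph_def by simp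
qed

text \<open>A vertex is the smallest arc: no edge and no disk lies within it, so every cell incident
  to it crosses.\<close>

lemma vclass_arc_class:
  assumes R: "regular_complex \<Omega>" shows "vclass \<Omega> q = arc_class \<Omega> {q}"
  unfolding vclass_def arc_class_def
proof (rule graph_class_cong)
  show "gverts (vertex_graph \<Omega> q) = gverts (arc_graph \<Omega> {q})"
  proof -
    have "\<not> ends \<Omega> e \<subseteq> {q}" if "e \<in> edges \<Omega>" for e
    proof
      assume "ends \<Omega> e \<subseteq> {q}"
      then have "card (ends \<Omega> e) \<le> card {q}" by (rule card_mono[rotated]) simp
      then show False using regular_complexD(4)[OF R] that by auto
    qed
    then show ?thesis unfolding vertex_graph_def arc_graph_def crossing_def by auto
  qed
  show "gedges (vertex_graph \<Omega> q) = gedges (arc_graph \<Omega> {q})"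
  proof -
    have "\<not> disk_verts \<Omega> d \<subseteq> {q}" if d: "d \<in> disks \<Omega>" for d
    proof
      assume a: "disk_verts \<Omega> d \<subseteq> {q}"
      obtain u e v where uv: "(u, e, v) \<in> bdry \<Omega> d"
        using disk_verts_nonempty[OF R d] unfolding disk_verts_def by blast
      show False using disk_verts_bdry[OF R d uv] bdry_ends(3)[OF R d uv] a by blast
    qed
    then show ?thesis unfolding arc_graph_gedges[OF R] vertex_graph_def by auto
  qed
  fix d assume "d \<in> gedges (arc_graph \<Omega> {q})"
  then have d: "d \<in> disks \<Omega>" unfolding arc_graph_gedges[OF R] by blast
  have "(\<exists>u. (u, e, q) \<in> bdry \<Omega> d) = enters \<Omega> {q} d e" "(\<exists>v. (q, e, v) \<in> bdry \<Omega> d) = leaves \<Omega> {q} d e" for e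
    unfolding enters_def leaves_def using d bdry_ends(3)[OF R d] by blast+
  then show "gsrc (vertex_graph \<Omega> q) d = gsrc (arc_graph \<Omega> {q}) d \<and>
        gtgt (vertex_graph \<Omega> q) d = gtgt (arc_graph \<Omega> {q}) d \<and>
        gcolor (vertex_graph \<Omega> q) d = gcolor (arc_graph \<Omega> {q}) d"
    unfolding vertex_graph_def arc_graph_def by simp
qed

lemma arc_graph_sel:
  assumes F: "film_on \<Omega> qs" "rotated qs (as @ bs)"
  shows "enters \<Omega> (set as) d e \<Longrightarrow> gsrc (arc_graph \<Omega> (set as)) d = e"
    and "leaves \<Omega> (set as) d e \<Longrightarrow> gtgt (arc_graph \<Omega> (set as)) d = e"
proof -
  assume e: "enters \<Omega> (set as) d e"
  have "e' = e" if "enters \<Omega> (set as) d e'" for e'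
    using e that entering_unique[OF F] unfolding enters_def by blast
  with e have "(THE e. enters \<Omega> (set as) d e) = e" by (intro the_equality)
  then show "gsrc (arc_graph \<Omega> (set as)) d = e" unfolding arc_graph_def by simp
next
  assume e: "leaves \<Omega> (set as) d e"
  have "e' = e" if "leaves \<Omega> (set as) d e'" for e'
    using e that leaving_unique[OF F] unfolding leaves_def by blast
  with e have "(THE e. leaves \<Omega> (set as) d e) = e" by (intro the_equality)
  then show "gtgt (arc_graph \<Omega> (set as)) d = e" unfolding arc_graph_def by simp
qed

lemma arc_graph_ends:
  assumes F: "film_on \<Omega> qs" "rotated qs (as @ bs)"
  shows "d \<in> gedges (arc_graph \<Omega> (set as)) \<and> gsrc (arc_graph \<Omega> (set as)) d = e \<longleftrightarrow> enters \<Omega> (set as) d e"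
    and "d \<in> gedges (arc_graph \<Omega> (set as)) \<and> gtgt (arc_graph \<Omega> (set as)) d = e \<longleftrightarrow> leaves \<Omega> (set as) d e"
proof -
  have g: "d \<in> gedges (arc_graph \<Omega> (set as)) \<longleftrightarrow> (\<exists>e. enters \<Omega> (set as) d e)"
    unfolding arc_graph_def by simp
  show "d \<in> gedges (arc_graph \<Omega> (set as)) \<and> gsrc (arc_graph \<Omega> (set as)) d = e \<longleftrightarrow> enters \<Omega> (set as) d e"
    using g arc_graph_sel(1)[OF F] by metis
  show "d \<in> gedges (arc_graph \<Omega> (set as)) \<and> gtgt (arc_graph \<Omega> (set as)) d = e \<longleftrightarrow> leaves \<Omega> (set as) d e"
    using g arc_graph_sel(2)[OF F] enters_iff_leaves[OF film_on_regular[OF F(1)]] by metis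
qed

text \<open>Connectedness is \<open>cut_connected\<close>, because a pair in \<open>cut_rel\<close>
  consists of the two ends of a chord; the distinct colors are those of the disks.\<close>

lemma conn_arc_graph:
  assumes F: "film_on \<Omega> qs" "rotated qs (as @ bs)" "as \<noteq> []" "bs \<noteq> []"
  shows "conn_graph (arc_graph \<Omega> (set as))"
proof -
  let ?S = "set as" let ?g = "arc_graph \<Omega> (set as)"
  note R = film_on_regular[OF F(1)]
  have sel: "gverts ?g = crossing \<Omega> ?S" "gcolor ?g = color \<Omega>" unfolding arc_graph_def by simp_all
  have sub: "gedges ?g \<subseteq> disks \<Omega>" unfolding arc_graph_gedges[OF R] by blast
  have ex: "\<exists>u1 e1 v1 u2 e2 v2. (u1, e1, v1) \<in> bdry \<Omega> d \<and> u1 \<notin> ?S \<and> v1 \<in> ?S \<and>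
      (u2, e2, v2) \<in> bdry \<Omega> d \<and> u2 \<in> ?S \<and> v2 \<notin> ?S" if "d \<in> gedges ?g" for d
  proof -
    have d: "d \<in> disks \<Omega>" "disk_verts \<Omega> d \<inter> ?S \<noteq> {}" "\<not> disk_verts \<Omega> d \<subseteq> ?S"
      using that unfolding arc_graph_gedges[OF R] by blast+
    show ?thesis using bdry_enters[OF R d] bdry_leaves[OF R d] by blast
  qed
  have ends: "gsrc ?g d \<noteq> gtgt ?g d \<and> {gsrc ?g d, gtgt ?g d} = crossing \<Omega> ?S \<inter> disk_edges \<Omega> d"
    if d: "d \<in> gedges ?g" for d
  proof -
    obtain u1 e1 v1 u2 e2 v2 where 1: "(u1, e1, v1) \<in> bdry \<Omega> d" "u1 \<notin> ?S" "v1 \<in> ?S"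
      and 2: "(u2, e2, v2) \<in> bdry \<Omega> d" "u2 \<in> ?S" "v2 \<notin> ?S" using ex[OF d] by blast
    have d': "d \<in> disks \<Omega>" using d sub by blast
    have "gsrc ?g d = e1" "gtgt ?g d = e2"
      using arc_graph_sel[OF F(1,2)] 1 2 d' unfolding enters_def leaves_def by blast+
    then show ?thesis using disk_crossing[OF F(1,2) d' 1 2] by simp
  qed
  have cc: "crossing \<Omega> ?S \<noteq> {}" "\<forall>u\<in>crossing \<Omega> ?S. \<forall>v\<in>crossing \<Omega> ?S. (u, v) \<in> (cut_rel \<Omega> ?S)\<^sup>*"
    using film_on_connected(2)[OF F] unfolding cut_connected_def connected_by_def by blast+
  have gd: "d \<in> gedges ?g" if "d \<in> disks \<Omega>" "e \<in> crossing \<Omega> ?S \<inter> disk_edges \<Omega> d" for d e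
    using crossing_disk_ends[OF R that] that(1) unfolding arc_graph_gedges[OF R] by blast
  have "cut_rel \<Omega> ?S \<subseteq> {(u, v). \<exists>d\<in>gedges ?g. (u = gsrc ?g d \<and> v = gtgt ?g d) \<or> (u = gtgt ?g d \<and> v = gsrc ?g d)}"
  proof clarify
    fix e e' assume "(e, e') \<in> cut_rel \<Omega> ?S"
    then obtain d where d: "d \<in> disks \<Omega>" "e \<noteq> e'" "{e, e'} = crossing \<Omega> ?S \<inter> disk_edges \<Omega> d"
      unfolding cut_rel_def by blast
    then have g: "d \<in> gedges ?g" using gd[of d e] by blast
    then have "{gsrc ?g d, gtgt ?g d} = {e, e'}" using ends d(3) by simp
    then show "\<exists>d\<in>gedges ?g. (e = gsrc ?g d \<and> e' = gtgt ?g d) \<or> (e = gtgt ?g d \<and> e' = gsrc ?g d)"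
      using g by (metis doubleton_eq_iff)
  qed
  from rtrancl_mono[OF this] have "connected_by (gverts ?g)
      {(u, v). \<exists>d\<in>gedges ?g. (u = gsrc ?g d \<and> v = gtgt ?g d) \<or> (u = gtgt ?g d \<and> v = gsrc ?g d)}"
    unfolding connected_by_def sel using cc by blast
  moreover have "gedges ?g \<noteq> {}"
  proof -
    obtain e where e: "e \<in> crossing \<Omega> ?S" using cc(1) by blast
    then obtain d where "d \<in> disks \<Omega>" "e \<in> disk_edges \<Omega> d"
      using film_onD(7)[OF F(1)] unfolding crossing_def by auto
    then show ?thesis using gd e by blast
  qed
  moreover have "finite (gverts ?g)" unfolding sel crossing_def using film_onD(4)[OF F(1)] by simp
  moreover have "finite (gedges ?g)" using sub film_onD(5)[OF F(1)] finite_subset by blast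
  moreover have "inj_on (gcolor ?g) (gedges ?g)"
    unfolding sel using film_onD(11)[OF F(1)] sub inj_on_subset by blast
  moreover have "\<forall>d\<in>gedges ?g. gsrc ?g d \<in> gverts ?g \<and> gtgt ?g d \<in> gverts ?g \<and> gsrc ?g d \<noteq> gtgt ?g d"
    using ends unfolding sel by blast
  ultimately show ?thesis unfolding conn_graph_def by blast
qed

lemma arc_class_in_Graphs:
  assumes "film_on \<Omega> qs" "rotated qs (as @ bs)" "as \<noteq> []" "bs \<noteq> []"
  shows "arc_class \<Omega> (set as) \<in> Graphs"
  unfolding arc_class_def using conn_arc_graph[OF assms] by (rule graph_class_in_Graphs)

lemma arc_class_star:
  assumes "film_on \<Omega> qs" "rotated qs (as @ bs)"
  shows "arc_class \<Omega> (set bs) = star (arc_class \<Omega> (set as))"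
proof -
  note R = film_on_regular[OF assms(1)]
  have "set bs \<inter> verts \<Omega> = - set as \<inter> verts \<Omega>" using film_on_complement[OF assms] by auto
  then show ?thesis using arc_class_cong[OF R] arc_class_complement[OF R] by metis
qed

lemma class_colors_arc_class:
  assumes "film_on \<Omega> qs" "rotated qs (as @ bs)" "as \<noteq> []" "bs \<noteq> []"
  shows "class_colors (arc_class \<Omega> (set as)) =
         color \<Omega> ` {d \<in> disks \<Omega>. disk_verts \<Omega> d \<inter> set as \<noteq> {} \<and> \<not> disk_verts \<Omega> d \<subseteq> set as}"
  unfolding arc_class_def class_colors_graph_class[OF conn_arc_graph[OF assms]]
    arc_graph_gedges[OF film_on_regular[OF assms(1)]]
  by (simp add: arc_graph_def)

lemma rotated_single:
  assumes "film_on \<Omega> qs" "q \<in> verts \<Omega>"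
  obtains bs where "rotated qs ([q] @ bs)" "bs \<noteq> []"
proof -
  obtain bs where bs: "rotated qs (q # bs)" using rotated_to_front assms film_onD(3) by metis
  then have "bs \<noteq> []" using rotated_length[OF bs] film_on_length[OF assms(1)] by auto
  then show thesis using that bs by simp
qed

lemma vclass_in_Graphs:
  assumes "film_on \<Omega> qs" "q \<in> verts \<Omega>" shows "vclass \<Omega> q \<in> Graphs"
proof -
  obtain bs where "rotated qs ([q] @ bs)" "bs \<noteq> []" using rotated_single[OF assms] .
  from arc_class_in_Graphs[OF assms(1) this(1) _ this(2)] show ?thesis
    unfolding vclass_arc_class[OF film_on_regular[OF assms(1)]] by simp
qed

text \<open>Contraction does not affect how disks and edges cross an arc inside \<open>as\<close>.
  Since \<open>q\<close> stands for everything outside \<open>as\<close>, the graph around it is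
  that of \<open>bs\<close>.\<close>

lemma arc_class_cut_piece:
  assumes F: "film_on \<Omega> (as @ bs)" and q: "q \<notin> set as"
  shows "S \<subseteq> set as \<Longrightarrow> arc_class (cut_piece \<Omega> (set as) q) S = arc_class \<Omega> S"
    and "arc_class (cut_piece \<Omega> (set as) q) {q} = arc_class \<Omega> (set bs)"
proof -
  let ?\<Omega> = "cut_piece \<Omega> (set as) q" let ?\<kappa> = "collapse (set as) q"
  note R = film_on_regular[OF F]
  { fix S assume S: "S \<subseteq> set as"
    have \<kappa>: "?\<kappa> v \<in> S \<longleftrightarrow> v \<in> S" for v using S q unfolding collapse_def by auto
    have "ends \<Omega> e \<inter> set as \<noteq> {} \<and> ?\<kappa> ` ends \<Omega> e \<inter> S \<noteq> {} \<and> \<not> ?\<kappa> ` ends \<Omega> e \<subseteq> S \<longleftrightarrow>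
          ends \<Omega> e \<inter> S \<noteq> {} \<and> \<not> ends \<Omega> e \<subseteq> S" for e using \<kappa> S by auto
    then have c: "crossing ?\<Omega> S = crossing \<Omega> S" unfolding crossing_def cut_piece_sel by blast
    have "enters ?\<Omega> S d e \<longleftrightarrow> enters \<Omega> S d e" for d e
    proof
      assume "enters ?\<Omega> S d e"
      then show "enters \<Omega> S d e" unfolding enters_def cut_piece_sel using \<kappa> by auto
    next
      assume "enters \<Omega> S d e"
      then obtain u v where uv: "d \<in> disks \<Omega>" "(u, e, v) \<in> bdry \<Omega> d" "u \<notin> S" "v \<in> S"
        unfolding enters_def by blast
      have "v \<in> set as" "v \<in> disk_verts \<Omega> d" using uv S disk_verts_bdry[OF R uv(1,2)] by auto
      then show "enters ?\<Omega> S d e" unfolding enters_def cut_piece_sel using uv \<kappa> by blast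
    qed
    then have en: "enters ?\<Omega> S = enters \<Omega> S" by blast
    have "leaves ?\<Omega> S d e \<longleftrightarrow> leaves \<Omega> S d e" for d e
    proof
      assume "leaves ?\<Omega> S d e"
      then show "leaves \<Omega> S d e" unfolding leaves_def cut_piece_sel using \<kappa> by auto
    next
      assume "leaves \<Omega> S d e"
      then obtain u v where uv: "d \<in> disks \<Omega>" "(u, e, v) \<in> bdry \<Omega> d" "u \<in> S" "v \<notin> S"
        unfolding leaves_def by blast
      have "u \<in> set as" "u \<in> disk_verts \<Omega> d" using uv S disk_verts_bdry[OF R uv(1,2)] by auto
      then show "leaves ?\<Omega> S d e" unfolding leaves_def cut_piece_sel using uv \<kappa> by blast
    qed
    then have le: "leaves ?\<Omega> S = leaves \<Omega> S" by blast
    show "arc_class ?\<Omega> S = arc_class \<Omega> S"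
      unfolding arc_class_def arc_graph_def c en le by simp }
  have \<kappa>: "?\<kappa> v = q \<longleftrightarrow> v \<in> - set as" for v using q unfolding collapse_def by auto
  have "ends \<Omega> e \<inter> set as \<noteq> {} \<and> ?\<kappa> ` ends \<Omega> e \<inter> {q} \<noteq> {} \<and> \<not> ?\<kappa> ` ends \<Omega> e \<subseteq> {q} \<longleftrightarrow>
        ends \<Omega> e \<inter> - set as \<noteq> {} \<and> \<not> ends \<Omega> e \<subseteq> - set as" for e
  proof -
    have "?\<kappa> ` ends \<Omega> e \<inter> {q} \<noteq> {} \<longleftrightarrow> (\<exists>x\<in>ends \<Omega> e. ?\<kappa> x = q)"
      "?\<kappa> ` ends \<Omega> e \<subseteq> {q} \<longleftrightarrow> (\<forall>x\<in>ends \<Omega> e. ?\<kappa> x = q)" by blast+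
    then show ?thesis unfolding \<kappa> by blast
  qed
  then have c: "crossing ?\<Omega> {q} = crossing \<Omega> (- set as)" unfolding crossing_def cut_piece_sel by blast
  have "enters ?\<Omega> {q} d e \<longleftrightarrow> enters \<Omega> (- set as) d e" for d e
  proof
    assume "enters ?\<Omega> {q} d e"
    then obtain u v where "d \<in> disks \<Omega>" "(u, e, v) \<in> bdry \<Omega> d" "?\<kappa> u \<noteq> q" "q = ?\<kappa> v"
      unfolding enters_def cut_piece_sel by auto
    then show "enters \<Omega> (- set as) d e" unfolding enters_def \<kappa>[symmetric] by metis
  next
    assume "enters \<Omega> (- set as) d e"
    then obtain u v where uv: "d \<in> disks \<Omega>" "(u, e, v) \<in> bdry \<Omega> d" "u \<in> set as" "v \<in> - set as"
      unfolding enters_def by blast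
    have "u \<in> disk_verts \<Omega> d" using uv disk_verts_bdry[OF R uv(1,2)] by auto
    then show "enters ?\<Omega> {q} d e" unfolding enters_def cut_piece_sel using uv \<kappa> by blast
  qed
  then have en: "enters ?\<Omega> {q} = enters \<Omega> (- set as)" by blast
  have "leaves ?\<Omega> {q} d e \<longleftrightarrow> leaves \<Omega> (- set as) d e" for d e
  proof
    assume "leaves ?\<Omega> {q} d e"
    then obtain u v where "d \<in> disks \<Omega>" "(u, e, v) \<in> bdry \<Omega> d" "q = ?\<kappa> u" "?\<kappa> v \<noteq> q"
      unfolding leaves_def cut_piece_sel by auto
    then show "leaves \<Omega> (- set as) d e" unfolding leaves_def \<kappa>[symmetric] by metis
  next
    assume "leaves \<Omega> (- set as) d e"
    then obtain u v where uv: "d \<in> disks \<Omega>" "(u, e, v) \<in> bdry \<Omega> d" "u \<in> - set as" "v \<in> set as"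
      unfolding leaves_def by blast
    have "v \<in> disk_verts \<Omega> d" using uv disk_verts_bdry[OF R uv(1,2)] by auto
    then show "leaves ?\<Omega> {q} d e" unfolding leaves_def cut_piece_sel using uv \<kappa> by blast
  qed
  then have le: "leaves ?\<Omega> {q} = leaves \<Omega> (- set as)" by blast
  have "set bs \<inter> verts \<Omega> = - set as \<inter> verts \<Omega>" using film_on_complement[OF F rotated_refl] by auto
  then show "arc_class ?\<Omega> {q} = arc_class \<Omega> (set bs)"
    using arc_class_cong[OF R, of "set bs" "- set as"]
    unfolding arc_class_def arc_graph_def c en le by simp
qed

section \<open>Film surfaces obtained by contracting arcs\<close>

lemma Film_nonempty_iff:
  "Film \<sigma>s \<noteq> {} \<longleftrightarrow> (\<exists>\<Omega> qs. film_on \<Omega> qs \<and> map (vclass \<Omega>) qs = \<sigma>s)"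
proof -
  have "Film \<sigma>s \<noteq> {} \<longleftrightarrow> (\<exists>\<Omega> qs. film_surface \<Omega> \<and> connected_complex \<Omega> \<and> numbering \<Omega> qs \<and>
                        map (vclass \<Omega>) qs = \<sigma>s)"
    unfolding Film_def by (auto simp: quotient_def)
  then show ?thesis
    using film_on_if_numbering film_on_imp_film_surface film_on_numbering by metis
qed

text \<open>The arcs are contracted one after the other: the first arc in \<open>rs\<close> becomes
  a fresh vertex that joins \<open>ps\<close>, and the classes of the remaining arcs do not change.
  The bound ensures that something is left outside the arc being contracted.\<close>

theorem Film_arcs:
  assumes "film_on \<Omega> (ps @ concat rs)" "\<forall>r\<in>set rs. r \<noteq> []" "2 \<le> length ps + length rs"
  shows "Film (map (\<lambda>p. arc_class \<Omega> {p}) ps @ map (arc_class \<Omega> \<circ> set) rs) \<noteq> {}"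
  using assms
proof (induction rs arbitrary: \<Omega> ps)
  case Nil
  then have "film_on \<Omega> ps" by simp
  moreover have "map (vclass \<Omega>) ps = map (\<lambda>p. arc_class \<Omega> {p}) ps"
    using vclass_arc_class[OF film_on_regular[OF \<open>film_on \<Omega> ps\<close>]] by simp
  ultimately have "\<exists>\<Omega>' qs. film_on \<Omega>' qs \<and> map (vclass \<Omega>') qs = map (\<lambda>p. arc_class \<Omega> {p}) ps"
    by blast
  then show ?case using Film_nonempty_iff[of "map (\<lambda>p. arc_class \<Omega> {p}) ps"] by simp
next
  case (Cons r rs)
  let ?as = "concat rs @ ps"
  have ne: "?as \<noteq> []" "r \<noteq> []" using Cons.prems(2,3) by (cases rs; auto)+
  have "rotated (ps @ concat (r # rs)) (?as @ r)"
    unfolding rotated_def by (intro exI[of _ "ps @ r"] exI[of _ "concat rs"]) simp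
  then have F: "film_on \<Omega> (?as @ r)" using film_on_rotated Cons.prems(1) by blast
  obtain q where q: "q \<notin> set ?as" using ex_new_if_finite[OF infinite_UNIV_nat] by blast
  let ?\<Omega> = "cut_piece \<Omega> (set ?as) q"
  have "film_on ?\<Omega> (?as @ [q])" using film_on_cut_piece[OF F ne q] .
  moreover have "rotated (?as @ [q]) ((ps @ [q]) @ concat rs)"
    unfolding rotated_def by (intro exI[of _ "concat rs"] exI[of _ "ps @ [q]"]) simp
  ultimately have F': "film_on ?\<Omega> ((ps @ [q]) @ concat rs)" using film_on_rotated by blast
  have IH: "Film (map (\<lambda>p. arc_class ?\<Omega> {p}) (ps @ [q]) @ map (arc_class ?\<Omega> \<circ> set) rs) \<noteq> {}"
    by (rule Cons.IH[OF F']) (use Cons.prems in auto)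
  have "arc_class ?\<Omega> {p} = arc_class \<Omega> {p}" if "p \<in> set ps" for p
    by (rule arc_class_cut_piece(1)[OF F q]) (use that in simp)
  moreover have "arc_class ?\<Omega> (set r') = arc_class \<Omega> (set r')" if "r' \<in> set rs" for r'
    by (rule arc_class_cut_piece(1)[OF F q]) (use that in auto)
  ultimately show ?case using IH arc_class_cut_piece(2)[OF F q]
    by (simp add: comp_def cong: map_cong)
qed

text \<open>Stated without a numbering, so that it also covers surfaces with several components. A
  boundary passes each vertex at most once, which makes the \<open>THE\<close> terms unique.\<close>

lemma flags_vertex_graph:
  assumes R: "regular_complex \<Omega>"
  shows "flags (arc_graph \<Omega> {q}) e =
    {(color \<Omega> d, True) | d. enters \<Omega> {q} d e} \<union> {(color \<Omega> d, False) | d. leaves \<Omega> {q} d e}"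
proof -
  have en: "gsrc (arc_graph \<Omega> {q}) d = e" if "enters \<Omega> {q} d e" for d e
  proof -
    have "e' = e" if "enters \<Omega> {q} d e'" for e'
      using \<open>enters \<Omega> {q} d e\<close> that bdry_in_unique(1)[OF R] unfolding enters_def by blast
    then have "(THE e. enters \<Omega> {q} d e) = e" using \<open>enters \<Omega> {q} d e\<close> by (intro the_equality)
    then show ?thesis unfolding arc_graph_def by simp
  qed
  have le: "gtgt (arc_graph \<Omega> {q}) d = e" if "leaves \<Omega> {q} d e" for d e
  proof -
    have "e' = e" if "leaves \<Omega> {q} d e'" for e'
      using \<open>leaves \<Omega> {q} d e\<close> that bdry_out_unique(1)[OF R] unfolding leaves_def by blast
    then have "(THE e. leaves \<Omega> {q} d e) = e" using \<open>leaves \<Omega> {q} d e\<close> by (intro the_equality)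
    then show ?thesis unfolding arc_graph_def by simp
  qed
  have g: "d \<in> gedges (arc_graph \<Omega> {q}) \<longleftrightarrow> (\<exists>e. enters \<Omega> {q} d e)" for d unfolding arc_graph_def by simp
  have 1: "d \<in> gedges (arc_graph \<Omega> {q}) \<and> gsrc (arc_graph \<Omega> {q}) d = e \<longleftrightarrow> enters \<Omega> {q} d e" for d
    using g[of d] en[of d] by blast
  have 2: "d \<in> gedges (arc_graph \<Omega> {q}) \<and> gtgt (arc_graph \<Omega> {q}) d = e \<longleftrightarrow> leaves \<Omega> {q} d e" for d
    using g[of d] le[of d] enters_iff_leaves[OF R, of "{q}" d] by blast
  have "gcolor (arc_graph \<Omega> {q}) = color \<Omega>" unfolding arc_graph_def by simp
  then have "flags (arc_graph \<Omega> {q}) e =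
      {(color \<Omega> d, True) | d. d \<in> gedges (arc_graph \<Omega> {q}) \<and> gsrc (arc_graph \<Omega> {q}) d = e} \<union>
      {(color \<Omega> d, False) | d. d \<in> gedges (arc_graph \<Omega> {q}) \<and> gtgt (arc_graph \<Omega> {q}) d = e}"
    unfolding flags_def by simp
  then show ?thesis unfolding 1 2 .
qed

text \<open>Blocks are compared instead of building a graph isomorphism: the edges \<open>e\<close>
  and \<open>fe e\<close> carry the same flags, since color and direction of every incident disk are
  kept.\<close>

lemma vclass_film_iso:
  assumes R: "regular_complex \<Omega>" and R': "regular_complex \<Omega>'"
    and g: "conn_graph (arc_graph \<Omega> {q})" "conn_graph (arc_graph \<Omega>' {fv q})"
    and iso: "film_iso fv fe fd \<Omega> \<Omega>'" and q: "q \<in> verts \<Omega>"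
  shows "vclass \<Omega>' (fv q) = vclass \<Omega> q"
proof -
  have iv: "inj_on fv (verts \<Omega>)" and V: "verts \<Omega>' = fv ` verts \<Omega>" and E: "edges \<Omega>' = fe ` edges \<Omega>"
    and D: "disks \<Omega>' = fd ` disks \<Omega>" and ie: "inj_on fe (edges \<Omega>)"
    and ends: "\<And>e. e \<in> edges \<Omega> \<Longrightarrow> ends \<Omega>' (fe e) = fv ` ends \<Omega> e"
    and bd: "\<And>d. d \<in> disks \<Omega> \<Longrightarrow> bdry \<Omega>' (fd d) = (\<lambda>(u, e, v). (fv u, fe e, fv v)) ` bdry \<Omega> d"
    and col: "\<And>d. d \<in> disks \<Omega> \<Longrightarrow> color \<Omega>' (fd d) = color \<Omega> d"
    using iso unfolding film_iso_def bij_betw_def by auto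
  have V': "fv v = fv q \<longleftrightarrow> v = q" if "v \<in> verts \<Omega>" for v using iv that q by (meson inj_onD)
  note fl = flags_vertex_graph[OF R, of q] flags_vertex_graph[OF R', of "fv q"]
  have mem: "v \<in> ends \<Omega> e \<Longrightarrow> v \<in> verts \<Omega>" if "e \<in> edges \<Omega>" for v e
    using regular_complexD(4)[OF R] that by blast
  have cr: "crossing \<Omega>' {fv q} = fe ` crossing \<Omega> {q}"
  proof -
    have "fe e \<in> crossing \<Omega>' {fv q} \<longleftrightarrow> e \<in> crossing \<Omega> {q}" if e: "e \<in> edges \<Omega>" for e
    proof -
      have "fv ` ends \<Omega> e \<inter> {fv q} \<noteq> {} \<longleftrightarrow> ends \<Omega> e \<inter> {q} \<noteq> {}"
        "fv ` ends \<Omega> e \<subseteq> {fv q} \<longleftrightarrow> ends \<Omega> e \<subseteq> {q}"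
      proof -
        have "fv ` ends \<Omega> e \<inter> {fv q} \<noteq> {} \<longleftrightarrow> (\<exists>x\<in>ends \<Omega> e. fv x = fv q)"
          "fv ` ends \<Omega> e \<subseteq> {fv q} \<longleftrightarrow> (\<forall>x\<in>ends \<Omega> e. fv x = fv q)" by blast+
        then show "fv ` ends \<Omega> e \<inter> {fv q} \<noteq> {} \<longleftrightarrow> ends \<Omega> e \<inter> {q} \<noteq> {}"
          "fv ` ends \<Omega> e \<subseteq> {fv q} \<longleftrightarrow> ends \<Omega> e \<subseteq> {q}" using V' mem[OF e] by blast+
      qed
      moreover have "fe e \<in> edges \<Omega>'" using e E by blast
      ultimately show ?thesis unfolding crossing_def using ends[OF e] e by simp
    qed
    moreover have "crossing \<Omega>' {fv q} \<subseteq> fe ` edges \<Omega>" "crossing \<Omega> {q} \<subseteq> edges \<Omega>"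
      unfolding crossing_def E by blast+
    ultimately show ?thesis by blast
  qed
  have bd': "(u', fe e, v') \<in> bdry \<Omega>' (fd d) \<longleftrightarrow> (\<exists>u v. u' = fv u \<and> v' = fv v \<and> (u, e, v) \<in> bdry \<Omega> d)"
    if de: "d \<in> disks \<Omega>" "e \<in> edges \<Omega>" for d e u' v'
  proof
    assume "(u', fe e, v') \<in> bdry \<Omega>' (fd d)"
    then obtain u e1 v where 1: "(u, e1, v) \<in> bdry \<Omega> d" "u' = fv u" "fe e = fe e1" "v' = fv v"
      unfolding bd[OF de(1)] by auto
    then have "e1 = e" using bdry_ends(1)[OF R de(1) 1(1)] ie de(2) by (metis inj_onD)
    then show "\<exists>u v. u' = fv u \<and> v' = fv v \<and> (u, e, v) \<in> bdry \<Omega> d" using 1 by blast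
  qed (force simp: bd[OF de(1)])
  have en: "enters \<Omega>' {fv q} (fd d) (fe e) \<longleftrightarrow> enters \<Omega> {q} d e"
    "leaves \<Omega>' {fv q} (fd d) (fe e) \<longleftrightarrow> leaves \<Omega> {q} d e"
    if d: "d \<in> disks \<Omega>" and e: "e \<in> edges \<Omega>" for d e
  proof -
    have V2: "(fv u = fv q \<longleftrightarrow> u = q) \<and> (fv v = fv q \<longleftrightarrow> v = q)" if "(u, e, v) \<in> bdry \<Omega> d" for u v
      using V' bdry_ends(4,5)[OF R d that] by blast
    have "fd d \<in> disks \<Omega>'" using d D by blast
    then have "enters \<Omega>' {fv q} (fd d) (fe e) \<longleftrightarrow> (\<exists>u v. (u, e, v) \<in> bdry \<Omega> d \<and> fv u \<noteq> fv q \<and> fv v = fv q)"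
      "leaves \<Omega>' {fv q} (fd d) (fe e) \<longleftrightarrow> (\<exists>u v. (u, e, v) \<in> bdry \<Omega> d \<and> fv u = fv q \<and> fv v \<noteq> fv q)"
      unfolding enters_def leaves_def bd'[OF d e] by (simp; metis)+
    moreover have "(u, e, v) \<in> bdry \<Omega> d \<and> fv u \<noteq> fv q \<and> fv v = fv q \<longleftrightarrow> (u, e, v) \<in> bdry \<Omega> d \<and> u \<notin> {q} \<and> v \<in> {q}"
      "(u, e, v) \<in> bdry \<Omega> d \<and> fv u = fv q \<and> fv v \<noteq> fv q \<longleftrightarrow> (u, e, v) \<in> bdry \<Omega> d \<and> u \<in> {q} \<and> v \<notin> {q}" for u v
      using V2[of u v] by auto
    ultimately show "enters \<Omega>' {fv q} (fd d) (fe e) \<longleftrightarrow> enters \<Omega> {q} d e"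
      "leaves \<Omega>' {fv q} (fd d) (fe e) \<longleftrightarrow> leaves \<Omega> {q} d e"
      unfolding enters_def[of \<Omega>] leaves_def[of \<Omega>] using d by simp_all
  qed
  have "flags (arc_graph \<Omega>' {fv q}) (fe e) = flags (arc_graph \<Omega> {q}) e" if e: "e \<in> edges \<Omega>" for e
  proof -
    have tr: "{(color \<Omega>' d', t) | d'. P d'} = {(color \<Omega> d, t) | d. Q d}"
      if PQ: "\<And>d'. P d' \<Longrightarrow> d' \<in> disks \<Omega>'" "\<And>d. Q d \<Longrightarrow> d \<in> disks \<Omega>"
        "\<And>d. d \<in> disks \<Omega> \<Longrightarrow> P (fd d) \<longleftrightarrow> Q d" for P Q and t :: bool
    proof (intro subset_antisym subsetI)
      fix k assume "k \<in> {(color \<Omega>' d', t) | d'. P d'}"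
      then obtain d' where d': "k = (color \<Omega>' d', t)" "P d'" by blast
      then obtain d where "d \<in> disks \<Omega>" "d' = fd d" using PQ(1) D by blast
      then show "k \<in> {(color \<Omega> d, t) | d. Q d}" using d' PQ(3) col by auto
    next
      fix k assume "k \<in> {(color \<Omega> d, t) | d. Q d}"
      then obtain d where d: "k = (color \<Omega> d, t)" "Q d" by blast
      then have "k = (color \<Omega>' (fd d), t)" "P (fd d)" using PQ(2,3) col by auto
      then show "k \<in> {(color \<Omega>' d', t) | d'. P d'}" by blast
    qed
    have "{(color \<Omega>' d', True) | d'. enters \<Omega>' {fv q} d' (fe e)} = {(color \<Omega> d, True) | d. enters \<Omega> {q} d e}"
      by (rule tr) (use en[OF _ e] in \<open>auto simp: enters_def[of \<Omega>' "{fv q}" _ "fe e"] enters_def[of \<Omega> "{q}" _ e]\<close>)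
    moreover have "{(color \<Omega>' d', False) | d'. leaves \<Omega>' {fv q} d' (fe e)} = {(color \<Omega> d, False) | d. leaves \<Omega> {q} d e}"
      by (rule tr) (use en[OF _ e] in \<open>auto simp: leaves_def[of \<Omega>' "{fv q}" _ "fe e"] leaves_def[of \<Omega> "{q}" _ e]\<close>)
    ultimately
    show ?thesis unfolding fl by simp
  qed
  then have "flags (arc_graph \<Omega>' {fv q}) (fe e) = flags (arc_graph \<Omega> {q}) e" if "e \<in> crossing \<Omega> {q}" for e
    using that unfolding crossing_def by blast
  then have "blocks (arc_graph \<Omega>' {fv q}) = blocks (arc_graph \<Omega> {q})"
    unfolding blocks_def arc_graph_gverts cr image_image by (rule image_cong[OF refl])
  then show ?thesis unfolding vclass_arc_class[OF R] vclass_arc_class[OF R'] arc_class_def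
    using graph_class_eq_iff_blocks[OF g] by simp
qed

section \<open>Uniqueness of the third vertex graph\<close>

definition swap_flag :: "'c \<times> bool \<Rightarrow> 'c \<times> bool" where
  "swap_flag p = (fst p, \<not> snd p)"

lemma swap_flag_simps [simp]:
  "swap_flag (k, s) = (k, \<not> s)" "swap_flag (swap_flag p) = p" "fst (swap_flag p) = fst p"
  unfolding swap_flag_def by simp_all

lemma swap_flag_image [simp]: "swap_flag ` swap_flag ` \<beta> = \<beta>"
  by (simp add: image_image)

lemma mem_swap_flag: "(k, s) \<in> swap_flag ` \<beta> \<longleftrightarrow> (k, \<not> s) \<in> \<beta>"
  by (force simp: image_iff swap_flag_def)

text \<open>The block of the edge \<open>e\<close> in the vertex graph at its end \<open>p\<close>,
  where \<open>x\<close> is the other end; \<open>True\<close> marks disks whose boundary arrives at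
  \<open>p\<close> along \<open>e\<close>.\<close>

definition edge_flags :: "'c complex2 \<Rightarrow> nat \<Rightarrow> nat \<Rightarrow> nat \<Rightarrow> ('c \<times> bool) set" where
  "edge_flags \<Omega> p x e = {(color \<Omega> d, True) | d. d \<in> disks \<Omega> \<and> (x, e, p) \<in> bdry \<Omega> d} \<union>
                        {(color \<Omega> d, False) | d. d \<in> disks \<Omega> \<and> (p, e, x) \<in> bdry \<Omega> d}"

lemma edge_flags_swap: "edge_flags \<Omega> x p e = swap_flag ` edge_flags \<Omega> p x e"
proof -
  have "(k, s) \<in> edge_flags \<Omega> x p e \<longleftrightarrow> (k, s) \<in> swap_flag ` edge_flags \<Omega> p x e" for k s
    unfolding mem_swap_flag edge_flags_def by (cases s) auto
  then show ?thesis by (metis prod.collapse set_eqI)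
qed

lemma enters_vertex:
  assumes R: "regular_complex \<Omega>" and e: "ends \<Omega> e = {p, x}" "p \<noteq> x"
  shows "enters \<Omega> {p} d e \<longleftrightarrow> d \<in> disks \<Omega> \<and> (x, e, p) \<in> bdry \<Omega> d"
    and "leaves \<Omega> {p} d e \<longleftrightarrow> d \<in> disks \<Omega> \<and> (p, e, x) \<in> bdry \<Omega> d"
proof -
  have "(u = x \<longleftrightarrow> v = p) \<and> (u = p \<longleftrightarrow> v = x)" if "d \<in> disks \<Omega>" "(u, e, v) \<in> bdry \<Omega> d" for u v
    using bdry_ends(2,3)[OF R that] e by (metis doubleton_eq_iff)
  then show "enters \<Omega> {p} d e \<longleftrightarrow> d \<in> disks \<Omega> \<and> (x, e, p) \<in> bdry \<Omega> d"
    "leaves \<Omega> {p} d e \<longleftrightarrow> d \<in> disks \<Omega> \<and> (p, e, x) \<in> bdry \<Omega> d"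
    unfolding enters_def leaves_def using e(2) by (metis singleton_iff)+
qed

lemma flags_vertex:
  assumes F: "film_on \<Omega> qs" and p: "p \<in> verts \<Omega>" and e: "ends \<Omega> e = {p, x}" "p \<noteq> x"
  shows "flags (arc_graph \<Omega> {p}) e = edge_flags \<Omega> p x e"
  using flags_vertex_graph[OF film_on_regular[OF F], of p e]
  unfolding edge_flags_def enters_vertex[OF film_on_regular[OF F] e, symmetric] by simp

lemma conn_vertex_graph:
  assumes F: "film_on \<Omega> qs" and p: "p \<in> verts \<Omega>"
  shows "conn_graph (arc_graph \<Omega> {p})"
proof -
  obtain bs where r: "rotated qs ([p] @ bs)" "bs \<noteq> []" using rotated_single[OF F p] .
  show ?thesis using conn_arc_graph[OF F r(1) _ r(2)] by simp
qed

lemma class_blocks_vclass: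
  assumes F: "film_on \<Omega> qs" and p: "p \<in> verts \<Omega>"
  shows "class_blocks (vclass \<Omega> p) = flags (arc_graph \<Omega> {p}) ` crossing \<Omega> {p}"
  unfolding vclass_arc_class[OF film_on_regular[OF F]] arc_class_def
    class_blocks_graph_class[OF conn_vertex_graph[OF F p]] blocks_def arc_graph_gverts ..

text \<open>The flags of an edge at its two ends differ by \<open>swap_flag\<close>. So for the vertex graphs at two vertices the
  unmatched blocks come from edges that do not join these vertices.\<close>

definition unmatched :: "'c ograph set \<Rightarrow> 'c ograph set \<Rightarrow> ('c \<times> bool) set set" where
  "unmatched \<sigma> \<tau> = {\<beta> \<in> class_blocks \<sigma>. swap_flag ` \<beta> \<notin> class_blocks \<tau>}"

text \<open>Generically the unmatched blocks at \<open>a\<close> and \<open>b\<close> belong to the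
  edges towards \<open>c\<close>, whose flags at \<open>c\<close> are the swapped ones. The second
  alternative arises when an edge from \<open>a\<close> to \<open>c\<close> and one from
  \<open>b\<close> to \<open>c\<close> carry opposite flags: then \<open>c\<close> merely subdivides
  an edge that all its disks traverse from \<open>b\<close> to \<open>a\<close>.\<close>

lemma third_blocks:
  assumes F: "film_on \<Omega> [a, b, c]"
  shows "class_blocks (vclass \<Omega> c) =
           image swap_flag ` (unmatched (vclass \<Omega> a) (vclass \<Omega> b) \<union> unmatched (vclass \<Omega> b) (vclass \<Omega> a)) \<or>
         (\<exists>\<beta>\<in>class_blocks (vclass \<Omega> a). (\<forall>p\<in>\<beta>. snd p) \<and>
            class_blocks (vclass \<Omega> c) = {\<beta>, swap_flag ` \<beta>} \<and>
            unmatched (vclass \<Omega> a) (vclass \<Omega> b) = {} \<and> unmatched (vclass \<Omega> b) (vclass \<Omega> a) = {})"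
    (is "?N \<or> ?A")
proof -
  note R = film_on_regular[OF F]
  have V: "verts \<Omega> = {a, b, c}" and abc: "a \<noteq> b" "b \<noteq> c" "a \<noteq> c"
    using film_onD(2,3)[OF F] by auto
  have inV: "a \<in> verts \<Omega>" "b \<in> verts \<Omega>" "c \<in> verts \<Omega>" using V by auto
  let ?g = "\<lambda>p. arc_graph \<Omega> {p}" let ?bl = "\<lambda>p. class_blocks (vclass \<Omega> p)"
  note C = conn_vertex_graph[OF F]
  have ends: "\<exists>x y. ends \<Omega> e = {x, y} \<and> x \<noteq> y \<and> x \<in> verts \<Omega> \<and> y \<in> verts \<Omega>" if "e \<in> edges \<Omega>" for e
  proof -
    have "card (ends \<Omega> e) = 2" "ends \<Omega> e \<subseteq> verts \<Omega>" using regular_complexD(4)[OF R] that by auto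
    then show ?thesis by (metis card_2_iff insert_subset)
  qed
  define E where "E x y = {e \<in> edges \<Omega>. ends \<Omega> e = {x, y}}" for x y
  have Ecomm: "E x y = E y x" for x y unfolding E_def by (simp add: insert_commute)
  have cr: "crossing \<Omega> {a} = E a b \<union> E a c" "crossing \<Omega> {b} = E a b \<union> E b c" "crossing \<Omega> {c} = E a c \<union> E b c"
  proof -
    have E3: "ends \<Omega> e = {a, b} \<or> ends \<Omega> e = {a, c} \<or> ends \<Omega> e = {b, c}" if "e \<in> edges \<Omega>" for e
      using ends[OF that] V by (auto simp: insert_commute)
    have "e \<in> crossing \<Omega> {a} \<longleftrightarrow> e \<in> E a b \<union> E a c" "e \<in> crossing \<Omega> {b} \<longleftrightarrow> e \<in> E a b \<union> E b c"
      "e \<in> crossing \<Omega> {c} \<longleftrightarrow> e \<in> E a c \<union> E b c" if e: "e \<in> edges \<Omega>" for e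
      using E3[OF e] abc e unfolding crossing_def E_def
      by (elim disjE; simp add: doubleton_eq_iff)+
    moreover have "crossing \<Omega> S \<subseteq> edges \<Omega>" "E x y \<subseteq> edges \<Omega>" for S x y
      unfolding crossing_def E_def by blast+
    ultimately show "crossing \<Omega> {a} = E a b \<union> E a c" "crossing \<Omega> {b} = E a b \<union> E b c"
      "crossing \<Omega> {c} = E a c \<union> E b c" by blast+
  qed
  have fl: "flags (?g a) e = edge_flags \<Omega> a b e" "flags (?g b) e = edge_flags \<Omega> b a e" if "e \<in> E a b" for e
    using flags_vertex[OF F inV(1), of e b] flags_vertex[OF F inV(2), of e a] that abc
    unfolding E_def by (auto simp: insert_commute)
  have fl2: "flags (?g a) e = edge_flags \<Omega> a c e" "flags (?g c) e = edge_flags \<Omega> c a e" if "e \<in> E a c" for e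
    using flags_vertex[OF F inV(1), of e c] flags_vertex[OF F inV(3), of e a] that abc
    unfolding E_def by (auto simp: insert_commute)
  have fl3: "flags (?g b) e = edge_flags \<Omega> b c e" "flags (?g c) e = edge_flags \<Omega> c b e" if "e \<in> E b c" for e
    using flags_vertex[OF F inV(2), of e c] flags_vertex[OF F inV(3), of e b] that abc
    unfolding E_def by (auto simp: insert_commute)
  have bl: "?bl a = edge_flags \<Omega> a b ` E a b \<union> edge_flags \<Omega> a c ` E a c"
    "?bl b = edge_flags \<Omega> b a ` E a b \<union> edge_flags \<Omega> b c ` E b c"
    "?bl c = edge_flags \<Omega> c a ` E a c \<union> edge_flags \<Omega> c b ` E b c"
    unfolding class_blocks_vclass[OF F inV(1)] class_blocks_vclass[OF F inV(2)]
      class_blocks_vclass[OF F inV(3)] cr image_Un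
    using fl fl2 fl3 by (auto intro!: arg_cong2[of _ _ _ _ "(\<union>)"] image_cong)
  have inj: "e = e'" if "flags (?g p) e = flags (?g p) e'" "p \<in> verts \<Omega>"
    "e \<in> crossing \<Omega> {p}" "e' \<in> crossing \<Omega> {p}" for e e' p
    using inj_on_flags[OF C[OF that(2)]] that unfolding arc_graph_gverts by (metis inj_onD)
  note sw = edge_flags_swap
  have match_ab: "swap_flag ` edge_flags \<Omega> a b e \<in> ?bl b" "swap_flag ` edge_flags \<Omega> b a e \<in> ?bl a"
    if "e \<in> E a b" for e using that unfolding bl sw[of \<Omega> b a, symmetric] sw[of \<Omega> a b, symmetric] by blast+
  show ?thesis
  proof (cases "\<exists>e\<in>E a c. \<exists>e'\<in>E b c. edge_flags \<Omega> b c e' = swap_flag ` edge_flags \<Omega> a c e")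
    case False
    have ab_disj: "e \<notin> E a b" if "e \<in> E a c \<or> e \<in> E b c" for e
      using that abc unfolding E_def by (auto simp: doubleton_eq_iff)
    \<comment> \<open>A match with an edge \<open>e'\<close> between \<open>a\<close> and
      \<open>b\<close> would give \<open>e\<close> and \<open>e'\<close> the same flags at
      \<open>a\<close>.\<close>
    have 1: "swap_flag ` edge_flags \<Omega> a c e \<notin> ?bl b" if e: "e \<in> E a c" for e
    proof
      assume "swap_flag ` edge_flags \<Omega> a c e \<in> ?bl b"
      then obtain e' where e': "e' \<in> E a b" "edge_flags \<Omega> b a e' = swap_flag ` edge_flags \<Omega> a c e"
        using False e unfolding bl(2) Un_iff image_iff by metis
      then have "edge_flags \<Omega> a b e' = edge_flags \<Omega> a c e"
        unfolding sw[of \<Omega> b a] by (metis swap_flag_image)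
      then have "e' = e" using inj[of a e' e] fl(1)[OF e'(1)] fl2(1)[OF e] inV(1) e e' unfolding cr by auto
      then show False using ab_disj e e'(1) by blast
    qed
    have 2: "swap_flag ` edge_flags \<Omega> b c e \<notin> ?bl a" if e: "e \<in> E b c" for e
    proof
      assume "swap_flag ` edge_flags \<Omega> b c e \<in> ?bl a"
      then consider e' where "e' \<in> E a b" "edge_flags \<Omega> a b e' = swap_flag ` edge_flags \<Omega> b c e"
        | e' where "e' \<in> E a c" "edge_flags \<Omega> a c e' = swap_flag ` edge_flags \<Omega> b c e"
        unfolding bl(1) by (metis UnE imageE)
      then show False
      proof cases
        case 1
        then have "edge_flags \<Omega> b a e' = edge_flags \<Omega> b c e"
          unfolding sw[of \<Omega> a b] by (metis swap_flag_image)
        then have "e' = e" using inj[of b e' e] fl(2)[OF 1(1)] fl3(1)[OF e] inV(2) e 1(1) unfolding cr by auto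
        then show False using ab_disj e 1(1) by blast
      next
        case 2
        then show False using False e by (metis swap_flag_image)
      qed
    qed
    have u1: "unmatched (vclass \<Omega> a) (vclass \<Omega> b) = edge_flags \<Omega> a c ` E a c"
      unfolding unmatched_def using 1 match_ab(1) by (auto simp: bl(1))
    have u2: "unmatched (vclass \<Omega> b) (vclass \<Omega> a) = edge_flags \<Omega> b c ` E b c"
      unfolding unmatched_def using 2 match_ab(2) by (auto simp: bl(2))
    have ?N unfolding u1 u2 bl(3) image_Un image_image sw[of \<Omega> a c] sw[of \<Omega> b c] by simp
    then show ?thesis ..
  next
    case True
    then obtain e e' where e: "e \<in> E a c" and e': "e' \<in> E b c"
      and eq: "edge_flags \<Omega> b c e' = swap_flag ` edge_flags \<Omega> a c e" by blast
    let ?\<beta> = "edge_flags \<Omega> a c e"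
    have col: "d = d'" if "color \<Omega> d = color \<Omega> d'" "d \<in> disks \<Omega>" "d' \<in> disks \<Omega>" for d d'
      using film_onD(11)[OF F] that by (meson inj_onD)
    have \<beta>: "(color \<Omega> d, True) \<in> ?\<beta> \<longleftrightarrow> (c, e, a) \<in> bdry \<Omega> d" "(color \<Omega> d, False) \<in> ?\<beta> \<longleftrightarrow> (a, e, c) \<in> bdry \<Omega> d"
      if "d \<in> disks \<Omega>" for d using that col unfolding edge_flags_def by auto
    have \<beta>': "(color \<Omega> d, False) \<in> ?\<beta> \<longleftrightarrow> (c, e', b) \<in> bdry \<Omega> d" "(color \<Omega> d, True) \<in> ?\<beta> \<longleftrightarrow> (b, e', c) \<in> bdry \<Omega> d"
      if "d \<in> disks \<Omega>" for d
    proof -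
      have "(color \<Omega> d, False) \<in> ?\<beta> \<longleftrightarrow> (color \<Omega> d, True) \<in> edge_flags \<Omega> b c e'"
        "(color \<Omega> d, True) \<in> ?\<beta> \<longleftrightarrow> (color \<Omega> d, False) \<in> edge_flags \<Omega> b c e'"
        unfolding eq mem_swap_flag by simp_all
      then show "(color \<Omega> d, False) \<in> ?\<beta> \<longleftrightarrow> (c, e', b) \<in> bdry \<Omega> d" "(color \<Omega> d, True) \<in> ?\<beta> \<longleftrightarrow> (b, e', c) \<in> bdry \<Omega> d"
        using that col unfolding edge_flags_def by auto
    qed
    \<comment> \<open>A disk with such a flag would run from \<open>a\<close> to \<open>c\<close>
      and on to \<open>b\<close>, against the cyclic order \<open>a, b, c\<close>.\<close>
    have pure: "(k, False) \<notin> ?\<beta>" for k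
    proof
      assume k: "(k, False) \<in> ?\<beta>"
      then obtain d where d: "d \<in> disks \<Omega>" "k = color \<Omega> d" unfolding edge_flags_def by blast
      then have ac: "(a, e, c) \<in> bdry \<Omega> d" "(c, e', b) \<in> bdry \<Omega> d" using k \<beta> \<beta>' by blast+
      obtain es where t: "traverses \<Omega> d (filter (\<lambda>v. v \<in> disk_verts \<Omega> d) [a, b, c]) es"
        using film_onD(9)[OF F d(1)] by blast
      have "a \<in> disk_verts \<Omega> d" "b \<in> disk_verts \<Omega> d" "c \<in> disk_verts \<Omega> d"
        using disk_verts_bdry[OF R d(1) ac(1)] disk_verts_bdry[OF R d(1) ac(2)] by auto
      then have "traverses \<Omega> d [a, b, c] es" using t by simp
      then have "(a, es ! 0, b) \<in> bdry \<Omega> d" using traverses_bdry[of \<Omega> d "[a, b, c]" es] by force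
      then show False using bdry_out_unique(2)[OF R d(1) ac(1)] abc by blast
    qed
    have disk: "d \<in> disks \<Omega> \<Longrightarrow> (c, e, a) \<in> bdry \<Omega> d \<longleftrightarrow> (b, e', c) \<in> bdry \<Omega> d"
      "d \<in> disks \<Omega> \<Longrightarrow> (a, e, c) \<notin> bdry \<Omega> d" "d \<in> disks \<Omega> \<Longrightarrow> (c, e', b) \<notin> bdry \<Omega> d" for d
      using \<beta> \<beta>' pure by blast+
    have en: "enters \<Omega> {c} d e \<longleftrightarrow> d \<in> disks \<Omega> \<and> (a, e, c) \<in> bdry \<Omega> d"
      "leaves \<Omega> {c} d e \<longleftrightarrow> d \<in> disks \<Omega> \<and> (c, e, a) \<in> bdry \<Omega> d"
      "enters \<Omega> {c} d e' \<longleftrightarrow> d \<in> disks \<Omega> \<and> (b, e', c) \<in> bdry \<Omega> d"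
      "leaves \<Omega> {c} d e' \<longleftrightarrow> d \<in> disks \<Omega> \<and> (c, e', b) \<in> bdry \<Omega> d" for d
      using enters_vertex[OF R, of e c a d] enters_vertex[OF R, of e' c b d] e e' abc
      unfolding E_def by (auto simp: insert_commute)
    have r: "rotated [a, b, c] ([c] @ [a, b])"
      unfolding rotated_def by (intro exI[of _ "[a, b]"] exI[of _ "[c]"]) simp
    note G = arc_graph_ends[OF F r, unfolded list.set(2) list.set(1)]
    \<comment> \<open>In the vertex graph of \<open>c\<close>, an edge that meets \<open>e\<close>
      or \<open>e'\<close> joins these two; connectedness then leaves no further vertices.\<close>
    have nbr: "{gsrc (?g c) d, gtgt (?g c) d} \<subseteq> {e, e'}"
      if d: "d \<in> gedges (?g c)" "gsrc (?g c) d \<in> {e, e'} \<or> gtgt (?g c) d \<in> {e, e'}" for d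
    proof -
      have "enters \<Omega> {c} d (gsrc (?g c) d)" "leaves \<Omega> {c} d (gtgt (?g c) d)" using G d(1) by blast+
      then have "enters \<Omega> {c} d e' \<and> leaves \<Omega> {c} d e" using d(2) en disk by auto
      then show ?thesis using G by blast
    qed
    have eV: "e \<in> gverts (?g c)" unfolding arc_graph_gverts cr using e by blast
    have "x \<in> {e, e'}" if "x \<in> gverts (?g c)" for x
    proof -
      have "(e, x) \<in> {(u, v). \<exists>d\<in>gedges (?g c). (u = gsrc (?g c) d \<and> v = gtgt (?g c) d) \<or>
                                              (u = gtgt (?g c) d \<and> v = gsrc (?g c) d)}\<^sup>*"
        using C[OF inV(3)] eV that unfolding conn_graph_def connected_by_def by blast
      then show ?thesis
      proof (induction rule: rtrancl_induct)
        case (step y z)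
        then show ?case using nbr by blast
      qed simp
    qed
    then have "E a c \<union> E b c \<subseteq> {e, e'}" unfolding arc_graph_gverts cr by blast
    moreover have "E a c \<inter> E b c = {}" using abc unfolding E_def by (auto simp: doubleton_eq_iff)
    ultimately have Es: "E a c = {e}" "E b c = {e'}" using e e' by blast+
    have m: "swap_flag ` ?\<beta> \<in> ?bl b" "swap_flag ` edge_flags \<Omega> b c e' \<in> ?bl a"
      unfolding bl Es using eq by simp_all
    have "?\<beta> \<in> ?bl a" using e unfolding bl by blast
    moreover have "\<forall>p\<in>?\<beta>. snd p" using pure by (metis prod.collapse)
    moreover have "?bl c = {?\<beta>, swap_flag ` ?\<beta>}"
      unfolding bl(3) Es sw[of \<Omega> c a] sw[of \<Omega> c b] by (simp add: eq insert_commute)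
    moreover have "unmatched (vclass \<Omega> a) (vclass \<Omega> b) = {}"
      unfolding unmatched_def using match_ab(1) m by (auto simp: bl(1) Es)
    moreover have "unmatched (vclass \<Omega> b) (vclass \<Omega> a) = {}"
      unfolding unmatched_def using match_ab(2) m by (auto simp: bl(2) Es)
    ultimately show ?thesis by blast
  qed
qed

text \<open>
  The classes of two vertex graphs of a surface with three vertices need not determine the third: an
  edge traversed in one direction only, of a surface with two vertices, may be subdivided. But two
  different outcomes have no color in common.
\<close>

theorem Film_third_unique:
  assumes 1: "Film [\<alpha>, \<beta>, \<gamma>] \<noteq> {}" and 2: "Film [\<alpha>, \<beta>, \<gamma>'] \<noteq> {}"
    and cols: "class_colors \<gamma> \<inter> class_colors \<gamma>' \<noteq> {}"
  shows "\<gamma> = \<gamma>'"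
proof -
  have ex: "\<exists>\<Omega> a b c. film_on \<Omega> [a, b, c] \<and> vclass \<Omega> a = \<alpha> \<and> vclass \<Omega> b = \<beta> \<and> vclass \<Omega> c = \<delta>"
    if "Film [\<alpha>, \<beta>, \<delta>] \<noteq> {}" for \<delta>
  proof -
    obtain \<Omega> qs where "film_on \<Omega> qs" "map (vclass \<Omega>) qs = [\<alpha>, \<beta>, \<delta>]" using \<open>Film [\<alpha>, \<beta>, \<delta>] \<noteq> {}\<close> Film_nonempty_iff by metis
    moreover from this(2) obtain a b c where "qs = [a, b, c]" by (auto simp: map_eq_Cons_conv)
    ultimately show ?thesis by auto
  qed
  have G: "\<alpha> \<in> Graphs" "\<delta> \<in> Graphs" if "Film [\<alpha>, \<beta>, \<delta>] \<noteq> {}" for \<delta>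
  proof -
    obtain \<Omega> a b c where f: "film_on \<Omega> [a, b, c]" "vclass \<Omega> a = \<alpha>" "vclass \<Omega> c = \<delta>" using ex[OF \<open>Film [\<alpha>, \<beta>, \<delta>] \<noteq> {}\<close>] by blast
    then show "\<alpha> \<in> Graphs" "\<delta> \<in> Graphs"
      using vclass_in_Graphs[OF f(1), of a] vclass_in_Graphs[OF f(1), of c] film_onD(3)[OF f(1)] by auto
  qed
  let ?N = "image swap_flag ` (unmatched \<alpha> \<beta> \<union> unmatched \<beta> \<alpha>)"
  have di: "class_blocks \<delta> = ?N \<or> (\<exists>\<zeta>\<in>class_blocks \<alpha>. (\<forall>p\<in>\<zeta>. snd p) \<and>
      class_blocks \<delta> = {\<zeta>, swap_flag ` \<zeta>} \<and> ?N = {})" if "Film [\<alpha>, \<beta>, \<delta>] \<noteq> {}" for \<delta>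
    using ex[OF that] third_blocks by fastforce
  have ne: "class_blocks \<delta> \<noteq> {}" if "\<delta> \<in> Graphs" for \<delta> :: "'a ograph set"
    using that blocks_nonempty by (elim GraphsE) (simp add: class_blocks_graph_class)
  note G' = G[OF 1] G(2)[OF 2]
  \<comment> \<open>The exceptional alternative requires \<open>?N\<close> to be empty, whereas the
    set of blocks of a class is not; so both classes fall under the same alternative.\<close>
  consider "class_blocks \<gamma> = class_blocks \<gamma>'"
    | \<zeta> \<zeta>' where "\<zeta> \<in> class_blocks \<alpha>" "\<forall>p\<in>\<zeta>. snd p" "class_blocks \<gamma> = {\<zeta>, swap_flag ` \<zeta>}"
      "\<zeta>' \<in> class_blocks \<alpha>" "\<forall>p\<in>\<zeta>'. snd p" "class_blocks \<gamma>' = {\<zeta>', swap_flag ` \<zeta>'}"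
    using di[OF 1] di[OF 2] ne[OF G'(2)] ne[OF G'(3)] by metis
  then show ?thesis
  proof cases
    case 1
    then show ?thesis using class_blocks_eqD G' by blast
  next
    case 2
    \<comment> \<open>The exceptional blocks are blocks of \<open>\<alpha>\<close> and contain only
      \<open>True\<close> flags. A shared color \<open>k\<close> therefore gives the shared flag
      \<open>(k, True)\<close>, which identifies them.\<close>
    obtain k where k: "k \<in> class_colors \<gamma>" "k \<in> class_colors \<gamma>'" using cols by blast
    have "class_colors \<delta> \<subseteq> fst ` \<xi>" if "class_blocks \<delta> = {\<xi>, swap_flag ` \<xi>}" for \<delta> \<xi>
      unfolding class_colors_def that by (auto intro: rev_image_eqI)
    then have "k \<in> fst ` \<zeta>" "k \<in> fst ` \<zeta>'" using k 2(3,6) by blast+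
    then obtain p p' where "p \<in> \<zeta>" "p' \<in> \<zeta>'" "k = fst p" "k = fst p'" by blast
    moreover from this have "snd p" "snd p'" using 2(2,5) by blast+
    ultimately have "(k, True) \<in> \<zeta>" "(k, True) \<in> \<zeta>'" by (cases p; cases p'; simp)+
    then have "\<zeta> = \<zeta>'" using class_blocks_disjoint[OF G'(1) 2(1,4)] by blast
    then show ?thesis using class_blocks_eqD[OF G'(2,3)] 2(3,6) by simp
  qed
qed

section \<open>Rotations and colors of film surfaces with prescribed vertex classes\<close>

lemma Film_rotate:
  assumes "Film (\<sigma>s @ \<tau>s) \<noteq> {}" shows "Film (\<tau>s @ \<sigma>s) \<noteq> {}"
proof -
  obtain \<Omega> qs where F: "film_on \<Omega> qs" "map (vclass \<Omega>) qs = \<sigma>s @ \<tau>s"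
    using assms Film_nonempty_iff by metis
  obtain l r where lr: "qs = l @ r" "map (vclass \<Omega>) l = \<sigma>s" "map (vclass \<Omega>) r = \<tau>s"
    using F(2) by (metis map_eq_append_conv)
  have "film_on \<Omega> (r @ l)" using F(1) film_on_rotated rotated_append lr(1) by blast
  then show ?thesis using lr(2,3) Film_nonempty_iff map_append by metis
qed

lemma Film_Graphs:
  assumes "Film \<sigma>s \<noteq> {}" shows "set \<sigma>s \<subseteq> Graphs"
proof -
  obtain \<Omega> qs where F: "film_on \<Omega> qs" "map (vclass \<Omega>) qs = \<sigma>s" using assms Film_nonempty_iff by metis
  then show ?thesis using vclass_in_Graphs[OF F(1)] film_onD(3)[OF F(1)] by auto
qed

lemma class_colors_vclass:
  assumes F: "film_on \<Omega> qs" and p: "p \<in> verts \<Omega>"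
  shows "class_colors (vclass \<Omega> p) = color \<Omega> ` {d \<in> disks \<Omega>. p \<in> disk_verts \<Omega> d}"
proof -
  note R = film_on_regular[OF F]
  obtain bs where r: "rotated qs ([p] @ bs)" "bs \<noteq> []" using rotated_single[OF F p] .
  have "\<not> disk_verts \<Omega> d \<subseteq> {p}" if d: "d \<in> disks \<Omega>" for d
  proof
    assume a: "disk_verts \<Omega> d \<subseteq> {p}"
    obtain u e v where uv: "(u, e, v) \<in> bdry \<Omega> d"
      using disk_verts_nonempty[OF R d] unfolding disk_verts_def by blast
    show False using disk_verts_bdry[OF R d uv] bdry_ends(3)[OF R d uv] a by blast
  qed
  then have "{d \<in> disks \<Omega>. disk_verts \<Omega> d \<inter> {p} \<noteq> {} \<and> \<not> disk_verts \<Omega> d \<subseteq> {p}} =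
             {d \<in> disks \<Omega>. p \<in> disk_verts \<Omega> d}" by blast
  then show ?thesis
    using class_colors_arc_class[OF F r(1) _ r(2)] unfolding vclass_arc_class[OF R] by simp
qed

text \<open>A disk at the third vertex has at least one more vertex, which is one of the other
  two.\<close>

lemma Film_third_colors:
  assumes "Film [\<alpha>, \<beta>, \<gamma>] \<noteq> {}" shows "class_colors \<gamma> \<subseteq> class_colors \<alpha> \<union> class_colors \<beta>"
proof -
  obtain \<Omega> qs where F: "film_on \<Omega> qs" "map (vclass \<Omega>) qs = [\<alpha>, \<beta>, \<gamma>]" using assms Film_nonempty_iff by metis
  then obtain a b c where abc: "qs = [a, b, c]" "vclass \<Omega> a = \<alpha>" "vclass \<Omega> b = \<beta>" "vclass \<Omega> c = \<gamma>"
    by (auto simp: map_eq_Cons_conv)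
  note F' = F(1)[unfolded abc(1)] and R = film_on_regular[OF F(1)]
  have V: "verts \<Omega> = {a, b, c}" using film_onD(3)[OF F'] by auto
  have "a \<in> disk_verts \<Omega> d \<or> b \<in> disk_verts \<Omega> d" if d: "d \<in> disks \<Omega>" "c \<in> disk_verts \<Omega> d" for d
  proof -
    obtain e v where "(c, e, v) \<in> bdry \<Omega> d" using d(2) unfolding disk_verts_def by blast
    from disk_verts_bdry(2)[OF R d(1) this] bdry_ends(3,5)[OF R d(1) this]
    show ?thesis using V by auto
  qed
  then have "color \<Omega> ` {d \<in> disks \<Omega>. c \<in> disk_verts \<Omega> d} \<subseteq>
    color \<Omega> ` {d \<in> disks \<Omega>. a \<in> disk_verts \<Omega> d} \<union> color \<Omega> ` {d \<in> disks \<Omega>. b \<in> disk_verts \<Omega> d}" by blast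
  then show ?thesis
    using class_colors_vclass[OF F', of a] class_colors_vclass[OF F', of b] class_colors_vclass[OF F', of c]
      V abc(2-4) by simp
qed


section \<open>Uniqueness of the intermediate classes\<close>

text \<open>The condition that no factor of the chain with intermediate classes
  \<open>\<sigma>s\<close> is forced to vanish, where \<open>\<alpha>\<close> is the class of the
  vector that enters from the left.\<close>

fun fits :: "'c ograph set \<Rightarrow> 'c ograph set list \<Rightarrow> 'c ograph set list \<Rightarrow> bool" where
  "fits \<alpha> [\<beta>, \<gamma>] [] \<longleftrightarrow> Film [\<alpha>, \<beta>, \<gamma>] \<noteq> {}"
| "fits \<alpha> (\<beta> # \<beta>s) (\<sigma> # \<sigma>s) \<longleftrightarrow> Film [\<alpha>, \<beta>, \<sigma>] \<noteq> {} \<and> fits (star \<sigma>) \<beta>s \<sigma>s"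
| "fits \<alpha> _ _ \<longleftrightarrow> False"

text \<open>The intermediate classes that the surface itself provides: those of the arcs that remain
  after each vertex, down to the arc with two vertices.\<close>

fun tail_classes :: "'c complex2 \<Rightarrow> nat list \<Rightarrow> 'c ograph set list" where
  "tail_classes \<Omega> (q # p # r # rs) = arc_class \<Omega> (set (p # r # rs)) # tail_classes \<Omega> (p # r # rs)"
| "tail_classes \<Omega> _ = []"

text \<open>A color of \<open>\<alpha>\<close> either sits on the next vertex or is handed on to
  \<open>star \<sigma>\<close>, and the chain ends with vertices only.\<close>

lemma fits_colors:
  "fits \<alpha> \<beta>s \<sigma>s \<Longrightarrow> class_colors \<alpha> \<subseteq> \<Union> (class_colors ` set \<beta>s)"
proof (induction \<alpha> \<beta>s \<sigma>s rule: fits.induct)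
  case (1 \<alpha> \<beta> \<gamma>)
  then show ?case using Film_third_colors[of \<beta> \<gamma> \<alpha>] Film_rotate[of "[\<alpha>]" "[\<beta>, \<gamma>]"] by simp
next
  case (2 \<alpha> \<beta> \<beta>s \<sigma> \<sigma>s)
  then have "Film [\<beta>, \<sigma>, \<alpha>] \<noteq> {}" "\<sigma> \<in> Graphs"
    using Film_rotate[of "[\<alpha>]" "[\<beta>, \<sigma>]"] Film_Graphs[of "[\<alpha>, \<beta>, \<sigma>]"] by simp_all
  then have "class_colors \<alpha> \<subseteq> class_colors \<beta> \<union> class_colors (star \<sigma>)"
    using Film_third_colors[of \<beta> \<sigma> \<alpha>] by simp
  then show ?case using 2 by auto
qed simp_all

lemma fits_length: "fits \<alpha> \<beta>s \<sigma>s \<Longrightarrow> length \<beta>s = length \<sigma>s + 2"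
  by (induction \<alpha> \<beta>s \<sigma>s rule: fits.induct) simp_all

text \<open>A color \<open>k\<close> of \<open>\<sigma>\<close> occurs to the left of the cut by
  \<open>Film_third_colors\<close> and to the right by \<open>fits_colors\<close>. As disks have
  distinct colors, one disk of \<open>\<Omega>\<close> reaches both sides, so \<open>k\<close> is
  also a color of the true class \<open>?\<tau>\<close>, and \<open>Film_third_unique\<close>
  applies.\<close>

theorem fits_unique:
  assumes "film_on \<Omega> (l @ qs)" "l \<noteq> []" "fits (arc_class \<Omega> (set l)) (map (vclass \<Omega>) qs) \<sigma>s"
  shows "\<sigma>s = tail_classes \<Omega> qs"
  using assms
proof (induction \<sigma>s arbitrary: l qs)
  case Nil
  then have "length qs = 2" using fits_length[OF Nil.prems(3)] by simp
  then show ?case by (auto simp: length_Suc_conv numeral_2_eq_2)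
next
  case (Cons \<sigma> \<sigma>s)
  have len: "length qs = length \<sigma>s + 3" using fits_length[OF Cons.prems(3)] by simp
  then obtain q qs' where qs: "qs = q # qs'" by (cases qs) auto
  then obtain p r rs where qs': "qs' = p # r # rs"
    using len by (cases qs'; cases "tl qs'") auto
  have fit: "Film [arc_class \<Omega> (set l), vclass \<Omega> q, \<sigma>] \<noteq> {}" "fits (star \<sigma>) (map (vclass \<Omega>) qs') \<sigma>s"
    using Cons.prems(3) unfolding qs by simp_all
  let ?\<tau> = "arc_class \<Omega> (set qs')"
  note F = Cons.prems(1) and R = film_on_regular[OF Cons.prems(1)]
  have V: "verts \<Omega> = set (l @ qs)" "distinct (l @ qs)" using film_onD(2,3)[OF F] by simp_all
  have "Film (map (arc_class \<Omega> \<circ> set) [l, [q], qs']) \<noteq> {}"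
    using Film_arcs[of \<Omega> "[]" "[l, [q], qs']"] F Cons.prems(2) qs qs' by simp
  then have true: "Film [arc_class \<Omega> (set l), vclass \<Omega> q, ?\<tau>] \<noteq> {}"
    by (simp add: vclass_arc_class[OF R])
  have G: "\<sigma> \<in> Graphs" using Film_Graphs[OF fit(1)] by simp
  then obtain k where k: "k \<in> class_colors \<sigma>" using class_colors_nonempty by blast
  then obtain x where x: "x \<in> set qs'" "k \<in> class_colors (vclass \<Omega> x)"
    using fits_colors[OF fit(2)] class_colors_star[OF G] by auto
  have xV: "x \<in> verts \<Omega>" "q \<in> verts \<Omega>" using x V qs by auto
  obtain d where d: "d \<in> disks \<Omega>" "x \<in> disk_verts \<Omega> d" "k = color \<Omega> d"
    using x(2) unfolding class_colors_vclass[OF F xV(1)] by blast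
  have rl: "rotated (l @ qs) (qs' @ (l @ [q]))"
    unfolding rotated_def qs by (intro exI[of _ "l @ [q]"] exI[of _ qs']) simp
  have ql: "set qs' \<inter> (insert q (set l)) = {}" using V(2) unfolding qs by auto
  have "\<exists>d'\<in>disks \<Omega>. k = color \<Omega> d' \<and> \<not> disk_verts \<Omega> d' \<subseteq> set qs'"
  proof -
    have "k \<in> class_colors (arc_class \<Omega> (set l)) \<union> class_colors (vclass \<Omega> q)"
      using Film_third_colors[OF fit(1)] k by blast
    then show ?thesis
    proof
      assume "k \<in> class_colors (arc_class \<Omega> (set l))"
      then show ?thesis
        using class_colors_arc_class[OF F rotated_refl Cons.prems(2)] ql qs by auto
    next
      assume "k \<in> class_colors (vclass \<Omega> q)"
      then show ?thesis unfolding class_colors_vclass[OF F xV(2)] using ql by blast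
    qed
  qed
  then have "\<not> disk_verts \<Omega> d \<subseteq> set qs'"
    using d film_onD(11)[OF F] by (metis inj_onD)
  then have "k \<in> class_colors ?\<tau>"
    using class_colors_arc_class[OF F rl] d x(1) qs' by auto
  then have \<sigma>\<tau>: "\<sigma> = ?\<tau>" using Film_third_unique[OF fit(1) true] k by blast
  have "star \<sigma> = arc_class \<Omega> (set (l @ [q]))" unfolding \<sigma>\<tau> using arc_class_star[OF F rl] by simp
  then have "\<sigma>s = tail_classes \<Omega> qs'"
    using Cons.IH[of "l @ [q]" qs'] F fit(2) qs by simp
  then show ?case using \<sigma>\<tau> unfolding qs qs' by simp
qed

section \<open>Products in a graph-Frobenius algebra\<close>

locale based_graph_frobenius =
  fixes scale :: "'k::field_char_0 \<Rightarrow> 'b::ab_group_add \<Rightarrow> 'b"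
    and B :: "'c ograph set \<Rightarrow> 'b set"
    and pair :: "'b \<Rightarrow> 'b \<Rightarrow> 'k"
    and tri :: "'b \<Rightarrow> 'b \<Rightarrow> 'b \<Rightarrow> 'k"
    and b :: "'c ograph set \<Rightarrow> 'b list"
    and F :: "'c ograph set \<Rightarrow> nat \<Rightarrow> nat \<Rightarrow> 'k"
  assumes gf: "graph_frobenius scale B pair tri"
    and ri: "rotation_invariant pair tri"
    and bas: "\<sigma> \<in> Graphs \<Longrightarrow> is_basis scale (B \<sigma>) (b \<sigma>)"
    and inv: "\<sigma> \<in> Graphs \<Longrightarrow> inverse_matrix pair (b \<sigma>) (b (star \<sigma>)) (F \<sigma>)"
begin

sublocale vector_space scale
  using gf unfolding graph_frobenius_def by (elim conjE)

definition lin :: "('b \<Rightarrow> 'k) \<Rightarrow> bool" where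
  "lin \<phi> \<longleftrightarrow> (\<forall>x y. \<phi> (x + y) = \<phi> x + \<phi> y) \<and> (\<forall>c x. \<phi> (scale c x) = c * \<phi> x)"

lemma gf_pair_linear:
  "\<forall>y. Vector_Spaces.linear scale (*) (\<lambda>x. pair x y)" "\<forall>x. Vector_Spaces.linear scale (*) (\<lambda>y. pair x y)"
proof -
  show "\<forall>y. Vector_Spaces.linear scale (*) (\<lambda>x. pair x y)"
    using gf unfolding graph_frobenius_def by (elim conjE)
  show "\<forall>x. Vector_Spaces.linear scale (*) (\<lambda>y. pair x y)"
    using gf unfolding graph_frobenius_def by (elim conjE)
qed

lemma gf_tri_linear:
  "\<forall>y z. Vector_Spaces.linear scale (*) (\<lambda>x. tri x y z)"
  "\<forall>x z. Vector_Spaces.linear scale (*) (\<lambda>y. tri x y z)"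
  "\<forall>x y. Vector_Spaces.linear scale (*) (\<lambda>z. tri x y z)"
proof -
  show "\<forall>y z. Vector_Spaces.linear scale (*) (\<lambda>x. tri x y z)"
    using gf unfolding graph_frobenius_def by (elim conjE)
  show "\<forall>x z. Vector_Spaces.linear scale (*) (\<lambda>y. tri x y z)"
    using gf unfolding graph_frobenius_def by (elim conjE)
  show "\<forall>x y. Vector_Spaces.linear scale (*) (\<lambda>z. tri x y z)"
    using gf unfolding graph_frobenius_def by (elim conjE)
qed

lemma gf_decompose:
  "\<exists>v. (\<forall>\<sigma>\<in>Graphs. v \<sigma> \<in> B \<sigma>) \<and> (\<forall>\<sigma>. \<sigma> \<notin> Graphs \<longrightarrow> v \<sigma> = 0) \<and>
       finite {\<sigma>. v \<sigma> \<noteq> 0} \<and> x = (\<Sum>\<sigma> | v \<sigma> \<noteq> 0. v \<sigma>)"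
proof -
  have "\<forall>x. \<exists>!v. (\<forall>\<sigma>\<in>Graphs. v \<sigma> \<in> B \<sigma>) \<and> (\<forall>\<sigma>. \<sigma> \<notin> Graphs \<longrightarrow> v \<sigma> = 0) \<and>
               finite {\<sigma>. v \<sigma> \<noteq> 0} \<and> x = (\<Sum>\<sigma> | v \<sigma> \<noteq> 0. v \<sigma>)"
    using gf unfolding graph_frobenius_def by (elim conjE)
  from spec[OF this, of x] show ?thesis by (rule ex1_implies_ex)
qed

lemma gf_orthogonal:
  "\<forall>\<sigma>1\<in>Graphs. \<forall>\<sigma>2\<in>Graphs. \<sigma>1 \<noteq> star \<sigma>2 \<longrightarrow> (\<forall>x\<in>B \<sigma>1. \<forall>y\<in>B \<sigma>2. pair x y = 0)"
  "\<forall>x. (\<forall>y. pair x y = 0) \<longrightarrow> x = 0"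
proof -
  show "\<forall>\<sigma>1\<in>Graphs. \<forall>\<sigma>2\<in>Graphs. \<sigma>1 \<noteq> star \<sigma>2 \<longrightarrow> (\<forall>x\<in>B \<sigma>1. \<forall>y\<in>B \<sigma>2. pair x y = 0)"
    using gf unfolding graph_frobenius_def by (elim conjE)
  show "\<forall>x. (\<forall>y. pair x y = 0) \<longrightarrow> x = 0"
    using gf unfolding graph_frobenius_def by (elim conjE)
qed

lemma gf_tri_vanishes:
  "\<forall>\<sigma>1\<in>Graphs. \<forall>\<sigma>2\<in>Graphs. \<forall>\<sigma>3\<in>Graphs. Film [\<sigma>1, \<sigma>2, \<sigma>3] = {} \<longrightarrow>
     (\<forall>x\<in>B \<sigma>1. \<forall>y\<in>B \<sigma>2. \<forall>z\<in>B \<sigma>3. tri x y z = 0)"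
  using gf unfolding graph_frobenius_def by (elim conjE)

lemma linI: "Vector_Spaces.linear scale (*) \<phi> \<Longrightarrow> lin \<phi>"
  unfolding lin_def Vector_Spaces.linear_iff by blast

lemma lin_pair: "lin (pair x)" "lin (\<lambda>x. pair x y)"
  using gf_pair_linear by (blast intro: linI)+

lemma lin_tri: "lin (tri x y)" "lin (\<lambda>y. tri x y z)" "lin (\<lambda>x. tri x y z)"
  using gf_tri_linear by (blast intro: linI)+

lemma lin_0: "lin \<phi> \<Longrightarrow> \<phi> 0 = 0"
  unfolding lin_def by (metis mult_zero_left scale_zero_left)

lemma lin_sum:
  assumes "lin \<phi>" shows "\<phi> (\<Sum>i\<in>A. scale (c i) (v i)) = (\<Sum>i\<in>A. c i * \<phi> (v i))"
proof (cases "finite A")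
  case True
  then show ?thesis
    using assms lin_0[OF assms] unfolding lin_def by (induction A rule: finite_induct) auto
qed (simp add: lin_0[OF assms])

lemma lin_diff: "lin \<phi> \<Longrightarrow> \<phi> (x - y) = \<phi> x - \<phi> y"
  unfolding lin_def by (metis add_diff_cancel_right' diff_add_cancel)

lemma pair_commute: "pair x y = pair y x"
  using ri unfolding rotation_invariant_def by blast

lemma tri_rotate: "tri x y z = tri y z x"
  using ri unfolding rotation_invariant_def by blast

lemma span_b: "\<sigma> \<in> Graphs \<Longrightarrow> B \<sigma> = span (set (b \<sigma>))"
  using bas unfolding is_basis_def by blast

lemma subspace_B: "\<sigma> \<in> Graphs \<Longrightarrow> subspace (B \<sigma>)"
  by (simp add: span_b)

lemma b_in_B: "\<sigma> \<in> Graphs \<Longrightarrow> i < length (b \<sigma>) \<Longrightarrow> b \<sigma> ! i \<in> B \<sigma>"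
  by (simp add: span_b span_base)

text \<open>Any \<open>y\<close> is a sum of homogeneous components, and those outside
  \<open>B (star \<sigma>)\<close> pair with \<open>x\<close> to zero, so non-degeneracy on the
  whole algebra restricts.\<close>

lemma nondegenerate:
  assumes \<sigma>: "\<sigma> \<in> Graphs" and x: "x \<in> B \<sigma>" and 0: "\<And>y. y \<in> B (star \<sigma>) \<Longrightarrow> pair x y = 0"
  shows "x = 0"
proof -
  have "pair x y = 0" for y
  proof -
    obtain v where v: "\<forall>\<sigma>\<in>Graphs. v \<sigma> \<in> B \<sigma>" "\<forall>\<sigma>. \<sigma> \<notin> Graphs \<longrightarrow> v \<sigma> = 0"
      "finite {\<sigma>. v \<sigma> \<noteq> 0}" "y = (\<Sum>\<sigma> | v \<sigma> \<noteq> 0. v \<sigma>)"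
      using gf_decompose by metis
    have "pair x (v \<tau>) = 0" if "v \<tau> \<noteq> 0" for \<tau>
    proof -
      have \<tau>: "\<tau> \<in> Graphs" "v \<tau> \<in> B \<tau>" using v that by blast+
      show ?thesis
      proof (cases "\<sigma> = star \<tau>")
        case True
        then show ?thesis using 0 \<tau> by simp
      next
        case False
        then show ?thesis using gf_orthogonal(1) \<sigma> \<tau> x by blast
      qed
    qed
    moreover have "y = (\<Sum>\<sigma> | v \<sigma> \<noteq> 0. scale 1 (v \<sigma>))" using v(4) by simp
    ultimately show ?thesis using lin_sum[OF lin_pair(1), of x "\<lambda>_. 1" v] by simp
  qed
  then show ?thesis using gf_orthogonal(2) by blast
qed

text \<open>Both sides are linear in \<open>w\<close>; on basis vectors this is the defining
  property of \<open>F\<close>.\<close>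

lemma expand_star:
  assumes \<phi>: "lin \<phi>" and \<sigma>: "\<sigma> \<in> Graphs" and w: "w \<in> B (star \<sigma>)"
  shows "(\<Sum>i<length (b \<sigma>). \<Sum>j<length (b (star \<sigma>)). F \<sigma> i j * pair (b \<sigma> ! i) w * \<phi> (b (star \<sigma>) ! j)) = \<phi> w"
proof -
  let ?E = "\<lambda>w. \<Sum>i<length (b \<sigma>). \<Sum>j<length (b (star \<sigma>)). F \<sigma> i j * pair (b \<sigma> ! i) w * \<phi> (b (star \<sigma>) ! j)"
  have add: "?E (scale c x + y) = c * ?E x + ?E y" for c x y
  proof -
    have "pair (b \<sigma> ! i) (scale c x + y) = c * pair (b \<sigma> ! i) x + pair (b \<sigma> ! i) y" for i
      using lin_pair(1) unfolding lin_def by simp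
    then show ?thesis
      by (simp add: sum_distrib_left sum.distrib[symmetric] algebra_simps)
  qed
  have "w \<in> span (set (b (star \<sigma>)))" using w span_b \<sigma> by simp
  then show ?thesis
  proof (induction rule: span_induct_alt)
    case base
    then show ?case using lin_0[OF \<phi>] lin_0[OF lin_pair(1)] by simp
  next
    case (step c x y)
    obtain l where l: "l < length (b (star \<sigma>))" "x = b (star \<sigma>) ! l"
      using step.hyps by (metis in_set_conv_nth)
    have "?E x = (\<Sum>j<length (b (star \<sigma>)). (\<Sum>i<length (b \<sigma>). F \<sigma> i j * pair (b \<sigma> ! i) x) * \<phi> (b (star \<sigma>) ! j))"
      by (subst sum.swap) (simp add: sum_distrib_right)
    also have "\<dots> = (\<Sum>j<length (b (star \<sigma>)). (if j = l then 1 else 0) * \<phi> (b (star \<sigma>) ! j))"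
      using inv[OF \<sigma>] l unfolding inverse_matrix_def by (intro sum.cong) auto
    also have "\<dots> = \<phi> x" using l by (simp add: if_distrib[of "\<lambda>t. t * _"] cong: if_cong)
    finally show ?case unfolding add step.IH using \<phi> unfolding lin_def by simp
  qed
qed

text \<open>The defining property of \<open>F\<close> is one-sided. The other side follows from
  non-degeneracy: the expansion \<open>y\<close> of \<open>x\<close> pairs with all of
  \<open>B (star \<sigma>)\<close> as \<open>x\<close> does, so \<open>y = x\<close>.\<close>

lemma expand:
  assumes \<phi>: "lin \<phi>" and \<sigma>: "\<sigma> \<in> Graphs" and x: "x \<in> B \<sigma>"
  shows "(\<Sum>i<length (b \<sigma>). \<Sum>j<length (b (star \<sigma>)). F \<sigma> i j * \<phi> (b \<sigma> ! i) * pair x (b (star \<sigma>) ! j)) = \<phi> x"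
proof -
  define c where "c i = (\<Sum>j<length (b (star \<sigma>)). F \<sigma> i j * pair x (b (star \<sigma>) ! j))" for i
  define y where "y = (\<Sum>i<length (b \<sigma>). scale (c i) (b \<sigma> ! i))"
  have y: "\<psi> y = (\<Sum>i<length (b \<sigma>). \<Sum>j<length (b (star \<sigma>)). F \<sigma> i j * \<psi> (b \<sigma> ! i) * pair x (b (star \<sigma>) ! j))"
    if "lin \<psi>" for \<psi>
    unfolding y_def lin_sum[OF that] c_def
    by (intro sum.cong refl) (simp add: sum_distrib_left sum_distrib_right ac_simps)
  have "y \<in> B \<sigma>" unfolding y_def
    using subspace_B[OF \<sigma>] b_in_B[OF \<sigma>] by (intro subspace_sum subspace_scale) auto
  then have "y - x \<in> B \<sigma>" using x subspace_B[OF \<sigma>] by (rule subspace_diff[rotated])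
  moreover have "pair (y - x) w = 0" if w: "w \<in> B (star \<sigma>)" for w
  proof -
    have "pair y w = (\<Sum>i<length (b \<sigma>). \<Sum>j<length (b (star \<sigma>)). F \<sigma> i j * pair (b \<sigma> ! i) w * pair x (b (star \<sigma>) ! j))"
      using y[OF lin_pair(2)] .
    then show ?thesis using expand_star[OF lin_pair(1) \<sigma> w] lin_diff[OF lin_pair(2)] by simp
  qed
  ultimately have "y - x = 0" using nondegenerate[OF \<sigma>] by blast
  then show ?thesis using y[OF \<phi>] by simp
qed

text \<open>The element of \<open>B \<tau>\<close> that represents the form \<open>tri x y\<close>
  on \<open>B (star \<tau>)\<close>; see \<open>pair_mult\<close>. The matrix is that of
  \<open>star \<tau>\<close> because the basis of this class is inserted into
  \<open>tri\<close>.\<close>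

definition mult :: "'c ograph set \<Rightarrow> 'b \<Rightarrow> 'b \<Rightarrow> 'b" where
  "mult \<tau> x y = (\<Sum>i<length (b (star \<tau>)). \<Sum>j<length (b \<tau>).
                   scale (tri x y (b (star \<tau>) ! i) * F (star \<tau>) i j) (b \<tau> ! j))"

lemma mult_in_B: "\<tau> \<in> Graphs \<Longrightarrow> mult \<tau> x y \<in> B \<tau>"
  unfolding mult_def using subspace_B b_in_B by (intro subspace_sum subspace_scale) auto

lemma lin_mult:
  assumes "lin \<phi>"
  shows "\<phi> (mult \<tau> x y) = (\<Sum>i<length (b (star \<tau>)). \<Sum>j<length (b \<tau>).
                             tri x y (b (star \<tau>) ! i) * F (star \<tau>) i j * \<phi> (b \<tau> ! j))"
proof -
  have "mult \<tau> x y = (\<Sum>i<length (b (star \<tau>)). scale 1 (\<Sum>j<length (b \<tau>).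
                   scale (tri x y (b (star \<tau>) ! i) * F (star \<tau>) i j) (b \<tau> ! j)))"
    unfolding mult_def by simp
  then show ?thesis by (simp only: lin_sum[OF assms]) simp
qed

lemma pair_mult:
  assumes "\<tau> \<in> Graphs" "z \<in> B (star \<tau>)" shows "pair (mult \<tau> x y) z = tri x y z"
  using expand[OF lin_tri(1), of "star \<tau>" z x y] assms unfolding lin_mult[OF lin_pair(2)]
  by (simp add: pair_commute ac_simps)

lemma mult_cong_tri:
  assumes \<tau>: "\<tau> \<in> Graphs" and eq: "\<And>z. z \<in> B (star \<tau>) \<Longrightarrow> tri x y z = tri x' y' z"
  shows "mult \<tau> x y = mult \<tau> x' y'"
proof -
  have "mult \<tau> x y - mult \<tau> x' y' \<in> B \<tau>"
    using subspace_B[OF \<tau>] mult_in_B[OF \<tau>] mult_in_B[OF \<tau>] by (rule subspace_diff)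
  moreover have "pair (mult \<tau> x y - mult \<tau> x' y') z = 0" if "z \<in> B (star \<tau>)" for z
    using eq[OF that] pair_mult[OF \<tau> that] lin_diff[OF lin_pair(2)] by simp
  ultimately have "mult \<tau> x y - mult \<tau> x' y' = 0" using nondegenerate[OF \<tau>] by blast
  then show ?thesis by simp
qed

lemma tri_vanishes:
  assumes "\<sigma>1 \<in> Graphs" "\<sigma>2 \<in> Graphs" "\<sigma>3 \<in> Graphs" "Film [\<sigma>1, \<sigma>2, \<sigma>3] = {}"
    and "x \<in> B \<sigma>1" "y \<in> B \<sigma>2" "z \<in> B \<sigma>3"
  shows "tri x y z = 0"
  using gf_tri_vanishes assms by blast

text \<open>Both sides of the Frobenius axiom are values of \<open>tri\<close> at a product. The
  value with \<open>mult \<rho> x4 x1\<close> is rewritten as its pairing with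
  \<open>mult (star \<rho>) x2 x3\<close>; reading this pairing from the other side gives the second
  product.\<close>

lemma tri_mult:
  assumes F4: "Film [\<sigma>1, \<sigma>2, \<sigma>3, \<sigma>4] \<noteq> {}"
    and F\<tau>: "Film [\<sigma>1, \<sigma>2, star \<tau>] \<noteq> {}" "Film [\<tau>, \<sigma>3, \<sigma>4] \<noteq> {}"
    and F\<rho>: "Film [\<sigma>4, \<sigma>1, star \<rho>] \<noteq> {}" "Film [\<rho>, \<sigma>2, \<sigma>3] \<noteq> {}"
    and x: "x1 \<in> B \<sigma>1" "x2 \<in> B \<sigma>2" "x3 \<in> B \<sigma>3" "x4 \<in> B \<sigma>4"
  shows "tri (mult \<tau> x1 x2) x3 x4 = tri x1 (mult (star \<rho>) x2 x3) x4"
proof -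
  have G: "\<sigma>1 \<in> Graphs" "\<sigma>2 \<in> Graphs" "\<sigma>3 \<in> Graphs" "\<sigma>4 \<in> Graphs" "\<tau> \<in> Graphs" "\<rho> \<in> Graphs"
    using Film_Graphs[OF F4] Film_Graphs[OF F\<tau>(2)] Film_Graphs[OF F\<rho>(2)] by auto
  have all: "\<forall>\<sigma>1\<in>Graphs. \<forall>\<sigma>2\<in>Graphs. \<forall>\<sigma>3\<in>Graphs. \<forall>\<sigma>4\<in>Graphs. \<forall>\<sigma>\<in>Graphs. \<forall>\<rho>\<in>Graphs.
        Film [\<sigma>1, \<sigma>2, \<sigma>3, \<sigma>4] \<noteq> {} \<and>
        Film [\<sigma>1, \<sigma>2, \<sigma>] \<noteq> {} \<and> Film [star \<sigma>, \<sigma>3, \<sigma>4] \<noteq> {} \<and>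
        Film [\<sigma>4, \<sigma>1, \<rho>] \<noteq> {} \<and> Film [star \<rho>, \<sigma>2, \<sigma>3] \<noteq> {} \<longrightarrow>
        (\<forall>b b' F c c' G.
           is_basis scale (B \<sigma>) b \<and> is_basis scale (B (star \<sigma>)) b' \<and> inverse_matrix pair b b' F \<and>
           is_basis scale (B \<rho>) c \<and> is_basis scale (B (star \<rho>)) c' \<and> inverse_matrix pair c c' G \<longrightarrow>
           (\<forall>x1\<in>B \<sigma>1. \<forall>x2\<in>B \<sigma>2. \<forall>x3\<in>B \<sigma>3. \<forall>x4\<in>B \<sigma>4.
              (\<Sum>i<length b. \<Sum>j<length b'. tri x1 x2 (b ! i) * F i j * tri (b' ! j) x3 x4) =
              (\<Sum>i<length c. \<Sum>j<length c'. tri x4 x1 (c ! i) * G i j * tri (c' ! j) x2 x3)))"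
    using gf unfolding graph_frobenius_def by (elim conjE)
  have "Film [star (star \<tau>), \<sigma>3, \<sigma>4] \<noteq> {}" "Film [star (star \<rho>), \<sigma>2, \<sigma>3] \<noteq> {}" using F\<tau>(2) F\<rho>(2) by simp_all
  moreover have "is_basis scale (B (star \<tau>)) (b (star \<tau>)) \<and> is_basis scale (B (star (star \<tau>))) (b \<tau>) \<and>
      inverse_matrix pair (b (star \<tau>)) (b \<tau>) (F (star \<tau>)) \<and>
      is_basis scale (B (star \<rho>)) (b (star \<rho>)) \<and> is_basis scale (B (star (star \<rho>))) (b \<rho>) \<and>
      inverse_matrix pair (b (star \<rho>)) (b \<rho>) (F (star \<rho>))"
    using bas[of "star \<tau>"] bas[of \<tau>] bas[of "star \<rho>"] bas[of \<rho>] inv[of "star \<tau>"] inv[of "star \<rho>"] G by simp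
  moreover have "star \<tau> \<in> Graphs" "star \<rho> \<in> Graphs" using G by simp_all
  ultimately have eq: "(\<Sum>i<length (b (star \<tau>)). \<Sum>j<length (b \<tau>).
        tri x1 x2 (b (star \<tau>) ! i) * F (star \<tau>) i j * tri (b \<tau> ! j) x3 x4) =
      (\<Sum>i<length (b (star \<rho>)). \<Sum>j<length (b \<rho>).
        tri x4 x1 (b (star \<rho>) ! i) * F (star \<rho>) i j * tri (b \<rho> ! j) x2 x3)"
    using all[rule_format, of \<sigma>1 \<sigma>2 \<sigma>3 \<sigma>4 "star \<tau>" "star \<rho>" "b (star \<tau>)" "b \<tau>" "F (star \<tau>)"
        "b (star \<rho>)" "b \<rho>" "F (star \<rho>)" x1 x2 x3 x4] F4 F\<tau>(1) F\<rho>(1) G x by blast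
  have "tri (mult \<tau> x1 x2) x3 x4 = tri (mult \<rho> x4 x1) x2 x3"
    unfolding lin_mult[OF lin_tri(3)] using eq by simp
  also have "\<dots> = tri x2 x3 (mult \<rho> x4 x1)" using tri_rotate by simp
  also have "\<dots> = pair (mult (star \<rho>) x2 x3) (mult \<rho> x4 x1)"
    using pair_mult[of "star \<rho>" "mult \<rho> x4 x1" x2 x3] mult_in_B[of \<rho>] G by simp
  also have "\<dots> = pair (mult \<rho> x4 x1) (mult (star \<rho>) x2 x3)" by (rule pair_commute)
  also have "\<dots> = tri x4 x1 (mult (star \<rho>) x2 x3)"
    using pair_mult[of \<rho> "mult (star \<rho>) x2 x3" x4 x1] mult_in_B[of "star \<rho>"] G by simp
  also have "\<dots> = tri x1 (mult (star \<rho>) x2 x3) x4" by (rule tri_rotate)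
  finally show ?thesis .
qed

text \<open>A left-nested product whose targets are the classes of the growing set of vertices;
  \<open>S\<close> holds the vertices already absorbed into \<open>a\<close>.\<close>

fun nest :: "(nat set \<Rightarrow> 'c ograph set) \<Rightarrow> (nat \<Rightarrow> 'b) \<Rightarrow> 'b \<Rightarrow> nat set \<Rightarrow> nat list \<Rightarrow> 'b" where
  "nest cl x a S [] = a"
| "nest cl x a S (q # qs) = nest cl x (mult (cl (insert q S)) a (x q)) (insert q S) qs"

text \<open>The value at the empty list is a default; the algebra concerns non-empty arcs.\<close>

fun arc_product :: "(nat set \<Rightarrow> 'c ograph set) \<Rightarrow> (nat \<Rightarrow> 'b) \<Rightarrow> nat list \<Rightarrow> 'b" where
  "arc_product cl x [] = 0"
| "arc_product cl x (q # qs) = nest cl x (x q) {q} qs"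

lemma nest_snoc:
  "nest cl x a S (qs @ [q]) = mult (cl (insert q (set qs \<union> S))) (nest cl x a S qs) (x q)"
  by (induction qs arbitrary: a S) simp_all

lemma arc_product_snoc:
  "qs \<noteq> [] \<Longrightarrow> arc_product cl x (qs @ [q]) = mult (cl (set (qs @ [q]))) (arc_product cl x qs) (x q)"
  by (cases qs) (simp_all add: nest_snoc insert_commute)

lemma nest_cong:
  assumes "\<And>T. T \<subseteq> S \<union> set qs \<Longrightarrow> cl T = cl' T" "\<And>q. q \<in> set qs \<Longrightarrow> x q = x' q"
  shows "nest cl x a S qs = nest cl' x' a S qs"
  using assms
proof (induction qs arbitrary: a S)
  case (Cons q qs)
  have "cl (insert q S) = cl' (insert q S)" "x q = x' q" using Cons.prems by auto
  then show ?case using Cons.IH[of "insert q S"] Cons.prems by simp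
qed simp

lemma arc_product_cong:
  assumes "\<And>T. T \<subseteq> set qs \<Longrightarrow> cl T = cl' T" "\<And>q. q \<in> set qs \<Longrightarrow> x q = x' q"
  shows "arc_product cl x qs = arc_product cl' x' qs"
  using assms by (cases qs) (auto intro!: nest_cong)

context
  fixes \<Omega> :: "'c complex2" and qs :: "nat list" and x :: "nat \<Rightarrow> 'b"
  assumes film: "film_on \<Omega> qs" and x: "\<And>q. q \<in> verts \<Omega> \<Longrightarrow> x q \<in> B (vclass \<Omega> q)"
begin

lemma x_in: "q \<in> set qs \<Longrightarrow> x q \<in> B (arc_class \<Omega> {q})"
  using x film_onD(3)[OF film] vclass_arc_class[OF film_on_regular[OF film]] by simp

lemma product_in_B:
  assumes "rotated qs (as @ bs)" "as \<noteq> []" "bs \<noteq> []"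
  shows "arc_product (arc_class \<Omega>) x as \<in> B (arc_class \<Omega> (set as))"
proof (cases as rule: rev_cases)
  case (snoc cs q)
  show ?thesis
  proof (cases "cs = []")
    case True
    then show ?thesis using snoc x_in rotated_set[OF assms(1)] by auto
  next
    case False
    then show ?thesis
      using mult_in_B[OF arc_class_in_Graphs[OF film assms]]
      unfolding snoc arc_product_snoc[OF False] by simp
  qed
qed (use assms in simp)

text \<open>Tested against \<open>z\<close> in the space of the complementary arc \<open>cs\<close>,
  this is \<open>tri_mult\<close> for the four arcs \<open>as\<close>, \<open>bs\<close>,
  \<open>[q]\<close>, \<open>cs\<close>; the five surfaces required there come from
  \<open>Film_arcs\<close>.\<close>

lemma product_assoc:
  assumes r: "rotated qs (as @ bs @ [q] @ cs)" and ne: "as \<noteq> []" "bs \<noteq> []" "cs \<noteq> []"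
    and u: "u \<in> B (arc_class \<Omega> (set as))" and v: "v \<in> B (arc_class \<Omega> (set bs))"
  shows "mult (arc_class \<Omega> (set (as @ bs @ [q]))) (mult (arc_class \<Omega> (set (as @ bs))) u v) (x q) =
         mult (arc_class \<Omega> (set (as @ bs @ [q]))) u (mult (arc_class \<Omega> (set (bs @ [q]))) v (x q))"
proof (rule mult_cong_tri)
  let ?C = "\<lambda>l. arc_class \<Omega> (set l)"
  have r1: "rotated qs ((as @ bs @ [q]) @ cs)" using r by simp
  have r2: "rotated qs ((as @ bs) @ ([q] @ cs))" using r by simp
  \<comment> \<open>The arc \<open>cs @ as\<close> wraps around the end of the list; numbering from
    \<open>bs\<close> on makes it contiguous.\<close>
  have "rotated (as @ bs @ [q] @ cs) ((bs @ [q]) @ (cs @ as))"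
    unfolding rotated_def by (intro exI[of _ as] exI[of _ "bs @ [q] @ cs"]) simp
  then have r3: "rotated qs ((bs @ [q]) @ (cs @ as))" using r rotated_trans by blast
  have f: "film_on \<Omega> (as @ bs @ [q] @ cs)" using film_on_rotated[OF film r] .
  have f3: "film_on \<Omega> (bs @ [q] @ cs @ as)" using film_on_rotated[OF film r3] by simp
  show "?C (as @ bs @ [q]) \<in> Graphs" using arc_class_in_Graphs[OF film r1] ne by simp
  fix z assume "z \<in> B (star (?C (as @ bs @ [q])))"
  then have z: "z \<in> B (?C cs)" using arc_class_star[OF film r1] by simp
  have s2: "star (?C (as @ bs)) = ?C ([q] @ cs)" using arc_class_star[OF film r2] by simp
  have s3: "star (?C (bs @ [q])) = ?C (cs @ as)" using arc_class_star[OF film r3] by simp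
  have s3': "star (?C (cs @ as)) = ?C (bs @ [q])" unfolding s3[symmetric] by simp
  have "Film [?C as, ?C bs, ?C [q], ?C cs] \<noteq> {}"
    using Film_arcs[of \<Omega> "[]" "[as, bs, [q], cs]"] f ne by simp
  moreover have "Film [?C as, ?C bs, star (?C (as @ bs))] \<noteq> {}"
    unfolding s2 using Film_arcs[of \<Omega> "[]" "[as, bs, [q] @ cs]"] f ne by simp
  moreover have "Film [?C (as @ bs), ?C [q], ?C cs] \<noteq> {}"
    using Film_arcs[of \<Omega> "[]" "[as @ bs, [q], cs]"] f ne by simp
  moreover have "Film [?C cs, ?C as, star (?C (cs @ as))] \<noteq> {}"
  proof -
    have "Film [?C (bs @ [q]), ?C cs, ?C as] \<noteq> {}"
      using Film_arcs[of \<Omega> "[]" "[bs @ [q], cs, as]"] f3 ne by simp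
    then show ?thesis unfolding s3' using Film_rotate[of "[?C (bs @ [q])]" "[?C cs, ?C as]"] by simp
  qed
  moreover have "Film [?C (cs @ as), ?C bs, ?C [q]] \<noteq> {}"
  proof -
    have "Film [?C bs, ?C [q], ?C (cs @ as)] \<noteq> {}"
      using Film_arcs[of \<Omega> "[]" "[bs, [q], cs @ as]"] f3 ne by simp
    then show ?thesis using Film_rotate[of "[?C bs, ?C [q]]" "[?C (cs @ as)]"] by simp
  qed
  moreover have "q \<in> set qs" using rotated_set[OF r] by auto
  then have "x q \<in> B (?C [q])" using x_in by simp
  ultimately show "tri (mult (?C (as @ bs)) u v) (x q) z = tri u (mult (?C (bs @ [q])) v (x q)) z"
    using tri_mult[of "?C as" "?C bs" "?C [q]" "?C cs" "?C (as @ bs)" "?C (cs @ as)" u v "x q" z] u v z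
    unfolding s3' by simp
qed

text \<open>Induction on \<open>bs\<close> from the right, with associativity for its last vertex;
  \<open>cs\<close> supplies the fourth arc.\<close>

lemma nest_product:
  assumes "rotated qs (as @ bs @ cs)" "as \<noteq> []" "bs \<noteq> []" "cs \<noteq> []" and u: "u \<in> B (arc_class \<Omega> (set as))"
  shows "nest (arc_class \<Omega>) x u (set as) bs =
         mult (arc_class \<Omega> (set (as @ bs))) u (arc_product (arc_class \<Omega>) x bs)"
  using assms
proof (induction bs arbitrary: cs rule: rev_induct)
  case (snoc q bs)
  show ?case
  proof (cases "bs = []")
    case False
    have r: "rotated qs (as @ bs @ [q] @ cs)" using snoc.prems(1) by simp
    have "rotated (as @ bs @ [q] @ cs) (bs @ ([q] @ cs @ as))"
      unfolding rotated_def by (intro exI[of _ as] exI[of _ "bs @ [q] @ cs"]) simp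
    then have rb: "rotated qs (bs @ ([q] @ cs @ as))" using r rotated_trans by blast
    have IH: "nest (arc_class \<Omega>) x u (set as) bs =
        mult (arc_class \<Omega> (set (as @ bs))) u (arc_product (arc_class \<Omega>) x bs)"
      by (rule snoc.IH[of "[q] @ cs"]) (use r snoc.prems False in auto)
    have "arc_product (arc_class \<Omega>) x bs \<in> B (arc_class \<Omega> (set bs))"
      using product_in_B[OF rb False] by simp
    from product_assoc[OF r snoc.prems(2) False snoc.prems(4) u this] show ?thesis
      unfolding nest_snoc IH arc_product_snoc[OF False] by (simp add: Un_commute)
  qed simp
qed simp

text \<open>By duality both sides are values of \<open>tri\<close> at \<open>x q\<close> and the
  products over \<open>as\<close> and \<open>bs\<close>, up to a cyclic permutation of the
  arguments.\<close>

lemma split_shift: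
  assumes r: "rotated qs (as @ q # bs)" and ne: "as \<noteq> []" "bs \<noteq> []"
  shows "pair (arc_product (arc_class \<Omega>) x as) (arc_product (arc_class \<Omega>) x (q # bs)) =
         pair (arc_product (arc_class \<Omega>) x (as @ [q])) (arc_product (arc_class \<Omega>) x bs)"
proof -
  let ?P = "arc_product (arc_class \<Omega>) x" let ?C = "\<lambda>l. arc_class \<Omega> (set l)"
  have r1: "rotated qs ((q # bs) @ as)"
    using r rotated_append[of as "q # bs"] rotated_trans by blast
  have r1': "rotated qs ([q] @ bs @ as)" using r1 by simp
  have r2: "rotated qs ((as @ [q]) @ bs)" using r by simp
  have "rotated ((as @ [q]) @ bs) (bs @ (as @ [q]))" by (rule rotated_append)
  then have r3: "rotated qs (bs @ (as @ [q]))" using r2 rotated_trans by blast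
  have "q \<in> set qs" using rotated_set[OF r] by auto
  then have xq: "x q \<in> B (?C [q])" using x_in by simp
  have "?P (q # bs) = mult (?C (q # bs)) (x q) (?P bs)"
    using nest_product[OF r1' _ ne(2,1), of "x q"] xq by simp
  moreover have "?P as \<in> B (star (?C (q # bs)))"
    using product_in_B[OF r ne(1)] arc_class_star[OF film r1] by simp
  moreover have "?C (q # bs) \<in> Graphs" using arc_class_in_Graphs[OF film r1] ne by simp
  ultimately have "pair (?P as) (?P (q # bs)) = tri (x q) (?P bs) (?P as)"
    using pair_mult pair_commute by metis
  also have "\<dots> = tri (?P as) (x q) (?P bs)" by (rule tri_rotate[symmetric])
  also have "\<dots> = pair (?P (as @ [q])) (?P bs)"
  proof -
    have "?P bs \<in> B (star (?C (as @ [q])))"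
      using product_in_B[OF r3] ne arc_class_star[OF film r2] by simp
    moreover have "?C (as @ [q]) \<in> Graphs" using arc_class_in_Graphs[OF film r2] ne by simp
    ultimately show ?thesis using pair_mult unfolding arc_product_snoc[OF ne(1)] by metis
  qed
  finally show ?thesis .
qed

text \<open>Vertices move to the left factor one by one until only the last remains in the right
  one.\<close>

lemma split_last:
  assumes "rotated qs (as @ bs)" "as \<noteq> []" "bs \<noteq> []"
  shows "pair (arc_product (arc_class \<Omega>) x as) (arc_product (arc_class \<Omega>) x bs) =
         pair (arc_product (arc_class \<Omega>) x (butlast (as @ bs))) (x (last (as @ bs)))"
  using assms
proof (induction bs arbitrary: as)
  case (Cons q bs)
  show ?case
  proof (cases "bs = []")
    case False
    then show ?thesis
      using split_shift[OF Cons.prems(1,2) False] Cons.IH[of "as @ [q]"] Cons.prems by simp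
  qed simp
qed simp

text \<open>The splits \<open>l @ r\<close> and \<open>r @ l\<close> have the same value by symmetry
  of the pairing, and \<open>split_last\<close> links each of them to all splits of the same
  list.\<close>

lemma split_rotated:
  assumes "rotated qs (as @ bs)" "as \<noteq> []" "bs \<noteq> []"
  shows "pair (arc_product (arc_class \<Omega>) x as) (arc_product (arc_class \<Omega>) x bs) =
         pair (arc_product (arc_class \<Omega>) x (butlast qs)) (x (last qs))"
proof -
  obtain l r where lr: "qs = l @ r" "as @ bs = r @ l" using assms(1) unfolding rotated_def by blast
  show ?thesis
  proof (cases "l = [] \<or> r = []")
    case True
    then have "as @ bs = qs" using lr by auto
    then show ?thesis using split_last[OF assms] by simp
  next
    case False
    have "rotated qs (l @ r)" "rotated qs (r @ l)" using lr rotated_append by auto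
    then have "pair (arc_product (arc_class \<Omega>) x l) (arc_product (arc_class \<Omega>) x r) =
        pair (arc_product (arc_class \<Omega>) x (butlast qs)) (x (last qs))"
      "pair (arc_product (arc_class \<Omega>) x r) (arc_product (arc_class \<Omega>) x l) =
        pair (arc_product (arc_class \<Omega>) x (butlast (r @ l))) (x (last (r @ l)))"
      using split_last[of l r] split_last[of r l] False lr(1) by auto
    then show ?thesis using split_last[OF assms] pair_commute unfolding lr(2) by metis
  qed
qed

end

end

section \<open>Connected components\<close>

lemma restrict_complex_sel [simp]:
  "verts (restrict_complex \<Omega> C) = C"
  "edges (restrict_complex \<Omega> C) = {e \<in> edges \<Omega>. ends \<Omega> e \<subseteq> C}"
  "ends (restrict_complex \<Omega> C) = ends \<Omega>"
  "disks (restrict_complex \<Omega> C) = {d \<in> disks \<Omega>. disk_verts \<Omega> d \<subseteq> C}"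
  "bdry (restrict_complex \<Omega> C) = bdry \<Omega>"
  "color (restrict_complex \<Omega> C) = color \<Omega>"
  "cyc (restrict_complex \<Omega> C) = cyc \<Omega> \<inter> C \<times> C \<times> C"
  "disk_verts (restrict_complex \<Omega> C) = disk_verts \<Omega>"
  "disk_edges (restrict_complex \<Omega> C) = disk_edges \<Omega>"
  unfolding restrict_complex_def disk_verts_def[abs_def] disk_edges_def[abs_def] by simp_all

text \<open>Needed because \<open>cyclic_complex\<close>, applied to a restricted complex, restricts
  once more to its component.\<close>

lemma restrict_restrict_complex: "restrict_complex (restrict_complex \<Omega> C) C = restrict_complex \<Omega> C"
proof -
  have "disk_verts (restrict_complex \<Omega> C) = disk_verts \<Omega>" by (rule restrict_complex_sel)
  then show ?thesis unfolding restrict_complex_def[of "restrict_complex \<Omega> C"]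
    by (simp add: Int_absorb2 restrict_complex_def cong: conj_cong)
qed

lemma component_closed:
  assumes R: "regular_complex \<Omega>" and C: "C \<in> components_of \<Omega>"
  shows "C \<subseteq> verts \<Omega>" "C \<noteq> {}"
    and "e \<in> edges \<Omega> \<Longrightarrow> ends \<Omega> e \<inter> C \<noteq> {} \<Longrightarrow> ends \<Omega> e \<subseteq> C"
    and "d \<in> disks \<Omega> \<Longrightarrow> disk_verts \<Omega> d \<inter> C \<noteq> {} \<Longrightarrow> disk_verts \<Omega> d \<subseteq> C"
proof -
  have C': "C \<in> verts \<Omega> // joined \<Omega> (edges \<Omega>)" using C unfolding components_of_def .
  show "C \<subseteq> verts \<Omega>" using C' equiv_joined by (metis Union_quotient Union_upper)
  show "C \<noteq> {}" using C' equiv_joined in_quotient_imp_non_empty by blast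
  have E: "\<forall>e\<in>edges \<Omega>. ends \<Omega> e \<subseteq> verts \<Omega>" using regular_complexD(4)[OF R] by simp
  have closed: "v \<in> C" if "u \<in> C" "e \<in> edges \<Omega>" "ends \<Omega> e = {u, v}" for u v e
    using joined_closed[OF E _ C' that] by blast
  show edge: "ends \<Omega> e \<subseteq> C" if "e \<in> edges \<Omega>" "ends \<Omega> e \<inter> C \<noteq> {}" for e
  proof -
    have "card (ends \<Omega> e) = 2" using regular_complexD(4)[OF R] that(1) by simp
    then obtain u v where uv: "ends \<Omega> e = {u, v}" by (meson card_2_iff)
    then have "ends \<Omega> e = {v, u}" by blast
    then have "u \<in> C \<Longrightarrow> v \<in> C" "v \<in> C \<Longrightarrow> u \<in> C" using closed[OF _ that(1)] uv by blast+
    then show ?thesis using that(2) uv by auto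
  qed
  show "disk_verts \<Omega> d \<subseteq> C" if d: "d \<in> disks \<Omega>" "disk_verts \<Omega> d \<inter> C \<noteq> {}" for d
  proof -
    obtain u where u: "u \<in> disk_verts \<Omega> d" "u \<in> C" using d(2) by blast
    show ?thesis
    proof (rule disk_verts_closed[OF R d(1) u])
      fix u e v assume uv: "(u, e, v) \<in> bdry \<Omega> d" "u \<in> C"
      have "ends \<Omega> e = {u, v}" "e \<in> edges \<Omega>" using bdry_ends(1,2)[OF R d(1) uv(1)] by simp_all
      then show "v \<in> C" using edge[of e] uv(2) by simp
    qed
  qed
qed

lemma components_cover:
  assumes "regular_complex \<Omega>" shows "\<Union> (components_of \<Omega>) = verts \<Omega>"
  unfolding components_of_def using equiv_joined by (rule Union_quotient)

lemma component_disjoint: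
  assumes "C \<in> components_of \<Omega>" "C' \<in> components_of \<Omega>" "C \<inter> C' \<noteq> {}" shows "C = C'"
  using assms equiv_joined quotient_disj unfolding components_of_def by metis

lemma finite_components:
  assumes "regular_complex \<Omega>" shows "finite (components_of \<Omega>)"
  using regular_complexD(1)[OF assms] components_cover[OF assms] finite_UnionD by metis

lemma traverses_restrict:
  "traverses (restrict_complex \<Omega> C) d us es \<longleftrightarrow> traverses \<Omega> d us es \<and> (\<forall>e\<in>set es. ends \<Omega> e \<subseteq> C)"
  unfolding traverses_def by auto

lemma traverses_ends:
  assumes "traverses \<Omega> d us es" "e \<in> set es" shows "ends \<Omega> e \<subseteq> disk_verts \<Omega> d"
proof -
  obtain i where "i < length us" "e = es ! i"
    using assms unfolding traverses_def by (metis in_set_conv_nth)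
  moreover from this have "us ! (Suc i mod length us) \<in> set us" by (intro nth_mem mod_less_divisor) auto
  ultimately show ?thesis
    using assms(1) unfolding traverses_disk_verts[OF assms(1)] traverses_def by auto
qed

lemma film_regular: "film_surface \<Omega> \<Longrightarrow> regular_complex \<Omega>"
  unfolding film_surface_def cyclic_complex_def almost_cyclic_def by blast

text \<open>Every cell that meets a component lies in it, so regularity, the cyclic order and the
  graph-cuts are inherited, and the restricted complex has the single component
  \<open>C\<close>.\<close>

lemma film_on_component:
  assumes film: "film_surface \<Omega>" and C: "C \<in> components_of \<Omega>"
  shows "\<exists>qs. film_on (restrict_complex \<Omega> C) qs"
proof -
  let ?\<Omega> = "restrict_complex \<Omega> C"
  have ac: "almost_cyclic \<Omega>" and cc: "cyclic_complex \<Omega>"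
    using film unfolding film_surface_def cyclic_complex_def by simp_all
  note R = film_regular[OF film]
  note cl = component_closed[OF R C]
  have tr: "\<exists>us es. traverses ?\<Omega> d us es" if "d \<in> disks ?\<Omega>" for d
  proof -
    have d: "d \<in> disks \<Omega>" "disk_verts \<Omega> d \<subseteq> C" using that by auto
    obtain us es where "traverses \<Omega> d us es" using regular_disk[OF R d(1)] .
    then show ?thesis unfolding traverses_restrict using traverses_ends d(2) by blast
  qed
  have R': "regular_complex ?\<Omega>" unfolding regular_complex_def
  proof (intro conjI)
    show "finite (verts ?\<Omega>)" using regular_complexD(1)[OF R] cl(1) finite_subset by auto
    show "finite (edges ?\<Omega>)" "finite (disks ?\<Omega>)" using regular_complexD(2,3)[OF R] by simp_all
    show "\<forall>e\<in>edges ?\<Omega>. ends ?\<Omega> e \<subseteq> verts ?\<Omega> \<and> card (ends ?\<Omega> e) = 2"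
      using regular_complexD(4)[OF R] by simp
    show "\<forall>d\<in>disks ?\<Omega>. \<exists>us es. traverses ?\<Omega> d us es" using tr by blast
    show "edges ?\<Omega> = (\<Union>d\<in>disks ?\<Omega>. disk_edges ?\<Omega> d)"
    proof (intro subset_antisym subsetI)
      fix e assume e: "e \<in> edges ?\<Omega>"
      then obtain d where d: "d \<in> disks \<Omega>" "e \<in> disk_edges \<Omega> d" using regular_complexD(6)[OF R] by auto
      then obtain u v where uv: "(u, e, v) \<in> bdry \<Omega> d" unfolding disk_edges_def by blast
      have "u \<in> disk_verts \<Omega> d" "u \<in> C"
        using disk_verts_bdry[OF R d(1) uv] bdry_ends(2)[OF R d(1) uv] e by auto
      then have "disk_verts \<Omega> d \<subseteq> C" using cl(4)[OF d(1)] by blast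
      then show "e \<in> (\<Union>d\<in>disks ?\<Omega>. disk_edges ?\<Omega> d)" using d by auto
    next
      fix e assume "e \<in> (\<Union>d\<in>disks ?\<Omega>. disk_edges ?\<Omega> d)"
      then obtain d u v where d: "d \<in> disks \<Omega>" "disk_verts \<Omega> d \<subseteq> C" "(u, e, v) \<in> bdry \<Omega> d"
        unfolding restrict_complex_sel disk_edges_def by blast
      then show "e \<in> edges ?\<Omega>"
        using bdry_ends(1,2)[OF R d(1,3)] disk_verts_bdry[OF R d(1,3)] by auto
    qed
    show "verts ?\<Omega> = (\<Union>d\<in>disks ?\<Omega>. disk_verts ?\<Omega> d)"
    proof (intro subset_antisym subsetI)
      fix v assume v: "v \<in> verts ?\<Omega>"
      then obtain d where d: "d \<in> disks \<Omega>" "v \<in> disk_verts \<Omega> d"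
        using regular_complexD(7)[OF R] cl(1) by auto
      then have "disk_verts \<Omega> d \<subseteq> C" using cl(4)[OF d(1)] v by auto
      then show "v \<in> (\<Union>d\<in>disks ?\<Omega>. disk_verts ?\<Omega> d)" using d by auto
    qed auto
  qed
  have "joined ?\<Omega> (edges ?\<Omega>) = C \<times> C"
  proof -
    have "(u, v) \<in> {(a, b). \<exists>e\<in>edges ?\<Omega>. ends \<Omega> e = {a, b}}\<^sup>* \<and> v \<in> C"
      if "(u, v) \<in> {(a, b). \<exists>e\<in>edges \<Omega>. ends \<Omega> e = {a, b}}\<^sup>*" "u \<in> C" for u v
      using that
    proof (induction rule: rtrancl_induct)
      case (step y z)
      then obtain e where e: "e \<in> edges \<Omega>" "ends \<Omega> e = {y, z}" by blast
      have "ends \<Omega> e \<subseteq> C" using cl(3)[OF e(1)] e(2) step by blast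
      then have "(y, z) \<in> {(a, b). \<exists>e\<in>edges ?\<Omega>. ends \<Omega> e = {a, b}}" "z \<in> C" using e by auto
      then show ?case using step.IH[OF step.prems] by (meson rtrancl.rtrancl_into_rtrancl)
    qed simp
    moreover have "(u, v) \<in> joined \<Omega> (edges \<Omega>)" if "u \<in> C" "v \<in> C" for u v
      using C that equiv_joined unfolding components_of_def
      by (metis in_quotient_imp_in_rel insert_subset empty_subsetI)
    ultimately have "(u, v) \<in> joined ?\<Omega> (edges ?\<Omega>)" if "u \<in> C" "v \<in> C" for u v
      using that unfolding joined_def restrict_complex_sel by blast
    then show ?thesis unfolding joined_def by auto
  qed
  then have comp: "components_of ?\<Omega> = {C}"
    unfolding components_of_def using cl(2) by (auto simp: quotient_def)
  have conn: "connected_complex ?\<Omega>" unfolding connected_complex_def comp by simp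
  have "almost_cyclic ?\<Omega>" unfolding almost_cyclic_def comp
  proof (intro conjI R' ballI allI impI)
    show "cyc ?\<Omega> \<subseteq> (\<Union>C\<in>{C}. C \<times> C \<times> C)" by simp
    fix C' assume "C' \<in> {C}"
    moreover have "cyclic_order_on C (cyc \<Omega> \<inter> C \<times> C \<times> C)"
      using ac C unfolding almost_cyclic_def by blast
    ultimately show "cyclic_order_on C' (cyc ?\<Omega> \<inter> C' \<times> C' \<times> C')" by (simp add: Int_assoc)
  next
    fix d us es assume d: "d \<in> disks ?\<Omega>" and t: "traverses ?\<Omega> d us es"
    then have t': "traverses \<Omega> d us es" unfolding traverses_restrict by blast
    have "d \<in> disks \<Omega>" using d by simp
    moreover have "\<forall>d\<in>disks \<Omega>. \<forall>us es. traverses \<Omega> d us es \<longrightarrow> in_cyclic_order (cyc \<Omega>) us"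
      using ac unfolding almost_cyclic_def by (elim conjE)
    ultimately have io: "in_cyclic_order (cyc \<Omega>) us" using t' by blast
    have "set us \<subseteq> C" using traverses_disk_verts[OF t'] d by simp
    then show "in_cyclic_order (cyc ?\<Omega>) us"
      by (intro in_cyclic_order_cong[OF _ io]) (auto simp: subset_iff)
  qed
  moreover have "division ?\<Omega> A B \<longrightarrow> (\<exists>P D. graph_cut ?\<Omega> P D A B)" for A B
    using cc C unfolding cyclic_complex_def by blast
  ultimately have "cyclic_complex ?\<Omega>"
    unfolding cyclic_complex_def comp by (simp add: restrict_restrict_complex)
  moreover have "inj_on (color ?\<Omega>) {d \<in> disks ?\<Omega>. disk_verts ?\<Omega> d \<subseteq> C}"
  proof -
    have "inj_on (color \<Omega>) {d \<in> disks \<Omega>. disk_verts \<Omega> d \<subseteq> C}"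
      using film C unfolding film_surface_def by blast
    then show ?thesis by (simp add: conj_assoc)
  qed
  ultimately have "film_surface ?\<Omega>" unfolding film_surface_def comp by simp
  then show ?thesis using ex_film_on conn by blast
qed

lemma arc_graph_component:
  assumes R: "regular_complex \<Omega>" and C: "C \<in> components_of \<Omega>" and q: "q \<in> C"
  shows "arc_graph (restrict_complex \<Omega> C) {q} = arc_graph \<Omega> {q}"
proof -
  note cl = component_closed[OF R C]
  have "crossing (restrict_complex \<Omega> C) {q} = crossing \<Omega> {q}"
    unfolding crossing_def using cl(3) q by auto
  moreover have "enters (restrict_complex \<Omega> C) {q} = enters \<Omega> {q}"
    "leaves (restrict_complex \<Omega> C) {q} = leaves \<Omega> {q}"
  proof -
    have "disk_verts \<Omega> d \<subseteq> C" if "d \<in> disks \<Omega>" "(u, e, v) \<in> bdry \<Omega> d" "u = q \<or> v = q" for d u e v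
      using cl(4)[OF that(1)] disk_verts_bdry[OF R that(1,2)] that(3) q by blast
    then show "enters (restrict_complex \<Omega> C) {q} = enters \<Omega> {q}"
      "leaves (restrict_complex \<Omega> C) {q} = leaves \<Omega> {q}"
      unfolding enters_def leaves_def fun_eq_iff restrict_complex_sel by blast+
  qed
  ultimately show ?thesis unfolding arc_graph_def by simp
qed

lemma vclass_component:
  assumes film: "film_surface \<Omega>" and C: "C \<in> components_of \<Omega>" and q: "q \<in> C"
  shows "vclass (restrict_complex \<Omega> C) q = vclass \<Omega> q"
    and "conn_graph (arc_graph \<Omega> {q})"
proof -
  obtain qs where qs: "film_on (restrict_complex \<Omega> C) qs" using film_on_component[OF film C] by blast
  note R = film_regular[OF film]
  show "vclass (restrict_complex \<Omega> C) q = vclass \<Omega> q"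
    unfolding vclass_arc_class[OF R] vclass_arc_class[OF film_on_regular[OF qs]] arc_class_def
      arc_graph_component[OF R C q] ..
  show "conn_graph (arc_graph \<Omega> {q})"
    using conn_vertex_graph[OF qs, of q] q unfolding arc_graph_component[OF R C q] by simp
qed

lemma film_conn_graph:
  assumes film: "film_surface \<Omega>" and q: "q \<in> verts \<Omega>"
  shows "conn_graph (arc_graph \<Omega> {q})" "vclass \<Omega> q \<in> Graphs"
proof -
  note R = film_regular[OF film]
  obtain C where C: "C \<in> components_of \<Omega>" "q \<in> C" using components_cover[OF R] q by blast
  show "conn_graph (arc_graph \<Omega> {q})" using vclass_component(2)[OF film C] .
  then show "vclass \<Omega> q \<in> Graphs"
    unfolding vclass_arc_class[OF R] arc_class_def by (rule graph_class_in_Graphs)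
qed

text \<open>The way back from components to a surface, needed for disjoint unions and hence for the
  results of cuts. The members of \<open>\<C>\<close> are the components because each is connected
  and no cell joins two of them.\<close>

lemma film_surfaceI:
  assumes fin: "finite (verts \<Omega>)" "finite (edges \<Omega>)" "finite (disks \<Omega>)"
    and V: "verts \<Omega> = \<Union> \<C>" and disj: "\<And>C C'. C \<in> \<C> \<Longrightarrow> C' \<in> \<C> \<Longrightarrow> C \<inter> C' \<noteq> {} \<Longrightarrow> C = C'"
    and E: "\<And>e. e \<in> edges \<Omega> \<Longrightarrow> \<exists>C\<in>\<C>. ends \<Omega> e \<subseteq> C"
    and D: "\<And>d. d \<in> disks \<Omega> \<Longrightarrow> \<exists>C\<in>\<C>. disk_verts \<Omega> d \<subseteq> C"
    and cyc: "cyc \<Omega> \<subseteq> (\<Union>C\<in>\<C>. C \<times> C \<times> C)"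
    and film: "\<And>C. C \<in> \<C> \<Longrightarrow> \<exists>qs. film_on (restrict_complex \<Omega> C) qs"
  shows "film_surface \<Omega> \<and> components_of \<Omega> = \<C>"
proof -
  have reg: "regular_complex (restrict_complex \<Omega> C)" if "C \<in> \<C>" for C
    using film[OF that] film_on_regular by blast
  have ne: "C \<noteq> {}" if "C \<in> \<C>" for C
    using film[OF that] film_onD(1,3) by fastforce
  have R: "regular_complex \<Omega>" unfolding regular_complex_def
  proof (intro conjI fin)
    show "\<forall>e\<in>edges \<Omega>. ends \<Omega> e \<subseteq> verts \<Omega> \<and> card (ends \<Omega> e) = 2"
    proof
      fix e assume e: "e \<in> edges \<Omega>"
      then obtain C where C: "C \<in> \<C>" "ends \<Omega> e \<subseteq> C" using E by blast
      then show "ends \<Omega> e \<subseteq> verts \<Omega> \<and> card (ends \<Omega> e) = 2"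
        using regular_complexD(4)[OF reg[OF C(1)]] e V by auto
    qed
    show "\<forall>d\<in>disks \<Omega>. \<exists>us es. traverses \<Omega> d us es"
    proof
      fix d assume d: "d \<in> disks \<Omega>"
      then obtain C where C: "C \<in> \<C>" "disk_verts \<Omega> d \<subseteq> C" using D by blast
      then have "d \<in> disks (restrict_complex \<Omega> C)" using d by simp
      then show "\<exists>us es. traverses \<Omega> d us es"
        using regular_disk[OF reg[OF C(1)]] unfolding traverses_restrict by metis
    qed
    show "edges \<Omega> = (\<Union>d\<in>disks \<Omega>. disk_edges \<Omega> d)"
    proof (intro subset_antisym subsetI)
      fix e assume e: "e \<in> edges \<Omega>"
      then obtain C where C: "C \<in> \<C>" "ends \<Omega> e \<subseteq> C" using E by blast
      then show "e \<in> (\<Union>d\<in>disks \<Omega>. disk_edges \<Omega> d)"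
        using regular_complexD(6)[OF reg[OF C(1)]] e by auto
    next
      fix e assume "e \<in> (\<Union>d\<in>disks \<Omega>. disk_edges \<Omega> d)"
      then obtain d where d: "d \<in> disks \<Omega>" "e \<in> disk_edges \<Omega> d" by blast
      then obtain C where C: "C \<in> \<C>" "disk_verts \<Omega> d \<subseteq> C" using D by blast
      then have "e \<in> edges (restrict_complex \<Omega> C)"
        using regular_complexD(6)[OF reg[OF C(1)]] d by auto
      then show "e \<in> edges \<Omega>" by simp
    qed
    show "verts \<Omega> = (\<Union>d\<in>disks \<Omega>. disk_verts \<Omega> d)"
    proof (intro subset_antisym subsetI)
      fix v assume "v \<in> verts \<Omega>"
      then obtain C where C: "C \<in> \<C>" "v \<in> C" using V by blast
      then show "v \<in> (\<Union>d\<in>disks \<Omega>. disk_verts \<Omega> d)"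
        using regular_complexD(7)[OF reg[OF C(1)]] by auto
    next
      fix v assume "v \<in> (\<Union>d\<in>disks \<Omega>. disk_verts \<Omega> d)"
      then show "v \<in> verts \<Omega>" using D V by blast
    qed
  qed
  have "joined \<Omega> (edges \<Omega>) `` {u} = C" if C: "C \<in> \<C>" and u: "u \<in> C" for C u
  proof (intro subset_antisym subsetI)
    fix v assume "v \<in> joined \<Omega> (edges \<Omega>) `` {u}"
    then have "(u, v) \<in> {(a, b). \<exists>e\<in>edges \<Omega>. ends \<Omega> e = {a, b}}\<^sup>*" unfolding joined_def by blast
    then show "v \<in> C"
    proof (induction rule: rtrancl_induct)
      case (step y z)
      then obtain e where e: "e \<in> edges \<Omega>" "ends \<Omega> e = {y, z}" by blast
      then obtain C' where "C' \<in> \<C>" "ends \<Omega> e \<subseteq> C'" using E by blast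
      then show ?case using disj[OF _ C, of C'] e step.IH by blast
    qed (rule u)
  next
    fix v assume v: "v \<in> C"
    obtain qs where "film_on (restrict_complex \<Omega> C) qs" using film[OF C] by blast
    from film_on_joined[OF this] have "(u, v) \<in> joined (restrict_complex \<Omega> C) (edges (restrict_complex \<Omega> C))"
      using u v by simp
    then have "(u, v) \<in> {(a, b). \<exists>e\<in>edges (restrict_complex \<Omega> C). ends \<Omega> e = {a, b}}\<^sup>*"
      unfolding joined_def by simp
    moreover have "{(a, b). \<exists>e\<in>edges (restrict_complex \<Omega> C). ends \<Omega> e = {a, b}} \<subseteq>
        {(a, b). \<exists>e\<in>edges \<Omega>. ends \<Omega> e = {a, b}}" by auto
    ultimately have "(u, v) \<in> {(a, b). \<exists>e\<in>edges \<Omega>. ends \<Omega> e = {a, b}}\<^sup>*" using rtrancl_mono by blast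
    then show "v \<in> joined \<Omega> (edges \<Omega>) `` {u}" using C u v V unfolding joined_def by blast
  qed
  then have comp: "components_of \<Omega> = \<C>"
    unfolding components_of_def quotient_def V using ne by (auto; blast)
  have films: "film_surface (restrict_complex \<Omega> C)" "components_of (restrict_complex \<Omega> C) = {C}"
    if "C \<in> \<C>" for C
    using film[OF that] film_on_imp_film_surface(1) film_on_components by fastforce+
  then have ac: "almost_cyclic (restrict_complex \<Omega> C)" "cyclic_complex (restrict_complex \<Omega> C)" if "C \<in> \<C>" for C
    using that unfolding film_surface_def cyclic_complex_def by blast+
  have "almost_cyclic \<Omega>" unfolding almost_cyclic_def comp
  proof (intro conjI R cyc ballI allI impI)
    fix C assume C: "C \<in> \<C>"
    have "cyclic_order_on C (cyc (restrict_complex \<Omega> C) \<inter> C \<times> C \<times> C)"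
      using ac(1)[OF C] films(2)[OF C] unfolding almost_cyclic_def by simp
    then show "cyclic_order_on C (cyc \<Omega> \<inter> C \<times> C \<times> C)" by (simp add: Int_assoc)
  next
    fix d us es assume d: "d \<in> disks \<Omega>" and t: "traverses \<Omega> d us es"
    obtain C where C: "C \<in> \<C>" "disk_verts \<Omega> d \<subseteq> C" using D[OF d] by blast
    have "traverses (restrict_complex \<Omega> C) d us es"
      unfolding traverses_restrict using t traverses_ends C(2) by blast
    moreover have "d \<in> disks (restrict_complex \<Omega> C)" using d C by simp
    ultimately have "in_cyclic_order (cyc (restrict_complex \<Omega> C)) us"
      using ac(1)[OF C(1)] unfolding almost_cyclic_def by blast
    then show "in_cyclic_order (cyc \<Omega>) us" by (rule in_cyclic_order_cong[rotated]) simp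
  qed
  moreover have "\<exists>P D. graph_cut (restrict_complex \<Omega> C) P D A B"
    if "C \<in> \<C>" "division (restrict_complex \<Omega> C) A B" for C A B
    using ac(2)[OF that(1)] films(2)[OF that(1)] that(2) restrict_restrict_complex[of \<Omega> C]
    unfolding cyclic_complex_def by simp
  ultimately have "cyclic_complex \<Omega>" unfolding cyclic_complex_def comp by blast
  moreover have "inj_on (color \<Omega>) {d \<in> disks \<Omega>. disk_verts \<Omega> d \<subseteq> C}" if C: "C \<in> \<C>" for C
    using film[OF C] film_onD(11) by fastforce
  ultimately show ?thesis using comp unfolding film_surface_def by simp
qed

section \<open>Components under isomorphisms and disjoint unions\<close>

lemma film_iso_components:
  assumes R: "regular_complex \<Omega>" and R': "regular_complex \<Omega>'" and iso: "film_iso fv fe fd \<Omega> \<Omega>'"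
  shows "components_of \<Omega>' = (`) fv ` components_of \<Omega>"
proof -
  have iv: "inj_on fv (verts \<Omega>)" and V: "verts \<Omega>' = fv ` verts \<Omega>" and E: "edges \<Omega>' = fe ` edges \<Omega>"
    and ends: "\<And>e. e \<in> edges \<Omega> \<Longrightarrow> ends \<Omega>' (fe e) = fv ` ends \<Omega> e"
    using iso unfolding film_iso_def bij_betw_def by auto
  let ?r = "{(a, b). \<exists>e\<in>edges \<Omega>. ends \<Omega> e = {a, b}}" and ?r' = "{(a, b). \<exists>e\<in>edges \<Omega>'. ends \<Omega>' e = {a, b}}"
  have 1: "(fv u, fv v) \<in> ?r'\<^sup>*" if "(u, v) \<in> ?r\<^sup>*" for u v
  proof (rule rtrancl_map[of ?r fv, OF _ that])
    fix a b assume "(a, b) \<in> ?r"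
    then obtain e where "e \<in> edges \<Omega>" "ends \<Omega> e = {a, b}" by blast
    then have "fe e \<in> edges \<Omega>'" "ends \<Omega>' (fe e) = {fv a, fv b}" using E ends by auto
    then show "(fv a, fv b) \<in> ?r'\<^sup>*" by blast
  qed
  have 2: "(u, v) \<in> ?r\<^sup>*" if uv: "(fv u, fv v) \<in> ?r'\<^sup>*" "u \<in> verts \<Omega>" "v \<in> verts \<Omega>" for u v
  proof -
    let ?g = "inv_into (verts \<Omega>) fv"
    have "(?g (fv u), ?g (fv v)) \<in> ?r\<^sup>*"
    proof (rule rtrancl_map[of ?r' ?g, OF _ uv(1)])
      fix a b assume "(a, b) \<in> ?r'"
      then obtain e where e: "e \<in> edges \<Omega>" "ends \<Omega>' (fe e) = {a, b}" unfolding E by blast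
      then have e2: "fv ` ends \<Omega> e = {a, b}" using ends by simp
      have "ends \<Omega> e \<subseteq> verts \<Omega>" using regular_complexD(4)[OF R] e(1) by blast
      then have "?g ` fv ` ends \<Omega> e = ends \<Omega> e" by (rule inv_into_image_cancel[OF iv])
      then have "ends \<Omega> e = {?g a, ?g b}" using e2 by simp
      then show "(?g a, ?g b) \<in> ?r\<^sup>*" using e(1) by blast
    qed
    then show ?thesis using uv iv by simp
  qed
  have "joined \<Omega>' (edges \<Omega>') `` {fv u} = fv ` (joined \<Omega> (edges \<Omega>) `` {u})" if u: "u \<in> verts \<Omega>" for u
  proof -
    have "(fv u, fv v) \<in> ?r'\<^sup>* \<longleftrightarrow> (u, v) \<in> ?r\<^sup>*" if "v \<in> verts \<Omega>" for v
      using 1[of u v] 2[OF _ u that] by (intro iffI)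
    moreover have "joined \<Omega> (edges \<Omega>) `` {u} = {v \<in> verts \<Omega>. (u, v) \<in> ?r\<^sup>*}"
      "joined \<Omega>' (edges \<Omega>') `` {fv u} = {w \<in> fv ` verts \<Omega>. (fv u, w) \<in> ?r'\<^sup>*}"
      using u V unfolding joined_def by auto
    ultimately show ?thesis by auto
  qed
  then show ?thesis unfolding components_of_def quotient_def V by (auto simp: image_UN)
qed

text \<open>Only the numbering has to be transported; that the image component is a connected film
  surface follows from \<open>film_on_component\<close>.\<close>

lemma film_iso_component_film_on:
  assumes film: "film_surface \<Omega>" "film_surface \<Omega>'" and iso: "film_iso fv fe fd \<Omega> \<Omega>'"
    and C: "C \<in> components_of \<Omega>" and qs: "film_on (restrict_complex \<Omega> C) qs"
  shows "film_on (restrict_complex \<Omega>' (fv ` C)) (map fv qs)"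
proof -
  note R = film_regular[OF film(1)] film_regular[OF film(2)]
  have iv: "inj_on fv (verts \<Omega>)" and cyc: "cyc \<Omega>' = (\<lambda>(a, b, c). (fv a, fv b, fv c)) ` cyc \<Omega>"
    using iso unfolding film_iso_def bij_betw_def by auto
  have "fv ` C \<in> components_of \<Omega>'" using film_iso_components[OF R iso] C by blast
  then obtain qs' where "film_on (restrict_complex \<Omega>' (fv ` C)) qs'" using film_on_component[OF film(2)] by blast
  note F' = film_on_imp_film_surface[OF this]
  have num: "set qs = C" "in_cyclic_order (cyc \<Omega> \<inter> C \<times> C \<times> C) qs"
    using film_on_numbering[OF qs] unfolding numbering_def by auto
  have "inj_on fv (set qs)" using inj_on_subset[OF iv component_closed(1)[OF R(1) C]] num(1) by simp
  moreover have "distinct qs" using num(2) in_cyclic_order_distinct by blast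
  ultimately have d: "distinct (map fv qs)" by (simp add: distinct_map)
  have "(map fv qs ! i, map fv qs ! j, map fv qs ! k) \<in> cyc \<Omega>' \<inter> fv ` C \<times> fv ` C \<times> fv ` C"
    if "i < j" "j < k" "k < length (map fv qs)" for i j k
  proof -
    have "(qs ! i, qs ! j, qs ! k) \<in> cyc \<Omega> \<inter> C \<times> C \<times> C"
      using num(2) that unfolding in_cyclic_order_def by simp
    then show ?thesis using that unfolding cyc by (auto intro!: rev_image_eqI)
  qed
  then have "in_cyclic_order (cyc \<Omega>' \<inter> fv ` C \<times> fv ` C \<times> fv ` C) (map fv qs)"
    unfolding in_cyclic_order_def using d by blast
  then have "numbering (restrict_complex \<Omega>' (fv ` C)) (map fv qs)"
    unfolding numbering_def using num(1) by simp
  then show ?thesis using film_on_if_numbering F' by blast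
qed

lemma disjoint_union_swap: "disjoint_union \<Omega>1 \<Omega>2 \<Omega> \<Longrightarrow> disjoint_union \<Omega>2 \<Omega>1 \<Omega>"
  unfolding disjoint_union_def by (auto simp: Un_commute Int_commute)

text \<open>The two records need not be equal, since \<open>ends\<close>, \<open>bdry\<close> and
  \<open>color\<close> may differ off the cells of the component; the identity maps are an
  isomorphism nevertheless.\<close>

lemma disjoint_union_left:
  assumes film: "film_surface \<Omega>1" "film_surface \<Omega>2" and u: "disjoint_union \<Omega>1 \<Omega>2 \<Omega>"
    and C: "C \<in> components_of \<Omega>1"
  shows "film_iso id id id (restrict_complex \<Omega>1 C) (restrict_complex \<Omega> C)"
proof -
  note R = film_regular[OF film(1)] and R2 = film_regular[OF film(2)]
  have V: "verts \<Omega>1 \<inter> verts \<Omega>2 = {}" and E: "edges \<Omega> = edges \<Omega>1 \<union> edges \<Omega>2"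
    and D: "disks \<Omega> = disks \<Omega>1 \<union> disks \<Omega>2" and cyc: "cyc \<Omega> = cyc \<Omega>1 \<union> cyc \<Omega>2"
    and e1: "\<And>e. e \<in> edges \<Omega>1 \<Longrightarrow> ends \<Omega> e = ends \<Omega>1 e" and e2: "\<And>e. e \<in> edges \<Omega>2 \<Longrightarrow> ends \<Omega> e = ends \<Omega>2 e"
    and d1: "\<And>d. d \<in> disks \<Omega>1 \<Longrightarrow> bdry \<Omega> d = bdry \<Omega>1 d \<and> color \<Omega> d = color \<Omega>1 d"
    and d2: "\<And>d. d \<in> disks \<Omega>2 \<Longrightarrow> bdry \<Omega> d = bdry \<Omega>2 d"
    using u unfolding disjoint_union_def by auto
  have CV: "C \<inter> verts \<Omega>2 = {}" using component_closed(1)[OF R C] V by blast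
  have "\<not> ends \<Omega>2 e \<subseteq> C" if e: "e \<in> edges \<Omega>2" for e
  proof
    assume "ends \<Omega>2 e \<subseteq> C"
    then have "ends \<Omega>2 e = {}" using regular_complexD(4)[OF R2] e CV by blast
    then show False using regular_complexD(4)[OF R2] e by force
  qed
  then have edges: "{e \<in> edges \<Omega>. ends \<Omega> e \<subseteq> C} = {e \<in> edges \<Omega>1. ends \<Omega>1 e \<subseteq> C}"
    unfolding E using e1 e2 by auto
  have dv: "disk_verts \<Omega> d = disk_verts \<Omega>1 d" if "d \<in> disks \<Omega>1" for d
    using d1[OF that] unfolding disk_verts_def by simp
  have dv2: "disk_verts \<Omega> d = disk_verts \<Omega>2 d" if "d \<in> disks \<Omega>2" for d
    using d2[OF that] unfolding disk_verts_def by simp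
  have "\<not> disk_verts \<Omega>2 d \<subseteq> C" if d: "d \<in> disks \<Omega>2" for d
    using disk_verts_subset[OF R2 d] disk_verts_nonempty[OF R2 d] CV by blast
  then have disks: "{d \<in> disks \<Omega>. disk_verts \<Omega> d \<subseteq> C} = {d \<in> disks \<Omega>1. disk_verts \<Omega>1 d \<subseteq> C}"
    unfolding D using dv dv2 by auto
  have "cyc \<Omega>2 \<inter> C \<times> C \<times> C = {}"
  proof -
    have "cyc \<Omega>2 \<subseteq> (\<Union>C\<in>components_of \<Omega>2. C \<times> C \<times> C)"
      using film(2) unfolding film_surface_def cyclic_complex_def almost_cyclic_def by blast
    then show ?thesis using components_cover[OF R2] CV by blast
  qed
  then have "cyc \<Omega> \<inter> C \<times> C \<times> C = cyc \<Omega>1 \<inter> C \<times> C \<times> C" unfolding cyc by blast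
  then show ?thesis unfolding film_iso_def restrict_complex_sel edges disks
    using e1 d1 by (auto simp: case_prod_unfold image_def)
qed

theorem disjoint_union_film:
  assumes film: "film_surface \<Omega>1" "film_surface \<Omega>2" and u: "disjoint_union \<Omega>1 \<Omega>2 \<Omega>"
  shows "film_surface \<Omega>" "components_of \<Omega> = components_of \<Omega>1 \<union> components_of \<Omega>2"
proof -
  note R1 = film_regular[OF film(1)] and R2 = film_regular[OF film(2)]
  note u' = disjoint_union_swap[OF u]
  let ?C = "components_of \<Omega>1 \<union> components_of \<Omega>2"
  have sel: "verts \<Omega>1 \<inter> verts \<Omega>2 = {}" "verts \<Omega> = verts \<Omega>1 \<union> verts \<Omega>2"
    "edges \<Omega> = edges \<Omega>1 \<union> edges \<Omega>2" "disks \<Omega> = disks \<Omega>1 \<union> disks \<Omega>2" "cyc \<Omega> = cyc \<Omega>1 \<union> cyc \<Omega>2"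
    using u unfolding disjoint_union_def by simp_all
  have en: "ends \<Omega> e = ends \<Omega>' e" if "e \<in> edges \<Omega>'" "\<Omega>' \<in> {\<Omega>1, \<Omega>2}" for e \<Omega>'
    using u that unfolding disjoint_union_def by blast
  have dv: "disk_verts \<Omega> d = disk_verts \<Omega>' d" if "d \<in> disks \<Omega>'" "\<Omega>' \<in> {\<Omega>1, \<Omega>2}" for d \<Omega>'
  proof -
    have "bdry \<Omega> d = bdry \<Omega>' d" using u that unfolding disjoint_union_def by blast
    then show ?thesis unfolding disk_verts_def by simp
  qed
  have cov: "\<Union> (components_of \<Omega>1) = verts \<Omega>1" "\<Union> (components_of \<Omega>2) = verts \<Omega>2"
    using components_cover R1 R2 by blast+
  have R: "regular_complex \<Omega>'" if "\<Omega>' \<in> {\<Omega>1, \<Omega>2}" for \<Omega>' using that R1 R2 by blast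
  have comp: "\<exists>C\<in>components_of \<Omega>'. X \<subseteq> C"
    if "\<Omega>' \<in> {\<Omega>1, \<Omega>2}" "X \<noteq> {}" "X \<subseteq> verts \<Omega>'"
      "\<And>C. C \<in> components_of \<Omega>' \<Longrightarrow> X \<inter> C \<noteq> {} \<Longrightarrow> X \<subseteq> C" for \<Omega>' X
  proof -
    obtain v where v: "v \<in> X" using \<open>X \<noteq> {}\<close> by blast
    then obtain C where "C \<in> components_of \<Omega>'" "v \<in> C"
      using components_cover[OF R[OF \<open>\<Omega>' \<in> {\<Omega>1, \<Omega>2}\<close>]] \<open>X \<subseteq> verts \<Omega>'\<close> by blast
    then show ?thesis using v that(4)[of C] by blast
  qed
  have "film_surface \<Omega> \<and> components_of \<Omega> = ?C"
  proof (rule film_surfaceI)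
    fix e assume "e \<in> edges \<Omega>"
    then have "e \<in> edges \<Omega>1 \<or> e \<in> edges \<Omega>2" unfolding sel(3) by simp
    then obtain \<Omega>' where o: "\<Omega>' \<in> {\<Omega>1, \<Omega>2}" "e \<in> edges \<Omega>'" by (metis insertI1 insertI2)
    have en': "ends \<Omega>' e \<noteq> {}" "ends \<Omega>' e \<subseteq> verts \<Omega>'"
      using regular_complexD(4)[OF R[OF o(1)]] o(2) by force+
    have "\<exists>C\<in>components_of \<Omega>'. ends \<Omega>' e \<subseteq> C"
      by (rule comp[OF o(1) en']) (rule component_closed(3)[OF R[OF o(1)] _ o(2)])
    then show "\<exists>C\<in>?C. ends \<Omega> e \<subseteq> C" using en[OF o(2,1)] o(1) by auto
  next
    fix d assume "d \<in> disks \<Omega>"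
    then have "d \<in> disks \<Omega>1 \<or> d \<in> disks \<Omega>2" unfolding sel(4) by simp
    then obtain \<Omega>' where o: "\<Omega>' \<in> {\<Omega>1, \<Omega>2}" "d \<in> disks \<Omega>'" by (metis insertI1 insertI2)
    have "\<exists>C\<in>components_of \<Omega>'. disk_verts \<Omega>' d \<subseteq> C"
      by (intro comp[OF o(1)] component_closed(4)[OF R[OF o(1)] _ o(2)]
          disk_verts_nonempty[OF R[OF o(1)] o(2)] disk_verts_subset[OF R[OF o(1)] o(2)])
    then show "\<exists>C\<in>?C. disk_verts \<Omega> d \<subseteq> C" using dv[OF o(2,1)] o(1) by auto
  next
    fix C C' assume "C \<in> ?C" "C' \<in> ?C" "C \<inter> C' \<noteq> {}"
    then show "C = C'" using component_disjoint cov sel(1) by blast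
  next
    fix C assume "C \<in> ?C"
    then show "\<exists>qs. film_on (restrict_complex \<Omega> C) qs"
    proof
      assume C: "C \<in> components_of \<Omega>1"
      then show ?thesis
        using film_on_component[OF film(1) C] film_iso_film_on[OF disjoint_union_left[OF film u C]] by blast
    next
      assume C: "C \<in> components_of \<Omega>2"
      then show ?thesis
        using film_on_component[OF film(2) C] film_iso_film_on[OF disjoint_union_left[OF film(2,1) u' C]] by blast
    qed
  next
    have "cyc \<Omega>' \<subseteq> (\<Union>C\<in>components_of \<Omega>'. C \<times> C \<times> C)" if "film_surface \<Omega>'" for \<Omega>' :: "'a complex2"
      using that unfolding film_surface_def cyclic_complex_def almost_cyclic_def by blast
    then show "cyc \<Omega> \<subseteq> (\<Union>C\<in>?C. C \<times> C \<times> C)" using film unfolding sel(5) by blast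
  qed (use sel cov regular_complexD(1-3)[OF R1] regular_complexD(1-3)[OF R2] in auto)
  then show "film_surface \<Omega>" "components_of \<Omega> = ?C" by simp_all
qed

lemma disjoint_union_vclass:
  assumes film: "film_surface \<Omega>1" "film_surface \<Omega>2" and u: "disjoint_union \<Omega>1 \<Omega>2 \<Omega>" and q: "q \<in> verts \<Omega>1"
  shows "vclass \<Omega> q = vclass \<Omega>1 q"
proof -
  note R1 = film_regular[OF film(1)]
  obtain C where C: "C \<in> components_of \<Omega>1" "q \<in> C" using components_cover[OF R1] q by blast
  have film': "film_surface \<Omega>" and C': "C \<in> components_of \<Omega>"
    using disjoint_union_film[OF film u] C by auto
  note iso = disjoint_union_left[OF film u C(1)]
  obtain qs where qs: "film_on (restrict_complex \<Omega>1 C) qs" using film_on_component[OF film(1) C(1)] by blast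
  note qs' = film_iso_film_on[OF iso qs]
  have "vclass (restrict_complex \<Omega> C) (id q) = vclass (restrict_complex \<Omega>1 C) q"
    using conn_vertex_graph[OF qs] conn_vertex_graph[OF qs'] C(2)
    by (intro vclass_film_iso[OF film_on_regular[OF qs] film_on_regular[OF qs'] _ _ iso]) simp_all
  then show ?thesis
    using vclass_component(1)[OF film(1) C] vclass_component(1)[OF film' C' C(2)] by simp
qed

section \<open>The chain formula\<close>

lemma indices_Nil: "indices b [] = {[]}"
  unfolding indices_def by auto

lemma indices_Cons: "indices b (\<sigma> # \<sigma>s) = (\<lambda>(i, I). i # I) ` ({..<length (b \<sigma>)} \<times> indices b \<sigma>s)"
proof (intro subset_antisym subsetI)
  fix L assume "L \<in> indices b (\<sigma> # \<sigma>s)"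
  then have L: "length L = Suc (length \<sigma>s)" "\<forall>k<Suc (length \<sigma>s). L ! k < length (b ((\<sigma> # \<sigma>s) ! k))"
    unfolding indices_def by auto
  then obtain i I where iI: "L = i # I" "length I = length \<sigma>s" by (cases L) auto
  have "i < length (b \<sigma>)" using L(2) iI(1) by force
  moreover have "\<forall>k<length \<sigma>s. I ! k < length (b (\<sigma>s ! k))" using L(2) iI(1) by force
  ultimately show "L \<in> (\<lambda>(i, I). i # I) ` ({..<length (b \<sigma>)} \<times> indices b \<sigma>s)"
    unfolding indices_def using iI by auto
next
  fix L assume "L \<in> (\<lambda>(i, I). i # I) ` ({..<length (b \<sigma>)} \<times> indices b \<sigma>s)"
  then show "L \<in> indices b (\<sigma> # \<sigma>s)" unfolding indices_def by (auto simp: nth_Cons')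
qed

lemma sum_indices_Cons:
  "(\<Sum>L\<in>indices b (\<sigma> # \<sigma>s). f L) = (\<Sum>i<length (b \<sigma>). \<Sum>I\<in>indices b \<sigma>s. f (i # I))"
proof -
  have "inj_on (\<lambda>(i, I). i # I) ({..<length (b \<sigma>)} \<times> indices b \<sigma>s)" by (auto simp: inj_on_def)
  then have "(\<Sum>L\<in>indices b (\<sigma> # \<sigma>s). f L) = (\<Sum>(i, I)\<in>{..<length (b \<sigma>)} \<times> indices b \<sigma>s. f (i # I))"
    unfolding indices_Cons by (subst sum.reindex) (auto simp: comp_def case_prod_unfold)
  then show ?thesis by (simp add: sum.cartesian_product)
qed

text \<open>Splitting off the first matrix entry and the first value of \<open>tri\<close> leaves a
  term of the same form, with \<open>b (star \<sigma>) ! j\<close> in place of the first two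
  vectors.\<close>

lemma chain_term_Cons:
  "chain_term tri b F (a # y # zs) (\<sigma> # \<sigma>s) (i # I) (j # J) =
   F \<sigma> i j * tri a y (b \<sigma> ! i) * chain_term tri b F (b (star \<sigma>) ! j # zs) \<sigma>s I J"
proof -
  define m where "m = length \<sigma>s"
  have 1: "(\<Prod>k<Suc m. F ((\<sigma> # \<sigma>s) ! k) ((i # I) ! k) ((j # J) ! k)) =
      F \<sigma> i j * (\<Prod>k<m. F (\<sigma>s ! k) (I ! k) (J ! k))"
    by (subst prod.lessThan_Suc_shift) simp
  have 2: "(\<Prod>k\<le>Suc m. tri (if k = 0 then (a # y # zs) ! 0 else b (star ((\<sigma> # \<sigma>s) ! (k - 1))) ! ((j # J) ! (k - 1)))
                ((a # y # zs) ! (k + 1))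
                (if k = Suc m then (a # y # zs) ! (Suc m + 2) else b ((\<sigma> # \<sigma>s) ! k) ! ((i # I) ! k))) =
      tri a y (b \<sigma> ! i) *
      (\<Prod>k\<le>m. tri (if k = 0 then (b (star \<sigma>) ! j # zs) ! 0 else b (star (\<sigma>s ! (k - 1))) ! (J ! (k - 1)))
                ((b (star \<sigma>) ! j # zs) ! (k + 1))
                (if k = m then (b (star \<sigma>) ! j # zs) ! (m + 2) else b (\<sigma>s ! k) ! (I ! k)))"
    unfolding prod.atMost_Suc_shift[of _ m]
    by (intro arg_cong2[of _ _ _ _ "(*)"] prod.cong) (auto simp: nth_Cons')
  show ?thesis
    using 1 2 unfolding chain_term_def Let_def m_def by (simp add: ac_simps)
qed

context based_graph_frobenius
begin

abbreviation chain :: "'b list \<Rightarrow> 'k" where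
  "chain \<equiv> chain_sum pair tri b F"

text \<open>Recursive form of the sums over all indices for fixed intermediate classes. The entering
  vector \<open>a\<close> is a separate argument so that linearity in it can be used.\<close>

fun chain_from :: "'b \<Rightarrow> 'b list \<Rightarrow> 'c ograph set list \<Rightarrow> 'k" where
  "chain_from a [y, z] [] = tri a y z"
| "chain_from a (y # ys) (\<sigma> # \<sigma>s) = (\<Sum>i<length (b \<sigma>). \<Sum>j<length (b (star \<sigma>)).
     tri a y (b \<sigma> ! i) * F \<sigma> i j * chain_from (b (star \<sigma>) ! j) ys \<sigma>s)"
| "chain_from a _ _ = 0"

lemma lin_chain_from: "lin (\<lambda>a. chain_from a ys \<sigma>s)"
\<comment> \<open>The claim already concerns all vectors \<open>a\<close>, so the recursion scheme
  gets an arbitrary value in this place.\<close>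
proof (induction "undefined :: 'b" ys \<sigma>s rule: chain_from.induct)
  case (1 y z)
  then show ?case using lin_tri(3) by simp
next
  case (2 y ys \<sigma> \<sigma>s)
  have "tri (x + x') y z = tri x y z + tri x' y z" "tri (scale c x) y z = c * tri x y z" for x x' z c
    using lin_tri(3) unfolding lin_def by blast+
  then show ?case unfolding lin_def
    by (simp add: sum.distrib sum_distrib_left algebra_simps)
qed (simp_all add: lin_def)

lemma sum_chain_terms:
  assumes "length ys = length \<sigma>s + 2"
  shows "(\<Sum>I\<in>indices b \<sigma>s. \<Sum>J\<in>indices b (map star \<sigma>s). chain_term tri b F (a # ys) \<sigma>s I J) =
         chain_from a ys \<sigma>s"
  using assms
proof (induction \<sigma>s arbitrary: a ys)
  case Nil
  then obtain y z where "ys = [y, z]" by (auto simp: length_Suc_conv numeral_2_eq_2)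
  then show ?case by (simp add: indices_Nil chain_term_def)
next
  case (Cons \<sigma> \<sigma>s)
  then obtain y zs where ys: "ys = y # zs" "length zs = length \<sigma>s + 2" by (cases ys) auto
  have "(\<Sum>I\<in>indices b (\<sigma> # \<sigma>s). \<Sum>J\<in>indices b (map star (\<sigma> # \<sigma>s)). chain_term tri b F (a # ys) (\<sigma> # \<sigma>s) I J) =
    (\<Sum>i<length (b \<sigma>). \<Sum>I\<in>indices b \<sigma>s. \<Sum>j<length (b (star \<sigma>)). \<Sum>J\<in>indices b (map star \<sigma>s).
       F \<sigma> i j * tri a y (b \<sigma> ! i) * chain_term tri b F (b (star \<sigma>) ! j # zs) \<sigma>s I J)"
    unfolding list.map sum_indices_Cons ys(1) chain_term_Cons ..
  also have "\<dots> = (\<Sum>i<length (b \<sigma>). \<Sum>j<length (b (star \<sigma>)). \<Sum>I\<in>indices b \<sigma>s. \<Sum>J\<in>indices b (map star \<sigma>s).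
       F \<sigma> i j * tri a y (b \<sigma> ! i) * chain_term tri b F (b (star \<sigma>) ! j # zs) \<sigma>s I J)"
    by (intro sum.cong refl sum.swap)
  also have "\<dots> = chain_from a ys (\<sigma> # \<sigma>s)"
    unfolding ys(1) chain_from.simps Cons.IH[OF ys(2), symmetric]
    by (simp add: sum_distrib_left ac_simps)
  finally show ?case .
qed

text \<open>If the lengths agree, some value of \<open>tri\<close> in every summand has arguments
  whose classes admit no surface, and is zero by the axiom; otherwise the default equation of
  \<open>chain_from\<close> gives zero.\<close>

lemma chain_from_vanishes:
  assumes "\<alpha> \<in> Graphs" "a \<in> B \<alpha>" "list_all2 (\<lambda>y \<beta>. \<beta> \<in> Graphs \<and> y \<in> B \<beta>) ys \<beta>s" "set \<sigma>s \<subseteq> Graphs"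
    and "\<not> fits \<alpha> \<beta>s \<sigma>s"
  shows "chain_from a ys \<sigma>s = 0"
  using assms
proof (induction \<sigma>s arbitrary: a \<alpha> ys \<beta>s)
  case Nil
  show ?case
  proof (cases "\<exists>y z. ys = [y, z]")
    case True
    then obtain y z where ys: "ys = [y, z]" by blast
    then obtain \<beta> \<gamma> where \<beta>s: "\<beta>s = [\<beta>, \<gamma>]" using Nil.prems(3) by (auto simp: list_all2_Cons1)
    then have "Film [\<alpha>, \<beta>, \<gamma>] = {}" using Nil.prems(5) by simp
    then show ?thesis using tri_vanishes[of \<alpha> \<beta> \<gamma> a y z] Nil.prems(1-3) ys \<beta>s by simp
  next
    case False
    then show ?thesis by (cases "(a, ys, [] :: 'c ograph set list)" rule: chain_from.cases) auto
  qed
next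
  case (Cons \<sigma> \<sigma>s)
  show ?case
  proof (cases ys)
    case (Cons y ys')
    then obtain \<beta> \<beta>s' where \<beta>s: "\<beta>s = \<beta> # \<beta>s'" using Cons.prems(3) by (auto simp: list_all2_Cons1)
    have \<sigma>: "\<sigma> \<in> Graphs" using Cons.prems(4) by simp
    have z: "tri a y (b \<sigma> ! i) * F \<sigma> i j * chain_from (b (star \<sigma>) ! j) ys' \<sigma>s = 0"
      if ij: "i < length (b \<sigma>)" "j < length (b (star \<sigma>))" for i j
    proof (cases "Film [\<alpha>, \<beta>, \<sigma>] = {}")
      case True
      then have "tri a y (b \<sigma> ! i) = 0"
        using tri_vanishes[OF Cons.prems(1) _ \<sigma> True Cons.prems(2) _ b_in_B[OF \<sigma> ij(1)]] Cons.prems(3)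
        unfolding Cons \<beta>s by simp
      then show ?thesis by simp
    next
      case False
      then have "\<not> fits (star \<sigma>) \<beta>s' \<sigma>s" using Cons.prems(5) unfolding \<beta>s by simp
      then have "chain_from (b (star \<sigma>) ! j) ys' \<sigma>s = 0"
        using Cons.IH[of "star \<sigma>" "b (star \<sigma>) ! j" ys' \<beta>s'] b_in_B[of "star \<sigma>" j] ij \<sigma> Cons.prems(3,4)
        unfolding Cons \<beta>s by simp
      then show ?thesis by simp
    qed
    show ?thesis unfolding Cons chain_from.simps
      by (intro sum.neutral ballI) (use z in \<open>simp only: lessThan_iff\<close>)
  qed simp
qed

section \<open>Evaluation of the chain formula on a connected film surface\<close>

context
  fixes \<Omega> :: "'c complex2" and qs :: "nat list" and x :: "nat \<Rightarrow> 'b"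
  assumes film: "film_on \<Omega> qs" and x: "\<And>q. q \<in> verts \<Omega> \<Longrightarrow> x q \<in> B (vclass \<Omega> q)"
begin

text \<open>When the inserted class is that of the remaining arc, the double sum over
  \<open>i\<close> and \<open>j\<close> is the definition of \<open>mult\<close> under a linear
  form. So each step multiplies by the next vertex, and the final value of \<open>tri\<close> is a
  pairing with the last one.\<close>

lemma chain_from_tail_classes:
  assumes "rotated qs (l @ rs)" "l \<noteq> []" "2 \<le> length rs" "u \<in> B (arc_class \<Omega> (set l))"
  shows "chain_from u (map x rs) (tail_classes \<Omega> rs) =
         pair (nest (arc_class \<Omega>) x u (set l) (butlast rs)) (x (last rs))"
  using assms
proof (induction rs arbitrary: l u)
  case (Cons q rs)
  let ?C = "arc_class \<Omega>"
  have r: "rotated qs ((l @ [q]) @ rs)" using Cons.prems(1) by simp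
  have ne: "rs \<noteq> []" using Cons.prems(3) by auto
  have s: "?C (set rs) = star (?C (set (l @ [q])))" using arc_class_star[OF film r] .
  have G: "?C (set (l @ [q])) \<in> Graphs" using arc_class_in_Graphs[OF film r _ ne] by simp
  let ?m = "mult (?C (insert q (set l))) u (x q)"
  show ?case
  proof (cases "\<exists>p. rs = [p]")
    case True
    then obtain p where p: "rs = [p]" by blast
    have "p \<in> set qs" using rotated_set[OF r] p by auto
    then have "x p \<in> B (star (?C (insert q (set l))))"
      using x[of p] film_onD(3)[OF film] vclass_arc_class[OF film_on_regular[OF film]] s p by simp
    then show ?thesis using pair_mult[of "?C (insert q (set l))" "x p" u "x q"] G p by simp
  next
    case False
    then obtain p r rs' where rs: "rs = p # r # rs'" using ne by (metis neq_Nil_conv)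
    let ?\<phi> = "\<lambda>a. chain_from a (map x rs) (tail_classes \<Omega> rs)"
    have "chain_from u (map x (q # rs)) (tail_classes \<Omega> (q # rs)) = ?\<phi> ?m"
      unfolding lin_mult[OF lin_chain_from] using s by (simp add: rs)
    also have "?\<phi> ?m = pair (nest ?C x ?m (set (l @ [q])) (butlast rs)) (x (last rs))"
      by (rule Cons.IH[OF r]) (use G mult_in_B rs in auto)
    finally show ?thesis using rs by simp
  qed
qed simp

lemma tail_classes_Graphs:
  assumes "rotated qs (l @ rs)" "l \<noteq> []"
  shows "set (tail_classes \<Omega> rs) \<subseteq> Graphs"
  using assms
proof (induction rs arbitrary: l)
  case (Cons q rs)
  have r: "rotated qs ((l @ [q]) @ rs)" using Cons.prems(1) by simp
  show ?case
  proof (cases "\<exists>p r rs'. rs = p # r # rs'")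
    case True
    have "rotated ((l @ [q]) @ rs) (rs @ (l @ [q]))" by (rule rotated_append)
    then have "rotated qs (rs @ (l @ [q]))" using r rotated_trans by blast
    then have "arc_class \<Omega> (set rs) \<in> Graphs" using arc_class_in_Graphs[OF film] True by fastforce
    then show ?thesis using Cons.IH[OF r] True by auto
  next
    case False
    then have "tail_classes \<Omega> (q # rs) = []" by (cases "(\<Omega>, q # rs)" rule: tail_classes.cases) auto
    then show ?thesis by simp
  qed
qed simp

text \<open>By \<open>fits_unique\<close>, only the list \<open>tail_classes \<Omega> rs\<close> can
  contribute to the sum over intermediate classes.\<close>

lemma chain_sum_last:
  "chain (map x qs) =
   pair (arc_product (arc_class \<Omega>) x (butlast qs)) (x (last qs))"
proof (cases "length qs = 2")
  case True
  then obtain p q where "qs = [p, q]" by (auto simp: length_Suc_conv numeral_2_eq_2)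
  then show ?thesis by (simp add: chain_sum_def)
next
  case False
  then have n: "3 \<le> length qs" using film_on_length[OF film] by simp
  then obtain q rs where qs: "qs = q # rs" by (cases qs) auto
  have len: "2 \<le> length rs" using n qs by simp
  have r: "rotated qs ([q] @ rs)" using qs by simp
  let ?t = "tail_classes \<Omega> rs"
  define g where "g \<sigma>s = (if set \<sigma>s \<subseteq> Graphs \<and> length \<sigma>s = length (map x qs) - 3
        then \<Sum>I\<in>indices b \<sigma>s. \<Sum>J\<in>indices b (map star \<sigma>s). chain_term tri b F (map x qs) \<sigma>s I J
        else 0)" for \<sigma>s
  have g: "g \<sigma>s = (if set \<sigma>s \<subseteq> Graphs \<and> length rs = length \<sigma>s + 2
        then chain_from (x q) (map x rs) \<sigma>s else 0)" for \<sigma>s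
  proof -
    \<comment> \<open>There are at least three vertices, so the subtraction is not
      truncated.\<close>
    have "length \<sigma>s = length (map x qs) - 3 \<longleftrightarrow> length rs = length \<sigma>s + 2" using len qs by auto
    then show ?thesis unfolding g_def using sum_chain_terms[of "map x rs" \<sigma>s "x q"] qs by simp
  qed
  have V: "vclass \<Omega> p = arc_class \<Omega> {p}" for p using vclass_arc_class[OF film_on_regular[OF film]] .
  have inV: "p \<in> verts \<Omega>" if "p \<in> set qs" for p using that film_onD(3)[OF film] by simp
  have xq: "x q \<in> B (arc_class \<Omega> (set [q]))" "arc_class \<Omega> (set [q]) \<in> Graphs"
    using x[of q] vclass_in_Graphs[OF film, of q] inV[of q] qs V by simp_all
  have all2: "list_all2 (\<lambda>y \<beta>. \<beta> \<in> Graphs \<and> y \<in> B \<beta>) (map x rs) (map (vclass \<Omega>) rs)"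
    using x vclass_in_Graphs[OF film] inV qs by (auto simp: list_all2_conv_all_nth)
  have zero: "g \<sigma>s = 0" if "\<sigma>s \<noteq> ?t" for \<sigma>s
  proof (cases "set \<sigma>s \<subseteq> Graphs")
    case True
    have "\<not> fits (arc_class \<Omega> (set [q])) (map (vclass \<Omega>) rs) \<sigma>s"
      using fits_unique[of \<Omega> "[q]" rs \<sigma>s] film qs that by auto
    then show ?thesis unfolding g using chain_from_vanishes[OF xq(2,1) all2 True] by simp
  qed (simp add: g)
  have "chain (map x qs) = Sum_any g"
    unfolding chain_sum_def g_def using False by simp
  also have "\<dots> = sum g {?t}" by (rule Sum_any.expand_superset) (use zero in auto)
  also have "\<dots> = chain_from (x q) (map x rs) ?t"
  proof -
    have "length (tail_classes \<Omega> rs) + 2 = length rs" if "2 \<le> length rs" for rs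
      using that by (induction \<Omega> rs rule: tail_classes.induct) (auto simp: Suc_le_eq)
    then show ?thesis using g tail_classes_Graphs[OF r] len by simp
  qed
  also have "\<dots> = pair (nest (arc_class \<Omega>) x (x q) {q} (butlast rs)) (x (last rs))"
    using chain_from_tail_classes[OF r _ len xq(1)] by simp
  also have "\<dots> = pair (arc_product (arc_class \<Omega>) x (butlast qs)) (x (last qs))"
    using len qs by (cases rs) auto
  finally show ?thesis .
qed

theorem chain_sum_split:
  assumes "rotated qs (as @ bs)" "as \<noteq> []" "bs \<noteq> []"
  shows "chain (map x qs) =
         pair (arc_product (arc_class \<Omega>) x as) (arc_product (arc_class \<Omega>) x bs)"
  using chain_sum_last split_rotated[OF film x assms] by simp

end

text \<open>The split of \<open>qs'\<close> into its first vertex and the rest is a split of a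
  rotation of \<open>qs\<close> as well, so it computes both values.\<close>

theorem chain_sum_rotated:
  assumes film: "film_on \<Omega> qs" and x: "\<And>q. q \<in> verts \<Omega> \<Longrightarrow> x q \<in> B (vclass \<Omega> q)" and r: "rotated qs qs'"
  shows "chain (map x qs') = chain (map x qs)"
proof -
  have F': "film_on \<Omega> qs'" using film_on_rotated[OF film r] .
  obtain q rs where qs: "qs' = [q] @ rs" "rs \<noteq> []"
    using film_on_length[OF F'] by (cases qs'; cases "tl qs'") auto
  show ?thesis
    using chain_sum_split[OF film x, of "[q]" rs] chain_sum_split[OF F' x, of "[q]" rs] r qs by simp
qed

text \<open>Each of the two chains is the pairing of an arc product with a basis vector, so the
  double sum is the expansion in dual bases of the pairing of the two arc products.\<close>

lemma chain_sum_cut: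
  assumes film: "film_on \<Omega> (as @ bs)" and ne: "as \<noteq> []" "bs \<noteq> []"
    and x: "\<And>q. q \<in> verts \<Omega> \<Longrightarrow> x q \<in> B (vclass \<Omega> q)"
    and \<sigma>: "\<sigma> = arc_class \<Omega> (set bs)"
  shows "(\<Sum>i<length (b \<sigma>). \<Sum>j<length (b (star \<sigma>)). F \<sigma> i j *
            (chain (map x as @ [b \<sigma> ! i]) *
             chain (map x bs @ [b (star \<sigma>) ! j]))) =
         chain (map x (as @ bs))"
proof -
  let ?C = "arc_class \<Omega>"
  note R = film_on_regular[OF film]
  \<comment> \<open>\<open>p\<close> names the contracted vertex; the two pieces may share it
    because they are evaluated separately.\<close>
  obtain p where p: "p \<notin> set (as @ bs)" using ex_new_if_finite[OF infinite_UNIV_nat] by blast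
  have rb: "rotated (as @ bs) (bs @ as)" by (rule rotated_append)
  have \<sigma>G: "\<sigma> \<in> Graphs" unfolding \<sigma> using arc_class_in_Graphs[OF film rb ne(2,1)] .
  have s\<sigma>: "star \<sigma> = ?C (set as)" unfolding \<sigma> using arc_class_star[OF film rb] by simp
  have piece: "chain (map x cs @ [u]) = pair (arc_product ?C x cs) u"
    if r: "rotated (as @ bs) (cs @ ds)" and ne': "cs \<noteq> []" "ds \<noteq> []" and u: "u \<in> B (?C (set ds))" for cs ds u
  proof -
    have f: "film_on \<Omega> (cs @ ds)" using film_on_rotated[OF film r] .
    have pc: "p \<notin> set cs" using p rotated_set[OF r] by auto
    let ?\<Omega> = "cut_piece \<Omega> (set cs) p"
    have f': "film_on ?\<Omega> (cs @ [p])" using film_on_cut_piece[OF f ne' pc] .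
    note R' = film_on_regular[OF f']
    let ?x = "x(p := u)"
    have "?x v \<in> B (vclass ?\<Omega> v)" if "v \<in> verts ?\<Omega>" for v
    proof (cases "v = p")
      case True
      then show ?thesis using u unfolding vclass_arc_class[OF R'] by (simp add: arc_class_cut_piece(2)[OF f pc])
    next
      case False
      then have v: "v \<in> set cs" using that by simp
      then have "v \<in> verts \<Omega>" using film_onD(3)[OF f] by simp
      then have "x v \<in> B (?C {v})" using x unfolding vclass_arc_class[OF R] by blast
      then show ?thesis
        using False v unfolding vclass_arc_class[OF R'] by (simp add: arc_class_cut_piece(1)[OF f pc])
    qed
    from chain_sum_split[OF f' this rotated_refl ne'(1)]
    have "chain (map ?x (cs @ [p])) = pair (arc_product (arc_class ?\<Omega>) ?x cs) u"
      by (simp add: fun_upd_def)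
    moreover have "map ?x cs = map x cs" using pc by simp
    moreover have "arc_product (arc_class ?\<Omega>) ?x cs = arc_product ?C x cs"
      using arc_class_cut_piece(1)[OF f pc] pc by (intro arc_product_cong) auto
    ultimately show ?thesis by simp
  qed
  let ?P = "arc_product ?C x as" and ?Q = "arc_product ?C x bs"
  have Q: "?Q \<in> B \<sigma>" unfolding \<sigma> using product_in_B[OF film x rb ne(2,1)] .
  have "(\<Sum>i<length (b \<sigma>). \<Sum>j<length (b (star \<sigma>)). F \<sigma> i j *
            (chain (map x as @ [b \<sigma> ! i]) *
             chain (map x bs @ [b (star \<sigma>) ! j]))) =
        (\<Sum>i<length (b \<sigma>). \<Sum>j<length (b (star \<sigma>)). F \<sigma> i j * pair ?P (b \<sigma> ! i) * pair ?Q (b (star \<sigma>) ! j))"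
  proof (intro sum.cong refl)
    fix i j assume "i \<in> {..<length (b \<sigma>)}" "j \<in> {..<length (b (star \<sigma>))}"
    then have "b \<sigma> ! i \<in> B (?C (set bs))" "b (star \<sigma>) ! j \<in> B (?C (set as))"
      using b_in_B[OF \<sigma>G] b_in_B[of "star \<sigma>"] \<sigma>G unfolding \<sigma>[symmetric] s\<sigma>[symmetric] by simp_all
    then show "F \<sigma> i j * (chain (map x as @ [b \<sigma> ! i]) *
             chain (map x bs @ [b (star \<sigma>) ! j])) =
        F \<sigma> i j * pair ?P (b \<sigma> ! i) * pair ?Q (b (star \<sigma>) ! j)"
      using piece[OF rotated_refl ne] piece[OF rb ne(2,1)] by simp
  qed
  also have "\<dots> = pair ?P ?Q" using expand[OF lin_pair(1) \<sigma>G Q] .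
  also have "\<dots> = chain (map x (as @ bs))"
    using chain_sum_split[OF film x rotated_refl ne] by simp
  finally show ?thesis .
qed

text \<open>With \<open>q\<close> rotated to the last place, the value is the pairing of a fixed
  product with the vector at \<open>q\<close>.\<close>

lemma chain_sum_linear:
  assumes film: "film_on \<Omega> qs" and x: "\<And>q. q \<in> verts \<Omega> \<Longrightarrow> x q \<in> B (vclass \<Omega> q)"
    and q: "q \<in> verts \<Omega>" and yz: "y \<in> B (vclass \<Omega> q)" "z \<in> B (vclass \<Omega> q)"
  shows "chain (map (x(q := y + z)) qs) =
           chain (map (x(q := y)) qs) + chain (map (x(q := z)) qs)"
    and "chain (map (x(q := scale c y)) qs) = c * chain (map (x(q := y)) qs)"
proof -
  obtain bs where bs: "rotated qs ([q] @ bs)" "bs \<noteq> []" using rotated_single[OF film q] .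
  have "rotated ([q] @ bs) (bs @ [q])" by (rule rotated_append)
  then have r: "rotated qs (bs @ [q])" using bs(1) rotated_trans by blast
  have qb: "q \<notin> set bs" using rotated_distinct[OF bs(1)] film_onD(2)[OF film] by simp
  have val: "chain (map (x(q := w)) qs) = pair (arc_product (arc_class \<Omega>) x bs) w"
    if "w \<in> B (vclass \<Omega> q)" for w
  proof -
    have "arc_product (arc_class \<Omega>) (x(q := w)) bs = arc_product (arc_class \<Omega>) x bs"
      using qb by (intro arc_product_cong) auto
    then show ?thesis
      using chain_sum_split[OF film, of "x(q := w)" bs "[q]"] x that r bs(2) by simp
  qed
  have sub: "subspace (B (vclass \<Omega> q))" using subspace_B vclass_in_Graphs[OF film q] by blast
  show "chain (map (x(q := y + z)) qs) =
           chain (map (x(q := y)) qs) + chain (map (x(q := z)) qs)"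
    using val[OF yz(1)] val[OF yz(2)] val[OF subspace_add[OF sub yz]] lin_pair(1) unfolding lin_def by simp
  show "chain (map (x(q := scale c y)) qs) = c * chain (map (x(q := y)) qs)"
    using val[OF yz(1)] val[OF subspace_scale[OF sub yz(1)]] lin_pair(1) unfolding lin_def by simp
qed

end

section \<open>Linear combinations of pure tensors\<close>

lemma pure_tensor_restrict: "pure_tensor scale I X (restrict x I) = pure_tensor scale I X x"
  unfolding pure_tensor_def by (simp add: fun_eq_iff)

lemma pure_tensor_eval:
  "multilinear_form scale I X M \<Longrightarrow> x \<in> PiE I X \<Longrightarrow> pure_tensor scale I X x M = M x"
  by (simp add: pure_tensor_def PiE_restrict)

lemma fun_upd_in_PiE: "x \<in> PiE I X \<Longrightarrow> i \<in> I \<Longrightarrow> y \<in> X i \<Longrightarrow> x(i := y) \<in> PiE I X"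
  by (auto simp: PiE_iff extensional_def)

text \<open>Closedness keeps the updated families inside \<open>PiE I X\<close>, where the two
  functions agree.\<close>

lemma multilinear_form_cong:
  assumes closed: "\<And>i y z c. i \<in> I \<Longrightarrow> y \<in> X i \<Longrightarrow> z \<in> X i \<Longrightarrow> y + z \<in> X i \<and> scale c y \<in> X i"
    and eq: "\<And>x. x \<in> PiE I X \<Longrightarrow> M x = N x" and M: "multilinear_form scale I X M"
  shows "multilinear_form scale I X N"
  unfolding multilinear_form_def
proof (intro ballI allI)
  fix x i y z c assume a: "x \<in> PiE I X" "i \<in> I" "y \<in> X i" "z \<in> X i"
  note up = fun_upd_in_PiE[OF a(1,2)]
  show "N (x(i := y + z)) = N (x(i := y)) + N (x(i := z)) \<and> N (x(i := scale c y)) = c * N (x(i := y))"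
    using M a closed[OF a(2-4), of c] eq[OF up] unfolding multilinear_form_def by metis
qed

lemma tensor_space_index_cong:
  assumes "\<And>i. i \<in> I \<Longrightarrow> X i = Y i"
  shows "tensor_space scale I X = tensor_space scale I Y"
    and "pure_tensor scale I X = pure_tensor scale I Y"
proof -
  have P: "PiE I X = PiE I Y" using assms by (rule PiE_cong)
  then have "multilinear_form scale I X = multilinear_form scale I Y"
    using assms unfolding multilinear_form_def fun_eq_iff by auto
  then show p: "pure_tensor scale I X = pure_tensor scale I Y"
    unfolding pure_tensor_def fun_eq_iff by simp
  show "tensor_space scale I X = tensor_space scale I Y" unfolding tensor_space_def P p ..
qed

lemma tensor_spaceE:
  assumes "t \<in> tensor_space scale I X"
  obtains T c where "finite T" "T \<subseteq> PiE I X" "t = (\<lambda>M. \<Sum>x\<in>T. c x * pure_tensor scale I X x M)"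
  using assms unfolding tensor_space_def by blast

text \<open>Elements of \<open>tensor_space\<close> are combinations over a set of families, so the
  coefficients are added up when \<open>f\<close> repeats a family.\<close>

lemma tensor_space_sumI:
  assumes "finite S" "\<And>a. a \<in> S \<Longrightarrow> f a \<in> PiE I X"
  shows "(\<lambda>M. \<Sum>a\<in>S. c a * pure_tensor scale I X (f a) M) \<in> tensor_space scale I X"
proof -
  have "(\<Sum>a\<in>S. c a * pure_tensor scale I X (f a) M) =
        (\<Sum>x\<in>f ` S. (\<Sum>a\<in>{a \<in> S. f a = x}. c a) * pure_tensor scale I X x M)" for M
    unfolding sum.image_gen[OF assms(1), of _ f] sum_distrib_right by (intro sum.cong refl) auto
  then show ?thesis unfolding tensor_space_def using assms by (auto intro!: exI[of _ "f ` S"])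
qed

text \<open>Uniqueness in the universal property: evaluation at \<open>M\<close> is a linear form
  with the same values on pure tensors.\<close>

lemma tensor_space_eval:
  assumes "linear_form_on (tensor_space scale I X) f" "multilinear_form scale I X M"
    and "\<And>x. x \<in> PiE I X \<Longrightarrow> f (pure_tensor scale I X x) = M x" and t: "t \<in> tensor_space scale I X"
  shows "f t = t M"
proof -
  obtain T c where T: "finite T" "T \<subseteq> PiE I X" "t = (\<lambda>M. \<Sum>x\<in>T. c x * pure_tensor scale I X x M)"
    using t by (rule tensor_spaceE)
  show ?thesis
    unfolding T(3) linear_form_on_lincomb[OF assms(1) T(1,2)]
    using T(2) assms(2,3) by (intro sum.cong refl) (auto simp: pure_tensor_eval)
qed

lemma multilinear_form_reindex:
  assumes g: "bij_betw g I J" and X: "\<And>i. i \<in> I \<Longrightarrow> X i = Y (g i)" and M: "multilinear_form scale I X M"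
  shows "multilinear_form scale J Y (\<lambda>x. M (\<lambda>i\<in>I. x (g i)))"
  unfolding multilinear_form_def
proof (intro ballI allI)
  fix x j y z c assume a: "x \<in> PiE J Y" "j \<in> J" "y \<in> Y j" "z \<in> Y j"
  obtain i where i: "i \<in> I" "j = g i" using g a(2) by (auto simp: bij_betw_def)
  have "(\<lambda>k\<in>I. (x(j := w)) (g k)) = (\<lambda>k\<in>I. x (g k))(i := w)" for w
    using g i by (auto simp: fun_eq_iff bij_betw_def inj_on_def)
  moreover have "(\<lambda>k\<in>I. x (g k)) \<in> PiE I X" using a(1) g X by (auto simp: bij_betw_def)
  moreover have "y \<in> X i" "z \<in> X i" using a i X by auto
  ultimately show "M (\<lambda>k\<in>I. (x(j := y + z)) (g k)) = M (\<lambda>k\<in>I. (x(j := y)) (g k)) + M (\<lambda>k\<in>I. (x(j := z)) (g k)) \<and>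
      M (\<lambda>k\<in>I. (x(j := scale c y)) (g k)) = c * M (\<lambda>k\<in>I. (x(j := y)) (g k))"
    using M i(1) unfolding multilinear_form_def by simp
qed

lemma tensor_reindex_sum:
  assumes g: "bij_betw g I J" and X: "\<And>i. i \<in> I \<Longrightarrow> X i = Y (g i)" and f: "\<And>a. a \<in> S \<Longrightarrow> f a \<in> PiE J Y"
  shows "tensor_reindex scale I X g (\<lambda>M. \<Sum>a\<in>S. c a * pure_tensor scale J Y (f a) M) =
         (\<lambda>M. \<Sum>a\<in>S. c a * pure_tensor scale I X (\<lambda>i\<in>I. f a (g i)) M)"
proof
  fix M
  show "tensor_reindex scale I X g (\<lambda>M. \<Sum>a\<in>S. c a * pure_tensor scale J Y (f a) M) M =
         (\<Sum>a\<in>S. c a * pure_tensor scale I X (\<lambda>i\<in>I. f a (g i)) M)"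
  proof (cases "multilinear_form scale I X M")
    case True
    then show ?thesis
      using multilinear_form_reindex[OF g X True] f
      by (auto simp: tensor_reindex_def pure_tensor_eval intro!: sum.cong) (simp add: pure_tensor_def)
  qed (simp add: tensor_reindex_def pure_tensor_def)
qed

text \<open>Extends \<open>tensor_mult_pure\<close> to linear combinations. The inner functional
  must be multilinear on \<open>I\<close>, as otherwise the outer pure tensors return 0; it is
  computed only on \<open>PiE\<close>, hence the closedness condition.\<close>

lemma tensor_mult_sum:
  fixes scale :: "'k::field \<Rightarrow> 'b::ab_group_add \<Rightarrow> 'b" and X :: "'i \<Rightarrow> 'b set"
  assumes IJ: "I \<inter> J = {}"
    and closed: "\<And>i y z c. i \<in> I \<union> J \<Longrightarrow> y \<in> X i \<Longrightarrow> z \<in> X i \<Longrightarrow> y + z \<in> X i \<and> scale c y \<in> X i"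
    and f: "\<And>a. a \<in> S \<Longrightarrow> f a \<in> PiE I X" and g: "\<And>a. a \<in> T \<Longrightarrow> g a \<in> PiE J X"
  shows "tensor_mult scale I J X (\<lambda>M. \<Sum>a\<in>S. c a * pure_tensor scale I X (f a) M)
           (\<lambda>M. \<Sum>a\<in>T. d a * pure_tensor scale J X (g a) M) =
         (\<lambda>M. \<Sum>a\<in>S. \<Sum>a'\<in>T. c a * d a' *
            pure_tensor scale (I \<union> J) X (\<lambda>i\<in>I \<union> J. if i \<in> I then f a i else g a' i) M)"
proof
  fix M
  define m :: "('i \<Rightarrow> 'b) \<Rightarrow> ('i \<Rightarrow> 'b) \<Rightarrow> 'i \<Rightarrow> 'b" where "m = (\<lambda>x y. \<lambda>i\<in>I \<union> J. if i \<in> I then x i else y i)"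
  show "tensor_mult scale I J X (\<lambda>M. \<Sum>a\<in>S. c a * pure_tensor scale I X (f a) M)
           (\<lambda>M. \<Sum>a\<in>T. d a * pure_tensor scale J X (g a) M) M =
         (\<Sum>a\<in>S. \<Sum>a'\<in>T. c a * d a' *
            pure_tensor scale (I \<union> J) X (\<lambda>i\<in>I \<union> J. if i \<in> I then f a i else g a' i) M)"
  proof (cases "multilinear_form scale (I \<union> J) X M")
    case True
    have mem: "m u v \<in> PiE (I \<union> J) X" if "u \<in> PiE I X" "v \<in> PiE J X" for u v
      using that by (auto simp: m_def PiE_iff)
    have updI: "m (u(i := y)) v = (m u v)(i := y)" if "i \<in> I" for u v i y
      using that by (auto simp: m_def fun_eq_iff)
    have updJ: "m u (v(i := y)) = (m u v)(i := y)" if "i \<in> J" for u v i y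
      using that IJ by (auto simp: m_def fun_eq_iff)
    have mlJ: "multilinear_form scale J X (\<lambda>v. M (m u v))" if "u \<in> PiE I X" for u
      using True mem[OF that] unfolding multilinear_form_def by (simp add: updJ)
    have mlI: "multilinear_form scale I X (\<lambda>u. M (m u v))" if "v \<in> PiE J X" for v
      using True mem[OF _ that] unfolding multilinear_form_def by (simp add: updI)
    let ?G = "\<lambda>u. \<Sum>a\<in>T. d a * M (m u (g a))"
    let ?H = "\<lambda>u. \<Sum>a\<in>T. d a * pure_tensor scale J X (g a) (\<lambda>v. M (m u v))"
    have "multilinear_form scale I X ?G"
      using mlI[OF g] unfolding multilinear_form_def
      by (simp add: sum.distrib sum_distrib_left algebra_simps)
    moreover have eq: "?G u = ?H u" if "u \<in> PiE I X" for u
      using mlJ[OF that] g by (intro sum.cong refl) (simp add: pure_tensor_eval)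
    ultimately have "multilinear_form scale I X ?H"
      using multilinear_form_cong[of I X scale ?G ?H] closed by blast
    then have "pure_tensor scale I X (f a) ?H = ?G (f a)" if "a \<in> S" for a
      using eq[OF f[OF that]] pure_tensor_eval[OF _ f[OF that]] by simp
    moreover have "pure_tensor scale (I \<union> J) X (m (f a) (g a')) M = M (m (f a) (g a'))"
      if "a \<in> S" "a' \<in> T" for a a'
      using pure_tensor_eval[OF True mem[OF f[OF that(1)] g[OF that(2)]]] .
    ultimately have "pure_tensor scale I X (f a) ?H =
        (\<Sum>a'\<in>T. d a' * pure_tensor scale (I \<union> J) X (m (f a) (g a')) M)" if "a \<in> S" for a
      using that by simp
    then show ?thesis
      using True unfolding m_def by (simp add: tensor_mult_def sum_distrib_left mult.assoc)
  qed (simp add: tensor_mult_def pure_tensor_def)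
qed


section \<open>The field theory\<close>

lemma map_restrict: "set qs = C \<Longrightarrow> map (restrict x C) qs = map x qs"
  by (auto simp: restrict_def)


context based_graph_frobenius
begin

definition comp_numbering :: "'c complex2 \<Rightarrow> nat set \<Rightarrow> nat list" where
  "comp_numbering \<Omega> C = (SOME qs. film_on (restrict_complex \<Omega> C) qs)"

text \<open>The multilinear form at which every admissible functional evaluates. The choice of
  numberings does not matter by \<open>chain_sum_component\<close>.\<close>

definition surface_value :: "'c complex2 \<Rightarrow> (nat \<Rightarrow> 'b) \<Rightarrow> 'k" where
  "surface_value \<Omega> x = (\<Prod>C\<in>components_of \<Omega>. chain (map x (comp_numbering \<Omega> C)))"

abbreviation labels :: "'c complex2 \<Rightarrow> nat \<Rightarrow> 'b set" where
  "labels \<Omega> \<equiv> (\<lambda>q. B (vclass \<Omega> q))"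

lemma comp_numbering:
  assumes "film_surface \<Omega>" "C \<in> components_of \<Omega>"
  shows "film_on (restrict_complex \<Omega> C) (comp_numbering \<Omega> C)" "set (comp_numbering \<Omega> C) = C"
proof -
  show "film_on (restrict_complex \<Omega> C) (comp_numbering \<Omega> C)"
    unfolding comp_numbering_def using film_on_component[OF assms] by (rule someI_ex)
  then show "set (comp_numbering \<Omega> C) = C" using film_onD(3) by fastforce
qed

lemma labels_closed:
  assumes "film_surface \<Omega>" "q \<in> verts \<Omega>" "y \<in> labels \<Omega> q" "z \<in> labels \<Omega> q"
  shows "y + z \<in> labels \<Omega> q \<and> scale c y \<in> labels \<Omega> q"
  using subspace_B[OF film_conn_graph(2)[OF assms(1,2)]] assms(3,4) subspace_add subspace_scale by blast

lemma chain_sum_component: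
  assumes film: "film_surface \<Omega>" and C: "C \<in> components_of \<Omega>" and qs: "film_on (restrict_complex \<Omega> C) qs"
    and x: "\<And>q. q \<in> C \<Longrightarrow> x q \<in> labels \<Omega> q"
  shows "chain (map x (comp_numbering \<Omega> C)) = chain (map x qs)"
proof (rule chain_sum_rotated[OF qs])
  show "x q \<in> B (vclass (restrict_complex \<Omega> C) q)" if "q \<in> verts (restrict_complex \<Omega> C)" for q
    using x[of q] vclass_component(1)[OF film C, of q] that by simp
  show "rotated qs (comp_numbering \<Omega> C)"
    using numbering_rotated[OF qs] film_on_numbering[OF comp_numbering(1)[OF film C]] by blast
qed

lemma film_on_whole:
  assumes "film_on \<Omega> qs" shows "restrict_complex \<Omega> (verts \<Omega>) = \<Omega>"
proof -
  have "cyclic_order_on (verts \<Omega>) (cyc \<Omega>)"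
    using film_onD(2,3,10)[OF assms] cyclic_order_on_circle by metis
  then show ?thesis
    using restrict_complex_verts[OF film_on_regular[OF assms]] cyclic_order_onD(1) by blast
qed

lemma surface_value_connected:
  assumes F: "film_on \<Omega> qs" and x: "\<And>q. q \<in> verts \<Omega> \<Longrightarrow> x q \<in> labels \<Omega> q"
  shows "surface_value \<Omega> x = chain (map x qs)"
proof -
  have C: "components_of \<Omega> = {verts \<Omega>}" using film_on_components[OF F] .
  have "film_on (restrict_complex \<Omega> (verts \<Omega>)) qs" using F film_on_whole[OF F] by simp
  from chain_sum_component[OF film_on_imp_film_surface(1)[OF F] _ this] show ?thesis
    unfolding surface_value_def C using x by simp
qed

text \<open>Changing the vector at \<open>q\<close> affects a single factor, that of the component
  of \<open>q\<close>.\<close>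

lemma multilinear_surface_value:
  assumes film: "film_surface \<Omega>"
  shows "multilinear_form scale (verts \<Omega>) (labels \<Omega>) (surface_value \<Omega>)"
  unfolding multilinear_form_def
proof (intro ballI allI)
  fix x q y z c assume a: "x \<in> PiE (verts \<Omega>) (labels \<Omega>)" "q \<in> verts \<Omega>" "y \<in> labels \<Omega> q" "z \<in> labels \<Omega> q"
  note R = film_regular[OF film]
  obtain C where C: "C \<in> components_of \<Omega>" "q \<in> C" using components_cover[OF R] a(2) by blast
  let ?f = "\<lambda>x C. chain (map x (comp_numbering \<Omega> C))"
  have "surface_value \<Omega> (x(q := w)) = ?f (x(q := w)) C * (\<Prod>C'\<in>components_of \<Omega> - {C}. ?f x C')" for w
  proof -
    have "?f (x(q := w)) C' = ?f x C'" if "C' \<in> components_of \<Omega> - {C}" for C'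
    proof -
      have "q \<notin> set (comp_numbering \<Omega> C')"
        using comp_numbering(2)[OF film, of C'] component_disjoint[of C \<Omega> C'] C that by auto
      then show ?thesis by (auto intro!: arg_cong[of _ _ chain])
    qed
    then show ?thesis unfolding surface_value_def
      by (subst prod.remove[OF finite_components[OF R] C(1)]) simp
  qed
  moreover have v: "vclass (restrict_complex \<Omega> C) p = vclass \<Omega> p" if "p \<in> C" for p
    using vclass_component(1)[OF film C(1) that] .
  have x: "x p \<in> B (vclass (restrict_complex \<Omega> C) p)" if "p \<in> verts (restrict_complex \<Omega> C)" for p
    using a(1) v[of p] component_closed(1)[OF R C(1)] that by (auto simp: PiE_iff)
  note l = chain_sum_linear[OF comp_numbering(1)[OF film C(1)] x, of q y z]
  have "?f (x(q := y + z)) C = ?f (x(q := y)) C + ?f (x(q := z)) C"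
    "?f (x(q := scale c y)) C = c * ?f (x(q := y)) C"
    using l a C(2) v[OF C(2)] by simp_all
  ultimately show "surface_value \<Omega> (x(q := y + z)) = surface_value \<Omega> (x(q := y)) + surface_value \<Omega> (x(q := z)) \<and>
      surface_value \<Omega> (x(q := scale c y)) = c * surface_value \<Omega> (x(q := y))"
    by (simp add: algebra_simps)
qed

lemma surface_value_components:
  assumes film: "film_surface \<Omega>" and x: "x \<in> PiE (verts \<Omega>) (labels \<Omega>)"
  shows "surface_value \<Omega> x = (\<Prod>C\<in>components_of \<Omega>. surface_value (restrict_complex \<Omega> C) (restrict x C))"
  unfolding surface_value_def[of \<Omega>]
proof (rule prod.cong[OF refl])
  fix C assume C: "C \<in> components_of \<Omega>"
  note R = film_regular[OF film]
  have "restrict x C q \<in> labels (restrict_complex \<Omega> C) q" if "q \<in> verts (restrict_complex \<Omega> C)" for q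
    using x that vclass_component(1)[OF film C] component_closed(1)[OF R C] by (auto simp: PiE_iff)
  from surface_value_connected[OF comp_numbering(1)[OF film C] this]
  show "chain (map x (comp_numbering \<Omega> C)) = surface_value (restrict_complex \<Omega> C) (restrict x C)"
    unfolding map_restrict[OF comp_numbering(2)[OF film C]] by (rule sym)
qed

lemma PiE_component:
  assumes film: "film_surface \<Omega>" and C: "C \<in> components_of \<Omega>" and x: "x \<in> PiE (verts \<Omega>) (labels \<Omega>)"
  shows "restrict x C \<in> PiE C (labels (restrict_complex \<Omega> C))"
  using x vclass_component(1)[OF film C] component_closed(1)[OF film_regular[OF film] C]
  by (auto simp: PiE_iff)

lemma film_component: "film_surface \<Omega> \<Longrightarrow> C \<in> components_of \<Omega> \<Longrightarrow> film_surface (restrict_complex \<Omega> C)"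
  using film_on_component film_on_imp_film_surface(1) by blast

text \<open>A tensor is a functional on multilinear forms, so evaluation at
  \<open>surface_value\<close> is linear by definition and has the prescribed values on pure
  tensors.\<close>

theorem film_construction_exists: "\<exists>\<Phi>. film_construction scale B pair tri b F \<Phi>"
proof -
  define \<Phi> where "\<Phi> \<Omega> t = t (surface_value \<Omega>)" for \<Omega> :: "'c complex2" and t :: "(nat, 'b, 'k) tensor"
  have pure: "\<Phi> \<Omega> (pure_tensor scale (verts \<Omega>) (labels \<Omega>) x) = surface_value \<Omega> x"
    if "film_surface \<Omega>" "x \<in> PiE (verts \<Omega>) (labels \<Omega>)" for \<Omega> x
    unfolding \<Phi>_def using pure_tensor_eval[OF multilinear_surface_value[OF that(1)] that(2)] .
  have "film_construction scale B pair tri b F \<Phi>" unfolding film_construction_def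
  proof (intro conjI allI impI ballI)
    fix \<Omega> show "linear_form_on (state_space scale B \<Omega>) (\<Phi> \<Omega>)"
      unfolding linear_form_on_def \<Phi>_def by simp
  next
    fix \<Omega> qs x assume a: "film_surface \<Omega> \<and> connected_complex \<Omega> \<and> numbering \<Omega> qs" and x: "x \<in> PiE (verts \<Omega>) (labels \<Omega>)"
    then have "film_on \<Omega> qs" using film_on_if_numbering by blast
    then show "\<Phi> \<Omega> (pure_tensor scale (verts \<Omega>) (labels \<Omega>) x) = chain (map x qs)"
      using pure[OF _ x] surface_value_connected x a by (simp add: PiE_iff)
  next
    fix \<Omega> x assume a: "film_surface \<Omega>" and x: "x \<in> PiE (verts \<Omega>) (labels \<Omega>)"
    have "\<Phi> (restrict_complex \<Omega> C) (pure_tensor scale C (labels (restrict_complex \<Omega> C)) x) =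
        surface_value (restrict_complex \<Omega> C) (restrict x C)" if C: "C \<in> components_of \<Omega>" for C
      using pure[OF film_component[OF a C], of "restrict x C"] PiE_component[OF a C x]
      by (simp add: pure_tensor_restrict)
    then show "\<Phi> \<Omega> (pure_tensor scale (verts \<Omega>) (labels \<Omega>) x) =
      (\<Prod>C\<in>components_of \<Omega>. \<Phi> (restrict_complex \<Omega> C) (pure_tensor scale C (labels (restrict_complex \<Omega> C)) x))"
      using pure[OF a x] surface_value_components[OF a x] by simp
  qed
  then show ?thesis by blast
qed

text \<open>The specification fixes the functional: on components it is the chain formula, on a
  surface their product, and linearity extends this to all tensors.\<close>

lemma film_construction_value:
  assumes \<Phi>: "film_construction scale B pair tri b F \<Phi>" and film: "film_surface \<Omega>"
  shows "x \<in> PiE (verts \<Omega>) (labels \<Omega>) \<Longrightarrow> \<Phi> \<Omega> (pure_tensor scale (verts \<Omega>) (labels \<Omega>) x) = surface_value \<Omega> x"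
    and "t \<in> state_space scale B \<Omega> \<Longrightarrow> \<Phi> \<Omega> t = t (surface_value \<Omega>)"
proof -
  have conn: "\<Phi> \<Omega> (pure_tensor scale (verts \<Omega>) (labels \<Omega>) x) = chain (map x qs)"
    if "film_on \<Omega> qs" "x \<in> PiE (verts \<Omega>) (labels \<Omega>)" for \<Omega> qs x
    using \<Phi> film_on_imp_film_surface[OF that(1)] film_on_numbering[OF that(1)] that(2)
    unfolding film_construction_def by blast
  show pure: "\<Phi> \<Omega> (pure_tensor scale (verts \<Omega>) (labels \<Omega>) x) = surface_value \<Omega> x"
    if x: "x \<in> PiE (verts \<Omega>) (labels \<Omega>)" for x
  proof -
    have "\<Phi> \<Omega> (pure_tensor scale (verts \<Omega>) (labels \<Omega>) x) =
      (\<Prod>C\<in>components_of \<Omega>. \<Phi> (restrict_complex \<Omega> C) (pure_tensor scale C (labels (restrict_complex \<Omega> C)) x))"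
      using \<Phi> film x unfolding film_construction_def by blast
    also have "\<dots> = surface_value \<Omega> x" unfolding surface_value_def
    proof (rule prod.cong[OF refl])
      fix C assume C: "C \<in> components_of \<Omega>"
      show "\<Phi> (restrict_complex \<Omega> C) (pure_tensor scale C (labels (restrict_complex \<Omega> C)) x) =
            chain (map x (comp_numbering \<Omega> C))"
        using conn[OF comp_numbering(1)[OF film C], of "restrict x C"] PiE_component[OF film C x]
        unfolding map_restrict[OF comp_numbering(2)[OF film C]] restrict_complex_sel pure_tensor_restrict .
    qed
    finally show ?thesis .
  qed
  have "linear_form_on (tensor_space scale (verts \<Omega>) (labels \<Omega>)) (\<Phi> \<Omega>)"
    using \<Phi> film unfolding film_construction_def state_space_def by blast
  from tensor_space_eval[OF this multilinear_surface_value[OF film] pure]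
  show "t \<in> state_space scale B \<Omega> \<Longrightarrow> \<Phi> \<Omega> t = t (surface_value \<Omega>)"
    unfolding state_space_def by blast
qed

section \<open>Verification of the axioms of a Film Topological Field Theory\<close>

lemma cut_tensor_eq:
  "cut_tensor scale B b F \<sigma> = (\<lambda>M. \<Sum>(i, j)\<in>{..<length (b \<sigma>)} \<times> {..<length (b (star \<sigma>))}.
     F \<sigma> i j * pure_tensor scale UNIV (dual_pair B \<sigma>) (\<lambda>s. if s then b \<sigma> ! i else b (star \<sigma>) ! j) M)"
  unfolding cut_tensor_def by (simp add: sum.cartesian_product)

lemma cut_tensor_family:
  assumes "\<sigma> \<in> Graphs" "p \<in> {..<length (b \<sigma>)} \<times> {..<length (b (star \<sigma>))}"
  shows "(\<lambda>s. if s then b \<sigma> ! fst p else b (star \<sigma>) ! snd p) \<in> PiE UNIV (dual_pair B \<sigma>)"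
  using assms b_in_B[of \<sigma>] b_in_B[of "star \<sigma>"] by (auto simp: PiE_UNIV_domain dual_pair_def)

lemma cut_tensor_in_space:
  assumes "\<sigma> \<in> Graphs" shows "cut_tensor scale B b F \<sigma> \<in> tensor_space scale UNIV (dual_pair B \<sigma>)"
  unfolding cut_tensor_eq case_prod_unfold
  by (rule tensor_space_sumI) (use cut_tensor_family[OF assms] in auto)

text \<open>The product over components is reindexed by \<open>fv\<close>, and the chosen numbering
  of an image component is replaced by the image of the chosen numbering.\<close>

lemma value_film_iso:
  assumes \<Phi>: "film_construction scale B pair tri b F \<Phi>"
    and film: "film_surface \<Omega>" "film_surface \<Omega>'" and iso: "film_iso fv fe fd \<Omega> \<Omega>'"
    and t: "t \<in> state_space scale B \<Omega>"
  shows "\<Phi> \<Omega>' (iso_map scale B fv \<Omega> \<Omega>' t) = \<Phi> \<Omega> t"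
proof -
  note R = film_regular[OF film(1)] and R' = film_regular[OF film(2)]
  have bv: "bij_betw fv (verts \<Omega>) (verts \<Omega>')" using iso unfolding film_iso_def by blast
  then have V': "verts \<Omega>' = fv ` verts \<Omega>" and inj: "inj_on fv (verts \<Omega>)" by (auto simp: bij_betw_def)
  let ?g = "inv_into (verts \<Omega>) fv"
  have bg: "bij_betw ?g (verts \<Omega>') (verts \<Omega>)" using bv by (rule bij_betw_inv_into)
  have vc: "vclass \<Omega>' (fv q) = vclass \<Omega> q" if q: "q \<in> verts \<Omega>" for q
    using vclass_film_iso[OF R R' film_conn_graph(1)[OF film(1) q] film_conn_graph(1)[OF film(2)] iso q] q V' by blast
  have lab: "labels \<Omega>' q = labels \<Omega> (?g q)" if "q \<in> verts \<Omega>'" for q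
    using that vc inj unfolding V' by auto
  obtain T c where T: "finite T" "T \<subseteq> PiE (verts \<Omega>) (labels \<Omega>)"
    and tT: "t = (\<lambda>M. \<Sum>x\<in>T. c x * pure_tensor scale (verts \<Omega>) (labels \<Omega>) x M)"
    using t unfolding state_space_def by (rule tensor_spaceE)
  have PiE': "(\<lambda>q\<in>verts \<Omega>'. x (?g q)) \<in> PiE (verts \<Omega>') (labels \<Omega>')" if "x \<in> T" for x
    using that T(2) lab bij_betwE[OF bg] by (auto simp: PiE_iff subset_iff)
  have im: "iso_map scale B fv \<Omega> \<Omega>' t =
      (\<lambda>M. \<Sum>x\<in>T. c x * pure_tensor scale (verts \<Omega>') (labels \<Omega>') (\<lambda>q\<in>verts \<Omega>'. x (?g q)) M)"
    unfolding iso_map_def tT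
    by (rule tensor_reindex_sum[where f = "\<lambda>x. x" and X = "labels \<Omega>'" and Y = "labels \<Omega>", OF bg lab]) (use T(2) in auto)
  have val: "surface_value \<Omega>' (\<lambda>q\<in>verts \<Omega>'. x (?g q)) = surface_value \<Omega> x" if x: "x \<in> T" for x
  proof -
    let ?y = "\<lambda>q\<in>verts \<Omega>'. x (?g q)"
    have "inj_on ((`) fv) (components_of \<Omega>)"
      using inj component_closed(1)[OF R] by (meson inj_onI inj_on_image_eq_iff)
    then have "surface_value \<Omega>' ?y =
        (\<Prod>C\<in>components_of \<Omega>. chain (map ?y (comp_numbering \<Omega>' (fv ` C))))"
      unfolding surface_value_def film_iso_components[OF R R' iso] by (simp add: prod.reindex)
    also have "\<dots> = surface_value \<Omega> x" unfolding surface_value_def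
    proof (rule prod.cong[OF refl])
      fix C assume C: "C \<in> components_of \<Omega>"
      then have C': "fv ` C \<in> components_of \<Omega>'" unfolding film_iso_components[OF R R' iso] by blast
      note CV = component_closed(1)[OF R C] component_closed(1)[OF R' C']
      have "chain (map ?y (comp_numbering \<Omega>' (fv ` C))) =
            chain (map ?y (map fv (comp_numbering \<Omega> C)))"
      proof (rule chain_sum_component[OF film(2) C'])
        show "film_on (restrict_complex \<Omega>' (fv ` C)) (map fv (comp_numbering \<Omega> C))"
          using film_iso_component_film_on[OF film iso C comp_numbering(1)[OF film(1) C]] .
        show "?y q \<in> labels \<Omega>' q" if "q \<in> fv ` C" for q
          using PiE'[OF x] CV(2) that by (auto simp: PiE_iff)
      qed
      also have "map ?y (map fv (comp_numbering \<Omega> C)) = map x (comp_numbering \<Omega> C)"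
        using comp_numbering(2)[OF film(1) C] CV(1) inj V' by (auto simp: subset_iff)
      finally show "chain (map ?y (comp_numbering \<Omega>' (fv ` C))) =
          chain (map x (comp_numbering \<Omega> C))" .
    qed
    finally show ?thesis .
  qed
  have "iso_map scale B fv \<Omega> \<Omega>' t \<in> state_space scale B \<Omega>'"
    unfolding im state_space_def by (rule tensor_space_sumI[OF T(1) PiE'])
  then have "\<Phi> \<Omega>' (iso_map scale B fv \<Omega> \<Omega>' t) = iso_map scale B fv \<Omega> \<Omega>' t (surface_value \<Omega>')"
    by (rule film_construction_value(2)[OF \<Phi> film(2)])
  also have "\<dots> = (\<Sum>x\<in>T. c x * surface_value \<Omega> x)"
    unfolding im using pure_tensor_eval[OF multilinear_surface_value[OF film(2)] PiE'] val
    by (intro sum.cong refl) simp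
  also have "\<dots> = t (surface_value \<Omega>)"
    unfolding tT using pure_tensor_eval[OF multilinear_surface_value[OF film(1)]] T(2)
    by (intro sum.cong refl) auto
  also have "\<dots> = \<Phi> \<Omega> t" using film_construction_value(2)[OF \<Phi> film(1) t] by simp
  finally show ?thesis .
qed

text \<open>The components of the union are those of the two parts, so \<open>surface_value\<close>
  factors; expanding both tensors into pure ones gives the product.\<close>

lemma value_disjoint_union:
  assumes \<Phi>: "film_construction scale B pair tri b F \<Phi>"
    and film: "film_surface \<Omega>1" "film_surface \<Omega>2" and u: "disjoint_union \<Omega>1 \<Omega>2 \<Omega>"
    and t: "t1 \<in> state_space scale B \<Omega>1" "t2 \<in> state_space scale B \<Omega>2"
  shows "\<Phi> \<Omega> (union_map scale B \<Omega>1 \<Omega>2 \<Omega> t1 t2) = \<Phi> \<Omega>1 t1 * \<Phi> \<Omega>2 t2"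
proof -
  note U = disjoint_union_film[OF film u] and u' = disjoint_union_swap[OF u]
  have V: "verts \<Omega>1 \<inter> verts \<Omega>2 = {}" "verts \<Omega> = verts \<Omega>1 \<union> verts \<Omega>2"
    using u unfolding disjoint_union_def by blast+
  have lab1: "labels \<Omega>1 q = labels \<Omega> q" if "q \<in> verts \<Omega>1" for q
    using disjoint_union_vclass[OF film u that] by simp
  have lab2: "labels \<Omega>2 q = labels \<Omega> q" if "q \<in> verts \<Omega>2" for q
    using disjoint_union_vclass[OF film(2,1) u' that] by simp
  note cong1 = tensor_space_index_cong[of "verts \<Omega>1" "labels \<Omega>1" "labels \<Omega>", OF lab1]
  note cong2 = tensor_space_index_cong[of "verts \<Omega>2" "labels \<Omega>2" "labels \<Omega>", OF lab2]
  have "t1 \<in> tensor_space scale (verts \<Omega>1) (labels \<Omega>)" "t2 \<in> tensor_space scale (verts \<Omega>2) (labels \<Omega>)"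
    using t cong1(1)[of scale] cong2(1)[of scale] unfolding state_space_def by (simp_all only:)
  note t' = this
  obtain S c where S: "finite S" "S \<subseteq> PiE (verts \<Omega>1) (labels \<Omega>)"
    and t1: "t1 = (\<lambda>M. \<Sum>x\<in>S. c x * pure_tensor scale (verts \<Omega>1) (labels \<Omega>) x M)"
    using t'(1) by (rule tensor_spaceE)
  obtain T d where T: "finite T" "T \<subseteq> PiE (verts \<Omega>2) (labels \<Omega>)"
    and t2: "t2 = (\<lambda>M. \<Sum>y\<in>T. d y * pure_tensor scale (verts \<Omega>2) (labels \<Omega>) y M)"
    using t'(2) by (rule tensor_spaceE)
  let ?m = "\<lambda>x y. \<lambda>i\<in>verts \<Omega>1 \<union> verts \<Omega>2. if i \<in> verts \<Omega>1 then x i else y i"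
  have PiE1: "PiE (verts \<Omega>1) (labels \<Omega>1) = PiE (verts \<Omega>1) (labels \<Omega>)" by (rule PiE_cong) (rule lab1)
  have PiE2: "PiE (verts \<Omega>2) (labels \<Omega>2) = PiE (verts \<Omega>2) (labels \<Omega>)" by (rule PiE_cong) (rule lab2)
  have m: "?m x y \<in> PiE (verts \<Omega>) (labels \<Omega>)" if "x \<in> S" "y \<in> T" for x y
    unfolding V(2) using that S(2) T(2) by (auto simp: PiE_iff subset_iff)
  have um: "union_map scale B \<Omega>1 \<Omega>2 \<Omega> t1 t2 =
      (\<lambda>M. \<Sum>x\<in>S. \<Sum>y\<in>T. c x * d y * pure_tensor scale (verts \<Omega>) (labels \<Omega>) (?m x y) M)"
    unfolding union_map_def t1 t2 V(2)
    by (rule tensor_mult_sum[where f = "\<lambda>x. x" and g = "\<lambda>x. x", OF V(1)])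
      (use labels_closed[OF U(1)] V(2) S(2) T(2) in auto)
  have "(\<lambda>M. \<Sum>p\<in>S \<times> T. c (fst p) * d (snd p) *
        pure_tensor scale (verts \<Omega>) (labels \<Omega>) (?m (fst p) (snd p)) M) \<in> tensor_space scale (verts \<Omega>) (labels \<Omega>)"
    by (rule tensor_space_sumI; (rule m)?) (use S(1) T(1) in auto)
  then have "union_map scale B \<Omega>1 \<Omega>2 \<Omega> t1 t2 \<in> state_space scale B \<Omega>"
    unfolding um state_space_def by (simp add: sum.cartesian_product case_prod_unfold)
  then have "\<Phi> \<Omega> (union_map scale B \<Omega>1 \<Omega>2 \<Omega> t1 t2) = union_map scale B \<Omega>1 \<Omega>2 \<Omega> t1 t2 (surface_value \<Omega>)"
    by (rule film_construction_value(2)[OF \<Phi> U(1)])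
  also have "\<dots> = (\<Sum>x\<in>S. \<Sum>y\<in>T. c x * d y * surface_value \<Omega> (?m x y))"
    unfolding um using pure_tensor_eval[OF multilinear_surface_value[OF U(1)] m]
    by (intro sum.cong refl) simp
  also have "\<dots> = (\<Sum>x\<in>S. \<Sum>y\<in>T. (c x * surface_value \<Omega>1 x) * (d y * surface_value \<Omega>2 y))"
  proof (intro sum.cong refl)
    fix x y assume xy: "x \<in> S" "y \<in> T"
    note R1 = film_regular[OF film(1)] and R2 = film_regular[OF film(2)]
    have disj: "components_of \<Omega>1 \<inter> components_of \<Omega>2 = {}"
      using component_closed(1,2)[OF R1] component_closed(1)[OF R2] V(1) by blast
    \<comment> \<open>The numbering chosen for a component may differ between the union and the
      part; \<open>chain_sum_component\<close> compares the two.\<close>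
    have part: "chain (map (?m x y) (comp_numbering \<Omega> C)) =
        chain (map z (comp_numbering \<Omega>' C))"
      if "C \<in> components_of \<Omega>'" "film_surface \<Omega>'" "C \<in> components_of \<Omega>"
        "film_on (restrict_complex \<Omega> C) (comp_numbering \<Omega>' C)" "\<And>q. q \<in> C \<Longrightarrow> ?m x y q = z q" "C \<subseteq> verts \<Omega>"
      for \<Omega>' C z
    proof -
      have "chain (map (?m x y) (comp_numbering \<Omega> C)) =
          chain (map (?m x y) (comp_numbering \<Omega>' C))"
        by (rule chain_sum_component[OF U(1) that(3,4) PiE_mem[OF m[OF xy]]]) (use that(6) in blast)
      moreover have "map (?m x y) (comp_numbering \<Omega>' C) = map z (comp_numbering \<Omega>' C)"
        using comp_numbering(2)[OF that(2,1)] that(5) by simp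
      ultimately show ?thesis by simp
    qed
    have "surface_value \<Omega> (?m x y) = surface_value \<Omega>1 x * surface_value \<Omega>2 y"
      unfolding surface_value_def U(2)
        prod.union_disjoint[OF finite_components[OF R1] finite_components[OF R2] disj]
    proof (intro arg_cong2[of _ _ _ _ "(*)"] prod.cong refl)
      fix C assume C: "C \<in> components_of \<Omega>1"
      note CV = component_closed(1)[OF R1 C]
      show "chain (map (?m x y) (comp_numbering \<Omega> C)) =
          chain (map x (comp_numbering \<Omega>1 C))"
        by (rule part[OF C film(1) _ film_iso_film_on[OF disjoint_union_left[OF film u C] comp_numbering(1)[OF film(1) C]]])
          (use C CV U(2) V in auto)
    next
      fix C assume C: "C \<in> components_of \<Omega>2"
      note CV = component_closed(1)[OF R2 C]
      show "chain (map (?m x y) (comp_numbering \<Omega> C)) =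
          chain (map y (comp_numbering \<Omega>2 C))"
        by (rule part[OF C film(2) _ film_iso_film_on[OF disjoint_union_left[OF film(2,1) u' C] comp_numbering(1)[OF film(2) C]]])
          (use C CV U(2) V in auto)
    qed
    then show "c x * d y * surface_value \<Omega> (?m x y) = (c x * surface_value \<Omega>1 x) * (d y * surface_value \<Omega>2 y)"
      by simp
  qed
  also have "\<dots> = (\<Sum>x\<in>S. c x * surface_value \<Omega>1 x) * (\<Sum>y\<in>T. d y * surface_value \<Omega>2 y)"
    by (simp add: sum_product)
  also have "(\<Sum>x\<in>S. c x * surface_value \<Omega>1 x) = \<Phi> \<Omega>1 t1"
  proof -
    have "\<Phi> \<Omega>1 t1 = t1 (surface_value \<Omega>1)" by (rule film_construction_value(2)[OF \<Phi> film(1) t(1)])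
    then show ?thesis unfolding t1
      using cong1(2)[of scale] pure_tensor_eval[OF multilinear_surface_value[OF film(1)]] S(2) PiE1 by (auto intro!: sum.cong)
  qed
  also have "(\<Sum>y\<in>T. d y * surface_value \<Omega>2 y) = \<Phi> \<Omega>2 t2"
  proof -
    have "\<Phi> \<Omega>2 t2 = t2 (surface_value \<Omega>2)" by (rule film_construction_value(2)[OF \<Phi> film(2) t(2)])
    then show ?thesis unfolding t2
      using cong2(2)[of scale] pure_tensor_eval[OF multilinear_surface_value[OF film(2)]] T(2) PiE2 by (auto intro!: sum.cong)
  qed
  finally show ?thesis .
qed

text \<open>Every component has at least two vertices, so a surface with two vertices is connected,
  and its functional is the pairing.\<close>

lemma value_nondegenerate:
  assumes \<Phi>: "film_construction scale B pair tri b F \<Phi>"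
    and film: "film_surface \<Omega>" and V: "verts \<Omega> = {p, q}" "p \<noteq> q"
  shows "star (vclass \<Omega> p) = vclass \<Omega> q"
    and "x \<in> labels \<Omega> p \<Longrightarrow> y \<in> labels \<Omega> q \<Longrightarrow>
      \<Phi> \<Omega> (pure_tensor scale {p, q} (labels \<Omega>) (\<lambda>v. if v = p then x else y)) = pair x y"
proof -
  note R = film_regular[OF film]
  obtain C where C: "C \<in> components_of \<Omega>" using components_cover[OF R] V by blast
  have CV: "C \<subseteq> {p, q}" using component_closed(1)[OF R C] V by simp
  obtain qs where qs: "film_on (restrict_complex \<Omega> C) qs" using film_on_component[OF film C] by blast
  have "2 \<le> card C"
    using film_on_length[OF qs] film_onD(2,3)[OF qs] by (simp add: distinct_card[symmetric])
  then have CV': "C = verts \<Omega>" using V CV by (metis card_2_iff card_seteq finite.emptyI finite_insert)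
  have "C' = C" if "C' \<in> components_of \<Omega>" for C'
    using component_disjoint[OF that C] component_closed(1,2)[OF R that] CV' by blast
  then have conn: "connected_complex \<Omega>" unfolding connected_complex_def using C CV' by blast
  obtain rs where rs: "film_on \<Omega> rs" using ex_film_on[OF film conn] by blast
  obtain ys where ys: "rotated rs (p # ys)" using rotated_to_front[of p rs] film_onD(3)[OF rs] V by auto
  note F' = film_on_rotated[OF rs ys]
  have "set (p # ys) = {p, q}" "distinct (p # ys)" using film_onD(2,3)[OF F'] V by simp_all
  then have "set ys = {q}" "distinct ys" using V(2) by auto
  then have "ys = [q]" by (cases ys; cases "tl ys") auto
  then have F: "film_on \<Omega> [p, q]" using F' by simp
  show "star (vclass \<Omega> p) = vclass \<Omega> q"
    using arc_class_star[of \<Omega> "[p, q]" "[p]" "[q]"] F unfolding vclass_arc_class[OF R] by simp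
  assume xy: "x \<in> labels \<Omega> p" "y \<in> labels \<Omega> q"
  let ?f = "\<lambda>v\<in>{p, q}. if v = p then x else y"
  have f: "?f \<in> PiE (verts \<Omega>) (labels \<Omega>)" using xy V by (auto simp: PiE_iff)
  have "\<Phi> \<Omega> (pure_tensor scale {p, q} (labels \<Omega>) (\<lambda>v. if v = p then x else y)) = surface_value \<Omega> ?f"
    using film_construction_value(1)[OF \<Phi> film f] unfolding V(1) pure_tensor_restrict .
  also have "\<dots> = chain (map ?f [p, q])"
    using f by (intro surface_value_connected[OF F]) (auto simp: PiE_iff)
  also have "\<dots> = pair x y" using V(2) by (simp add: chain_sum_def)
  finally show "\<Phi> \<Omega> (pure_tensor scale {p, q} (labels \<Omega>) (\<lambda>v. if v = p then x else y)) = pair x y" .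
qed

text \<open>The vertex classes are unchanged except at the new vertices \<open>p\<close> and
  \<open>q\<close>, whose classes are dual. Expanding all tensors into pure ones reduces the claim
  to \<open>chain_sum_cut\<close> for each family.\<close>

lemma value_cut:
  assumes \<Phi>: "film_construction scale B pair tri b F \<Phi>"
    and film: "film_surface \<Omega>" "connected_complex \<Omega>" and cut: "graph_cut \<Omega> P D A A'"
    and res: "cut_result \<Omega> A A' p q \<Omega>'" and t: "t \<in> state_space scale B \<Omega>"
  shows "\<Phi> \<Omega>' (cut_map scale B (cut_tensor scale B b F) p q \<Omega> \<Omega>' t) = \<Phi> \<Omega> t"
proof -
  obtain qs where qs: "film_on \<Omega> qs" using ex_film_on[OF film] by blast
  have div: "division \<Omega> A A'" using cut unfolding graph_cut_def by blast
  obtain as bs where r: "rotated qs (as @ bs)" and ne: "as \<noteq> []" "bs \<noteq> []"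
    and A: "A = set as" "A' = set bs" using divisionE[OF qs div] .
  have F: "film_on \<Omega> (as @ bs)" and F2: "film_on \<Omega> (bs @ as)"
    using film_on_rotated[OF qs] r rotated_append rotated_trans by blast+
  have V: "verts \<Omega> = set as \<union> set bs" using film_onD(3)[OF F] by simp
  have disj: "set as \<inter> set bs = {}" using film_onD(2)[OF F] by simp
  obtain \<Omega>1 \<Omega>2 fe1 fd1 fe2 fd2 where pq: "p \<noteq> q" "p \<notin> verts \<Omega>" "q \<notin> verts \<Omega>"
    and iso1: "film_iso id fe1 fd1 (cut_piece \<Omega> (set as) p) \<Omega>1"
    and iso2: "film_iso id fe2 fd2 (cut_piece \<Omega> (set bs) q) \<Omega>2" and u: "disjoint_union \<Omega>1 \<Omega>2 \<Omega>'"
    using res unfolding cut_result_def A by blast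
  have pas: "p \<notin> set as" and qbs: "q \<notin> set bs" using pq V by auto
  note P1 = film_on_cut_piece[OF F ne pas] and P2 = film_on_cut_piece[OF F2 ne(2,1) qbs]
  note F1 = film_iso_film_on[OF iso1 P1] and F2' = film_iso_film_on[OF iso2 P2]
  note film1 = film_on_imp_film_surface(1)[OF F1] and film2 = film_on_imp_film_surface(1)[OF F2']
  note U = disjoint_union_film[OF film1 film2 u] and u' = disjoint_union_swap[OF u]
  have V1: "verts \<Omega>1 = insert p (set as)" and V2: "verts \<Omega>2 = insert q (set bs)"
    using film_onD(3)[OF F1] film_onD(3)[OF F2'] by auto
  have V': "verts \<Omega>' = verts \<Omega> \<union> {p, q}" using u V1 V2 V unfolding disjoint_union_def by auto
  have vc1: "vclass \<Omega>' v = arc_class (cut_piece \<Omega> (set as) p) {v}" if v: "v \<in> verts \<Omega>1" for v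
  proof -
    have "vclass \<Omega>1 (id v) = vclass (cut_piece \<Omega> (set as) p) v"
      using conn_vertex_graph[OF P1] conn_vertex_graph[OF F1] v V1
      by (intro vclass_film_iso[OF film_on_regular[OF P1] film_on_regular[OF F1] _ _ iso1]) simp_all
    then show ?thesis
      using disjoint_union_vclass[OF film1 film2 u v] vclass_arc_class[OF film_on_regular[OF P1]] by simp
  qed
  have vc2: "vclass \<Omega>' v = arc_class (cut_piece \<Omega> (set bs) q) {v}" if v: "v \<in> verts \<Omega>2" for v
  proof -
    have "vclass \<Omega>2 (id v) = vclass (cut_piece \<Omega> (set bs) q) v"
      using conn_vertex_graph[OF P2] conn_vertex_graph[OF F2'] v V2
      by (intro vclass_film_iso[OF film_on_regular[OF P2] film_on_regular[OF F2'] _ _ iso2]) simp_all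
    then show ?thesis
      using disjoint_union_vclass[OF film2 film1 u' v] vclass_arc_class[OF film_on_regular[OF P2]] by simp
  qed
  note R = film_regular[OF film(1)]
  \<comment> \<open>In the piece that keeps \<open>as\<close>, the new vertex \<open>p\<close>
    replaces \<open>bs\<close>, so its class is that of \<open>bs\<close>.\<close>
  define \<sigma> where "\<sigma> = arc_class \<Omega> (set bs)"
  have p: "vclass \<Omega>' p = \<sigma>" using vc1[of p] V1 arc_class_cut_piece(2)[OF F pas] unfolding \<sigma>_def by simp
  have "vclass \<Omega>' q = arc_class \<Omega> (set as)" using vc2[of q] V2 arc_class_cut_piece(2)[OF F2 qbs] by simp
  then have q: "vclass \<Omega>' q = star \<sigma>" using arc_class_star[OF F2 rotated_refl] unfolding \<sigma>_def by simp
  have v: "vclass \<Omega>' v = vclass \<Omega> v" if "v \<in> verts \<Omega>" for v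
    using that vc1[of v] vc2[of v] arc_class_cut_piece(1)[OF F pas, of "{v}"]
      arc_class_cut_piece(1)[OF F2 qbs, of "{v}"] vclass_arc_class[OF R, of v] V V1 V2 by auto
  have \<sigma>G: "\<sigma> \<in> Graphs" using film_conn_graph(2)[OF U(1), of p] p V' by simp
  let ?L = "labels \<Omega>'"
  have lab: "labels \<Omega> w = ?L w" if "w \<in> verts \<Omega>" for w using v[OF that] by simp
  note cong = tensor_space_index_cong[of "verts \<Omega>" "labels \<Omega>" ?L, OF lab]
  have PiEL: "PiE (verts \<Omega>) (labels \<Omega>) = PiE (verts \<Omega>) ?L" by (rule PiE_cong) (rule lab)
  have t': "t \<in> tensor_space scale (verts \<Omega>) ?L"
    using t cong(1)[of scale] unfolding state_space_def by (simp only:)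
  obtain S c where S: "finite S" "S \<subseteq> PiE (verts \<Omega>) ?L"
    and tS: "t = (\<lambda>M. \<Sum>x\<in>S. c x * pure_tensor scale (verts \<Omega>) ?L x M)"
    using t' by (rule tensor_spaceE)
  let ?J = "{..<length (b \<sigma>)} \<times> {..<length (b (star \<sigma>))}"
  let ?h = "\<lambda>r s. if s then b \<sigma> ! fst r else b (star \<sigma>) ! snd r"
  let ?k = "\<lambda>r. \<lambda>v\<in>{p, q}. ?h r (v = p)"
  \<comment> \<open>The factor of the cut tensor indexed by \<open>True\<close> goes to
    \<open>p\<close>, the other one to \<open>q\<close>.\<close>
  have bij: "bij_betw (\<lambda>v. v = p) {p, q} (UNIV :: bool set)"
    unfolding bij_betw_def inj_on_def UNIV_bool using pq(1) by auto
  have re: "tensor_reindex scale {p, q} ?L (\<lambda>v. v = p) (cut_tensor scale B b F \<sigma>) =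
      (\<lambda>M. \<Sum>r\<in>?J. F \<sigma> (fst r) (snd r) * pure_tensor scale {p, q} ?L (?k r) M)"
    unfolding cut_tensor_eq case_prod_unfold
    by (rule tensor_reindex_sum[OF bij]) (use cut_tensor_family[OF \<sigma>G] p q in \<open>auto simp: dual_pair_def\<close>)
  have k: "?k r \<in> PiE {p, q} ?L" if "r \<in> ?J" for r
    using cut_tensor_family[OF \<sigma>G that] p q by (auto simp: PiE_iff dual_pair_def all_bool_eq)
  let ?m = "\<lambda>x r. \<lambda>i\<in>verts \<Omega> \<union> {p, q}. if i \<in> verts \<Omega> then x i else ?k r i"
  have m: "?m x r \<in> PiE (verts \<Omega>') ?L" if "x \<in> S" "r \<in> ?J" for x r
    unfolding V' using that(1) S(2) k[OF that(2)] by (auto simp: PiE_iff subset_iff)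
  have cm: "cut_map scale B (cut_tensor scale B b F) p q \<Omega> \<Omega>' t =
      (\<lambda>M. \<Sum>x\<in>S. \<Sum>r\<in>?J. c x * F \<sigma> (fst r) (snd r) * pure_tensor scale (verts \<Omega>') ?L (?m x r) M)"
    unfolding cut_map_def p re V' tS
    by (rule tensor_mult_sum[where f = "\<lambda>x. x" and g = ?k])
      (use pq k S(2) labels_closed[OF U(1)] V' in auto)
  have "(\<lambda>M. \<Sum>z\<in>S \<times> ?J. c (fst z) * F \<sigma> (fst (snd z)) (snd (snd z)) *
        pure_tensor scale (verts \<Omega>') ?L (?m (fst z) (snd z)) M) \<in> tensor_space scale (verts \<Omega>') ?L"
    by (rule tensor_space_sumI; (rule m)?) (use S(1) in auto)
  then have "cut_map scale B (cut_tensor scale B b F) p q \<Omega> \<Omega>' t \<in> state_space scale B \<Omega>'"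
    unfolding cm state_space_def by (simp add: sum.cartesian_product case_prod_unfold)
  then have "\<Phi> \<Omega>' (cut_map scale B (cut_tensor scale B b F) p q \<Omega> \<Omega>' t) =
      cut_map scale B (cut_tensor scale B b F) p q \<Omega> \<Omega>' t (surface_value \<Omega>')"
    by (rule film_construction_value(2)[OF \<Phi> U(1)])
  also have "\<dots> = (\<Sum>x\<in>S. \<Sum>r\<in>?J. c x * F \<sigma> (fst r) (snd r) * surface_value \<Omega>' (?m x r))"
    unfolding cm using pure_tensor_eval[OF multilinear_surface_value[OF U(1)] m]
    by (intro sum.cong refl) simp
  also have "\<dots> = (\<Sum>x\<in>S. c x * surface_value \<Omega> x)"
  proof (rule sum.cong[OF refl])
    fix x assume x: "x \<in> S"
    have xl: "x w \<in> labels \<Omega> w" if "w \<in> verts \<Omega>" for w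
      using x S(2) that lab by (auto simp: PiE_iff subset_iff)
    have sv: "surface_value \<Omega>' (?m x r) =
        chain (map x as @ [b \<sigma> ! fst r]) * chain (map x bs @ [b (star \<sigma>) ! snd r])"
      if rJ: "r \<in> ?J" for r
    proof -
      have comps: "components_of \<Omega>1 = {verts \<Omega>1}" "components_of \<Omega>2 = {verts \<Omega>2}"
        using film_on_components F1 F2' by blast+
      have C: "verts \<Omega>1 \<in> components_of \<Omega>'" "verts \<Omega>2 \<in> components_of \<Omega>'" using U(2) comps by auto
      have neq: "verts \<Omega>1 \<noteq> verts \<Omega>2" using u V1 unfolding disjoint_union_def by auto
      have "film_on (restrict_complex \<Omega>1 (verts \<Omega>1)) (as @ [p])" using F1 film_on_whole[OF F1] by simp
      from film_iso_film_on[OF disjoint_union_left[OF film1 film2 u] this]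
      have f1: "film_on (restrict_complex \<Omega>' (verts \<Omega>1)) (as @ [p])" using comps by simp
      have "film_on (restrict_complex \<Omega>2 (verts \<Omega>2)) (bs @ [q])" using F2' film_on_whole[OF F2'] by simp
      from film_iso_film_on[OF disjoint_union_left[OF film2 film1 u'] this]
      have f2: "film_on (restrict_complex \<Omega>' (verts \<Omega>2)) (bs @ [q])" using comps by simp
      have mx: "?m x r w \<in> ?L w" if "w \<in> verts \<Omega>'" for w using m[OF x rJ] that by (auto simp: PiE_iff)
      have "surface_value \<Omega>' (?m x r) =
          chain (map (?m x r) (comp_numbering \<Omega>' (verts \<Omega>1))) *
          chain (map (?m x r) (comp_numbering \<Omega>' (verts \<Omega>2)))"
        unfolding surface_value_def U(2) comps using neq by simp
      also have "\<dots> = chain (map (?m x r) (as @ [p])) * chain (map (?m x r) (bs @ [q]))"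
      proof -
        have "chain (map (?m x r) (comp_numbering \<Omega>' (verts \<Omega>1))) =
            chain (map (?m x r) (as @ [p]))"
          by (rule chain_sum_component[OF U(1) C(1) f1]) (use mx V' V1 V in auto)
        moreover have "chain (map (?m x r) (comp_numbering \<Omega>' (verts \<Omega>2))) =
            chain (map (?m x r) (bs @ [q]))"
          by (rule chain_sum_component[OF U(1) C(2) f2]) (use mx V' V2 V in auto)
        ultimately show ?thesis by simp
      qed
      also have "map (?m x r) (as @ [p]) = map x as @ [b \<sigma> ! fst r]" using V pq by simp
      also have "map (?m x r) (bs @ [q]) = map x bs @ [b (star \<sigma>) ! snd r]" using V pq by simp
      finally show ?thesis .
    qed
    have "(\<Sum>r\<in>?J. c x * F \<sigma> (fst r) (snd r) * surface_value \<Omega>' (?m x r)) =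
        c x * (\<Sum>i<length (b \<sigma>). \<Sum>j<length (b (star \<sigma>)). F \<sigma> i j *
            (chain (map x as @ [b \<sigma> ! i]) * chain (map x bs @ [b (star \<sigma>) ! j])))"
      unfolding sum_distrib_left sum.cartesian_product
      by (intro sum.cong refl) (simp only: sv case_prod_unfold mult.assoc)
    also have "\<dots> = c x * chain (map x (as @ bs))"
      using chain_sum_cut[OF F ne xl \<sigma>_def] by simp
    also have "\<dots> = c x * surface_value \<Omega> x" using surface_value_connected[OF F xl] by simp
    finally show "(\<Sum>r\<in>?J. c x * F \<sigma> (fst r) (snd r) * surface_value \<Omega>' (?m x r)) = c x * surface_value \<Omega> x" .
  qed
  also have "\<dots> = t (surface_value \<Omega>)"
    unfolding tS
    using cong(2)[of scale] pure_tensor_eval[OF multilinear_surface_value[OF film(1)]] S(2) PiEL by (auto intro!: sum.cong)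
  also have "\<dots> = \<Phi> \<Omega> t" using film_construction_value(2)[OF \<Phi> film(1) t] by simp
  finally show ?thesis .
qed

theorem film_construction_tft:
  assumes \<Phi>: "film_construction scale B pair tri b F \<Phi>"
  shows "film_tft scale B (cut_tensor scale B b F) \<Phi>"
  unfolding film_tft_def
proof (intro conjI allI impI ballI)
  show "vector_space scale" by (rule vector_space_axioms)
next
  fix \<sigma> :: "'c ograph set" assume \<sigma>: "\<sigma> \<in> Graphs"
  have "\<forall>\<sigma>\<in>Graphs. fin_dim_subspace scale (B \<sigma>)" using gf unfolding graph_frobenius_def by (elim conjE)
  then show "fin_dim_subspace scale (B \<sigma>)" using \<sigma> by blast
  show "cut_tensor scale B b F \<sigma> \<in> tensor_space scale UNIV (dual_pair B \<sigma>)"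
    by (rule cut_tensor_in_space[OF \<sigma>])
next
  fix \<Omega> :: "'c complex2" assume "film_surface \<Omega>"
  then show "linear_form_on (state_space scale B \<Omega>) (\<Phi> \<Omega>)"
    using \<Phi> unfolding film_construction_def by blast
next
  fix \<Omega> \<Omega>' :: "'c complex2" and fv fe fd t
  assume "film_surface \<Omega> \<and> film_surface \<Omega>' \<and> film_iso fv fe fd \<Omega> \<Omega>'" "t \<in> state_space scale B \<Omega>"
  then show "\<Phi> \<Omega>' (iso_map scale B fv \<Omega> \<Omega>' t) = \<Phi> \<Omega> t" using value_film_iso[OF \<Phi>] by blast
next
  fix \<Omega> :: "'c complex2" and q1 q2 \<sigma>
  assume a: "film_surface \<Omega> \<and> verts \<Omega> = {q1, q2} \<and> q1 \<noteq> q2 \<and> \<sigma> = vclass \<Omega> q1"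
  have \<sigma>: "\<sigma> \<in> Graphs" using film_conn_graph(2)[of \<Omega> q1] a by simp
  have s: "vclass \<Omega> q2 = star \<sigma>" using value_nondegenerate(1)[OF \<Phi>, of \<Omega> q1 q2] a by simp
  have form: "\<Phi> \<Omega> (pure_tensor scale {q1, q2} (labels \<Omega>) (\<lambda>q. if q = q1 then x else y)) = pair x y"
    if "x \<in> B \<sigma>" "y \<in> B (star \<sigma>)" for x y
    using value_nondegenerate(2)[OF \<Phi>, of \<Omega> q1 q2 x y] a s that by simp
  have "x = 0" if "x \<in> B \<sigma>" "\<forall>y\<in>B (star \<sigma>). pair x y = 0" for x
    using nondegenerate[OF \<sigma>] that by blast
  \<comment> \<open>Symmetry of the pairing turns this side into the previous one for
    \<open>star \<sigma>\<close>.\<close>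
  moreover have "y = 0" if "y \<in> B (star \<sigma>)" "\<forall>x\<in>B \<sigma>. pair x y = 0" for y
    using nondegenerate[of "star \<sigma>" y] that \<sigma> pair_commute[of y] by simp
  ultimately show "let form = (\<lambda>x y. \<Phi> \<Omega> (pure_tensor scale {q1, q2} (labels \<Omega>) (\<lambda>q. if q = q1 then x else y))) in
      (\<forall>x\<in>B \<sigma>. (\<forall>y\<in>B (star \<sigma>). form x y = 0) \<longrightarrow> x = 0) \<and> (\<forall>y\<in>B (star \<sigma>). (\<forall>x\<in>B \<sigma>. form x y = 0) \<longrightarrow> y = 0)"
    unfolding Let_def using form by auto
next
  fix \<Omega> :: "'c complex2" and P D A A' qp qm \<Omega>' t
  assume "film_surface \<Omega> \<and> connected_complex \<Omega> \<and> graph_cut \<Omega> P D A A' \<and> cut_result \<Omega> A A' qp qm \<Omega>'"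
    "t \<in> state_space scale B \<Omega>"
  then show "\<Phi> \<Omega>' (cut_map scale B (cut_tensor scale B b F) qp qm \<Omega> \<Omega>' t) = \<Phi> \<Omega> t"
    using value_cut[OF \<Phi>] by blast
next
  fix \<Omega>1 \<Omega>2 \<Omega> :: "'c complex2" and t1 t2
  assume "film_surface \<Omega>1 \<and> film_surface \<Omega>2 \<and> disjoint_union \<Omega>1 \<Omega>2 \<Omega>"
    "t1 \<in> state_space scale B \<Omega>1" "t2 \<in> state_space scale B \<Omega>2"
  then show "\<Phi> \<Omega> (union_map scale B \<Omega>1 \<Omega>2 \<Omega> t1 t2) = \<Phi> \<Omega>1 t1 * \<Phi> \<Omega>2 t2"
    using value_disjoint_union[OF \<Phi>] by blast
qed

end

theorem theorem3p2:
  fixes scale :: "'k::field_char_0 \<Rightarrow> 'b::ab_group_add \<Rightarrow> 'b"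
    and B :: "'c ograph set \<Rightarrow> 'b set"
    and pair :: "'b \<Rightarrow> 'b \<Rightarrow> 'k"
    and tri :: "'b \<Rightarrow> 'b \<Rightarrow> 'b \<Rightarrow> 'k"
    and b :: "'c ograph set \<Rightarrow> 'b list"
    and F :: "'c ograph set \<Rightarrow> nat \<Rightarrow> nat \<Rightarrow> 'k"
  assumes "graph_frobenius scale B pair tri"
    and "rotation_invariant pair tri"
    and "\<And>\<sigma>. \<sigma> \<in> Graphs \<Longrightarrow> is_basis scale (B \<sigma>) (b \<sigma>)"
    and "\<And>\<sigma>. \<sigma> \<in> Graphs \<Longrightarrow> inverse_matrix pair (b \<sigma>) (b (star \<sigma>)) (F \<sigma>)"
  shows "(\<exists>\<Phi>. film_construction scale B pair tri b F \<Phi>) \<and>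
         (\<forall>\<Phi>. film_construction scale B pair tri b F \<Phi> \<longrightarrow>
              film_tft scale B (cut_tensor scale B b F) \<Phi>)"
proof -
  interpret based_graph_frobenius scale B pair tri b F
    using assms by unfold_locales
  show ?thesis using film_construction_exists film_construction_tft by blast
qed

end
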